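(* Let $N\geq 2$, $\alpha>0$, let $F_1,\dots,F_N\in\mathcal S^\sharp$ have degrees $d_1,\dots,d_N>0$, and let $\kappa_1,\dots,\kappa_N>0$ satisfy $\sum_{\nu=1}^N d_\nu\kappa_\nu=1$. Let $\boldsymbol F(\boldsymbol s,\alpha)$ be the associated multiple standard twist, holomorphic on $\mathbb C_1^N$. Then: (i) if $\alpha\notin\mathrm{Spec}(\boldsymbol F)$, then $\boldsymbol F(\boldsymbol s,\alpha)$ has analytic continuation to an entire function on $\mathbb C^N$; (ii) if $\alpha\in\mathrm{Spec}(\boldsymbol F)$, then $\boldsymbol F(\boldsymbol s,\alpha)$ has analytic continuation to a holomorphic function on $\mathbb C^N\setminus\bigcup_{\ell=0}^\infty H^*_\ell$, and for every integer $\ell\geq 0$ and every $\boldsymbol s\in H^*_\ell$ the limit \[ \Xi_\ell(\boldsymbol s,\alpha)=\lim_{\substack{\boldsymbol w\to\boldsymbol s\\ \boldsymbol w\notin H^*_\ell}}\Big(\sum_{\nu=1}^N d_\nu(w_\nu-s_\nu)\Big)\boldsymbol F(\boldsymbol w,\alpha) \] exists and defines a holomorphic function on $H^*_\ell$.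
   Context: The extended Selberg class $\mathcal S^\sharp$ consists of non-identically vanishing Dirichlet series $F(s)=\sum_{n\ge1}a(n)n^{-s}$, absolutely convergent for $\Re s>1$, admitting a meromorphic continuation of finite order to $\mathbb C$ whose only possible singularity is at $s=1$, and satisfying a functional equation $Q^s\prod_{j=1}^r\Gamma(\lambda_js+\mu_j)F(s)=\omega Q^{1-s}\prod_{j=1}^r\Gamma(\lambda_j(1-s)+\overline{\mu_j})\overline F(1-s)$, where $\overline F(s)=\overline{F(\overline s)}$, $Q>0$, $\lambda_j>0$, $\mu_j\in\mathbb C$ with $\Re\mu_j\ge0$, $|\omega|=1$. Its invariants are: degree $d_F=2\sum_j\lambda_j$; conductor $q_F=(2\pi)^{d_F}Q^2\prod_j\lambda_j^{2\lambda_j}$; root number $\omega_F=\omega\prod_j\lambda_j^{-2i\Im\mu_j}$; $\xi$-invariant $\xi_F=2\sum_j(\mu_j-\tfrac12)=\eta_F+i\theta_Fd_F$ with $\eta_F,\theta_F\in\mathbb R$, where $\theta_F$ is the internal shift. (These are invariants of $F$.) For $F_\nu\in\mathcal S^\sharp$ ($\nu=1,\dots,N$) write $a_\nu(n)$ for the Dirichlet coefficients, $d_\nu,q_\nu,\omega_\nu,\xi_\nu,\theta_\nu$ for degree, conductor, root number, $\xi$-invariant and internal shift of $F_\nu$; $\boldsymbol F=\{F_1,\dots,F_N\}$. Let $\mathbb C_1^N=\{\boldsymbol s=(s_1,\dots,s_N)\in\mathbb C^N:\Re s_\nu>1\ \forall\nu\}$. For $\alpha>0$ and $\kappa_\nu>0$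 with $\sum_\nu d_\nu\kappa_\nu=1$, the multiple standard twist is \[\boldsymbol F(\boldsymbol s,\alpha)=\sum_{n_1\ge1}\cdots\sum_{n_N\ge1}\frac{a_1(n_1)\cdots a_N(n_N)}{n_1^{s_1}\cdots n_N^{s_N}}e(-\alpha n_1^{\kappa_1}\cdots n_N^{\kappa_N}),\quad e(x)=e^{2\pi ix},\] absolutely convergent on $\mathbb C_1^N$. For $\boldsymbol n=(n_1,\dots,n_N)\in\mathbb N^N$ put $\alpha_{\boldsymbol n}=\prod_{\nu=1}^N\big(n_\nu/(q_\nu\kappa_\nu^{d_\nu})\big)^{\kappa_\nu}$, and define the spectrum $\mathrm{Spec}(\boldsymbol F)=\{\alpha_{\boldsymbol n}:\prod_\nu a_\nu(n_\nu)\neq0\}$. Let $d=\sum_\nu d_\nu$, $\theta=\sum_\nu d_\nu\theta_\nu$, and for integers $\ell\ge0$ let $H^*_\ell=\{\boldsymbol s\in\mathbb C^N:\sum_{\nu=1}^Nd_\nu s_\nu=\frac{d+1}{2}-\ell-i\theta\}$. *)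

theory Defs
  imports "HOL-Analysis.Analysis"
begin

(* Holomorphy of functions of several complex variables (vectors complex^'n),
   on an arbitrary set S: at every point z of S, f is complex (Frechet)
   differentiable within S, with a C-linear differential h |-> sum_i a_i h_i.
   For open S this is the usual notion of holomorphy on S. *)
definition holo_multi_on :: "(complex^'n::finite \<Rightarrow> complex) \<Rightarrow> (complex^'n) set \<Rightarrow> bool" where
  "holo_multi_on f S \<longleftrightarrow>
     (\<forall>z\<in>S. \<exists>a::complex^'n.
        (f has_derivative (\<lambda>h. \<Sum>i\<in>UNIV. a $ i * h $ i)) (at z within S))"

(* Extended Selberg class, with explicit functional-equation data:
   coefficients a (a 0 is ignored; the series is over n >= 1),
   the meromorphic continuation Fc, and data Q, lam = [lambda_j], mu = [mu_j], om = omega. *)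
definition selberg_sharp ::
  "(nat \<Rightarrow> complex) \<Rightarrow> (complex \<Rightarrow> complex) \<Rightarrow> real \<Rightarrow> real list \<Rightarrow> complex list \<Rightarrow> complex \<Rightarrow> bool" where
  "selberg_sharp a Fc Q lam mu om \<longleftrightarrow>
     (\<exists>n\<ge>1. a n \<noteq> 0) \<and>
     (\<forall>s. Re s > 1 \<longrightarrow>
         summable (\<lambda>n. norm (a (Suc n) / of_nat (Suc n) powr s)) \<and>
         Fc s = (\<Sum>n. a (Suc n) / of_nat (Suc n) powr s)) \<and>
     Fc holomorphic_on (UNIV - {1}) \<and>
     (\<exists>m::nat. \<exists>g. g holomorphic_on UNIV \<and> (\<forall>s. s \<noteq> 1 \<longrightarrow> g s = (s - 1) ^ m * Fc s) \<and>
         (\<exists>A c. \<forall>s. norm (g s) \<le> A * exp (norm s powr c))) \<and>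
     Q > 0 \<and> length mu = length lam \<and> (\<forall>l\<in>set lam. l > 0) \<and>
     (\<forall>m\<in>set mu. Re m \<ge> 0) \<and> norm om = 1 \<and>
     (\<forall>s. s \<notin> {0, 1} \<and>
          (\<forall>j<length lam. of_real (lam ! j) * s + mu ! j \<notin> \<int>\<^sub>\<le>\<^sub>0 \<and>
                          of_real (lam ! j) * (1 - s) + cnj (mu ! j) \<notin> \<int>\<^sub>\<le>\<^sub>0) \<longrightarrow>
          of_real Q powr s * (\<Prod>j<length lam. Gamma (of_real (lam ! j) * s + mu ! j)) * Fc s
          = om * of_real Q powr (1 - s) *
            (\<Prod>j<length lam. Gamma (of_real (lam ! j) * (1 - s) + cnj (mu ! j))) *
            cnj (Fc (cnj (1 - s))))"

definition sel_degree :: "real list \<Rightarrow> real" where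
  "sel_degree lam = 2 * sum_list lam"

definition sel_conductor :: "real \<Rightarrow> real list \<Rightarrow> real" where
  "sel_conductor Q lam = (2 * pi) powr (sel_degree lam) * Q\<^sup>2 *
      (\<Prod>j<length lam. (lam ! j) powr (2 * lam ! j))"

definition sel_xi :: "complex list \<Rightarrow> complex" where
  "sel_xi mu = 2 * (\<Sum>j<length mu. mu ! j - 1/2)"

(* internal shift: xi = eta + i * theta * d *)
definition sel_theta :: "real list \<Rightarrow> complex list \<Rightarrow> real" where
  "sel_theta lam mu = Im (sel_xi mu) / sel_degree lam"

definition multi_twist ::
  "('n::finite \<Rightarrow> nat \<Rightarrow> complex) \<Rightarrow> ('n \<Rightarrow> real) \<Rightarrow> real \<Rightarrow> complex^'n \<Rightarrow> complex" where
  "multi_twist a \<kappa> \<alpha> s =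
     infsum (\<lambda>n::nat^'n. (\<Prod>\<nu>\<in>UNIV. a \<nu> (n $ \<nu>) / of_nat (n $ \<nu>) powr (s $ \<nu>)) *
                exp (- 2 * of_real pi * \<i> * of_real (\<alpha> * (\<Prod>\<nu>\<in>UNIV. real (n $ \<nu>) powr \<kappa> \<nu>))))
            {n. \<forall>\<nu>. n $ \<nu> \<ge> 1}"

definition twist_spec ::
  "('n::finite \<Rightarrow> nat \<Rightarrow> complex) \<Rightarrow> ('n \<Rightarrow> real) \<Rightarrow> ('n \<Rightarrow> real) \<Rightarrow> ('n \<Rightarrow> real) \<Rightarrow> real set" where
  "twist_spec a q d \<kappa> =
     {(\<Prod>\<nu>\<in>UNIV. (real (n $ \<nu>) / (q \<nu> * \<kappa> \<nu> powr d \<nu>)) powr \<kappa> \<nu>) | n::nat^'n.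
        (\<forall>\<nu>. n $ \<nu> \<ge> 1) \<and> (\<Prod>\<nu>\<in>UNIV. a \<nu> (n $ \<nu>)) \<noteq> 0}"

definition twist_H :: "('n::finite \<Rightarrow> real) \<Rightarrow> ('n \<Rightarrow> real) \<Rightarrow> nat \<Rightarrow> (complex^'n) set" where
  "twist_H d \<theta> l =
     {s. (\<Sum>\<nu>\<in>UNIV. of_real (d \<nu>) * s $ \<nu>) =
         of_real (((\<Sum>\<nu>\<in>UNIV. d \<nu>) + 1) / 2 - real l) - \<i> * of_real (\<Sum>\<nu>\<in>UNIV. d \<nu> * \<theta> \<nu>)}"

end

(* The twist is the Mellin integral of prod F_nu(s_nu + kappa_nu w) Gamma(w) z^(-w) over Re w = c, with
   z = 2 pi i alpha exp(-i eps), in the limit eps -> 0+. By Phragmen-Lindelof the parts |Im w| >= T of the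
   line can be moved to Re w = -c without crossing the real axis, so that no residues have to be
   computed; the finite part and the lower part are then holomorphic in s. On the upper part the functional
   equations and Stirling's formula turn the integrand into
   E(s) sum_m C_m(s) x_m^(-w) w^B(s) (sum_k c_k(s) w^(-k) + O(w^(-K))), where x_m = alpha / alpha_m and
   B(s) = (d - 1)/2 - sum_nu d_nu s_nu - i theta. Terms with x_m <> 1 oscillate and are continued by partial
   integration; a term with x_m = 1 gives w_0^(B(s)-k+1) / (B(s)-k+1), i.e. the pole along H*_k.
   The resulting expansions on polydiscs are glued by the identity theorem on complex lines. *)
theory Submission
  imports Defs "HOL-Complex_Analysis.Complex_Analysis" "HOL-Real_Asymp.Real_Asymp"
begin

text \<open>The normalisation \<open>kappa_sum\<close> decides everything. By Stirling the quotients
  of Gamma factors contribute w^(-w) in total, which cancels the w^w of Gamma(w); the decay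
  exp(-pi/2 Im w) of Gamma is likewise cancelled by |z^(-w)| on the upper half of the line as eps
  tends to 0. Only a power of w times pure exponentials x_m^(-w) survives, so the limit integral
  need not converge absolutely, and the rotation by eps supplies the damping exp(-eps Im w) under
  which sums and integrals are exchanged. The constants depend on a bound R for the coordinates of
  s: c puts Re w = c where every F_nu converges absolutely and Re w = -c where the dual series does,
  T lies above all poles in w, and K makes the error term integrable. No choice serves all s at
  once, hence only local expansions on polydiscs. Such an expansion is compared with the twist only
  where also Re B(s) <= -2: there the resonant integrals converge absolutely and can be evaluated,
  while the resulting formula makes sense on the whole polydisc off the hyperplanes.\<close>

no_notation fps_nth (infixl "$" 75)

section \<open>Holomorphic functions of several variables\<close>

lemma norm_higher_deriv_half_ball:
  assumes hol: "f holomorphic_on ball z0 r" and r: "r > 0"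
    and bd: "\<And>z. z \<in> ball z0 r \<Longrightarrow> norm (f z) \<le> M"
    and w: "w \<in> cball z0 (r/2)"
  shows "norm ((deriv ^^ k) f w) \<le> fact k * M / (r/4) ^ k"
proof -
  have sub: "cball w (r/4) \<subseteq> ball z0 r"
  proof
    fix u assume "u \<in> cball w (r/4)"
    hence "dist z0 u \<le> r/2 + r/4" using w by (smt (verit) dist_triangle mem_cball)
    thus "u \<in> ball z0 r" using r by simp
  qed
  show ?thesis
  proof (rule Cauchy_inequality)
    show "f holomorphic_on ball w (r/4)"
      using hol sub by (meson ball_subset_cball holomorphic_on_subset subset_trans)
    show "continuous_on (cball w (r/4)) f"
      using hol sub holomorphic_on_imp_continuous_on continuous_on_subset by blast
    show "norm (f x) \<le> M" if "norm (w - x) = r/4" for x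
      using bd sub that by (auto simp: dist_norm)
  qed (use r in auto)
qed

text \<open>A bound for difference quotients in terms of the supremum of f alone, with an explicit
  constant, makes dominated convergence available for them and keeps Osgood's argument uniform in
  the direction.\<close>

lemma holomorphic_lipschitz_bound:
  assumes hol: "f holomorphic_on ball z0 r" and r: "r > 0"
    and bd: "\<And>z. z \<in> ball z0 r \<Longrightarrow> norm (f z) \<le> M"
    and z: "norm (z - z0) \<le> r / 2"
  shows "norm (f z - f z0) \<le> 4 * M / r * norm (z - z0)"
proof -
  have der: "norm (deriv f w) \<le> 4 * M / r" if "w \<in> cball z0 (r/2)" for w
    using norm_higher_deriv_half_ball[OF hol r bd that, of 1] by (simp add: field_simps)
  have "norm (f z - f z0) \<le> 4 * M / r * norm (z - z0)"
  proof (rule field_differentiable_bound[where S = "cball z0 (r/2)" and f' = "deriv f"])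
    fix w assume w: "w \<in> cball z0 (r/2)"
    hence "w \<in> ball z0 r" using r by auto
    thus "(f has_field_derivative deriv f w) (at w within cball z0 (r/2))"
      using hol by (meson DERIV_subset holomorphic_derivI open_ball subset_UNIV)
  qed (use der z r in \<open>auto simp: dist_norm norm_minus_commute\<close>)
  thus ?thesis .
qed

lemma holomorphic_taylor1_bound:
  assumes hol: "f holomorphic_on ball z0 r" and r: "r > 0"
    and bd: "\<And>z. z \<in> ball z0 r \<Longrightarrow> norm (f z) \<le> M"
    and z: "norm (z - z0) \<le> r / 2"
  shows "norm (f z - f z0 - deriv f z0 * (z - z0)) \<le> 32 * M / r\<^sup>2 * norm (z - z0) ^ 2"
proof -
  have der: "norm ((deriv ^^ 2) f w) \<le> 32 * M / r\<^sup>2" if "w \<in> cball z0 (r/2)" for w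
    using norm_higher_deriv_half_ball[OF hol r bd that, of 2] by (simp add: field_simps power2_eq_square)
  have "norm ((deriv ^^ 0) f z - (\<Sum>i\<le>1. (deriv ^^ i) f z0 * (z - z0) ^ i / fact i))
          \<le> 32 * M / r\<^sup>2 * norm (z - z0) ^ Suc 1 / fact 1"
  proof (rule field_Taylor[where S = "cball z0 (r/2)" and f = "\<lambda>i. (deriv ^^ i) f" and n = 1])
    fix i w assume w: "w \<in> cball z0 (r/2)"
    hence "w \<in> ball z0 r" using r by auto
    moreover have "(deriv ^^ i) f holomorphic_on ball z0 r"
      by (intro holomorphic_higher_deriv hol) auto
    ultimately have "((deriv ^^ i) f has_field_derivative deriv ((deriv ^^ i) f) w) (at w)"
      using holomorphic_derivI by blast
    thus "((deriv ^^ i) f has_field_derivative (deriv ^^ Suc i) f w) (at w within cball z0 (r/2))"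
      by (simp add: has_field_derivative_at_within)
  qed (use der z r in \<open>auto simp: dist_norm norm_minus_commute numeral_2_eq_2\<close>)
  thus ?thesis by (simp add: numeral_2_eq_2 algebra_simps)
qed

text \<open>Difference quotients of the integrand converge pointwise and are dominated by 4 g / r,
  so dominated convergence along every sequence tending to z0 yields the complex derivative of the
  integral.\<close>

lemma holomorphic_on_integral_dominated:
  fixes f :: "complex \<Rightarrow> 'a \<Rightarrow> complex"
  assumes U: "open U" and hol: "\<And>x. x \<in> space M \<Longrightarrow> (\<lambda>z. f z x) holomorphic_on U"
    and meas: "\<And>z. z \<in> U \<Longrightarrow> f z \<in> borel_measurable M"
    and g: "integrable M g" and bd: "\<And>z x. z \<in> U \<Longrightarrow> x \<in> space M \<Longrightarrow> norm (f z x) \<le> g x"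
  shows "(\<lambda>z. integral\<^sup>L M (f z)) holomorphic_on U"
proof (rule holomorphic_onI)
  fix z0 assume z0: "z0 \<in> U"
  obtain r where r: "r > 0" "ball z0 r \<subseteq> U" using U z0 openE by blast
  let ?D = "\<lambda>x. deriv (\<lambda>z. f z x) z0"
  have int: "integrable M (f z)" if "z \<in> U" for z
    by (rule Bochner_Integration.integrable_bound[OF g meas[OF that]])
       (use bd that in \<open>fastforce intro!: AE_I2 elim: order_trans simp: abs_if\<close>)
  have "((\<lambda>z. (integral\<^sup>L M (f z) - integral\<^sup>L M (f z0)) / (z - z0)) \<longlongrightarrow> integral\<^sup>L M ?D) (at z0)"
    unfolding tendsto_at_iff_sequentially o_def
  proof (intro allI impI)
    fix X assume X: "\<forall>i. X i \<in> UNIV - {z0}" "X \<longlonglongrightarrow> z0"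
    have "eventually (\<lambda>n. dist (X n) z0 < r/2) sequentially"
      using X(2) r(1) tendstoD[of X z0 sequentially "r/2"] by simp
    then obtain N where N: "\<And>n. n \<ge> N \<Longrightarrow> dist (X n) z0 < r/2"
      by (auto simp: eventually_at_top_linorder)
    \<comment> \<open>Dropping finitely many terms keeps the sequence inside the half ball where the
      Lipschitz bound applies.\<close>
    let ?Y = "\<lambda>n. X (n + N)"
    have Y: "?Y \<longlonglongrightarrow> z0" using X(2) by (rule LIMSEQ_ignore_initial_segment)
    have Yr: "norm (?Y n - z0) < r/2" for n using N[of "n+N"] by (simp add: dist_norm)
    have YU: "?Y n \<in> U" for n using Yr[of n] r by (auto simp: dist_norm norm_minus_commute intro!: subsetD[OF r(2)])
    have lim: "(\<lambda>n. (f (?Y n) x - f z0 x) / (?Y n - z0)) \<longlonglongrightarrow> ?D x" if x: "x \<in> space M" for x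
    proof -
      have "((\<lambda>z. f z x) has_field_derivative ?D x) (at z0)"
        using hol[OF x] U z0 holomorphic_derivI by blast
      hence "((\<lambda>z. (f z x - f z0 x) / (z - z0)) \<longlongrightarrow> ?D x) (at z0)"
        by (simp add: has_field_derivative_iff)
      moreover have "filterlim ?Y (at z0) sequentially"
        using X(1) by (intro filterlim_atI Y) auto
      ultimately show ?thesis by (rule filterlim_compose)
    qed
    have mq: "(\<lambda>x. (f (?Y n) x - f z0 x) / (?Y n - z0)) \<in> borel_measurable M" for n
      using meas[OF YU[of n]] meas[OF z0] by measurable
    have mD: "?D \<in> borel_measurable M"
      by (rule borel_measurable_LIMSEQ_metric[OF mq lim])
    have "(\<lambda>n. \<integral>x. (f (?Y n) x - f z0 x) / (?Y n - z0) \<partial>M) \<longlonglongrightarrow> integral\<^sup>L M ?D"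
    proof (rule integral_dominated_convergence[where w = "\<lambda>x. 4 * g x / r"])
      show "AE x in M. norm ((f (?Y n) x - f z0 x) / (?Y n - z0)) \<le> 4 * g x / r" for n
      proof (rule AE_I2)
        fix x assume x: "x \<in> space M"
        have "norm (f (?Y n) x - f z0 x) \<le> 4 * g x / r * norm (?Y n - z0)"
          by (rule holomorphic_lipschitz_bound[where f = "\<lambda>z. f z x"])
             (use hol[OF x] r bd x Yr[of n] in \<open>auto intro: holomorphic_on_subset\<close>)
        thus "norm ((f (?Y n) x - f z0 x) / (?Y n - z0)) \<le> 4 * g x / r"
          using X(1) by (simp add: norm_divide divide_le_eq)
      qed
    qed (use mq mD g lim in auto)
    moreover have "(\<integral>x. (f (?Y n) x - f z0 x) / (?Y n - z0) \<partial>M)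
        = (integral\<^sup>L M (f (?Y n)) - integral\<^sup>L M (f z0)) / (?Y n - z0)" for n
      using int[OF YU] int[OF z0] by (simp add: Bochner_Integration.integral_diff del: divide_eq_eq)
    ultimately have "(\<lambda>n. (integral\<^sup>L M (f (?Y n)) - integral\<^sup>L M (f z0)) / (?Y n - z0)) \<longlonglongrightarrow> integral\<^sup>L M ?D"
      by (simp only:)
    thus "(\<lambda>n. (integral\<^sup>L M (f (X n)) - integral\<^sup>L M (f z0)) / (X n - z0)) \<longlonglongrightarrow> integral\<^sup>L M ?D"
      by (rule LIMSEQ_offset)
  qed
  hence "((\<lambda>z. integral\<^sup>L M (f z)) has_field_derivative integral\<^sup>L M ?D) (at z0)"
    by (simp add: has_field_derivative_iff)
  thus "(\<lambda>z. integral\<^sup>L M (f z)) field_differentiable at z0 within U"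
    using field_differentiable_at_within field_differentiable_def by blast
qed

lemma norm_vector_smult_complex [simp]: "norm (c *s (h::complex^'n::finite)) = norm c * norm h"
  by (simp add: norm_vec_def norm_mult L2_set_right_distrib)

lemma holo_multi_on_line:
  assumes f: "holo_multi_on f S" and S: "open S"
  shows "(\<lambda>t. f (p + t *s h)) holomorphic_on {t. p + t *s h \<in> S}"
proof (rule holomorphic_onI)
  fix t assume t: "t \<in> {t. p + t *s h \<in> S}"
  hence pt: "p + t *s h \<in> S" by simp
  then obtain a where "(f has_derivative (\<lambda>h. \<Sum>i\<in>UNIV. a $ i * h $ i)) (at (p + t *s h) within S)"
    using f unfolding holo_multi_on_def by blast
  hence a: "(f has_derivative (\<lambda>h. \<Sum>i\<in>UNIV. a $ i * h $ i)) (at (p + t *s h))"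
    by (simp only: at_within_open[OF pt S])
  have bl: "bounded_linear (\<lambda>t::complex. t *s h)"
    by (rule bounded_linear_intro[where K = "norm h"]) (auto simp: vec_eq_iff algebra_simps)
  have "((\<lambda>t. p + t *s h) has_derivative (\<lambda>u. 0 + u *s h)) (at t)"
    by (intro derivative_intros bounded_linear_imp_has_derivative bl)
  from diff_chain_at[OF this a]
  have "((\<lambda>t. f (p + t *s h)) has_derivative (\<lambda>u. (\<Sum>i\<in>UNIV. a $ i * h $ i) * u)) (at t)"
    by (simp add: o_def sum_distrib_left sum_distrib_right mult_ac)
  hence "((\<lambda>t. f (p + t *s h)) has_field_derivative (\<Sum>i\<in>UNIV. a $ i * h $ i)) (at t)"
    by (simp add: has_field_derivative_def)
  thus "(\<lambda>t. f (p + t *s h)) field_differentiable at t within {t. p + t *s h \<in> S}"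
    using field_differentiable_at_within field_differentiable_def by blast
qed

lemma open_line_preimage: "open S \<Longrightarrow> open {t::complex. p + t *s (h::complex^'n::finite) \<in> S}"
proof -
  assume S: "open S"
  have bl: "bounded_linear (\<lambda>t::complex. t *s h)"
    by (rule bounded_linear_intro[where K = "norm h"]) (auto simp: vec_eq_iff algebra_simps)
  have "continuous_on UNIV (\<lambda>t::complex. p + t *s h)"
    by (intro continuous_intros bounded_linear.continuous_on[OF bl])
  thus ?thesis using S by (simp add: continuous_on_open_vimage vimage_def)
qed

text \<open>A form of Osgood's lemma.\<close>
theorem holo_multi_on_lines:
  fixes f :: "complex^'n::finite \<Rightarrow> complex"
  assumes S: "open S"
    and lines: "\<And>p h. (\<lambda>t. f (p + t *s h)) holomorphic_on {t. p + t *s h \<in> S}"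
    and bdd: "\<And>p. p \<in> S \<Longrightarrow> \<exists>e>0. \<exists>M. \<forall>s\<in>ball p e \<inter> S. norm (f s) \<le> M"
  shows "holo_multi_on f S"
  unfolding holo_multi_on_def
proof
  fix p assume p: "p \<in> S"
  obtain e0 M where e0: "e0 > 0" "\<And>s. s \<in> ball p e0 \<inter> S \<Longrightarrow> norm (f s) \<le> M" using bdd[OF p] by blast
  obtain e1 where e1: "e1 > 0" "ball p e1 \<subseteq> S" using S p openE by blast
  define e where "e = min e0 e1"
  have e: "e > 0" "ball p e \<subseteq> S" "\<And>s. s \<in> ball p e \<Longrightarrow> norm (f s) \<le> M"
    using e0 e1 by (auto simp: e_def)
  have M0: "M \<ge> 0" using e(3)[of p] e(1) by (smt (verit) centre_in_ball norm_ge_zero)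
  have line: "(\<lambda>t. f (q + t *s h)) holomorphic_on ball 0 (e / (2 * norm h))"
    and lineb: "\<And>t. t \<in> ball 0 (e / (2 * norm h)) \<Longrightarrow> q + t *s h \<in> ball p e"
    if q: "dist p q < e/2" and h: "h \<noteq> 0" for q h
  proof -
    show *: "q + t *s h \<in> ball p e" if "t \<in> ball 0 (e / (2 * norm h))" for t
    proof -
      have "norm (t *s h) < e/2" using that h by (simp add: field_simps)
      hence "dist q (q + t *s h) < e/2" by (simp add: dist_norm)
      thus ?thesis using q dist_triangle[of p "q + t *s h" q] by simp
    qed
    show "(\<lambda>t. f (q + t *s h)) holomorphic_on ball 0 (e / (2 * norm h))"
      by (rule holomorphic_on_subset[OF lines]) (use * e(2) in auto)
  qed
  define D where "D h = deriv (\<lambda>t. f (p + t *s h)) 0" for h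
  have lip: "norm (f (q + h) - f q) \<le> 8 * M / e * norm h" if q: "dist p q < e/2" and h: "norm h \<le> e/4" for q h
  proof (cases "h = 0")
    case False
    have "norm (f (q + 1 *s h) - f (q + 0 *s h)) \<le> 4 * M / (e / (2 * norm h)) * norm (1 - 0::complex)"
      by (rule holomorphic_lipschitz_bound[where f = "\<lambda>t. f (q + t *s h)", OF line[OF q False]])
         (use lineb[OF q False] e h False in \<open>auto simp: field_simps\<close>)
    thus ?thesis by (simp add: field_simps)
  qed auto
  have der: "((\<lambda>t. f (p + t *s h)) has_field_derivative D h) (at 0)" for h
  proof -
    have "0 \<in> {t. p + t *s h \<in> S}" using p by (simp add: vec_eq_iff)
    thus ?thesis unfolding D_def
      using holomorphic_derivI[OF lines open_line_preimage[OF S]] by blast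
  qed
  have D0: "D 0 = 0" unfolding D_def by simp
  \<comment> \<open>On the line in direction h the disc has radius e / (2 |h|), so the second-order
    error is a constant times |h|^2, uniformly in the direction. Once D is linear, this is Frechet
    differentiability.\<close>
  have taylor: "norm (f (p + h) - f p - D h) \<le> 128 * M / e\<^sup>2 * norm h ^ 2" if h: "norm h \<le> e/4" for h
  proof (cases "h = 0")
    case True
    thus ?thesis using D0 by simp
  next
    case False
    have pp: "dist p p < e/2" using e by simp
    have "norm (f (p + 1 *s h) - f (p + 0 *s h) - deriv (\<lambda>t. f (p + t *s h)) 0 * (1 - 0)) \<le>
          32 * M / (e / (2 * norm h))\<^sup>2 * norm (1 - 0::complex) ^ 2"
      by (rule holomorphic_taylor1_bound[where f = "\<lambda>t. f (p + t *s h)", OF line[OF pp False]])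
         (use lineb[OF pp False] e h False in \<open>auto simp: field_simps\<close>)
    thus ?thesis by (simp add: field_simps D_def)
  qed
  have Dscale: "D (c *s h) = c * D h" for c h
  proof -
    have "((\<lambda>t. f (p + (t * c) *s h)) has_field_derivative D h * c) (at 0)"
      by (rule DERIV_chain2[where g = "\<lambda>t. t * c" and x = 0, simplified]) (auto intro!: derivative_eq_intros der)
    moreover have "p + (t * c) *s h = p + t *s (c *s h)" for t by (simp add: vec_eq_iff)
    ultimately show ?thesis using der[of "c *s h"] by (metis (no_types, lifting) DERIV_unique ext mult.commute)
  qed
  \<comment> \<open>The mixed second difference of f in the directions t h and t k is O(t^2):
    \<open>lip\<close> bounds the first difference \<open>?\<psi>\<close> by a multiple of |t|, and
    the one-variable Lipschitz bound for \<open>?\<psi>\<close> gives a second factor |t|. Division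
    by t leaves an error that tends to 0.\<close>
  have Dadd: "D (h + k) = D h + D k" for h k
  proof (cases "h = 0 \<or> k = 0")
    case True
    thus ?thesis using D0 by auto
  next
    case False
    hence hk: "h \<noteq> 0" "k \<noteq> 0" by auto
    define \<tau> where "\<tau> = e / (8 * (norm h + norm k))"
    have nn: "norm h > 0" "norm k > 0" using hk by auto
    have \<tau>: "\<tau> > 0" unfolding \<tau>_def by (intro divide_pos_pos mult_pos_pos add_pos_pos e(1) nn) auto
    let ?q = "\<lambda>h t. (f (p + t *s h) - f p) / t"
    have mixed: "norm (?q (h+k) t - ?q h t - ?q k t) \<le> 8 * M / e * norm k * (8 * norm h / e) * 2 * norm t"
      if t: "norm t < \<tau>" "t \<noteq> 0" for t
    proof -
      have th: "norm t * norm h \<le> e / 8" "norm t * norm k \<le> e/8"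
      proof -
        have "norm h + norm k > 0" using nn by linarith
        hence "norm t * (norm h + norm k) < e / 8"
          using t(1) by (simp add: \<tau>_def pos_less_divide_eq mult.commute mult.left_commute)
        moreover have "norm t * norm h \<ge> 0" "norm t * norm k \<ge> 0" by simp_all
        ultimately show "norm t * norm h \<le> e / 8" "norm t * norm k \<le> e / 8"
          unfolding distrib_left by linarith+
      qed
      let ?\<psi> = "\<lambda>u. f (p + t *s k + u *s h) - f (p + u *s h)"
      have d1: "dist p (p + t *s k) < e/2" using th e by (simp add: dist_norm)
      have le1: "norm (?\<psi> t - ?\<psi> 0) \<le> 4 * (8 * M / e * (norm t * norm k)) / (e / (4 * norm h)) * norm (t - 0)"
      proof (rule holomorphic_lipschitz_bound)
        have sub: "ball 0 (e / (4 * norm h)) \<subseteq> ball (0::complex) (e / (2 * norm h))"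
          using e nn by (intro subset_ball) (simp add: field_simps)
        show "?\<psi> holomorphic_on ball 0 (e / (4 * norm h))"
          using line[OF d1 hk(1)] line[of p h] e hk sub
          by (intro holomorphic_intros) (auto intro: holomorphic_on_subset)
        show "norm (?\<psi> u) \<le> 8 * M / e * (norm t * norm k)" if u: "u \<in> ball 0 (e / (4 * norm h))" for u
        proof -
          have "norm (u *s h) < e/4" using u nn by (simp add: field_simps)
          hence "dist p (p + u *s h) < e/2" using e by (simp add: dist_norm)
          from lip[OF this, of "t *s k"] th e show ?thesis by (simp add: algebra_simps)
        qed
        show "norm (t - 0) \<le> e / (4 * norm h) / 2" using th nn by (simp add: field_simps)
      qed (use e nn in auto)
      have seq1: "p + t *s (h + k) = p + t *s k + t *s h" by (simp add: vec_eq_iff algebra_simps)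
      have eq2: "?q (h+k) t - ?q h t - ?q k t = (?\<psi> t - ?\<psi> 0) / t"
        unfolding seq1 by (simp add: diff_divide_distrib)
      have "norm (?q (h+k) t - ?q h t - ?q k t) \<le> 4 * (8 * M / e * (norm t * norm k)) / (e / (4 * norm h))"
        unfolding eq2 norm_divide using t le1 by (simp add: divide_le_eq del: zero_eq_1_divide_iff)
      also have "\<dots> = 8 * M / e * norm k * (8 * norm h / e) * 2 * norm t" using e nn by (simp add: field_simps)
      finally show ?thesis .
    qed
    have lims: "(?q h \<longlongrightarrow> D h) (at 0)" for h
      using der[of h] by (simp add: has_field_derivative_iff)
    have "((\<lambda>t. ?q (h+k) t - ?q h t - ?q k t) \<longlongrightarrow> D (h+k) - D h - D k) (at 0)"
      by (intro tendsto_intros lims)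
    moreover have "((\<lambda>t. ?q (h+k) t - ?q h t - ?q k t) \<longlongrightarrow> 0) (at 0)"
    proof (rule Lim_null_comparison)
      show "\<forall>\<^sub>F t in at 0. norm (?q (h+k) t - ?q h t - ?q k t) \<le> 8 * M / e * norm k * (8 * norm h / e) * 2 * norm t"
        unfolding eventually_at using mixed \<tau> by (auto simp: dist_norm)
      show "((\<lambda>t. 8 * M / e * norm k * (8 * norm h / e) * 2 * norm (t::complex)) \<longlongrightarrow> 0) (at 0)"
        by (intro tendsto_mult_right_zero tendsto_norm_zero tendsto_ident_at)
    qed
    ultimately have "D (h+k) - D h - D k = 0" using tendsto_unique trivial_limit_at by blast
    thus ?thesis by (simp add: algebra_simps)
  qed
  define a where "a = (\<chi> i. D (axis i 1))"
  have Dlin: "D h = (\<Sum>i\<in>UNIV. a $ i * h $ i)" for h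
  proof -
    have "D (\<Sum>i\<in>A. h $ i *s axis i 1) = (\<Sum>i\<in>A. a $ i * h $ i)" for A
      by (induction A rule: infinite_finite_induct) (auto simp: D0 Dadd Dscale a_def mult.commute)
    moreover have "(\<Sum>i\<in>UNIV. h $ i *s axis i 1) = h" by (simp add: basis_expansion)
    ultimately show ?thesis by metis
  qed
  have "(f has_derivative D) (at p)"
    unfolding has_derivative_at
  proof
    have "D = (\<lambda>h. \<Sum>i\<in>UNIV. a $ i * h $ i)" using Dlin by blast
    thus "bounded_linear D"
      by (simp add: bounded_linear_sum bounded_linear_mult_right bounded_linear_const_mult bounded_linear_vec_nth)
    show "(\<lambda>h. norm (f (p + h) - f p - D h) / norm h) \<midarrow>0\<rightarrow> 0"
    proof (rule Lim_null_comparison)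
      show "\<forall>\<^sub>F h in at 0. norm (norm (f (p + h) - f p - D h) / norm h) \<le> 128 * M / e\<^sup>2 * norm h"
        unfolding eventually_at using taylor e
        by (intro exI[of _ "e/4"]) (auto simp: dist_norm divide_le_eq power2_eq_square mult.assoc)
      show "((\<lambda>h. 128 * M / e\<^sup>2 * norm h) \<longlongrightarrow> 0) (at 0)"
        by (intro tendsto_mult_right_zero tendsto_norm_zero tendsto_ident_at)
    qed
  qed
  hence "(f has_derivative (\<lambda>h. \<Sum>i\<in>UNIV. a $ i * h $ i)) (at p within S)"
    using Dlin by (metis (no_types, lifting) ext has_derivative_at_withinI)
  thus "\<exists>a. (f has_derivative (\<lambda>h. \<Sum>i\<in>UNIV. a $ i * h $ i)) (at p within S)" by blast
qed

section \<open>Closure properties of holomorphy in several variables\<close>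

lemma holo_multi_on_continuous_on: "holo_multi_on f S \<Longrightarrow> continuous_on S f"
  unfolding holo_multi_on_def continuous_on_eq_continuous_within
  using has_derivative_continuous by blast

lemma holo_multi_on_subset: "holo_multi_on f S \<Longrightarrow> T \<subseteq> S \<Longrightarrow> holo_multi_on f T"
  unfolding holo_multi_on_def by (meson has_derivative_subset subsetD)

lemma holo_multi_on_cong:
  fixes f g :: "complex^'n::finite \<Rightarrow> complex"
  assumes "\<And>s. s \<in> S \<Longrightarrow> f s = g s" shows "holo_multi_on f S \<longleftrightarrow> holo_multi_on g S"
proof -
  have "holo_multi_on g S" if fS: "holo_multi_on f S" and eq: "\<And>s. s \<in> S \<Longrightarrow> f s = g s" for f g :: "complex^'n \<Rightarrow> complex"
    unfolding holo_multi_on_def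
  proof
    fix z assume z: "z \<in> S"
    then obtain a where "(f has_derivative (\<lambda>h. \<Sum>i\<in>UNIV. a $ i * h $ i)) (at z within S)"
      using fS unfolding holo_multi_on_def by blast
    hence "(g has_derivative (\<lambda>h. \<Sum>i\<in>UNIV. a $ i * h $ i)) (at z within S)"
      by (rule has_derivative_transform[OF z, rotated]) (simp add: eq)
    thus "\<exists>a. (g has_derivative (\<lambda>h. \<Sum>i\<in>UNIV. a $ i * h $ i)) (at z within S)" by blast
  qed
  thus ?thesis using assms by metis
qed

lemma holo_multi_on_locally:
  assumes S: "open S" and "\<And>p. p \<in> S \<Longrightarrow> \<exists>U. open U \<and> p \<in> U \<and> U \<subseteq> S \<and> holo_multi_on f U"
  shows "holo_multi_on f S"
  unfolding holo_multi_on_def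
proof
  fix z assume z: "z \<in> S"
  then obtain U where U: "open U" "z \<in> U" "U \<subseteq> S" "holo_multi_on f U" using assms by blast
  then obtain a where "(f has_derivative (\<lambda>h. \<Sum>i\<in>UNIV. a $ i * h $ i)) (at z within U)"
    unfolding holo_multi_on_def by blast
  hence "(f has_derivative (\<lambda>h. \<Sum>i\<in>UNIV. a $ i * h $ i)) (at z within S)"
    using at_within_open[OF z S] at_within_open[OF U(2) U(1)] by simp
  thus "\<exists>a. (f has_derivative (\<lambda>h. \<Sum>i\<in>UNIV. a $ i * h $ i)) (at z within S)" by blast
qed

lemma holo_multi_on_const: "holo_multi_on (\<lambda>_. c) S"
  unfolding holo_multi_on_def by (intro ballI exI[of _ 0]) simp

lemma holo_multi_on_coord: "holo_multi_on (\<lambda>s. s $ i) S"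
  unfolding holo_multi_on_def
proof (intro ballI exI[of _ "axis i 1"])
  fix z assume "z \<in> S"
  have "(\<Sum>j\<in>UNIV. axis i 1 $ j * h $ j) = h $ i" for h :: "complex^'a"
    by (simp add: axis_def if_distrib[of "\<lambda>x. x * _"] cong: if_cong)
  thus "((\<lambda>s. s $ i) has_derivative (\<lambda>h. \<Sum>j\<in>UNIV. axis i 1 $ j * h $ j)) (at z within S)"
    by (simp add: bounded_linear_imp_has_derivative bounded_linear_vec_nth)
qed

lemma holo_multi_on_add:
  assumes "holo_multi_on f S" "holo_multi_on g S" shows "holo_multi_on (\<lambda>s. f s + g s) S"
  unfolding holo_multi_on_def
proof
  fix z assume z: "z \<in> S"
  obtain a where a: "(f has_derivative (\<lambda>h. \<Sum>i\<in>UNIV. a $ i * h $ i)) (at z within S)"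
    using assms(1) z unfolding holo_multi_on_def by blast
  obtain b where b: "(g has_derivative (\<lambda>h. \<Sum>i\<in>UNIV. b $ i * h $ i)) (at z within S)"
    using assms(2) z unfolding holo_multi_on_def by blast
  show "\<exists>c. ((\<lambda>s. f s + g s) has_derivative (\<lambda>h. \<Sum>i\<in>UNIV. c $ i * h $ i)) (at z within S)"
    using has_derivative_add[OF a b] by (intro exI[of _ "a + b"]) (simp add: sum.distrib algebra_simps)
qed

lemma holo_multi_on_mult:
  assumes "holo_multi_on f S" "holo_multi_on g S" shows "holo_multi_on (\<lambda>s. f s * g s) S"
  unfolding holo_multi_on_def
proof
  fix z assume z: "z \<in> S"
  obtain a where a: "(f has_derivative (\<lambda>h. \<Sum>i\<in>UNIV. a $ i * h $ i)) (at z within S)"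
    using assms(1) z unfolding holo_multi_on_def by blast
  obtain b where b: "(g has_derivative (\<lambda>h. \<Sum>i\<in>UNIV. b $ i * h $ i)) (at z within S)"
    using assms(2) z unfolding holo_multi_on_def by blast
  show "\<exists>c. ((\<lambda>s. f s * g s) has_derivative (\<lambda>h. \<Sum>i\<in>UNIV. c $ i * h $ i)) (at z within S)"
    using has_derivative_mult[OF a b]
    by (intro exI[of _ "f z *s b + g z *s a"]) (simp add: sum.distrib sum_distrib_left sum_distrib_right algebra_simps)
qed

lemma holo_multi_on_compose:
  assumes f: "holo_multi_on f S" and g: "g holomorphic_on T" "open T" and sub: "f ` S \<subseteq> T"
  shows "holo_multi_on (\<lambda>s. g (f s)) S"
  unfolding holo_multi_on_def
proof
  fix z assume z: "z \<in> S"
  obtain a where a: "(f has_derivative (\<lambda>h. \<Sum>i\<in>UNIV. a $ i * h $ i)) (at z within S)"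
    using f z unfolding holo_multi_on_def by blast
  have "(g has_field_derivative deriv g (f z)) (at (f z))"
    using g sub z holomorphic_derivI by blast
  hence b: "(g has_derivative (\<lambda>h. deriv g (f z) * h)) (at (f z))"
    by (simp add: has_field_derivative_def)
  show "\<exists>c. ((\<lambda>s. g (f s)) has_derivative (\<lambda>h. \<Sum>i\<in>UNIV. c $ i * h $ i)) (at z within S)"
    using has_derivative_compose[OF a b]
    by (intro exI[of _ "deriv g (f z) *s a"]) (simp add: sum_distrib_left algebra_simps)
qed

lemma holo_multi_on_sum:
  "(\<And>i. i \<in> I \<Longrightarrow> holo_multi_on (f i) S) \<Longrightarrow> holo_multi_on (\<lambda>s. \<Sum>i\<in>I. f i s) S"
  by (induction I rule: infinite_finite_induct) (auto intro!: holo_multi_on_const holo_multi_on_add)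

lemma holo_multi_on_prod:
  "(\<And>i. i \<in> I \<Longrightarrow> holo_multi_on (f i) S) \<Longrightarrow> holo_multi_on (\<lambda>s. \<Prod>i\<in>I. f i s) S"
  by (induction I rule: infinite_finite_induct) (auto intro!: holo_multi_on_const holo_multi_on_mult)

lemma holo_multi_on_minus: "holo_multi_on f S \<Longrightarrow> holo_multi_on (\<lambda>s. - f s) S"
  using holo_multi_on_mult[OF holo_multi_on_const[of "-1" S]] by fastforce

lemma holo_multi_on_diff:
  "holo_multi_on f S \<Longrightarrow> holo_multi_on g S \<Longrightarrow> holo_multi_on (\<lambda>s. f s - g s) S"
  using holo_multi_on_add[OF _ holo_multi_on_minus, of f S g] by simp

lemma holo_multi_on_exp: "holo_multi_on f S \<Longrightarrow> holo_multi_on (\<lambda>s. exp (f s)) S"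
  by (rule holo_multi_on_compose[where T = UNIV]) (auto intro: holomorphic_intros)

lemma holo_multi_on_divide:
  assumes "holo_multi_on f S" "holo_multi_on g S" "\<And>s. s \<in> S \<Longrightarrow> g s \<noteq> 0"
  shows "holo_multi_on (\<lambda>s. f s / g s) S"
proof -
  have "holo_multi_on (\<lambda>s. inverse (g s)) S"
    by (rule holo_multi_on_compose[where T = "- {0}", OF assms(2)]) (use assms(3) in \<open>auto intro!: holomorphic_intros\<close>)
  from holo_multi_on_mult[OF assms(1) this] show ?thesis by (simp add: divide_inverse)
qed

lemmas holo_multi_intros = holo_multi_on_const holo_multi_on_coord holo_multi_on_add holo_multi_on_mult
  holo_multi_on_sum holo_multi_on_prod holo_multi_on_minus holo_multi_on_diff holo_multi_on_exp

text \<open>On each complex line the one-variable theorem applies locally, since a dominating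
  function is required only near each point; the same function bounds the integral near that point,
  which is the local boundedness that Osgood's lemma demands.\<close>

lemma holo_multi_on_integral:
  fixes f :: "complex^'n::finite \<Rightarrow> 'a \<Rightarrow> complex"
  assumes S: "open S" and hol: "\<And>x. x \<in> space M \<Longrightarrow> holo_multi_on (\<lambda>s. f s x) S"
    and meas: "\<And>s. s \<in> S \<Longrightarrow> f s \<in> borel_measurable M"
    and dom: "\<And>p. p \<in> S \<Longrightarrow> \<exists>e>0. \<exists>g. integrable M g \<and> (\<forall>s\<in>ball p e \<inter> S. \<forall>x\<in>space M. norm (f s x) \<le> g x)"
  shows "holo_multi_on (\<lambda>s. integral\<^sup>L M (f s)) S"
proof (rule holo_multi_on_lines[OF S])
  fix p assume p: "p \<in> S"
  then obtain e g where e: "e > 0" "integrable M g" "\<forall>s\<in>ball p e \<inter> S. \<forall>x\<in>space M. norm (f s x) \<le> g x"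
    using dom by blast
  have "norm (integral\<^sup>L M (f s)) \<le> integral\<^sup>L M g" if "s \<in> ball p e \<inter> S" for s
  proof -
    have int: "integrable M (f s)"
      by (rule Bochner_Integration.integrable_bound[OF e(2)])
         (use e that meas in \<open>auto intro!: AE_I2 order_trans[OF _ abs_ge_self]\<close>)
    have "norm (integral\<^sup>L M (f s)) \<le> (\<integral>x. norm (f s x) \<partial>M)" by (rule integral_norm_bound)
    also have "\<dots> \<le> integral\<^sup>L M g"
      by (rule Bochner_Integration.integral_mono) (use e that int in auto)
    finally show ?thesis .
  qed
  thus "\<exists>e>0. \<exists>M'. \<forall>s\<in>ball p e \<inter> S. norm (integral\<^sup>L M (f s)) \<le> M'" using e(1) by blast
next
  fix p h :: "complex^'n"
  let ?V = "{t. p + t *s h \<in> S}"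
  have oV: "open ?V" by (rule open_line_preimage[OF S])
  show "(\<lambda>t. integral\<^sup>L M (f (p + t *s h))) holomorphic_on ?V"
  proof (rule holomorphic_onI)
    fix t assume t: "t \<in> ?V"
    then obtain e g where e: "e > 0" "integrable M g"
      "\<forall>s\<in>ball (p + t *s h) e \<inter> S. \<forall>x\<in>space M. norm (f s x) \<le> g x"
      using dom by blast
    let ?W = "{t'. p + t' *s h \<in> ball (p + t *s h) e \<inter> S}"
    have oW: "open ?W" by (rule open_line_preimage) (use S in auto)
    have tW: "t \<in> ?W" using t e by simp
    have "(\<lambda>t. integral\<^sup>L M (f (p + t *s h))) holomorphic_on ?W"
    proof (rule holomorphic_on_integral_dominated[OF oW])
      fix x assume "x \<in> space M"
      from holo_multi_on_line[OF hol[OF this] S]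
      show "(\<lambda>t. f (p + t *s h) x) holomorphic_on ?W" by (rule holomorphic_on_subset) auto
    qed (use e meas in auto)
    thus "(\<lambda>t. integral\<^sup>L M (f (p + t *s h))) field_differentiable at t within ?V"
      using oW tW holomorphic_on_imp_differentiable_at field_differentiable_at_within by blast
  qed
qed

section \<open>Stirling's series\<close>

lemma holomorphic_factor_out_zero:
  assumes h: "h holomorphic_on ball 0 r" and h0: "h 0 = 0" and r: "r > 0"
  shows "\<exists>q. q holomorphic_on ball 0 r \<and> q 0 = deriv h 0 \<and> (\<forall>u. h u = u * q u)"
proof -
  define q where "q = (\<lambda>u. if u = 0 then deriv h 0 else (h u - h 0) / (u - 0))"
  have "q holomorphic_on ball 0 r" unfolding q_def by (rule pole_lemma_open[OF h open_ball])
  moreover have "h u = u * q u" for u by (simp add: q_def h0)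
  ultimately show ?thesis by (intro exI[of _ q]) (simp add: q_def)
qed

definition stirling_log :: "complex \<Rightarrow> complex" where
  "stirling_log u = (if u = 0 then 1 else Ln (1 + u) / u)"

lemma stirling_log_holomorphic: "stirling_log holomorphic_on ball 0 1"
proof -
  have *: "(\<lambda>u. Ln (1 + u)) holomorphic_on ball 0 1"
  proof (intro holomorphic_intros)
    fix u :: complex assume "u \<in> ball 0 1"
    hence "norm u < 1" by simp
    hence "Re (1 + u) > 0" using abs_Re_le_cmod[of u] by simp
    thus "1 + u \<notin> \<real>\<^sub>\<le>\<^sub>0" by (auto simp: complex_nonpos_Reals_iff)
  qed
  have "deriv (\<lambda>u. Ln (1 + u)) 0 = (1::complex)"
    by (rule DERIV_imp_deriv) (auto intro!: derivative_eq_intros simp: complex_nonpos_Reals_iff)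
  hence "stirling_log = (\<lambda>u. if u = 0 then deriv (\<lambda>u. Ln (1 + u)) 0 else (Ln (1 + u) - Ln (1 + 0)) / (u - 0))"
    by (auto simp: stirling_log_def fun_eq_iff)
  with pole_lemma_open[OF * open_ball, of 0] show ?thesis by simp
qed

lemma stirling_log_mult: "u * stirling_log u = Ln (1 + u)"
  by (simp add: stirling_log_def)

text \<open>The derivative is already known to exist, so a single sequence determines it; along the
  real points 1 / (n + 1) it becomes an elementary real limit.\<close>

lemma deriv_stirling_log_0: "deriv stirling_log 0 = -1/2"
proof -
  have "(stirling_log has_field_derivative deriv stirling_log 0) (at 0)"
    using stirling_log_holomorphic by (rule holomorphic_derivI) auto
  hence "((\<lambda>u. (stirling_log u - stirling_log 0) / u) \<longlongrightarrow> deriv stirling_log 0) (at 0)"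
    by (simp add: has_field_derivative_iff)
  moreover have "filterlim (\<lambda>n::nat. complex_of_real (1 / (real n + 1))) (at 0) sequentially"
  proof (rule filterlim_atI)
    have "(\<lambda>n::nat. 1 / (real n + 1)) \<longlonglongrightarrow> 0" by real_asymp
    from tendsto_of_real[OF this, where 'a = complex]
    show "(\<lambda>n::nat. complex_of_real (1 / (real n + 1))) \<longlonglongrightarrow> 0" by simp
    have "complex_of_real (1 / (real n + 1)) \<noteq> 0" for n
      unfolding of_real_eq_0_iff by (simp add: add_nonneg_eq_0_iff)
    thus "\<forall>\<^sub>F n in sequentially. complex_of_real (1 / (real n + 1)) \<noteq> 0" by simp
  qed
  ultimately have lim: "(\<lambda>n::nat. (stirling_log (of_real (1 / (real n + 1))) - stirling_log 0) / of_real (1 / (real n + 1))) \<longlonglongrightarrow> deriv stirling_log 0"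
    by (rule filterlim_compose)
  have eq: "(stirling_log (of_real x) - stirling_log 0) / of_real x = of_real ((ln (1 + x) / x - 1) / x)"
    if "x > 0" for x :: real
    using that Ln_of_real[of "1 + x"] by (simp add: stirling_log_def)
  have "(\<lambda>n::nat. (ln (1 + 1 / (real n + 1)) / (1 / (real n + 1)) - 1) / (1 / (real n + 1))) \<longlonglongrightarrow> -1/2"
    by real_asymp
  from tendsto_of_real[OF this, where 'a = complex]
  have "(\<lambda>n::nat. (stirling_log (of_real (1 / (real n + 1))) - stirling_log 0) / of_real (1 / (real n + 1))) \<longlonglongrightarrow> -1/2"
    by (subst eq) (auto simp: add_pos_pos)
  from LIMSEQ_unique[OF lim this] show ?thesis .
qed

text \<open>
  Formal solution of the difference equation \<open>\<phi>(z) - \<phi>(z + 1) = (z + 1/2) log (1 + 1/z) - 1\<close> in powers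
  of \<open>u = 1/z\<close>, where \<open>z + 1\<close> corresponds to \<open>u / (1 + u)\<close>.
\<close>
lemma stirling_difference_equation:
  "\<exists>p q. poly p 0 = 0 \<and> q holomorphic_on ball 0 1 \<and>
     (\<forall>u\<in>ball 0 1. (1 + u / 2) * stirling_log u - 1 = poly p u - poly p (u / (1 + u)) + u ^ (K + 2) * q u)"
proof (induction K)
  case 0
  let ?G = "\<lambda>u. (1 + u / 2) * stirling_log u - 1"
  have G: "?G holomorphic_on ball 0 1" by (intro holomorphic_intros stirling_log_holomorphic) auto
  have G0: "?G 0 = 0" by (simp add: stirling_log_def)
  have sd: "(stirling_log has_field_derivative - 1 / 2) (at 0)"
    using holomorphic_derivI[OF stirling_log_holomorphic, of 0] deriv_stirling_log_0 by simp
  have s0: "stirling_log 0 = 1" by (simp add: stirling_log_def)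
  \<comment> \<open>The summand u/2 in 1 + u/2 cancels the linear term -u/2 of
    \<open>stirling_log\<close>; this produces the double zero that starts the induction at
    u^2.\<close>
  have "(?G has_field_derivative 0) (at 0)"
    by (rule derivative_eq_intros sd refl | simp add: s0)+
  hence d0: "deriv ?G 0 = 0" by (rule DERIV_imp_deriv)
  obtain q where q: "q holomorphic_on ball 0 1" "q 0 = 0" "\<And>u. ?G u = u * q u"
    using holomorphic_factor_out_zero[OF G G0 zero_less_one, unfolded d0] by blast
  obtain q2 where q2: "q2 holomorphic_on ball 0 1" "\<And>u. q u = u * q2 u"
    using holomorphic_factor_out_zero[OF q(1,2) zero_less_one] by blast
  show ?case using q2 q(3) by (intro exI[of _ 0] exI[of _ q2]) (auto simp: power2_eq_square)
next
  case (Suc K)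
  then obtain p q where p: "poly p 0 = 0" and q: "q holomorphic_on ball 0 1"
    and eq: "\<And>u. u \<in> ball 0 1 \<Longrightarrow> (1 + u / 2) * stirling_log u - 1 = poly p u - poly p (u / (1 + u)) + u ^ (K + 2) * q u"
    by blast
  have nz: "1 + u \<noteq> 0" if "u \<in> ball 0 1" for u :: complex
    using that by (auto simp: add_eq_0_iff)
  let ?f = "\<lambda>u::complex. 1 - 1 / (1 + u) ^ (K + 1)"
  have f: "?f holomorphic_on ball 0 1" using nz by (intro holomorphic_intros) auto
  have f0: "?f 0 = 0" by simp
  have df: "deriv ?f 0 = of_nat (K + 1)"
    by (rule DERIV_imp_deriv) (rule derivative_eq_intros refl | simp)+
  obtain r where r: "r holomorphic_on ball 0 1" "r 0 = of_nat (K + 1)" "\<And>u. ?f u = u * r u"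
    using holomorphic_factor_out_zero[OF f f0 zero_less_one, unfolded df] by blast
  \<comment> \<open>The difference u^(K+1) - (u / (1 + u))^(K+1) starts with (K + 1) u^(K+2), so
    this coefficient makes the new monomial cancel the leading term q(0) u^(K+2) of the
    error.\<close>
  define c where "c = q 0 / of_nat (K + 1)"
  have h: "(\<lambda>u. q u - c * r u) holomorphic_on ball 0 1" by (intro holomorphic_intros q r)
  have h0: "q 0 - c * r 0 = 0" by (simp add: c_def r(2) del: of_nat_add of_nat_Suc)
  obtain q' where q': "q' holomorphic_on ball 0 1" "\<And>u. q u - c * r u = u * q' u"
    using holomorphic_factor_out_zero[OF h h0 zero_less_one] by blast
  define p' where "p' = p + monom c (K + 1)"
  have "(1 + u / 2) * stirling_log u - 1 = poly p' u - poly p' (u / (1 + u)) + u ^ (Suc K + 2) * q' u"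
    if u: "u \<in> ball 0 1" for u
  proof -
    have "u ^ (K + 1) - (u / (1 + u)) ^ (K + 1) = u ^ (K + 1) * ?f u"
      by (simp add: power_divide right_diff_distrib)
    also have "\<dots> = u ^ (K + 2) * r u" unfolding r(3) by (simp add: power_add power2_eq_square)
    finally have m: "u ^ (K + 1) - (u / (1 + u)) ^ (K + 1) = u ^ (K + 2) * r u" .
    have "poly p' u - poly p' (u / (1 + u)) + u ^ (Suc K + 2) * q' u
        = poly p u - poly p (u / (1 + u)) + c * (u ^ (K + 1) - (u / (1 + u)) ^ (K + 1)) + u ^ (K + 2) * (u * q' u)"
      by (simp add: p'_def poly_monom right_diff_distrib power_add power2_eq_square mult_ac)
    also have "\<dots> = poly p u - poly p (u / (1 + u)) + u ^ (K + 2) * (c * r u + u * q' u)"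
      unfolding m by (simp add: distrib_left mult_ac)
    also have "c * r u + u * q' u = q u" using q'(2)[of u] by (simp add: algebra_simps)
    finally show ?thesis using eq[OF u] by simp
  qed
  moreover have "poly p' 0 = 0" by (simp add: p'_def p poly_monom)
  ultimately show ?case using q'(1) by blast
qed

text \<open>In the upper half-plane the arguments of z and 1 + 1/z have opposite signs, so their sum
  cannot leave the principal branch; the lower half-plane follows by conjugation.\<close>

lemma Ln_plus_1:
  assumes "Im z \<noteq> 0" shows "Ln (z + 1) = Ln z + Ln (1 + 1 / z)"
proof -
  have pos: "Ln (z + 1) = Ln z + Ln (1 + 1 / z)" if z: "Im z > 0" for z
  proof -
    have z0: "z \<noteq> 0" using z by auto
    have im: "Im (1 + 1 / z) < 0" using z by (simp add: Im_divide divide_neg_pos sum_power2_gt_zero_iff)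
    hence n0: "1 + 1 / z \<noteq> 0" by (metis less_irrefl zero_complex.sel(2))
    have "Im (Ln z) > 0" "Im (Ln z) < pi" using Im_Ln_pos_lt[OF z0] z by auto
    moreover have "Im (Ln (1 + 1 / z)) > - pi" "Im (Ln (1 + 1 / z)) < 0"
      using mpi_less_Im_Ln[OF n0] Im_Ln_pos_le[OF n0] im Im_Ln_le_pi[OF n0] by auto
    ultimately have "Ln (z * (1 + 1 / z)) = Ln z + Ln (1 + 1 / z)"
      by (intro Ln_times_simple z0 n0) auto
    thus ?thesis using z0 by (simp add: distrib_left)
  qed
  show ?thesis
  proof (cases "Im z > 0")
    case False
    hence "Im (cnj z) > 0" using assms by simp
    from arg_cong[OF pos[OF this], of cnj]
    have "cnj (Ln (cnj z + 1)) = cnj (Ln (cnj z)) + cnj (Ln (1 + 1 / cnj z))" by simp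
    moreover have "cnj (Ln (cnj z + 1)) = Ln (cnj (cnj z + 1))"
      using assms by (intro cnj_Ln) (auto simp: complex_nonpos_Reals_iff)
    moreover have "cnj (Ln (cnj z)) = Ln (cnj (cnj z))"
      using assms by (intro cnj_Ln) (auto simp: complex_nonpos_Reals_iff)
    moreover have "cnj (Ln (1 + 1 / cnj z)) = Ln (cnj (1 + 1 / cnj z))"
      using assms by (intro cnj_Ln) (auto simp: complex_nonpos_Reals_iff Im_divide)
    ultimately show ?thesis by simp
  qed (use pos in auto)
qed

text \<open>\<open>E\<close> is Stirling's main term. Its increment E(w + 1) - E(w) is Ln w up to
  the right-hand side of the difference equation above at u = 1 / w, so the sum of logarithms in
  Euler's limit telescopes and leaves a sum of exactly those errors.\<close>

lemma ln_Gamma_series_eq: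
  fixes z :: complex
  defines "E \<equiv> \<lambda>z. (z - 1/2) * Ln z - z"
  assumes z: "Im z \<noteq> 0" and n: "n > 0"
  shows "ln_Gamma_series z n = z * Ln (of_nat n) + of_real (ln (fact n)) - E (z + of_nat n + 1) + E z
     + (\<Sum>k\<le>n. (z + of_nat k + 1/2) * Ln (1 + 1 / (z + of_nat k)) - 1)"
proof -
  have step: "E (w + 1) - E w = Ln w + ((w + 1/2) * Ln (1 + 1 / w) - 1)" if "Im w \<noteq> 0" for w
    unfolding E_def Ln_plus_1[OF that] by (simp add: field_simps)
  have rearr: "x = y + u + v" if "x - y = u + v" for x y u v :: complex using that by (simp add: algebra_simps)
  have tel: "(\<Sum>k\<le>n. Ln (z + of_nat k)) =
     E (z + of_nat n + 1) - E z - (\<Sum>k\<le>n. (z + of_nat k + 1/2) * Ln (1 + 1 / (z + of_nat k)) - 1)"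
  proof (induction n)
    case 0
    show ?case using step[OF z] by (simp add: algebra_simps)
  next
    case (Suc n)
    have "Im (z + of_nat (Suc n)) \<noteq> 0" using z by simp
    from step[OF this] have st: "E (z + of_nat (Suc n) + 1) = E (z + of_nat (Suc n)) + Ln (z + of_nat (Suc n)) + ((z + of_nat (Suc n) + 1/2) * Ln (1 + 1 / (z + of_nat (Suc n))) - 1)"
      by (rule rearr)
    have e: "z + of_nat n + 1 = z + of_nat (Suc n)" by simp
    show ?case unfolding sum.atMost_Suc Suc.IH st e by (simp only: algebra_simps)
  qed
  have "(\<Sum>k=1..n. ln (z / of_nat k + 1)) = (\<Sum>k=1..n. Ln (z + of_nat k) - of_real (ln (real k)))"
  proof (rule sum.cong)
    fix k assume k: "k \<in> {1..n}"
    have "z / of_nat k + 1 = (z + of_nat k) / of_real (real k)" using k by (simp add: field_simps)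
    also have "Ln \<dots> = Ln (z + of_nat k) - of_real (ln (real k))"
      using k z by (intro Ln_divide_of_real) (auto simp: complex_eq_iff)
    finally show "ln (z / of_nat k + 1) = Ln (z + of_nat k) - of_real (ln (real k))" .
  qed auto
  also have "\<dots> = (\<Sum>k=1..n. Ln (z + of_nat k)) - of_real (ln (fact n))"
  proof -
    have "(\<Sum>k=1..n. ln (real k)) = ln (fact n)"
      by (induction n) (auto simp: ln_mult)
    thus ?thesis by (simp add: sum_subtractf flip: of_real_sum)
  qed
  finally have "ln z + (\<Sum>k=1..n. ln (z / of_nat k + 1)) = (\<Sum>k\<le>n. Ln (z + of_nat k)) - of_real (ln (fact n))"
    by (simp add: atLeast1_atMost_eq_remove0 sum.remove[of "{..n}" 0])
  thus ?thesis unfolding ln_Gamma_series_def tel by (simp add: algebra_simps)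
qed

text \<open>This is the part of E(z + n + 1) that depends on z; once it is known to vanish, the
  remaining limit no longer involves z.\<close>

lemma stirling_linear_part_tendsto:
  fixes z :: complex
  shows "(\<lambda>n. z + 1 - (z + of_nat n + 1/2) * Ln (1 + (z + 1) / of_nat n)) \<longlonglongrightarrow> 0"
proof -
  have v: "(\<lambda>n. (z + 1) / of_nat n) \<longlonglongrightarrow> 0" by (rule lim_const_over_n)
  have "isCont stirling_log 0"
    using stirling_log_holomorphic by (intro continuous_on_interior[OF holomorphic_on_imp_continuous_on]) auto
  from isCont_tendsto_compose[OF this v]
  have s: "(\<lambda>n. stirling_log ((z + 1) / of_nat n)) \<longlonglongrightarrow> 1" by (simp add: stirling_log_def)
  have m: "(\<lambda>n. (z + 1/2) / of_nat n) \<longlonglongrightarrow> 0" by (rule lim_const_over_n)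
  have "(\<lambda>n. (z + 1) - (1 + (z + 1/2) / of_nat n) * (z + 1) * stirling_log ((z + 1) / of_nat n)) \<longlonglongrightarrow> (z + 1) - (1 + 0) * (z + 1) * 1"
    by (intro tendsto_intros m s)
  hence "(\<lambda>n. (z + 1) - (1 + (z + 1/2) / of_nat n) * (z + 1) * stirling_log ((z + 1) / of_nat n)) \<longlonglongrightarrow> 0" by simp
  moreover have "\<forall>\<^sub>F n in sequentially. (z + 1) - (1 + (z + 1/2) / of_nat n) * (z + 1) * stirling_log ((z + 1) / of_nat n)
       = z + 1 - (z + of_nat n + 1/2) * Ln (1 + (z + 1) / of_nat n)"
    using eventually_gt_at_top[of 0]
  proof eventually_elim
    case (elim n)
    have "(z + of_nat n + 1/2) * Ln (1 + (z + 1) / of_nat n) = (z + of_nat n + 1/2) * ((z + 1) / of_nat n * stirling_log ((z + 1) / of_nat n))"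
      by (simp only: stirling_log_mult)
    also have "\<dots> = (1 + (z + 1/2) / of_nat n) * (z + 1) * stirling_log ((z + 1) / of_nat n)"
    proof -
      have "z + of_nat n + 1/2 = of_nat n * (1 + (z + 1/2) / of_nat n)" using elim by (simp add: field_simps)
      thus ?thesis using elim by (simp only:) simp
    qed
    finally show ?case by simp
  qed
  ultimately show ?thesis by (rule Lim_transform_eventually)
qed

text \<open>In this sector |z| <= 2 |Im z|, and adding k leaves the imaginary part unchanged. The
  first bound serves for decay in z, the second for convergence of sums over k.\<close>

lemma norm_sector_add_ge:
  fixes z :: complex
  assumes z: "norm z \<ge> 4" "\<bar>Re z\<bar> \<le> \<bar>Im z\<bar>"
  shows "norm (z + of_nat k) \<ge> norm z / 2" "norm (z + of_nat k) \<ge> (real k + 1) / 8"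
proof -
  have "norm z \<le> \<bar>Re z\<bar> + \<bar>Im z\<bar>" by (rule cmod_le)
  moreover have "\<bar>Im (z + of_nat k)\<bar> \<le> norm (z + of_nat k)" by (rule abs_Im_le_cmod)
  ultimately show 1: "norm (z + of_nat k) \<ge> norm z / 2" using z by simp
  have "norm (of_nat k :: complex) \<le> norm (z + of_nat k) + norm z" by norm
  hence "real k \<le> norm (z + of_nat k) + norm z" by simp
  thus "norm (z + of_nat k) \<ge> (real k + 1) / 8" using 1 z by simp
qed

text \<open>With u_k = 1 / (z + k) the map u -> u / (1 + u) sends u_k to u_(k+1), so the polynomial
  part telescopes. Of the K + 2 powers of u in the error, K give the decay in z and two the
  convergence of the sum over k.\<close>

lemma stirling_remainder_series:
  fixes p :: "complex poly"
  assumes p0: "poly p 0 = 0" and q: "q holomorphic_on ball 0 1"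
    and eq: "\<And>u. u \<in> ball 0 1 \<Longrightarrow> (1 + u / 2) * stirling_log u - 1 = poly p u - poly p (u / (1 + u)) + u ^ (K + 2) * q u"
  obtains R C where "\<And>z. norm z \<ge> 4 \<Longrightarrow> \<bar>Re z\<bar> \<le> \<bar>Im z\<bar> \<Longrightarrow>
      (\<lambda>n. \<Sum>k\<le>n. (z + of_nat k + 1/2) * Ln (1 + 1 / (z + of_nat k)) - 1) \<longlonglongrightarrow> poly p (1 / z) + R z"
    "\<And>z. norm z \<ge> 4 \<Longrightarrow> \<bar>Re z\<bar> \<le> \<bar>Im z\<bar> \<Longrightarrow> norm (R z) \<le> C / norm z ^ K"
proof -
  have "compact (q ` cball 0 (1/2))"
    by (intro compact_continuous_image holomorphic_on_imp_continuous_on holomorphic_on_subset[OF q]) auto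
  then obtain M where M: "\<And>u. norm u \<le> 1/2 \<Longrightarrow> norm (q u) \<le> M"
    using compact_imp_bounded bounded_iff by (metis image_eqI mem_cball_0)
  have "norm (q 0) \<le> M" by (rule M) simp
  hence M0: "M \<ge> 0" using norm_ge_zero[of "q 0"] by linarith
  define u where "u z k = 1 / (z + of_nat k)" for z :: complex and k :: nat
  define S where "S = (\<Sum>k. 64 / (real k + 1)\<^sup>2)"
  have S: "summable (\<lambda>k. 64 / (real k + 1)\<^sup>2)"
  proof -
    have "summable (\<lambda>k. inverse (real k ^ 2))" by (rule inverse_power_summable) simp
    hence "summable (\<lambda>k. inverse (real (Suc k) ^ 2))" by (subst summable_Suc_iff)
    hence "summable (\<lambda>k. 64 * inverse (real (Suc k) ^ 2))" by (rule summable_mult)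
    thus ?thesis by (simp add: divide_inverse add.commute)
  qed
  define R where "R z = (\<Sum>k. u z k ^ (K + 2) * q (u z k))" for z
  have bd: "norm (u z k ^ (K + 2) * q (u z k)) \<le> M * (2 / norm z) ^ K * (64 / (real k + 1)\<^sup>2)"
    if z: "norm z \<ge> 4" "\<bar>Re z\<bar> \<le> \<bar>Im z\<bar>" for z k
  proof -
    note n = norm_sector_add_ge[OF z, of k]
    define m where "m = norm (z + of_nat k)"
    have m: "m > 0" "norm z > 0" "norm z \<le> 2 * m" "real k + 1 \<le> 8 * m" "real k + 1 > 0"
      using n z by (auto simp: m_def[symmetric])
    have um: "norm (u z k) = 1 / m" by (simp add: u_def norm_divide m_def)
    have u1: "norm (u z k) \<le> 2 / norm z"
    proof -
      have "norm (u z k) = 2 / (2 * m)" unfolding um by simp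
      also have "\<dots> \<le> 2 / norm z" by (rule divide_left_mono) (use m in auto)
      finally show ?thesis .
    qed
    have u2: "norm (u z k) \<le> 8 / (real k + 1)" unfolding um using m(1,4,5) by (simp add: divide_simps)
    have u3: "norm (u z k) \<le> 1/2" unfolding um using m z(1) by (simp add: divide_simps)
    have "norm (u z k) ^ K * norm (u z k) ^ 2 * norm (q (u z k)) \<le> (2 / norm z) ^ K * (8 / (real k + 1)) ^ 2 * M"
      using u1 u2 M[OF u3] by (intro mult_mono power_mono) auto
    thus ?thesis by (simp add: norm_mult norm_power power_add power_divide power2_eq_square mult_ac)
  qed
  have sm: "summable (\<lambda>k. u z k ^ (K + 2) * q (u z k))" and Rb: "norm (R z) \<le> M * (2 / norm z) ^ K * S"
    if z: "norm z \<ge> 4" "\<bar>Re z\<bar> \<le> \<bar>Im z\<bar>" for z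
  proof -
    have S': "summable (\<lambda>k. M * (2 / norm z) ^ K * (64 / (real k + 1)\<^sup>2))" by (intro summable_mult S)
    show "summable (\<lambda>k. u z k ^ (K + 2) * q (u z k))"
      by (rule summable_comparison_test'[OF S' bd[OF z]])
    have "norm (R z) \<le> (\<Sum>k. M * (2 / norm z) ^ K * (64 / (real k + 1)\<^sup>2))"
      unfolding R_def by (rule norm_suminf_le[OF bd[OF z] S'])
    also have "\<dots> = M * (2 / norm z) ^ K * S" unfolding S_def by (rule suminf_mult[OF S])
    finally show "norm (R z) \<le> M * (2 / norm z) ^ K * S" .
  qed
  show ?thesis
  proof
    fix z :: complex assume z: "norm z \<ge> 4" "\<bar>Re z\<bar> \<le> \<bar>Im z\<bar>"
    have summand: "(z + of_nat k + 1/2) * Ln (1 + 1 / (z + of_nat k)) - 1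
        = poly p (u z k) - poly p (u z (Suc k)) + u z k ^ (K + 2) * q (u z k)" for k
    proof -
      note n = norm_sector_add_ge[OF z, of k]
      have nz: "z + of_nat k \<noteq> 0" using n z by auto
      have nz1: "z + of_nat (Suc k) \<noteq> 0" using norm_sector_add_ge[OF z, of "Suc k"] z by auto
      have "norm (z + of_nat k) > 1" using n z by linarith
      hence "norm (u z k) < 1" by (simp add: u_def norm_divide divide_less_eq)
      hence "(1 + u z k / 2) * stirling_log (u z k) - 1 = poly p (u z k) - poly p (u z k / (1 + u z k)) + u z k ^ (K + 2) * q (u z k)"
        by (intro eq) simp
      moreover have "u z k / (1 + u z k) = u z (Suc k)" using nz nz1 by (simp add: u_def divide_simps add_ac)
      moreover have "(1 + u z k / 2) * stirling_log (u z k) = (z + of_nat k + 1/2) * Ln (1 + 1 / (z + of_nat k))"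
      proof -
        have "u z k \<noteq> 0" using nz by (simp add: u_def)
        moreover have "1 + (1 / x) / 2 = (x + 1/2) * (1 / x)" if "x \<noteq> 0" for x :: complex
          using that by (simp add: field_simps)
        from this[OF nz] have "1 + u z k / 2 = (z + of_nat k + 1/2) * u z k" by (simp only: u_def)
        ultimately show ?thesis by (simp only: mult.assoc stirling_log_mult) (simp add: u_def)
      qed
      ultimately show ?thesis by simp
    qed
    have sum_eq: "(\<Sum>k\<le>n. (z + of_nat k + 1/2) * Ln (1 + 1 / (z + of_nat k)) - 1)
       = poly p (1 / z) - poly p (u z (Suc n)) + (\<Sum>k\<le>n. u z k ^ (K + 2) * q (u z k))" for n
      unfolding summand by (induction n) (simp_all add: u_def)
    have "(\<lambda>n. 1 / (real n + 1)) \<longlonglongrightarrow> 0" by real_asymp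
    hence "(\<lambda>n. u z (Suc n)) \<longlonglongrightarrow> 0"
    proof (rule Lim_null_comparison[rotated, OF tendsto_mult_right_zero[of _ _ 8]])
      show "\<forall>\<^sub>F n in sequentially. norm (u z (Suc n)) \<le> 8 * (1 / (real n + 1))"
      proof (rule always_eventually, rule allI)
        fix n
        have "norm (z + of_nat (Suc n)) \<ge> (real n + 1) / 8" using norm_sector_add_ge[OF z, of "Suc n"] by simp
        moreover have "(real n + 1) / 8 > 0" by simp
        ultimately have "1 / norm (z + of_nat (Suc n)) \<le> 1 / ((real n + 1) / 8)"
          by (intro divide_left_mono mult_pos_pos) linarith+
        thus "norm (u z (Suc n)) \<le> 8 * (1 / (real n + 1))" by (simp add: u_def norm_divide)
      qed
    qed
    hence A: "(\<lambda>n. poly p (u z (Suc n))) \<longlonglongrightarrow> poly p 0" by (intro tendsto_intros)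
    have B: "(\<lambda>n. \<Sum>k\<le>n. u z k ^ (K + 2) * q (u z k)) \<longlonglongrightarrow> R z"
      unfolding R_def by (rule summable_LIMSEQ'[OF sm[OF z]])
    have "(\<lambda>n. poly p (1 / z) - poly p (u z (Suc n)) + (\<Sum>k\<le>n. u z k ^ (K + 2) * q (u z k))) \<longlonglongrightarrow> poly p (1 / z) - poly p 0 + R z"
      by (rule tendsto_add[OF tendsto_diff[OF tendsto_const A] B])
    thus "(\<lambda>n. \<Sum>k\<le>n. (z + of_nat k + 1/2) * Ln (1 + 1 / (z + of_nat k)) - 1) \<longlonglongrightarrow> poly p (1 / z) + R z"
      unfolding sum_eq using p0 by simp
    show "norm (R z) \<le> (M * 2 ^ K * S) / norm z ^ K" using Rb[OF z] by (simp add: power_divide)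
  qed
qed

text \<open>All dependence on z has been separated from the sequence \<open>a\<close>, so its limit
  is the same for every z of the sector. This constant, half the logarithm of 2 pi, is added to the
  polynomial and never has to be evaluated.\<close>

lemma stirling_series:
  "\<exists>(p::complex poly) C. \<forall>z. norm z \<ge> 4 \<longrightarrow> \<bar>Re z\<bar> \<le> \<bar>Im z\<bar> \<longrightarrow>
     norm (ln_Gamma z - ((z - 1/2) * Ln z - z) - poly p (1 / z)) \<le> C / norm z ^ K"
proof -
  obtain p q where pq: "poly p 0 = 0" "q holomorphic_on ball 0 1"
    "\<And>u. u \<in> ball 0 1 \<Longrightarrow> (1 + u / 2) * stirling_log u - 1 = poly p u - poly p (u / (1 + u)) + u ^ (K + 2) * q u"
    using stirling_difference_equation[of K] by blast
  obtain R C where R: "\<And>z. norm z \<ge> 4 \<Longrightarrow> \<bar>Re z\<bar> \<le> \<bar>Im z\<bar> \<Longrightarrow>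
      (\<lambda>n. \<Sum>k\<le>n. (z + of_nat k + 1/2) * Ln (1 + 1 / (z + of_nat k)) - 1) \<longlonglongrightarrow> poly p (1 / z) + R z"
    "\<And>z. norm z \<ge> 4 \<Longrightarrow> \<bar>Re z\<bar> \<le> \<bar>Im z\<bar> \<Longrightarrow> norm (R z) \<le> C / norm z ^ K"
    using stirling_remainder_series[OF pq] by blast
  define a where "a n = complex_of_real (ln (fact n)) - (of_nat n + 1/2) * Ln (of_nat n) + of_nat n" for n :: nat
  have lim: "a \<longlonglongrightarrow> ln_Gamma z - ((z - 1/2) * Ln z - z) - poly p (1 / z) - R z"
    if z: "norm z \<ge> 4" "\<bar>Re z\<bar> \<le> \<bar>Im z\<bar>" for z
  proof -
    have im: "Im z \<noteq> 0" using z by (cases "Im z = 0") (auto simp: cmod_def)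
    have "z \<notin> \<int>\<^sub>\<le>\<^sub>0" using im by (auto elim!: nonpos_Ints_cases)
    hence "ln_Gamma_series z \<longlonglongrightarrow> ln_Gamma z" by (rule ln_Gamma_complex_LIMSEQ)
    from tendsto_diff[OF tendsto_diff[OF tendsto_diff[OF this tendsto_const[of "(z - 1/2) * Ln z - z"]] R(1)[OF z]] stirling_linear_part_tendsto[of z]]
    have L: "(\<lambda>n. ln_Gamma_series z n - ((z - 1/2) * Ln z - z) -
        (\<Sum>k\<le>n. (z + of_nat k + 1/2) * Ln (1 + 1 / (z + of_nat k)) - 1) - (z + 1 - (z + of_nat n + 1/2) * Ln (1 + (z + 1) / of_nat n)))
      \<longlonglongrightarrow> ln_Gamma z - ((z - 1/2) * Ln z - z) - poly p (1 / z) - R z"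
      by (simp add: algebra_simps)
    have "\<forall>\<^sub>F n in sequentially. ln_Gamma_series z n - ((z - 1/2) * Ln z - z) -
        (\<Sum>k\<le>n. (z + of_nat k + 1/2) * Ln (1 + 1 / (z + of_nat k)) - 1) - (z + 1 - (z + of_nat n + 1/2) * Ln (1 + (z + 1) / of_nat n))
       = a n"
      using eventually_gt_at_top[of 0]
    proof eventually_elim
      case (elim n)
      have nz: "1 + (z + 1) / of_nat n \<noteq> 0"
      proof
        assume "1 + (z + 1) / of_nat n = 0"
        hence "z + of_nat n + 1 = 0" using elim by (simp add: field_simps)
        hence "Im (z + of_nat n + 1) = 0" by (simp only: zero_complex.sel)
        thus False using im by simp
      qed
      have "z + of_nat n + 1 = of_real (real n) * (1 + (z + 1) / of_nat n)" using elim by (simp add: field_simps)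
      also have "Ln \<dots> = of_real (ln (real n)) + Ln (1 + (z + 1) / of_nat n)"
        using elim nz Ln_times_of_real[of "real n" "1 + (z + 1) / of_nat n"] by auto
      also have "of_real (ln (real n)) = Ln (of_nat n)" using elim by (simp add: Ln_of_nat)
      finally have e: "Ln (z + of_nat n + 1) = Ln (of_nat n) + Ln (1 + (z + 1) / of_nat n)" .
      show ?case unfolding ln_Gamma_series_eq[OF im elim] e a_def by (simp add: algebra_simps)
    qed
    thus ?thesis using Lim_transform_eventually[OF L] by blast
  qed
  define c where "c = lim a"
  have c: "ln_Gamma z - ((z - 1/2) * Ln z - z) - poly p (1 / z) - R z = c" if "norm z \<ge> 4" "\<bar>Re z\<bar> \<le> \<bar>Im z\<bar>" for z
    unfolding c_def using limI[OF lim[OF that]] by simp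
  show ?thesis
  proof (intro exI allI impI)
    fix z :: complex assume z: "norm z \<ge> 4" "\<bar>Re z\<bar> \<le> \<bar>Im z\<bar>"
    have "ln_Gamma z - ((z - 1/2) * Ln z - z) - poly (p + [:c:]) (1 / z) = R z"
      using c[OF z] by (simp add: algebra_simps)
    thus "norm (ln_Gamma z - ((z - 1/2) * Ln z - z) - poly (p + [:c:]) (1 / z)) \<le> C / norm z ^ K"
      using R(2)[OF z] by simp
  qed
qed

section \<open>Integrals depending holomorphically on several parameters\<close>

lemma holo_multi_on_set_integral:
  fixes f :: "complex^'n::finite \<Rightarrow> 'a \<Rightarrow> complex"
  assumes S: "open S" and hol: "\<And>x. x \<in> A \<Longrightarrow> holo_multi_on (\<lambda>s. f s x) S"
    and meas: "\<And>s. s \<in> S \<Longrightarrow> set_borel_measurable M A (f s)"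
    and dom: "\<And>p. p \<in> S \<Longrightarrow> \<exists>e>0. \<exists>g. set_integrable M A g \<and> (\<forall>s\<in>ball p e \<inter> S. \<forall>x\<in>A. norm (f s x) \<le> g x)"
  shows "holo_multi_on (\<lambda>s. LINT x:A|M. f s x) S"
  unfolding set_lebesgue_integral_def
proof (rule holo_multi_on_integral[OF S])
  show "holo_multi_on (\<lambda>s. indicat_real A x *\<^sub>R f s x) S" for x
    by (cases "x \<in> A") (auto intro: hol holo_multi_on_const)
  show "(\<lambda>x. indicat_real A x *\<^sub>R f s x) \<in> borel_measurable M" if "s \<in> S" for s
    using meas[OF that] by (simp add: set_borel_measurable_def)
next
  fix p assume "p \<in> S"
  then obtain e g where e: "e > 0" "set_integrable M A g" "\<forall>s\<in>ball p e \<inter> S. \<forall>x\<in>A. norm (f s x) \<le> g x"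
    using dom by blast
  show "\<exists>e>0. \<exists>g. integrable M g \<and> (\<forall>s\<in>ball p e \<inter> S. \<forall>x\<in>space M. norm (indicat_real A x *\<^sub>R f s x) \<le> g x)"
    using e by (intro exI[of _ e] conjI exI[of _ "\<lambda>x. indicat_real A x *\<^sub>R g x"])
       (auto simp: set_integrable_def indicator_def)
qed

lemma holo_multi_on_integral_interval:
  fixes f :: "complex^'n::finite \<Rightarrow> real \<Rightarrow> complex"
  assumes S: "open S" and hol: "\<And>x. x \<in> {a..b} \<Longrightarrow> holo_multi_on (\<lambda>s. f s x) S"
    and cont: "\<And>s. s \<in> S \<Longrightarrow> continuous_on {a..b} (f s)"
    and bd: "\<And>p. p \<in> S \<Longrightarrow> \<exists>e>0. \<exists>M. \<forall>s\<in>ball p e \<inter> S. \<forall>x\<in>{a..b}. norm (f s x) \<le> M"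
  shows "holo_multi_on (\<lambda>s. integral {a..b} (f s)) S"
proof -
  have int: "set_integrable lborel {a..b} (f s)" if "s \<in> S" for s
    by (rule borel_integrable_atLeastAtMost'[OF cont[OF that]])
  have "holo_multi_on (\<lambda>s. LINT x:{a..b}|lborel. f s x) S"
  proof (rule holo_multi_on_set_integral[OF S hol])
    show "set_borel_measurable lborel {a..b} (f s)" if "s \<in> S" for s
      using int[OF that] unfolding set_integrable_def set_borel_measurable_def by (rule borel_measurable_integrable)
  next
    fix p assume "p \<in> S"
    then obtain e M where "e > 0" "\<forall>s\<in>ball p e \<inter> S. \<forall>x\<in>{a..b}. norm (f s x) \<le> M" using bd by blast
    moreover have "set_integrable lborel {a..b} (\<lambda>x. M)"
      by (intro borel_integrable_atLeastAtMost' continuous_intros)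
    ultimately show "\<exists>e>0. \<exists>g. set_integrable lborel {a..b} g \<and> (\<forall>s\<in>ball p e \<inter> S. \<forall>x\<in>{a..b}. norm (f s x) \<le> g x)"
      by blast
  qed
  thus ?thesis
    by (rule iffD1[OF holo_multi_on_cong, rotated]) (simp add: set_borel_integral_eq_integral(2)[OF int])
qed

lemma holomorphic_on_poly: "f holomorphic_on A \<Longrightarrow> (\<lambda>z. poly p (f z)) holomorphic_on A"
  by (induction p) (auto intro!: holomorphic_intros)

lemma compact_ball_bound:
  fixes f :: "complex \<Rightarrow> complex"
  assumes "f holomorphic_on ball 0 r" "r' < r"
  shows "\<exists>M\<ge>0. \<forall>u. norm u \<le> r' \<longrightarrow> norm (f u) \<le> M"
proof -
  have "compact (f ` cball 0 r')"
    by (intro compact_continuous_image holomorphic_on_imp_continuous_on holomorphic_on_subset[OF assms(1)])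
       (use assms in auto)
  then obtain M where "\<And>u. u \<in> cball 0 r' \<Longrightarrow> norm (f u) \<le> M"
    using compact_imp_bounded bounded_iff by (metis image_eqI)
  thus ?thesis by (intro exI[of _ "max M 0"]) (auto simp: le_max_iff_disj)
qed

lemma norm_exp_minus_1_le: "norm (exp z - 1 :: complex) \<le> norm z * exp (norm z)"
proof -
  have "norm (exp z - exp 0) \<le> exp (norm z) * norm (z - 0)"
  proof (rule field_differentiable_bound[where S = "cball 0 (norm z)" and f' = exp])
    fix w :: complex assume "w \<in> cball 0 (norm z)"
    thus "norm (exp w) \<le> exp (norm z)" using complex_Re_le_cmod[of w] by (auto intro: order_trans)
  qed (auto intro!: derivative_eq_intros)
  thus ?thesis by (simp add: mult.commute)
qed

section \<open>Size of Gamma on vertical lines\<close>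

lemma Ln_upper_cone:
  assumes "4 * \<bar>Re z\<bar> \<le> Im z" "Im z > 0"
  obtains L where "Ln z = of_real (ln (Im z)) + \<i> * of_real pi / 2 + L" "norm L \<le> 2 * \<bar>Re z\<bar> / Im z" "norm L \<le> 1/2"
proof
  \<comment> \<open>z equals i Im z (1 + v) with a small v, so Ln z differs from ln(Im z) + i pi/2
    by Ln(1 + v).\<close>
  define v where "v = - \<i> * of_real (Re z / Im z)"
  have v: "norm v = \<bar>Re z\<bar> / Im z" "norm v \<le> 1/4"
    using assms by (auto simp: v_def norm_mult norm_divide divide_simps)
  have re: "Re (1 + v) = 1" by (simp add: v_def)
  have nz: "1 + v \<noteq> 0" using re by (metis zero_complex.sel(1) zero_neq_one)
  have "z = of_real (Im z) * (\<i> * (1 + v))" using assms by (simp add: v_def complex_eq_iff)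
  hence "Ln z = Ln (of_real (Im z) * (\<i> * (1 + v)))" by simp
  also have "\<dots> = of_real (ln (Im z)) + Ln (\<i> * (1 + v))"
    using assms nz Ln_times_of_real[of "Im z" "\<i> * (1 + v)"] by (auto simp: Ln_of_real)
  also have "Ln (\<i> * (1 + v)) = Ln (1 + v) + \<i> * of_real pi / 2"
    using Ln_times_ii[OF nz] re by simp
  finally show "Ln z = of_real (ln (Im z)) + \<i> * of_real pi / 2 + Ln (1 + v)" by simp
  have "norm (Ln (1 + v)) \<le> 2 * norm v" using v by (intro norm_Ln_le) auto
  thus "norm (Ln (1 + v)) \<le> 2 * \<bar>Re z\<bar> / Im z" "norm (Ln (1 + v)) \<le> 1/2"
  proof -
    show "norm (Ln (1 + v)) \<le> 1/2" using \<open>norm (Ln (1 + v)) \<le> 2 * norm v\<close> v(2) by linarith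
    have "norm (Ln (1 + v)) \<le> 2 * (\<bar>Re z\<bar> / Im z)" using \<open>norm (Ln (1 + v)) \<le> 2 * norm v\<close> unfolding v(1) .
    thus "norm (Ln (1 + v)) \<le> 2 * \<bar>Re z\<bar> / Im z" by simp
  qed
qed

text \<open>In the real part of Stirling's main term, -Im z times arg z gives -pi/2 Im z up to a
  bounded amount, because arg z differs from pi/2 by O(X / Im z); the factor (Re z - 1/2) ln(Im z)
  gives the power. The crudest order K = 0 of the series suffices.\<close>

lemma Gamma_vertical_bounds_upper:
  assumes X: "X \<ge> 0"
  shows "\<exists>C>0. \<forall>z. \<bar>Re z\<bar> \<le> X \<longrightarrow> Im z \<ge> max 4 (4 * X) \<longrightarrow>
    norm (Gamma z) \<le> C * Im z powr (X + 1) * exp (- pi / 2 * Im z) \<and>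
    norm (rGamma z) \<le> C * Im z powr (X + 1) * exp (pi / 2 * Im z)"
proof -
  obtain p C0 where st: "\<And>z. norm z \<ge> 4 \<Longrightarrow> \<bar>Re z\<bar> \<le> \<bar>Im z\<bar> \<Longrightarrow>
     norm (ln_Gamma z - ((z - 1/2) * Ln z - z) - poly p (1 / z)) \<le> C0 / norm z ^ 0"
    using stirling_series[of 0] by blast
  obtain M where M: "\<And>u. norm u \<le> 1 \<Longrightarrow> norm (poly p u) \<le> M"
    using compact_ball_bound[OF holomorphic_on_poly[OF holomorphic_on_ident], of 1 2 p] by auto
  define B where "B = C0 + M + (X + 1) + 3 * X"
  have main: "\<bar>Re (ln_Gamma z) + pi / 2 * Im z\<bar> \<le> (X + 1) * ln (Im z) + B" and notpole: "z \<notin> \<int>\<^sub>\<le>\<^sub>0"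
    if z: "\<bar>Re z\<bar> \<le> X" "Im z \<ge> max 4 (4 * X)" for z
  proof -
    let ?x = "Re z" and ?y = "Im z"
    have y: "?y \<ge> 4" "?y \<ge> 4 * X" using z by auto
    show "z \<notin> \<int>\<^sub>\<le>\<^sub>0" using y by (auto elim!: nonpos_Ints_cases)
    have nz: "norm z \<ge> 4" using abs_Im_le_cmod[of z] y by linarith
    obtain L where L: "Ln z = of_real (ln ?y) + \<i> * of_real pi / 2 + L" "norm L \<le> 2 * \<bar>?x\<bar> / ?y" "norm L \<le> 1/2"
      using Ln_upper_cone[of z] y z by force
    have "norm (1 / z) \<le> 1" using nz by (simp add: norm_divide divide_simps)
    from M[OF this] st[OF nz] y z have "norm (ln_Gamma z - ((z - 1/2) * Ln z - z)) \<le> C0 + M"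
      using norm_triangle_ineq[of "ln_Gamma z - ((z - 1/2) * Ln z - z) - poly p (1 / z)" "poly p (1/z)"] by auto
    hence 1: "\<bar>Re (ln_Gamma z) - Re ((z - 1/2) * Ln z - z)\<bar> \<le> C0 + M"
      by (metis abs_Re_le_cmod minus_complex.sel(1) order_trans)
    have reL: "\<bar>Re L\<bar> \<le> 1/2" using L(3) abs_Re_le_cmod[of L] by linarith
    have "?y * \<bar>Im L\<bar> \<le> ?y * (2 * \<bar>?x\<bar> / ?y)" using L(2) abs_Im_le_cmod[of L] y by (intro mult_left_mono) linarith+
    hence imL: "\<bar>?y * Im L\<bar> \<le> 2 * X" using y z by (simp add: abs_mult)
    have eq: "Re ((z - 1/2) * Ln z - z) + pi / 2 * ?y = (?x - 1/2) * (ln ?y + Re L) - ?y * Im L - ?x"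
      unfolding L(1) by (simp add: algebra_simps)
    have lny: "ln ?y \<ge> 0" using y by simp
    have "\<bar>ln ?y + Re L\<bar> \<le> ln ?y + 1" using reL lny by linarith
    moreover have "\<bar>?x - 1/2\<bar> \<le> X + 1" using z by linarith
    ultimately have "\<bar>(?x - 1/2) * (ln ?y + Re L)\<bar> \<le> (X + 1) * (ln ?y + 1)"
      unfolding abs_mult using X by (intro mult_mono) auto
    hence 2: "\<bar>Re ((z - 1/2) * Ln z - z) + pi / 2 * ?y\<bar> \<le> (X + 1) * (ln ?y + 1) + 3 * X"
      unfolding eq using imL z(1) by linarith
    show "\<bar>Re (ln_Gamma z) + pi / 2 * ?y\<bar> \<le> (X + 1) * ln ?y + B"
      using 1 2 by (simp add: B_def algebra_simps)
  qed
  show ?thesis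
  proof (intro exI[of _ "exp B"] conjI allI impI)
    fix z assume z: "\<bar>Re z\<bar> \<le> X" "Im z \<ge> max 4 (4 * X)"
    have e: "Im z powr (X + 1) = exp ((X + 1) * ln (Im z))" using z by (simp add: powr_def)
    show "norm (Gamma z) \<le> exp B * Im z powr (X + 1) * exp (- pi / 2 * Im z)"
      using main[OF z] notpole[OF z] unfolding e by (simp add: Gamma_complex_altdef flip: exp_add)
    show "norm (rGamma z) \<le> exp B * Im z powr (X + 1) * exp (pi / 2 * Im z)"
      using main[OF z] notpole[OF z] unfolding e by (simp add: rGamma_complex_altdef flip: exp_add)
  qed auto
qed

lemma Gamma_vertical_bounds:
  assumes X: "X \<ge> 0"
  obtains C where "C > 0" "\<And>z. \<bar>Re z\<bar> \<le> X \<Longrightarrow> \<bar>Im z\<bar> \<ge> max 4 (4 * X) \<Longrightarrow>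
    norm (Gamma z) \<le> C * \<bar>Im z\<bar> powr (X + 1) * exp (- pi / 2 * \<bar>Im z\<bar>)"
    "\<And>z. \<bar>Re z\<bar> \<le> X \<Longrightarrow> \<bar>Im z\<bar> \<ge> max 4 (4 * X) \<Longrightarrow>
    norm (rGamma z) \<le> C * \<bar>Im z\<bar> powr (X + 1) * exp (pi / 2 * \<bar>Im z\<bar>)"
proof -
  obtain C where C: "C > 0" "\<And>z. \<bar>Re z\<bar> \<le> X \<Longrightarrow> Im z \<ge> max 4 (4 * X) \<Longrightarrow>
    norm (Gamma z) \<le> C * Im z powr (X + 1) * exp (- pi / 2 * Im z) \<and>
    norm (rGamma z) \<le> C * Im z powr (X + 1) * exp (pi / 2 * Im z)"
    using Gamma_vertical_bounds_upper[OF X] by blast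
  have "norm (Gamma z) \<le> C * \<bar>Im z\<bar> powr (X + 1) * exp (- pi / 2 * \<bar>Im z\<bar>) \<and>
    norm (rGamma z) \<le> C * \<bar>Im z\<bar> powr (X + 1) * exp (pi / 2 * \<bar>Im z\<bar>)"
    if z: "\<bar>Re z\<bar> \<le> X" "\<bar>Im z\<bar> \<ge> max 4 (4 * X)" for z
  proof (cases "Im z \<ge> 0")
    case True
    thus ?thesis using C(2)[of z] z by simp
  next
    case False
    hence "norm (Gamma (cnj z)) \<le> C * \<bar>Im z\<bar> powr (X + 1) * exp (- pi / 2 * \<bar>Im z\<bar>) \<and>
      norm (rGamma (cnj z)) \<le> C * \<bar>Im z\<bar> powr (X + 1) * exp (pi / 2 * \<bar>Im z\<bar>)"
      using C(2)[of "cnj z"] z by simp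
    thus ?thesis by (simp flip: cnj_Gamma cnj_rGamma)
  qed
  with C(1) that show ?thesis by blast
qed

section \<open>Gamma at an affine function of w\<close>

lemma Ln_real_mult_upper:
  assumes "a \<noteq> 0" "Im w > 0"
  shows "Ln (of_real a * w) = of_real (ln \<bar>a\<bar>) + Ln w - (if a < 0 then \<i> * of_real pi else 0)"
proof -
  have w: "w \<noteq> 0" using assms by auto
  show ?thesis
  proof (cases "a > 0")
    case True
    thus ?thesis using Ln_times_of_real[of a w] w by (simp add: Ln_of_real)
  next
    case False
    hence "Ln (of_real (- a) * (- w)) = Ln (of_real (- a)) + Ln (- w)"
      using assms w by (intro Ln_times_of_real) auto
    also have "Ln (- w) = Ln w - \<i> * of_real pi" using Ln_minus[OF w] assms by simp
    also have "Ln (of_real (- a)) = of_real (ln \<bar>a\<bar>)" using assms False by (subst Ln_of_real) auto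
    finally show ?thesis using False assms by simp
  qed
qed

text \<open>Stirling's formula is expanded at a w instead of a w + b, so that the logarithm does not
  involve b; the factor log(1 + b / (a w)) is moved into g, which is holomorphic in u = 1/w and in b
  and bounded uniformly. Negative a is included because the functional equation produces Gamma
  factors containing -w.\<close>

lemma ln_Gamma_affine_expansion:
  fixes a \<rho> :: real assumes a: "a \<noteq> 0" and \<rho>: "\<rho> > 0"
  shows "\<exists>g u0 C. u0 > 0 \<and> u0 \<le> 1 \<and> C \<ge> 0 \<and>
   (\<forall>b. norm b < \<rho> \<longrightarrow> (\<lambda>u. g b u) holomorphic_on ball 0 u0) \<and>
   (\<forall>u. norm u < u0 \<longrightarrow> (\<lambda>b. g b u) holomorphic_on ball 0 \<rho>) \<and>
   (\<forall>b u. norm b < \<rho> \<longrightarrow> norm u < u0 \<longrightarrow> norm (g b u) \<le> C) \<and>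
   (\<forall>b w. norm b < \<rho> \<longrightarrow> 4 * \<bar>Re w\<bar> \<le> Im w \<longrightarrow> norm w > 1 / u0 \<longrightarrow> of_real a * w + b \<notin> \<int>\<^sub>\<le>\<^sub>0 \<and>
      norm (ln_Gamma (of_real a * w + b) - ((of_real a * w + b - 1/2) * Ln (of_real a * w) - of_real a * w) - g b (1 / w)) \<le> C / norm w ^ K)"
proof -
  obtain p C0 where st: "\<And>z. norm z \<ge> 4 \<Longrightarrow> \<bar>Re z\<bar> \<le> \<bar>Im z\<bar> \<Longrightarrow>
     norm (ln_Gamma z - ((z - 1/2) * Ln z - z) - poly p (1 / z)) \<le> C0 / norm z ^ K"
    using stirling_series[of K] by blast
  obtain M1 where M1: "M1 \<ge> 0" "\<And>u. norm u \<le> 1/2 \<Longrightarrow> norm (stirling_log u) \<le> M1"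
    using compact_ball_bound[OF stirling_log_holomorphic, of "1/2"] by auto
  obtain M2 where M2: "M2 \<ge> 0" "\<And>u. norm u \<le> 1 \<Longrightarrow> norm (poly p u) \<le> M2"
    using compact_ball_bound[OF holomorphic_on_poly[OF holomorphic_on_ident], of 1 2 p] by auto
  \<comment> \<open>This keeps |b u / a| below 1/8, inside the disc of \<open>stirling_log\<close>,
    and makes |u / (a + b u)| at most 1, where the polynomial is bounded by
    \<open>M2\<close>.\<close>
  define u0 where "u0 = min 1 (\<bar>a\<bar> / (8 * (\<rho> + 1)))"
  have u0: "u0 > 0" "u0 \<le> 1" using a \<rho> by (auto simp: u0_def)
  define g where "g b u = - b + (of_real a + (b - 1/2) * u) * (b / of_real a) * stirling_log (b * u / of_real a)
      + poly p (u / (of_real a + b * u))" for b u :: complex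
  have small: "norm (b * u / of_real a) \<le> 1/8" "of_real a + b * u \<noteq> 0" "norm (u / (of_real a + b * u)) \<le> 1"
    if b: "norm b < \<rho>" and u: "norm u < u0" for b u :: complex
  proof -
    have "norm b * norm u \<le> (\<rho> + 1) * (\<bar>a\<bar> / (8 * (\<rho> + 1)))" using b u \<rho> by (intro mult_mono) (auto simp: u0_def)
    also have "\<dots> = \<bar>a\<bar> / 8"
    proof -
      have "\<rho> + 1 \<noteq> 0" using \<rho> by linarith
      thus ?thesis by (simp add: divide_simps)
    qed
    finally have bu: "norm b * norm u \<le> \<bar>a\<bar> / 8" .
    thus "norm (b * u / of_real a) \<le> 1/8" using a by (simp add: norm_mult norm_divide divide_simps)
    have "\<bar>a\<bar> - norm (b * u) \<le> norm (of_real a + b * u)"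
      using norm_diff_ineq[of "of_real a" "b * u"] by simp
    hence ge: "norm (of_real a + b * u) \<ge> 7 / 8 * \<bar>a\<bar>" using bu by (simp add: norm_mult)
    thus nz: "of_real a + b * u \<noteq> 0" using a by auto
    have "\<bar>a\<bar> / (8 * (\<rho> + 1)) \<le> \<bar>a\<bar> / (8 * 1)" using \<rho> a by (intro divide_left_mono) auto
    moreover have "norm u \<le> \<bar>a\<bar> / (8 * (\<rho> + 1))" using u by (simp add: u0_def)
    ultimately have "norm u \<le> \<bar>a\<bar> / 8" by linarith
    hence "norm u \<le> norm (of_real a + b * u)" using ge by simp
    thus "norm (u / (of_real a + b * u)) \<le> 1" using nz by (simp add: norm_divide divide_simps)
  qed
  define C1 where "C1 = \<rho> + (\<bar>a\<bar> + (\<rho> + 1)) * (\<rho> / \<bar>a\<bar>) * M1 + M2"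
  define C2 where "C2 = \<bar>C0\<bar> * (2 / \<bar>a\<bar>) ^ K"
  have C12: "C1 \<ge> 0" "C2 \<ge> 0" using M1(1) M2(1) \<rho> by (auto simp: C1_def C2_def)
  show ?thesis
  proof (rule exI[of _ g], rule exI[of _ u0], rule exI[of _ "C1 + C2"], intro conjI allI impI)
    show "u0 > 0" "u0 \<le> 1" "C1 + C2 \<ge> 0" using u0 C12 by auto
    show "(\<lambda>u. g b u) holomorphic_on ball 0 u0" if b: "norm b < \<rho>" for b
    proof -
      have "(\<lambda>u. stirling_log (b * u / of_real a)) holomorphic_on ball 0 u0"
        by (rule holomorphic_on_compose_gen[OF _ stirling_log_holomorphic, unfolded o_def])
           (use small(1)[OF b] a in \<open>fastforce intro!: holomorphic_intros\<close>)+
      thus ?thesis unfolding g_def using small(2)[OF b] a by (intro holomorphic_intros holomorphic_on_poly) auto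
    qed
    show "(\<lambda>b. g b u) holomorphic_on ball 0 \<rho>" if u: "norm u < u0" for u
    proof -
      have "(\<lambda>b. stirling_log (b * u / of_real a)) holomorphic_on ball 0 \<rho>"
        by (rule holomorphic_on_compose_gen[OF _ stirling_log_holomorphic, unfolded o_def])
           (use small(1)[OF _ u] a in \<open>fastforce intro!: holomorphic_intros\<close>)+
      thus ?thesis unfolding g_def using small(2)[OF _ u] a by (intro holomorphic_intros holomorphic_on_poly) auto
    qed
    show "norm (g b u) \<le> C1 + C2" if b: "norm b < \<rho>" and u: "norm u < u0" for b u
    proof -
      have s: "norm (stirling_log (b * u / of_real a)) \<le> M1" using small(1)[OF b u] by (intro M1(2)) simp
      have q: "norm (poly p (u / (of_real a + b * u))) \<le> M2" using small(3)[OF b u] by (intro M2(2)) simp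
      have "norm (of_real a + (b - 1/2) * u) \<le> \<bar>a\<bar> + norm (b - 1/2) * norm u"
        using norm_triangle_ineq[of "of_real a" "(b - 1/2) * u"] by (simp add: norm_mult)
      also have "norm (b - 1/2) * norm u \<le> (\<rho> + 1) * 1"
        using norm_triangle_ineq4[of b "1/2"] b u u0 \<rho> by (intro mult_mono) auto
      finally have l: "norm (of_real a + (b - 1/2) * u) \<le> \<bar>a\<bar> + (\<rho> + 1)" by simp
      have "norm ((of_real a + (b - 1/2) * u) * (b / of_real a) * stirling_log (b * u / of_real a)) \<le> (\<bar>a\<bar> + (\<rho> + 1)) * (\<rho> / \<bar>a\<bar>) * M1"
        unfolding norm_mult norm_divide using l s b \<rho> by (intro mult_mono mult_nonneg_nonneg) (auto intro: divide_right_mono)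
      moreover have "norm (g b u) \<le> norm (- b) + norm ((of_real a + (b - 1/2) * u) * (b / of_real a) * stirling_log (b * u / of_real a)) + norm (poly p (u / (of_real a + b * u)))"
        unfolding g_def by (intro norm_triangle_le add_mono order_refl norm_triangle_ineq)
      ultimately show ?thesis using q b C12 unfolding C1_def by simp
    qed
  next
    fix b w :: complex assume b: "norm b < \<rho>" and w: "4 * \<bar>Re w\<bar> \<le> Im w" "norm w > 1 / u0"
    have "1 / u0 \<ge> 1" using u0 by simp
    hence w1: "norm w > 1" using w(2) by linarith
    hence w0: "w \<noteq> 0" by auto
    have imw: "norm w \<le> 5 / 4 * Im w" using cmod_le[of w] w(1) by simp
    hence impos: "Im w > 0" using w1 by linarith
    define u where "u = 1 / w"
    have u: "norm u < u0" using w(2) u0 w0 by (simp add: u_def norm_divide divide_simps mult.commute)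
    define v where "v = b * u / of_real a"
    define z where "z = of_real a * w + b"
    have wu: "w * u = 1" using w0 by (simp add: u_def)
    have v: "norm v \<le> 1/8" unfolding v_def by (rule small(1)[OF b u])
    define A where "A = \<bar>a\<bar>"
    have A: "A > 0" using a by (simp add: A_def)
    have "1 / u0 \<ge> 1 / (A / (8 * (\<rho> + 1)))" using u0 A \<rho> by (intro divide_left_mono) (auto simp: u0_def A_def)
    hence "8 * (\<rho> + 1) / A < norm w" using w(2) by simp
    hence aw: "A * norm w > 8 * (\<rho> + 1)" using A by (simp add: pos_divide_less_eq mult.commute)
    define AW AI AR where "AW = A * norm w" and "AI = A * Im w" and "AR = A * \<bar>Re w\<bar>"
    have aW: "AW > 8 * \<rho> + 8" using aw by (simp add: AW_def)
    have "AW \<le> 5 / 4 * AI" using imw mult_left_mono[of "norm w" "5/4 * Im w" A] A by (simp add: AW_def AI_def)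
    hence aim: "AI \<ge> 6 * \<rho> + 6" using aW \<rho> by linarith
    have are: "4 * AR \<le> AI" using w(1) mult_left_mono[of "4 * \<bar>Re w\<bar>" "Im w" A] A by (simp add: AI_def AR_def)
    have bri: "\<bar>Re b\<bar> \<le> \<rho>" "\<bar>Im b\<bar> \<le> \<rho>" using abs_Re_le_cmod[of b] abs_Im_le_cmod[of b] b by auto
    have abs_eq: "\<bar>a * Re w\<bar> = AR" "\<bar>a * Im w\<bar> = AI" using impos by (auto simp: abs_mult A_def AR_def AI_def)
    have rz: "Re z = a * Re w + Re b" "Im z = a * Im w + Im b" by (auto simp: z_def)
    have reim: "\<bar>Re z\<bar> \<le> AR + \<rho>" "\<bar>Im z\<bar> \<ge> AI - \<rho>"
      using bri abs_eq rz by linarith+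
    have zcone: "\<bar>Re z\<bar> \<le> \<bar>Im z\<bar>" using reim aim are \<rho> by linarith
    have "norm (of_real a * w) - norm b \<le> norm z" unfolding z_def by (rule norm_diff_ineq)
    hence zn: "norm z \<ge> AW - \<rho>" using b by (simp add: norm_mult A_def AW_def)
    hence z4: "norm z \<ge> 4" using aW \<rho> by linarith
    have "norm z \<ge> AW / 2" using zn aW \<rho> by linarith
    hence z2: "norm z \<ge> \<bar>a\<bar> * norm w / 2" unfolding AW_def A_def .
    have "Im z \<noteq> 0" using reim aim \<rho> by linarith
    hence np: "z \<notin> \<int>\<^sub>\<le>\<^sub>0" by (auto elim!: nonpos_Ints_cases)
    have zv: "z = of_real a * w * (1 + v)"
    proof -
      have "of_real a * w * v = b * (w * u)" using a by (simp add: v_def)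
      thus ?thesis by (simp add: z_def distrib_left wu)
    qed
    have v1: "norm (Ln (1 + v)) \<le> 1/4" using norm_Ln_le[of v] v by simp
    have "1 + v \<noteq> 0" using v by (auto simp: add_eq_0_iff)
    \<comment> \<open>The argument of a w lies within 1/2 of pi/2 or -pi/2 and that of 1 + v is at
      most 1/4 in modulus, so the principal branches add up.\<close>
    have Lz: "Ln z = Ln (of_real a * w) + Ln (1 + v)"
    proof -
      obtain L where L: "Ln w = of_real (ln (Im w)) + \<i> * of_real pi / 2 + L" "norm L \<le> 1/2"
        using Ln_upper_cone[OF w(1) impos] by blast
      have "\<bar>Im L\<bar> \<le> 1/2" "\<bar>Im (Ln (1 + v))\<bar> \<le> 1/4" using L(2) v1 abs_Im_le_cmod order_trans by blast+
      moreover have "Im (Ln (of_real a * w)) = (if a < 0 then - (pi / 2) else pi / 2) + Im L"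
        unfolding Ln_real_mult_upper[OF a impos] L(1) by simp
      ultimately show ?thesis unfolding zv using \<open>1 + v \<noteq> 0\<close> a w0 pi_gt3
        by (intro Ln_times_simple) (auto split: if_splits)
    qed
    have "1 / z = u / (of_real a + b * u)"
    proof -
      have "z = w * (of_real a + b * u)" using wu by (simp add: z_def algebra_simps)
      thus ?thesis using small(2)[OF b u] w0 by (simp add: u_def)
    qed
    moreover have "((z - 1/2) * Ln z - z) = (z - 1/2) * Ln (of_real a * w) - of_real a * w + (- b + (of_real a + (b - 1/2) * u) * (b / of_real a) * stirling_log v)"
    proof -
      have "(z - 1/2) * Ln (1 + v) = (z - 1/2) * u * (b / of_real a) * stirling_log v"
        unfolding stirling_log_mult[symmetric] by (simp add: v_def)
      also have "(z - 1/2) * u = of_real a + (b - 1/2) * u"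
      proof -
        have "(z - 1/2) * u = of_real a * (w * u) + (b - 1/2) * u" by (simp add: z_def algebra_simps)
        thus ?thesis by (simp add: wu)
      qed
      finally have "(z - 1/2) * Ln (1 + v) = (of_real a + (b - 1/2) * u) * (b / of_real a) * stirling_log v" .
      thus ?thesis unfolding Lz distrib_left by (simp add: z_def)
    qed
    ultimately have "ln_Gamma z - ((z - 1/2) * Ln z - z) - poly p (1 / z) = ln_Gamma z - ((z - 1/2) * Ln (of_real a * w) - of_real a * w) - g b u"
      unfolding g_def v_def by simp
    with st[OF z4 zcone] have "norm (ln_Gamma z - ((z - 1/2) * Ln (of_real a * w) - of_real a * w) - g b u) \<le> C0 / norm z ^ K" by simp
    also have "\<dots> \<le> \<bar>C0\<bar> / (\<bar>a\<bar> * norm w / 2) ^ K"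
      using z2 a w0 z4 by (intro frac_le power_mono) auto
    also have "\<dots> = C2 / norm w ^ K" using a by (simp add: C2_def power_divide power_mult_distrib)
    also have "\<dots> \<le> (C1 + C2) / norm w ^ K" using C12 by (intro divide_right_mono) auto
    finally show "norm (ln_Gamma (of_real a * w + b) - ((of_real a * w + b - 1/2) * Ln (of_real a * w) - of_real a * w) - g b (1 / w)) \<le> (C1 + C2) / norm w ^ K"
      by (simp add: z_def u_def)
    show "of_real a * w + b \<notin> \<int>\<^sub>\<le>\<^sub>0" using np by (simp add: z_def)
  qed
qed

text \<open>
  \<open>asym D K X\<close>: uniformly in the parameter \<open>s\<close>, \<open>X s w\<close> is a holomorphic function of \<open>1/w\<close> up to
  \<open>O(\<bar>w\<bar>\<^sup>-\<^sup>K)\<close> as \<open>w\<close> tends to infinity in a cone around the upper imaginary axis. Unlike a truncated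
  power series, this form is stable under products and exponentials.
\<close>
definition asym :: "(complex^'n::finite) set \<Rightarrow> nat \<Rightarrow> (complex^'n \<Rightarrow> complex \<Rightarrow> complex) \<Rightarrow> bool" where
  "asym D K X \<longleftrightarrow> (\<exists>g u0 C. 0 < u0 \<and> u0 \<le> 1 \<and> 0 \<le> C \<and>
     (\<forall>s\<in>D. g s holomorphic_on ball 0 u0) \<and>
     (\<forall>u. norm u < u0 \<longrightarrow> holo_multi_on (\<lambda>s. g s u) D) \<and>
     (\<forall>s\<in>D. \<forall>u. norm u < u0 \<longrightarrow> norm (g s u) \<le> C) \<and>
     (\<forall>s\<in>D. \<forall>w. 4 * \<bar>Re w\<bar> \<le> Im w \<longrightarrow> norm w > 1 / u0 \<longrightarrow> norm (X s w - g s (1 / w)) \<le> C / norm w ^ K))"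

section \<open>Calculus of uniform expansions in 1/w\<close>

lemma divide_ge_one_le: "0 \<le> C \<Longrightarrow> 1 \<le> m \<Longrightarrow> C / m \<le> (C::real)"
  using frac_le[of C C 1 m] by simp

lemma asym_one: "asym D K (\<lambda>s w. 1)"
  unfolding asym_def by (intro exI[of _ "\<lambda>s u. 1"] exI[of _ 1]) (auto intro: holo_multi_on_const)

lemma asym_mult:
  assumes "asym D K X" "asym D K Y"
  shows "asym D K (\<lambda>s w. X s w * Y s w)"
proof -
  obtain g u0 C where g: "0 < u0" "u0 \<le> 1" "0 \<le> C" "\<And>s. s \<in> D \<Longrightarrow> g s holomorphic_on ball 0 u0"
     "\<And>u. norm u < u0 \<Longrightarrow> holo_multi_on (\<lambda>s. g s u) D"
     "\<And>s u. s \<in> D \<Longrightarrow> norm u < u0 \<Longrightarrow> norm (g s u) \<le> C"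
     "\<And>s w. s \<in> D \<Longrightarrow> 4 * \<bar>Re w\<bar> \<le> Im w \<Longrightarrow> norm w > 1 / u0 \<Longrightarrow> norm (X s w - g s (1 / w)) \<le> C / norm w ^ K"
    using assms(1) unfolding asym_def by blast
  obtain h u1 C' where h: "0 < u1" "u1 \<le> 1" "0 \<le> C'" "\<And>s. s \<in> D \<Longrightarrow> h s holomorphic_on ball 0 u1"
     "\<And>u. norm u < u1 \<Longrightarrow> holo_multi_on (\<lambda>s. h s u) D"
     "\<And>s u. s \<in> D \<Longrightarrow> norm u < u1 \<Longrightarrow> norm (h s u) \<le> C'"
     "\<And>s w. s \<in> D \<Longrightarrow> 4 * \<bar>Re w\<bar> \<le> Im w \<Longrightarrow> norm w > 1 / u1 \<Longrightarrow> norm (Y s w - h s (1 / w)) \<le> C' / norm w ^ K"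
    using assms(2) unfolding asym_def by blast
  define v where "v = min u0 u1"
  have v: "v > 0" "v \<le> 1" "v \<le> u0" "v \<le> u1" using g h by (auto simp: v_def)
  have inv: "1 / u0 \<le> 1 / v" "1 / u1 \<le> 1 / v" "1 \<le> 1 / v" using v g(1) h(1) by (auto intro!: divide_left_mono)
  have "norm (X s w * Y s w - g s (1 / w) * h s (1 / w)) \<le> (3 * C * C') / norm w ^ K"
    if s: "s \<in> D" and w: "4 * \<bar>Re w\<bar> \<le> Im w" "norm w > 1 / v" for s w
  proof -
    have w1: "norm w > 1 / u0" "norm w > 1 / u1" "norm w > 1" using w(2) inv by linarith+
    have nw: "norm (1 / w) < u0" "norm (1 / w) < u1"
      using w1 g(1) h(1) by (auto simp: norm_divide divide_simps mult.commute split: if_splits)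
    have k: "norm w ^ K \<ge> 1" using w1 by simp
    have gd: "norm (X s w - g s (1 / w)) \<le> C / norm w ^ K" by (rule g(7)[OF s w(1) w1(1)])
    have hd: "norm (Y s w - h s (1 / w)) \<le> C' / norm w ^ K" by (rule h(7)[OF s w(1) w1(2)])
    have hd': "norm (Y s w - h s (1 / w)) \<le> C'"
      by (rule order_trans[OF hd divide_ge_one_le[OF h(3) k]])
    have gb: "norm (g s (1 / w)) \<le> C" "norm (h s (1 / w)) \<le> C'" using g(6)[OF s nw(1)] h(6)[OF s nw(2)] by auto
    have yb: "norm (Y s w) \<le> 2 * C'" using hd' gb(2) norm_triangle_sub[of "Y s w" "h s (1 / w)"] by linarith
    have "X s w * Y s w - g s (1 / w) * h s (1 / w) = (X s w - g s (1 / w)) * Y s w + g s (1 / w) * (Y s w - h s (1 / w))"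
      by (simp add: algebra_simps)
    also have "norm \<dots> \<le> C / norm w ^ K * (2 * C') + C * (C' / norm w ^ K)"
      using gd hd gb yb g(3) h(3)
      by (intro norm_triangle_le add_mono) (auto simp only: norm_mult intro!: mult_mono norm_ge_zero divide_nonneg_nonneg zero_le_power mult_nonneg_nonneg)
    also have "\<dots> = (3 * C * C') / norm w ^ K" by (simp add: add_divide_distrib[symmetric])
    finally show ?thesis .
  qed
  moreover have "norm (g s u * h s u) \<le> 3 * C * C'" if "s \<in> D" "norm u < v" for s u
  proof -
    have "norm (g s u * h s u) \<le> C * C'" unfolding norm_mult using g(3,6) h(3,6) that v by (intro mult_mono) auto
    thus ?thesis using mult_nonneg_nonneg[OF g(3) h(3)] by linarith
  qed
  moreover have "ball 0 v \<subseteq> ball (0::complex) u0" "ball 0 v \<subseteq> ball (0::complex) u1" using v by auto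
  hence "(\<lambda>u. g s u * h s u) holomorphic_on ball 0 v" if "s \<in> D" for s
    using g(4)[OF that] h(4)[OF that] by (intro holomorphic_on_mult) (auto intro: holomorphic_on_subset)
  moreover have "holo_multi_on (\<lambda>s. g s u * h s u) D" if "norm u < v" for u
    using that v by (intro holo_multi_on_mult g(5) h(5)) auto
  moreover have "0 \<le> 3 * C * C'" using g(3) h(3) by simp
  ultimately show ?thesis unfolding asym_def
    using v(1,2) by (intro exI[of _ "\<lambda>s u. g s u * h s u"] exI[of _ v] exI[of _ "3 * C * C'"]) blast
qed

lemma asym_prod: "(\<And>i. i \<in> I \<Longrightarrow> asym D K (X i)) \<Longrightarrow> asym D K (\<lambda>s w. \<Prod>i\<in>I. X i s w)"
  by (induction I rule: infinite_finite_induct) (auto intro: asym_one asym_mult)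

text \<open>As g is bounded, |e^r - 1| <= |r| e^|r| turns the additive error of the exponent into an
  error of the same order. \<open>X\<close> need agree with exp f only far out in the cone, where
  the argument of Gamma is known not to be a pole and \<open>ln_Gamma\<close> is a logarithm of
  it.\<close>

lemma asym_exp:
  fixes f :: "complex^'n::finite \<Rightarrow> complex \<Rightarrow> complex"
  assumes u0: "0 < u0" "u0 \<le> 1" and C: "0 \<le> C"
     and g: "\<And>s. s \<in> D \<Longrightarrow> g s holomorphic_on ball 0 u0" "\<And>u. norm u < u0 \<Longrightarrow> holo_multi_on (\<lambda>s. g s u) D"
     "\<And>s u. s \<in> D \<Longrightarrow> norm u < u0 \<Longrightarrow> norm (g s u) \<le> C"
     and f: "\<And>s w. s \<in> D \<Longrightarrow> 4 * \<bar>Re w\<bar> \<le> Im w \<Longrightarrow> norm w > 1 / u0 \<Longrightarrow> norm (f s w - g s (1 / w)) \<le> C / norm w ^ K"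
     and X: "\<And>s w. s \<in> D \<Longrightarrow> 4 * \<bar>Re w\<bar> \<le> Im w \<Longrightarrow> norm w > 1 / u0 \<Longrightarrow> X s w = exp (f s w)"
  shows "asym D K X"
proof -
  have bd: "norm (exp (g s u)) \<le> exp C" if "s \<in> D" "norm u < u0" for s u
    using complex_Re_le_cmod[of "g s u"] g(3)[OF that] by simp
  have expg: "exp C \<le> exp C * (1 + C * exp C)" using C by simp
  have "norm (X s w - exp (g s (1 / w))) \<le> exp C * (1 + C * exp C) / norm w ^ K"
    if s: "s \<in> D" and w: "4 * \<bar>Re w\<bar> \<le> Im w" "norm w > 1 / u0" for s w
  proof -
    have "1 / u0 \<ge> 1" using u0 by simp
    hence w1: "norm w > 1" using w(2) by linarith
    have nw: "norm (1 / w) < u0" using w(2) w1 u0 by (auto simp: norm_divide divide_simps mult.commute split: if_splits)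
    define r where "r = f s w - g s (1 / w)"
    have r: "norm r \<le> C / norm w ^ K" unfolding r_def by (rule f[OF s w])
    have r': "norm r \<le> C" by (rule order_trans[OF r divide_ge_one_le[OF C]]) (use w1 in simp)
    have "X s w - exp (g s (1 / w)) = exp (g s (1 / w)) * (exp r - 1)"
      unfolding X[OF s w] r_def by (simp add: right_diff_distrib flip: exp_add)
    also have "norm \<dots> \<le> exp C * (C / norm w ^ K * exp C)"
    proof -
      have "norm (exp r - 1) \<le> norm r * exp (norm r)" by (rule norm_exp_minus_1_le)
      also have "\<dots> \<le> C / norm w ^ K * exp C" using r r' C by (intro mult_mono) auto
      finally show ?thesis unfolding norm_mult using bd[OF s nw] C by (intro mult_mono) auto
    qed
    also have "\<dots> \<le> exp C * (1 + C * exp C) / norm w ^ K"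
      using C by (simp add: divide_simps distrib_left)
    finally show ?thesis .
  qed
  moreover have "norm (exp (g s u)) \<le> exp C * (1 + C * exp C)" if "s \<in> D" "norm u < u0" for s u
    using bd[OF that] expg by linarith
  moreover have "0 \<le> exp C * (1 + C * exp C)" using C by simp
  ultimately show ?thesis unfolding asym_def
    using u0 holo_multi_on_exp[OF g(2)] holomorphic_on_compose[OF g(1) holomorphic_on_exp, unfolded o_def]
    by (intro exI[of _ "\<lambda>s u. exp (g s u)"] exI[of _ u0] exI[of _ "exp C * (1 + C * exp C)"]) blast
qed

lemma asym_Gamma:
  fixes \<beta> :: "complex^'n::finite \<Rightarrow> complex" and a \<rho> :: real
  assumes a: "a \<noteq> 0" and \<beta>: "holo_multi_on \<beta> D" "\<And>s. s \<in> D \<Longrightarrow> norm (\<beta> s) < \<rho>" and \<rho>: "\<rho> > 0"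
  shows "asym D K (\<lambda>s w. Gamma (of_real a * w + \<beta> s) * exp (- ((of_real a * w + \<beta> s - 1/2) * Ln (of_real a * w) - of_real a * w)))"
    and "asym D K (\<lambda>s w. rGamma (of_real a * w + \<beta> s) * exp ((of_real a * w + \<beta> s - 1/2) * Ln (of_real a * w) - of_real a * w))"
proof -
  obtain g u0 C where g: "u0 > 0" "u0 \<le> 1" "C \<ge> 0"
   "\<And>b. norm b < \<rho> \<Longrightarrow> (\<lambda>u. g b u) holomorphic_on ball 0 u0"
   "\<And>u. norm u < u0 \<Longrightarrow> (\<lambda>b. g b u) holomorphic_on ball 0 \<rho>"
   "\<And>b u. norm b < \<rho> \<Longrightarrow> norm u < u0 \<Longrightarrow> norm (g b u) \<le> C"
   "\<And>b w. norm b < \<rho> \<Longrightarrow> 4 * \<bar>Re w\<bar> \<le> Im w \<Longrightarrow> norm w > 1 / u0 \<Longrightarrow> of_real a * w + b \<notin> \<int>\<^sub>\<le>\<^sub>0 \<and>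
      norm (ln_Gamma (of_real a * w + b) - ((of_real a * w + b - 1/2) * Ln (of_real a * w) - of_real a * w) - g b (1 / w)) \<le> C / norm w ^ K"
    using ln_Gamma_affine_expansion[OF a \<rho>, of K] by blast
  let ?E = "\<lambda>s w. (of_real a * w + \<beta> s - 1/2) * Ln (of_real a * w) - of_real a * w"
  have hg: "holo_multi_on (\<lambda>s. g (\<beta> s) u) D" if "norm u < u0" for u
    by (rule holo_multi_on_compose[OF \<beta>(1) g(5)[OF that]]) (use \<beta>(2) in auto)
  have main: "of_real a * w + \<beta> s \<notin> \<int>\<^sub>\<le>\<^sub>0" "norm (ln_Gamma (of_real a * w + \<beta> s) - ?E s w - g (\<beta> s) (1 / w)) \<le> C / norm w ^ K"
    if s: "s \<in> D" and w: "4 * \<bar>Re w\<bar> \<le> Im w" "norm w > 1 / u0" for s w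
    using g(7)[OF \<beta>(2)[OF s] w] by blast+
  show "asym D K (\<lambda>s w. Gamma (of_real a * w + \<beta> s) * exp (- ?E s w))"
  proof (rule asym_exp[where f = "\<lambda>s w. ln_Gamma (of_real a * w + \<beta> s) - ?E s w" and g = "\<lambda>s. g (\<beta> s)" and ?u0.0 = u0 and C = C, OF g(1,2,3)])
    show "Gamma (of_real a * w + \<beta> s) * exp (- ?E s w) = exp (ln_Gamma (of_real a * w + \<beta> s) - ?E s w)"
      if "s \<in> D" "4 * \<bar>Re w\<bar> \<le> Im w" "norm w > 1 / u0" for s w
      using main(1)[OF that] by (simp only: Gamma_complex_altdef if_False exp_add[symmetric] diff_conv_add_uminus)
    show "g (\<beta> s) holomorphic_on ball 0 u0" if "s \<in> D" for s by (rule g(4)[OF \<beta>(2)[OF that]])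
    show "norm (g (\<beta> s) u) \<le> C" if "s \<in> D" "norm u < u0" for s u by (rule g(6)[OF \<beta>(2)[OF that(1)] that(2)])
  qed (fact hg main)+
  show "asym D K (\<lambda>s w. rGamma (of_real a * w + \<beta> s) * exp (?E s w))"
  proof (rule asym_exp[where f = "\<lambda>s w. - (ln_Gamma (of_real a * w + \<beta> s) - ?E s w)" and g = "\<lambda>s u. - g (\<beta> s) u" and ?u0.0 = u0 and C = C, OF g(1,2,3)])
    fix s w assume s: "s \<in> D" and w: "4 * \<bar>Re w\<bar> \<le> Im w" "norm w > 1 / u0"
    have "- (ln_Gamma (of_real a * w + \<beta> s) - ?E s w) - - g (\<beta> s) (1 / w) = - (ln_Gamma (of_real a * w + \<beta> s) - ?E s w - g (\<beta> s) (1 / w))"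
      by simp
    thus "norm (- (ln_Gamma (of_real a * w + \<beta> s) - ?E s w) - - g (\<beta> s) (1 / w)) \<le> C / norm w ^ K"
      using main(2)[OF s w] by (simp only: norm_minus_cancel)
    show "rGamma (of_real a * w + \<beta> s) * exp (?E s w) = exp (- (ln_Gamma (of_real a * w + \<beta> s) - ?E s w))"
      using main(1)[OF s w] by (simp add: rGamma_complex_altdef flip: exp_add)
  next
    show "(\<lambda>u. - g (\<beta> s) u) holomorphic_on ball 0 u0" if "s \<in> D" for s
      by (intro holomorphic_on_minus g \<beta>(2) that)
    show "holo_multi_on (\<lambda>s. - g (\<beta> s) u) D" if "norm u < u0" for u
      by (intro holo_multi_on_minus hg that)
    show "norm (- g (\<beta> s) u) \<le> C" if "s \<in> D" "norm u < u0" for s u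
      unfolding norm_minus_cancel by (intro g \<beta>(2) that)
  qed
qed

text \<open>Each derivative is a Cauchy integral over the circle of radius u0 / 2, whose integrand
  is bounded and holomorphic in s.\<close>

lemma holo_multi_on_taylor_coeff:
  fixes g :: "complex^'n::finite \<Rightarrow> complex \<Rightarrow> complex"
  assumes D: "open D" and u0: "u0 > 0" and hol: "\<And>s. s \<in> D \<Longrightarrow> g s holomorphic_on ball 0 u0"
    and holm: "\<And>u. norm u < u0 \<Longrightarrow> holo_multi_on (\<lambda>s. g s u) D"
    and bd: "\<And>s u. s \<in> D \<Longrightarrow> norm u < u0 \<Longrightarrow> norm (g s u) \<le> C"
  shows "holo_multi_on (\<lambda>s. (deriv ^^ k) (g s) 0) D"
proof -
  define r where "r = u0 / 2"
  have r: "r > 0" "r < u0" using u0 by (auto simp: r_def)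
  define \<gamma> where "\<gamma> x = of_real r * exp (2 * of_real pi * \<i> * of_real x)" for x :: real
  have \<gamma>: "norm (\<gamma> x) = r" for x using r by (simp add: \<gamma>_def norm_mult)
  have \<gamma>c: "continuous_on A \<gamma>" for A unfolding \<gamma>_def by (intro continuous_intros)
  have sub: "ball 0 r \<subseteq> ball (0::complex) u0" "cball 0 r \<subseteq> ball (0::complex) u0" using r by auto
  let ?I = "\<lambda>s x. g s (\<gamma> x) / \<gamma> x ^ k * (2 * of_real pi * \<i>)"
  have eq: "(deriv ^^ k) (g s) 0 = integral {0..1} (?I s) * (fact k / (2 * of_real pi * \<i>))" if s: "s \<in> D" for s
  proof -
    have "((\<lambda>u. g s u / (u - 0) ^ Suc k) has_contour_integral 2 * pi * \<i> / fact k * (deriv ^^ k) (g s) 0) (circlepath 0 r)"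
      by (rule Cauchy_has_contour_integral_higher_derivative_circlepath)
         (use r hol[OF s] sub in \<open>auto intro: holomorphic_on_imp_continuous_on holomorphic_on_subset\<close>)
    hence "contour_integral (circlepath 0 r) (\<lambda>u. g s u / (u - 0) ^ Suc k) = 2 * pi * \<i> / fact k * (deriv ^^ k) (g s) 0"
      by (rule contour_integral_unique)
    moreover have "contour_integral (circlepath 0 r) (\<lambda>u. g s u / (u - 0) ^ Suc k) = integral {0..1} (?I s)"
      unfolding contour_integral_integral
    proof (rule Henstock_Kurzweil_Integration.integral_cong)
      fix x :: real
      have "\<gamma> x \<noteq> 0" using \<gamma>[of x] r by auto
      thus "g s (circlepath 0 r x) / (circlepath 0 r x - 0) ^ Suc k * vector_derivative (circlepath 0 r) (at x) = ?I s x"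
        unfolding vector_derivative_circlepath by (simp add: circlepath \<gamma>_def field_simps)
    qed
    ultimately have "integral {0..1} (?I s) = 2 * pi * \<i> / fact k * (deriv ^^ k) (g s) 0" by (simp only:)
    thus ?thesis by simp
  qed
  have "holo_multi_on (\<lambda>s. integral {0..1} (?I s)) D"
  proof (rule holo_multi_on_integral_interval[OF D])
    show "holo_multi_on (\<lambda>s. ?I s x) D" for x
      using holm[of "\<gamma> x"] \<gamma>[of x] r unfolding divide_inverse
      by (intro holo_multi_on_mult holo_multi_on_const) auto
    show "continuous_on {0..1} (?I s)" if s: "s \<in> D" for s
    proof -
      have "continuous_on {0..1} (\<lambda>x. g s (\<gamma> x))"
        by (rule continuous_on_compose2[OF holomorphic_on_imp_continuous_on[OF hol[OF s]] \<gamma>c]) (use \<gamma> r in auto)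
      moreover have "\<gamma> x \<noteq> 0" for x using \<gamma>[of x] r by auto
      ultimately show ?thesis by (intro continuous_intros \<gamma>c) auto
    qed
    fix p assume "p \<in> D"
    have "norm (?I s x) \<le> C / r ^ k * (2 * pi)" if "s \<in> ball p 1 \<inter> D" for s x
      using bd[of s "\<gamma> x"] that \<gamma>[of x] r by (auto simp: norm_mult norm_divide norm_power intro!: mult_right_mono divide_right_mono)
    thus "\<exists>e>0. \<exists>M. \<forall>s\<in>ball p e \<inter> D. \<forall>x\<in>{0..1}. norm (?I s x) \<le> M" by (intro exI[of _ "1::real"] conjI exI[of _ "C / r ^ k * (2 * pi)"] ballI zero_less_one)
  qed
  from holo_multi_on_mult[OF this holo_multi_on_const[of "fact k / (2 * of_real pi * \<i>)"]]
  show ?thesis by (rule iffD1[OF holo_multi_on_cong, rotated]) (simp add: eq)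
qed

lemma taylor_remainder_bound:
  assumes hol: "f holomorphic_on ball 0 r" and r: "r > 0" and bd: "\<And>u. norm u < r \<Longrightarrow> norm (f u) \<le> C"
    and u: "norm u \<le> r / 2" and K: "K > 0"
  shows "norm (f u - (\<Sum>k<K. (deriv ^^ k) f 0 / fact k * u ^ k)) \<le> real K * C * (4 / r) ^ K * norm u ^ K"
proof -
  have der: "norm ((deriv ^^ K) f w) \<le> fact K * C / (r / 4) ^ K" if w: "w \<in> cball 0 (r/2)" for w
  proof -
    have sub: "cball w (r/4) \<subseteq> ball 0 r"
    proof
      fix u assume "u \<in> cball w (r/4)"
      hence "norm u \<le> r/2 + r/4" using w norm_triangle_ineq2[of u w] by (simp add: dist_norm norm_minus_commute)
      thus "u \<in> ball 0 r" using r by simp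
    qed
    show ?thesis
    proof (rule Cauchy_inequality)
      show "f holomorphic_on ball w (r/4)"
        using hol sub by (meson ball_subset_cball holomorphic_on_subset subset_trans)
      show "continuous_on (cball w (r/4)) f"
        using hol sub holomorphic_on_imp_continuous_on continuous_on_subset by blast
      show "norm (f x) \<le> C" if "norm (w - x) = r/4" for x
        using bd sub that by (auto simp: dist_norm subset_iff)
    qed (use r in auto)
  qed
  obtain n where n: "K = Suc n" using K by (cases K) auto
  have "norm ((deriv ^^ 0) f u - (\<Sum>i\<le>n. (deriv ^^ i) f 0 * (u - 0) ^ i / fact i))
          \<le> (fact K * C / (r / 4) ^ K) * norm (u - 0) ^ Suc n / fact n"
  proof (rule field_Taylor[where S = "cball 0 (r/2)" and f = "\<lambda>i. (deriv ^^ i) f"])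
    fix i and w :: complex assume w: "w \<in> cball 0 (r/2)"
    hence "w \<in> ball 0 r" using r by auto
    moreover have "(deriv ^^ i) f holomorphic_on ball 0 r"
      by (intro holomorphic_higher_deriv hol) auto
    ultimately have "((deriv ^^ i) f has_field_derivative deriv ((deriv ^^ i) f) w) (at w)"
      using holomorphic_derivI by blast
    thus "((deriv ^^ i) f has_field_derivative (deriv ^^ Suc i) f w) (at w within cball 0 (r/2))"
      by (simp add: has_field_derivative_at_within)
  qed (use der u r n in auto)
  also have "\<dots> = real K * C * (4 / r) ^ K * norm u ^ K"
  proof -
    have a: "x / (r / 4) ^ K = x * (4 / r) ^ K" for x by (simp add: power_divide)
    have b: "fact K = real K * fact n" by (simp add: n)
    show ?thesis unfolding a b diff_zero n[symmetric] by simp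
  qed
  finally show ?thesis by (simp add: n lessThan_Suc_atMost)
qed

text \<open>Only here is g replaced by its Taylor polynomial in 1/w. As 2 / u0 >= 1, the factor (2 /
  u0)^K dominates Cauchy's bounds for all coefficients of lower order, so that one constant serves
  coefficients and error.\<close>

lemma asym_expansion:
  fixes X :: "complex^'n::finite \<Rightarrow> complex \<Rightarrow> complex"
  assumes X: "asym D K X" and D: "open D" and K: "K > 0"
  obtains c T C where "T > 0" "C \<ge> 0" "\<And>k. holo_multi_on (c k) D"
    "\<And>k s. k < K \<Longrightarrow> s \<in> D \<Longrightarrow> norm (c k s) \<le> C"
    "\<And>s w. s \<in> D \<Longrightarrow> 4 * \<bar>Re w\<bar> \<le> Im w \<Longrightarrow> norm w > T \<Longrightarrow> norm (X s w - (\<Sum>k<K. c k s / w ^ k)) \<le> C / norm w ^ K"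
proof -
  obtain g u0 C where g: "0 < u0" "u0 \<le> 1" "0 \<le> C" "\<And>s. s \<in> D \<Longrightarrow> g s holomorphic_on ball 0 u0"
     "\<And>u. norm u < u0 \<Longrightarrow> holo_multi_on (\<lambda>s. g s u) D"
     "\<And>s u. s \<in> D \<Longrightarrow> norm u < u0 \<Longrightarrow> norm (g s u) \<le> C"
     "\<And>s w. s \<in> D \<Longrightarrow> 4 * \<bar>Re w\<bar> \<le> Im w \<Longrightarrow> norm w > 1 / u0 \<Longrightarrow> norm (X s w - g s (1 / w)) \<le> C / norm w ^ K"
    using X unfolding asym_def by blast
  define c where "c k s = (deriv ^^ k) (g s) 0 / fact k" for k s
  define C1 where "C1 = C + real K * C * (4 / u0) ^ K"
  define C2 where "C2 = C * (2 / u0) ^ K + C1"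
  have hc: "holo_multi_on (c k) D" for k
    unfolding c_def[abs_def] divide_inverse
    by (intro holo_multi_on_mult holo_multi_on_const holo_multi_on_taylor_coeff[OF D g(1) g(4) g(5) g(6)])
  have cb: "norm (c k s) \<le> C * (2 / u0) ^ K" if k: "k < K" and s: "s \<in> D" for k s
  proof -
    have sub: "cball 0 (u0/2) \<subseteq> ball (0::complex) u0" using g(1) by auto
    have "norm ((deriv ^^ k) (g s) 0) \<le> fact k * C / (u0/2) ^ k"
    proof (rule Cauchy_inequality)
      show "g s holomorphic_on ball 0 (u0/2)"
        by (rule holomorphic_on_subset[OF g(4)[OF s]]) (use g(1) in auto)
      show "continuous_on (cball 0 (u0/2)) (g s)"
        using g(4)[OF s] sub holomorphic_on_imp_continuous_on continuous_on_subset by blast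
      show "norm (g s x) \<le> C" if "norm (0 - x) = u0/2" for x
        using g(6)[OF s] that g(1) by auto
    qed (use g in auto)
    hence "norm (c k s) \<le> C * (2 / u0) ^ k" unfolding c_def by (simp add: norm_divide field_simps)
    also have "\<dots> \<le> C * (2 / u0) ^ K" using g(1-3) k by (intro mult_left_mono power_increasing) auto
    finally show ?thesis .
  qed
  show ?thesis
  proof (rule that[of "2 / u0" C2 c])
    have "C1 \<ge> 0" using g(1-3) by (simp add: C1_def)
    show "C2 \<ge> 0" using \<open>C1 \<ge> 0\<close> g(1-3) by (simp add: C2_def)
    show "norm (c k s) \<le> C2" if "k < K" "s \<in> D" for k s
      using cb[OF that] \<open>C1 \<ge> 0\<close> unfolding C2_def by linarith
    fix s w assume s: "s \<in> D" and w: "4 * \<bar>Re w\<bar> \<le> Im w" "norm w > 2 / u0"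
    have "2 / u0 > 1 / u0" using g(1) by (simp add: divide_strict_right_mono)
    hence w': "norm w > 1 / u0" using w(2) by linarith
    have w0: "norm w > 0" using w' g(1) by (meson less_trans zero_less_divide_1_iff)
    have nw: "norm (1 / w) \<le> u0 / 2" using w(2) w0 g(1) by (simp add: norm_divide field_simps)
    have "norm (g s (1 / w) - (\<Sum>k<K. (deriv ^^ k) (g s) 0 / fact k * (1 / w) ^ k)) \<le> real K * C * (4 / u0) ^ K * norm (1 / w) ^ K"
      by (rule taylor_remainder_bound[OF g(4)[OF s] g(1) g(6)[OF s] nw K])
    moreover have "(\<Sum>k<K. (deriv ^^ k) (g s) 0 / fact k * (1 / w) ^ k) = (\<Sum>k<K. c k s / w ^ k)"
      by (simp add: c_def power_divide)
    ultimately have "norm (g s (1 / w) - (\<Sum>k<K. c k s / w ^ k)) \<le> real K * C * (4 / u0) ^ K / norm w ^ K"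
      by (simp add: norm_divide power_divide)
    moreover have "norm (X s w - g s (1 / w)) \<le> C / norm w ^ K" by (rule g(7)[OF s w(1) w'])
    ultimately have "norm (X s w - (\<Sum>k<K. c k s / w ^ k)) \<le> C / norm w ^ K + real K * C * (4 / u0) ^ K / norm w ^ K"
      using norm_triangle_ineq[of "X s w - g s (1 / w)" "g s (1 / w) - (\<Sum>k<K. c k s / w ^ k)"] by simp
    also have "\<dots> = C1 / norm w ^ K" by (simp add: C1_def add_divide_distrib)
    also have "\<dots> \<le> C2 / norm w ^ K" unfolding C2_def using g(1-3) by (intro divide_right_mono) auto
    finally show "norm (X s w - (\<Sum>k<K. c k s / w ^ k)) \<le> C2 / norm w ^ K" .
  qed (use g(1) hc in auto)
qed

section \<open>Shifting vertical lines\<close>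

lemma cis_strip_cos_ge:
  assumes "\<bar>x\<bar> \<le> 1/2" shows "cos x \<ge> (1/2::real)"
proof -
  have "cos (pi / 3) \<le> cos \<bar>x\<bar>" using assms pi_gt3 by (intro cos_monotone_0_pi_le) auto
  thus ?thesis by (simp add: cos_60)
qed

text \<open>The barrier exp(-delta h) with h(w) = exp(-i k (w - m)) has modulus at most exp(-delta/2
  exp(k Im w)) in the strip. This beats growth exp(A (1 + |w|)^p) for every p, so the maximum
  principle on a tall rectangle only sees the boundary values of f; finally delta tends to
  0.\<close>

lemma phragmen_lindelof_half_strip:
  fixes f :: "complex \<Rightarrow> complex" and a b y0 A p M :: real
  defines "S \<equiv> {w. a \<le> Re w \<and> Re w \<le> b \<and> y0 \<le> Im w}"
  assumes ab: "a < b" and U: "open U" "S \<subseteq> U" and f: "f holomorphic_on U"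
    and growth: "\<And>w. w \<in> S \<Longrightarrow> norm (f w) \<le> exp (A * (1 + norm w) powr p)" and Ap: "A > 0" "p > 0"
    and bdry: "\<And>w. w \<in> S \<Longrightarrow> Re w = a \<or> Re w = b \<or> Im w = y0 \<Longrightarrow> norm (f w) \<le> M"
    and w0: "w0 \<in> S"
  shows "norm (f w0) \<le> M"
proof -
  \<comment> \<open>With m the midpoint of the strip, k (Re w - m) stays in [-1/2, 1/2], where the
    cosine is at least 1/2.\<close>
  define k where "k = 1 / (b - a)"
  define m where "m = (a + b) / 2"
  have k: "k > 0" using ab by (simp add: k_def)
  define h where "h w = exp (- \<i> * of_real k * (w - of_real m))" for w
  have reh: "Re (h w) = exp (k * Im w) * cos (k * (Re w - m))" for w
    by (simp add: h_def Re_exp)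
  have cosge: "cos (k * (Re w - m)) \<ge> 1/2" if "a \<le> Re w" "Re w \<le> b" for w
  proof (rule cis_strip_cos_ge)
    have "\<bar>Re w - m\<bar> \<le> (b - a) / 2" using that by (simp add: m_def abs_le_iff field_simps)
    hence "k * \<bar>Re w - m\<bar> \<le> k * ((b - a) / 2)" using k by (intro mult_left_mono) auto
    also have "\<dots> = 1/2" using ab by (simp add: k_def)
    finally show "\<bar>k * (Re w - m)\<bar> \<le> 1/2" using k by (simp add: abs_mult)
  qed
  have hge: "Re (h w) \<ge> exp (k * Im w) / 2" if "a \<le> Re w" "Re w \<le> b" for w
    unfolding reh using cosge[OF that] mult_left_mono[of "1/2" "cos (k * (Re w - m))" "exp (k * Im w)"] by simp
  have "norm (f (Complex a y0)) \<le> M" by (rule bdry) (use ab in \<open>auto simp: S_def\<close>)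
  hence M0: "M \<ge> 0" using norm_ge_zero order_trans by blast
  have main: "norm (f w0) * exp (- \<delta> * Re (h w0)) \<le> M + \<epsilon>" if \<delta>: "\<delta> > 0" and \<epsilon>: "\<epsilon> > 0" for \<delta> \<epsilon>
  proof -
    define B where "B = 1 + \<bar>a\<bar> + \<bar>b\<bar>"
    have "((\<lambda>Y. exp (A * (B + Y) powr p - \<delta> / 2 * exp (k * Y))) \<longlongrightarrow> 0) at_top"
    proof -
      have "filterlim (\<lambda>Y. A * (B + Y) powr p - \<delta> / 2 * exp (k * Y)) at_bot at_top"
        using Ap \<delta> k by real_asymp
      thus ?thesis by (rule filterlim_compose[OF exp_at_bot])
    qed
    hence "\<forall>\<^sub>F Y in at_top. exp (A * (B + Y) powr p - \<delta> / 2 * exp (k * Y)) < \<epsilon>"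
      using \<epsilon> by (simp add: order_tendsto_iff)
    moreover have "\<forall>\<^sub>F Y in at_top. Y > max (Im w0) (max y0 0)" by (rule eventually_gt_at_top)
    ultimately have "\<forall>\<^sub>F Y in at_top. exp (A * (B + Y) powr p - \<delta> / 2 * exp (k * Y)) < \<epsilon> \<and> Y > max (Im w0) (max y0 0)"
      by (rule eventually_conj)
    then obtain Y where Y: "exp (A * (B + Y) powr p - \<delta> / 2 * exp (k * Y)) < \<epsilon>" "Y > Im w0" "Y > y0" "Y > 0"
      using eventually_happens'[OF trivial_limit_at_top_linorder] by auto
    let ?R = "cbox (Complex a y0) (Complex b Y)"
    have R: "w \<in> ?R \<longleftrightarrow> a \<le> Re w \<and> Re w \<le> b \<and> y0 \<le> Im w \<and> Im w \<le> Y" for w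
      by (auto simp: in_cbox_complex_iff)
    have RS: "?R \<subseteq> S" using R by (auto simp: S_def)
    let ?u = "\<lambda>w. f w * exp (- of_real \<delta> * h w)"
    have nu: "norm (?u w) = norm (f w) * exp (- \<delta> * Re (h w))" for w by (simp add: norm_mult)
    have hol: "?u holomorphic_on U" unfolding h_def by (intro holomorphic_intros f)
    have "norm (?u w0) \<le> M + \<epsilon>"
    proof (rule maximum_modulus_frontier[where S = ?R and f = ?u])
      show "?u holomorphic_on interior ?R"
        by (rule holomorphic_on_subset[OF hol]) (use RS U interior_subset in blast)
      show "continuous_on (closure ?R) ?u"
        by (rule holomorphic_on_imp_continuous_on, rule holomorphic_on_subset[OF hol]) (use RS U in auto)
      show "w0 \<in> ?R" using w0 Y unfolding R S_def by auto
    next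
      fix z assume z: "z \<in> frontier ?R"
      hence zR: "z \<in> ?R" and zb: "z \<notin> box (Complex a y0) (Complex b Y)" by (auto simp: frontier_cbox)
      have zr: "a \<le> Re z" "Re z \<le> b" "y0 \<le> Im z" "Im z \<le> Y" using zR R by auto
      have zS: "z \<in> S" using zR RS by auto
      have pos: "exp (- \<delta> * Re (h z)) \<le> 1"
        using hge[OF zr(1,2)] \<delta> by (simp add: order_trans[OF _ hge[OF zr(1,2)]])
      consider "Re z = a \<or> Re z = b \<or> Im z = y0" | "Im z = Y"
        using zb zr by (auto simp: in_box_complex_iff)
      thus "norm (?u z) \<le> M + \<epsilon>"
      proof cases
        case 1
        have "norm (?u z) \<le> M * 1" unfolding nu using bdry[OF zS 1] pos M0 by (intro mult_mono) auto
        thus ?thesis using \<epsilon> by simp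
      next
        case 2
        have "norm z \<le> \<bar>a\<bar> + \<bar>b\<bar> + Y" using cmod_le[of z] zr 2 Y by linarith
        hence "(1 + norm z) powr p \<le> (B + Y) powr p" using Ap by (intro powr_mono2) (auto simp: B_def)
        hence "norm (f z) \<le> exp (A * (B + Y) powr p)" using growth[OF zS] Ap
          by (meson exp_le_cancel_iff mult_left_mono less_imp_le order_trans)
        moreover have "exp (- \<delta> * Re (h z)) \<le> exp (- (\<delta> / 2 * exp (k * Y)))"
          using mult_left_mono[OF hge[OF zr(1,2)], of \<delta>] \<delta> 2 by simp
        ultimately have "norm (?u z) \<le> exp (A * (B + Y) powr p) * exp (- (\<delta> / 2 * exp (k * Y)))"
          unfolding nu by (intro mult_mono) auto
        also have "\<dots> = exp (A * (B + Y) powr p - \<delta> / 2 * exp (k * Y))" by (simp flip: exp_add)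
        finally show ?thesis using Y(1) M0 by linarith
      qed
    qed auto
    thus ?thesis unfolding nu .
  qed
  have le: "norm (f w0) * exp (- \<delta> * Re (h w0)) \<le> M" if "\<delta> > 0" for \<delta>
    using main[OF that] by (rule field_le_epsilon)
  have "((\<lambda>\<delta>. norm (f w0) * exp (- \<delta> * Re (h w0))) \<longlongrightarrow> norm (f w0) * exp (- 0 * Re (h w0))) (at_right 0)"
    by (intro tendsto_intros)
  moreover have "\<forall>\<^sub>F \<delta> in at_right 0. norm (f w0) * exp (- \<delta> * Re (h w0)) \<le> M"
    using eventually_at_right_less[of 0] by eventually_elim (rule le)
  ultimately have "norm (f w0) * exp (- 0 * Re (h w0)) \<le> M"
    by (rule tendsto_upperbound) simp
  thus ?thesis by simp
qed

text \<open>The convex rectangle carries a primitive, and each of the four side integrals is a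
  difference of its corner values.\<close>

lemma rectangle_cauchy:
  fixes f :: "complex \<Rightarrow> complex" and a b y1 y2 :: real
  assumes U: "open U" "cbox (Complex a y1) (Complex b y2) \<subseteq> U" and f: "f holomorphic_on U"
    and ab: "a \<le> b" "y1 \<le> y2"
  shows "integral {y1..y2} (\<lambda>t. f (Complex b t)) - integral {y1..y2} (\<lambda>t. f (Complex a t))
       = \<i> * (integral {a..b} (\<lambda>x. f (Complex x y1)) - integral {a..b} (\<lambda>x. f (Complex x y2)))"
proof -
  let ?R = "cbox (Complex a y1) (Complex b y2)"
  have "\<exists>F. \<forall>x\<in>?R. (F has_field_derivative f x) (at x within ?R)"
  proof (rule holomorphic_convex_primitive[where K = "{}"])
    show "continuous_on ?R f"
      using f U(2) holomorphic_on_imp_continuous_on continuous_on_subset by blast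
    show "f field_differentiable at x" if "x \<in> interior ?R - {}" for x
      using that U f interior_subset by (intro holomorphic_on_imp_differentiable_at[OF f U(1)]) blast
  qed auto
  then obtain F where F: "\<And>x. x \<in> ?R \<Longrightarrow> (F has_field_derivative f x) (at x within ?R)" by blast
  have vert: "integral {y1..y2} (\<lambda>t. f (Complex c t)) = (F (Complex c y2) - F (Complex c y1)) / \<i>"
    if c: "a \<le> c" "c \<le> b" for c
  proof -
    have "((\<lambda>t. f (Complex c t) * \<i>) has_integral (F (Complex c y2) - F (Complex c y1))) {y1..y2}"
    proof (rule fundamental_theorem_of_calculus[OF ab(2)])
      fix t assume t: "t \<in> {y1..y2}"
      have "((\<lambda>t. F (Complex c t)) has_vector_derivative \<i> * f (Complex c t)) (at t within {y1..y2})"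
      proof -
        have "((\<lambda>t. of_real c + of_real t * \<i>) has_vector_derivative 0 + 1 * \<i>) (at t within {y1..y2})"
          by (intro has_vector_derivative_add has_vector_derivative_const has_vector_derivative_mult_left
              has_vector_derivative_of_real) (auto intro!: derivative_eq_intros)
        hence 1: "(Complex c has_vector_derivative \<i>) (at t within {y1..y2})"
          by (simp add: Complex_eq[abs_def] mult.commute)
        have 2: "(F has_field_derivative f (Complex c t)) (at (Complex c t) within Complex c ` {y1..y2})"
          by (rule has_field_derivative_subset[OF F]) (use t c in \<open>auto simp: in_cbox_complex_iff\<close>)
        show ?thesis using field_vector_diff_chain_within[OF 1 2] by (simp add: o_def)
      qed
      thus "((\<lambda>t. F (Complex c t)) has_vector_derivative f (Complex c t) * \<i>) (at t within {y1..y2})"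
        by (simp add: mult.commute)
    qed
    from has_integral_mult_left[OF this, of "1 / \<i>"] show ?thesis
      by (intro integral_unique) (simp add: field_simps)
  qed
  have horiz: "integral {a..b} (\<lambda>x. f (Complex x y)) = F (Complex b y) - F (Complex a y)"
    if y: "y1 \<le> y" "y \<le> y2" for y
  proof (rule integral_unique, rule fundamental_theorem_of_calculus[OF ab(1)])
    fix t assume t: "t \<in> {a..b}"
    have "((\<lambda>x. F (Complex x y)) has_vector_derivative 1 * f (Complex t y)) (at t within {a..b})"
    proof -
      have "((\<lambda>t. of_real t + of_real y * \<i>) has_vector_derivative 1 + 0) (at t within {a..b})"
        by (intro has_vector_derivative_add has_vector_derivative_const
              has_vector_derivative_of_real) (auto intro!: derivative_eq_intros)
      hence 1: "((\<lambda>x. Complex x y) has_vector_derivative 1) (at t within {a..b})"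
        by (simp add: Complex_eq[abs_def] mult.commute)
      have 2: "(F has_field_derivative f (Complex t y)) (at (Complex t y) within (\<lambda>x. Complex x y) ` {a..b})"
        by (rule has_field_derivative_subset[OF F]) (use t y in \<open>auto simp: in_cbox_complex_iff\<close>)
      show ?thesis using field_vector_diff_chain_within[OF 1 2] by (simp add: o_def)
    qed
    thus "((\<lambda>x. F (Complex x y)) has_vector_derivative f (Complex t y)) (at t within {a..b})" by simp
  qed
  show ?thesis unfolding vert[OF order_refl ab(1)] vert[OF ab(1) order_refl] horiz[OF order_refl ab(2)] horiz[OF ab(2) order_refl]
    by (simp add: field_simps)
qed

section \<open>Improper integrals over rays and lines\<close>

lemma tendsto_set_integral_exhaustion:
  fixes f :: "real \<Rightarrow> complex"
  assumes f: "set_integrable lborel A f" and B: "\<And>Y. B Y \<subseteq> A" "\<And>Y. B Y \<in> sets borel"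
    and ev: "\<And>x. x \<in> A \<Longrightarrow> \<forall>\<^sub>F Y in at_top. x \<in> B Y"
  shows "((\<lambda>Y::real. LINT x:B Y|lborel. f x) \<longlongrightarrow> (LINT x:A|lborel. f x)) at_top"
  unfolding set_lebesgue_integral_def
proof (rule integral_dominated_convergence_at_top[where w = "\<lambda>x. norm (indicat_real A x *\<^sub>R f x)"])
  have fA: "integrable lborel (\<lambda>x. indicat_real A x *\<^sub>R f x)" using f by (simp add: set_integrable_def)
  show m: "(\<lambda>x. indicat_real A x *\<^sub>R f x) \<in> borel_measurable lborel" using fA by (rule borel_measurable_integrable)
  show "(\<lambda>x. indicat_real (B Y) x *\<^sub>R f x) \<in> borel_measurable lborel" for Y
  proof -
    have "(\<lambda>x. indicat_real (B Y) x *\<^sub>R (indicat_real A x *\<^sub>R f x)) \<in> borel_measurable lborel"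
      by (rule borel_measurable_scaleR[OF borel_measurable_indicator m]) (use B(2) in simp)
    moreover have "indicat_real (B Y) x *\<^sub>R (indicat_real A x *\<^sub>R f x) = indicat_real (B Y) x *\<^sub>R f x" for x
      using B(1)[of Y] by (auto simp: indicator_def)
    ultimately show ?thesis by (simp only:)
  qed
  show "integrable lborel (\<lambda>x. norm (indicat_real A x *\<^sub>R f x))" using fA by (rule integrable_norm)
  show "AE x in lborel. ((\<lambda>Y. indicat_real (B Y) x *\<^sub>R f x) \<longlongrightarrow> indicat_real A x *\<^sub>R f x) at_top"
  proof (rule AE_I2)
    fix x
    show "((\<lambda>Y. indicat_real (B Y) x *\<^sub>R f x) \<longlongrightarrow> indicat_real A x *\<^sub>R f x) at_top"
    proof (cases "x \<in> A")
      case True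
      show ?thesis by (rule tendsto_eventually) (use ev[OF True] True in \<open>auto elim: eventually_mono\<close>)
    next
      case False
      hence "x \<notin> B Y" for Y using B(1)[of Y] by auto
      thus ?thesis using False by simp
    qed
  qed
  show "\<forall>\<^sub>F Y in at_top. AE x in lborel. norm (indicat_real (B Y) x *\<^sub>R f x) \<le> norm (indicat_real A x *\<^sub>R f x)"
    using B(1) by (intro always_eventually allI AE_I2) (auto simp: indicator_def subset_iff)
qed

lemma set_integrable_FTC_atLeast:
  fixes f F :: "real \<Rightarrow> real"
  assumes "f \<in> borel_measurable borel" "\<And>x. a \<le> x \<Longrightarrow> (F has_real_derivative f x) (at x)"
    "\<And>x. a \<le> x \<Longrightarrow> 0 \<le> f x" "(F \<longlongrightarrow> T) at_top"
  shows "set_integrable lborel {a..} f"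
proof -
  have "(\<integral>\<^sup>+x. ennreal (f x) * indicator {a..} x \<partial>lborel) = T - F a"
    by (rule nn_integral_FTC_atLeast[OF assms])
  moreover have "(\<integral>\<^sup>+x. ennreal (f x) * indicator {a..} x \<partial>lborel) = (\<integral>\<^sup>+x. ennreal (indicat_real {a..} x *\<^sub>R f x) \<partial>lborel)"
    by (intro nn_integral_cong) (auto simp: indicator_def)
  ultimately have "(\<integral>\<^sup>+x. ennreal (indicat_real {a..} x *\<^sub>R f x) \<partial>lborel) < \<infinity>" by simp
  thus ?thesis unfolding set_integrable_def
    using assms(1,3) by (intro integrableI_nonneg) (auto simp: indicator_def)
qed

lemma set_integrable_exp_atLeast: "\<eta> > 0 \<Longrightarrow> set_integrable lborel {a..} (\<lambda>t::real. exp (- \<eta> * t))"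
  by (rule set_integrable_FTC_atLeast[where F = "\<lambda>t. - exp (- \<eta> * t) / \<eta>" and T = 0])
     (auto intro!: derivative_eq_intros, real_asymp)

lemma set_integrable_powr2_atLeast: "a > 0 \<Longrightarrow> set_integrable lborel {a..} (\<lambda>t::real. 1 / t ^ 2)"
  by (rule set_integrable_FTC_atLeast[where F = "\<lambda>t. - 1 / t" and T = 0])
     (auto intro!: derivative_eq_intros simp: power2_eq_square, real_asymp)

lemma set_integrable_continuous_bound:
  fixes f :: "real \<Rightarrow> complex"
  assumes g: "set_integrable lborel A g" and A: "A \<in> sets borel" and f: "continuous_on A f" and bd: "\<And>t. t \<in> A \<Longrightarrow> norm (f t) \<le> g t"
  shows "set_integrable lborel A f"
  unfolding set_integrable_def
proof (rule Bochner_Integration.integrable_bound[OF g[unfolded set_integrable_def]])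
  have "(\<lambda>x. indicat_real A x *\<^sub>R f x) \<in> borel_measurable borel"
    using borel_measurable_continuous_on_indicator[OF A f] .
  thus "(\<lambda>x. indicat_real A x *\<^sub>R f x) \<in> borel_measurable lborel" by simp
  show "AE x in lborel. norm (indicat_real A x *\<^sub>R f x) \<le> norm (indicat_real A x *\<^sub>R g x)"
    using bd by (intro AE_I2) (fastforce simp: indicator_def intro: order_trans[OF _ abs_ge_self])
qed

lemma continuous_on_Complex_line: "continuous_on A (\<lambda>t. Complex c t)" "continuous_on A (\<lambda>x. Complex x c)"
  by (auto simp: Complex_eq intro!: continuous_intros)

lemma upper_tail_shift:
  fixes f :: "complex \<Rightarrow> complex" and a b y0 M \<eta> :: real
  defines "S \<equiv> {w. a \<le> Re w \<and> Re w \<le> b \<and> y0 \<le> Im w}"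
  assumes ab: "a \<le> b" and U: "open U" "S \<subseteq> U" and f: "f holomorphic_on U"
    and bd: "\<And>w. w \<in> S \<Longrightarrow> norm (f w) \<le> M * exp (- \<eta> * Im w)" and \<eta>: "\<eta> > 0"
  shows "(LINT t:{y0..}|lborel. f (Complex b t)) =
         (LINT t:{y0..}|lborel. f (Complex a t)) + \<i> * integral {a..b} (\<lambda>x. f (Complex x y0))"
proof -
  have cont: "continuous_on S f" using f U holomorphic_on_imp_continuous_on continuous_on_subset by blast
  have cv: "continuous_on {y0..} (\<lambda>t. f (Complex c t))" if "a \<le> c" "c \<le> b" for c
    by (rule continuous_on_compose2[OF cont continuous_on_Complex_line(1)]) (use that in \<open>auto simp: S_def\<close>)
  have int: "set_integrable lborel {y0..} (\<lambda>t. f (Complex c t))" if c: "a \<le> c" "c \<le> b" for c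
    by (rule set_integrable_continuous_bound[OF set_integrable_mult_right[OF set_integrable_exp_atLeast[OF \<eta>, of y0], of M] _ cv[OF c]])
       (use bd[of "Complex c _"] c in \<open>auto simp: S_def\<close>)
  have lim: "((\<lambda>Y. integral {y0..Y} (\<lambda>t. f (Complex c t))) \<longlongrightarrow> (LINT t:{y0..}|lborel. f (Complex c t))) at_top"
    if c: "a \<le> c" "c \<le> b" for c
  proof -
    have "((\<lambda>Y. LINT t:{y0..Y}|lborel. f (Complex c t)) \<longlongrightarrow> (LINT t:{y0..}|lborel. f (Complex c t))) at_top"
      by (rule tendsto_set_integral_exhaustion[OF int[OF c]]) (auto intro: eventually_ge_at_top)
    moreover have "(LINT t:{y0..Y}|lborel. f (Complex c t)) = integral {y0..Y} (\<lambda>t. f (Complex c t))" for Y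
      by (rule set_borel_integral_eq_integral(2), rule set_integrable_subset[OF int[OF c]]) auto
    ultimately show ?thesis by simp
  qed
  have top: "((\<lambda>Y. integral {a..b} (\<lambda>x. f (Complex x Y))) \<longlongrightarrow> 0) at_top"
  proof (rule Lim_null_comparison)
    show "\<forall>\<^sub>F Y in at_top. norm (integral {a..b} (\<lambda>x. f (Complex x Y))) \<le> (M * exp (- \<eta> * Y)) * (b - a)"
      using eventually_ge_at_top[of y0]
    proof eventually_elim
      case (elim Y)
      show ?case
      proof (rule integral_bound[OF ab])
        show "continuous_on {a..b} (\<lambda>x. f (Complex x Y))"
          by (rule continuous_on_compose2[OF cont continuous_on_Complex_line(2)]) (use elim in \<open>auto simp: S_def\<close>)
        show "norm (f (Complex x Y)) \<le> M * exp (- \<eta> * Y)" if "x \<in> {a..b}" for x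
          using bd[of "Complex x Y"] that elim by (simp add: S_def)
      qed
    qed
    have "((\<lambda>Y. exp (- \<eta> * Y)) \<longlongrightarrow> 0) at_top" using \<eta> by real_asymp
    from tendsto_mult_right[OF this, of "M * (b - a)"]
    show "((\<lambda>Y. M * exp (- \<eta> * Y) * (b - a)) \<longlongrightarrow> 0) at_top" by (simp add: mult_ac)
  qed
  let ?L = "\<lambda>Y. integral {y0..Y} (\<lambda>t. f (Complex b t)) - integral {y0..Y} (\<lambda>t. f (Complex a t))"
  let ?R = "\<lambda>Y. \<i> * (integral {a..b} (\<lambda>x. f (Complex x y0)) - integral {a..b} (\<lambda>x. f (Complex x Y)))"
  have limL: "(?L \<longlongrightarrow> (LINT t:{y0..}|lborel. f (Complex b t)) - (LINT t:{y0..}|lborel. f (Complex a t))) at_top"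
    by (intro tendsto_diff lim ab order_refl)
  have limR: "(?R \<longlongrightarrow> \<i> * (integral {a..b} (\<lambda>x. f (Complex x y0)) - 0)) at_top"
    by (intro tendsto_intros top)
  have "\<forall>\<^sub>F Y in at_top. ?R Y = ?L Y"
    using eventually_ge_at_top[of y0]
  proof eventually_elim
    case (elim Y)
    show ?case by (rule rectangle_cauchy[OF U(1) _ f ab elim, symmetric])
      (use U(2) in \<open>auto simp: in_cbox_complex_iff S_def\<close>)
  qed
  note lims = this
  have "(LINT t:{y0..}|lborel. f (Complex b t)) - (LINT t:{y0..}|lborel. f (Complex a t)) = \<i> * (integral {a..b} (\<lambda>x. f (Complex x y0)) - 0)"
    by (rule tendsto_unique[OF trivial_limit_at_top_linorder limL Lim_transform_eventually[OF limR lims]])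
  thus ?thesis by (simp add: algebra_simps)
qed

lemma full_strip_shift:
  fixes f :: "complex \<Rightarrow> complex" and a b M \<eta> :: real
  defines "S \<equiv> {w. a \<le> Re w \<and> Re w \<le> b}"
  assumes ab: "a \<le> b" and U: "open U" "S \<subseteq> U" and f: "f holomorphic_on U"
    and bd: "\<And>w. w \<in> S \<Longrightarrow> norm (f w) \<le> M * exp (- \<eta> * \<bar>Im w\<bar>)" and \<eta>: "\<eta> > 0"
  shows "(LINT t|lborel. f (Complex b t)) = (LINT t|lborel. f (Complex a t))"
    and "integrable lborel (\<lambda>t. f (Complex a t))" "integrable lborel (\<lambda>t. f (Complex b t))"
proof -
  have cont: "continuous_on S f" using f U holomorphic_on_imp_continuous_on continuous_on_subset by blast
  have cv: "continuous_on A (\<lambda>t. f (Complex c t))" if "a \<le> c" "c \<le> b" for c A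
    by (rule continuous_on_compose2[OF cont continuous_on_Complex_line(1)]) (use that in \<open>auto simp: S_def\<close>)
  have e: "set_integrable lborel UNIV (\<lambda>t::real. M * exp (- \<eta> * \<bar>t\<bar>))"
  proof -
    have 1: "set_integrable lborel {0..} (\<lambda>t::real. exp (- \<eta> * \<bar>t\<bar>))"
      by (rule iffD1[OF set_integrable_cong[OF refl refl] set_integrable_exp_atLeast[OF \<eta>, of 0]]) auto
    have "integrable lborel (\<lambda>x. (\<lambda>t. indicat_real {0..} t *\<^sub>R exp (- \<eta> * \<bar>t\<bar>)) (0 + (-1) * x))"
      by (rule lborel_integrable_real_affine) (use 1 in \<open>auto simp: set_integrable_def\<close>)
    hence 2: "set_integrable lborel {..0} (\<lambda>t::real. exp (- \<eta> * \<bar>t\<bar>))"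
      unfolding set_integrable_def by (simp add: indicator_def)
    have "{0..} \<union> {..0} = (UNIV :: real set)" by auto
    with set_integrable_Un[OF 1 2] have "set_integrable lborel UNIV (\<lambda>t::real. exp (- \<eta> * \<bar>t\<bar>))" by simp
    thus ?thesis by (rule set_integrable_mult_right)
  qed
  have int: "set_integrable lborel UNIV (\<lambda>t. f (Complex c t))" if c: "a \<le> c" "c \<le> b" for c
    by (rule set_integrable_continuous_bound[OF e _ cv[OF c]])
       (use bd[of "Complex c _"] c in \<open>auto simp: S_def\<close>)
  thus "integrable lborel (\<lambda>t. f (Complex a t))" "integrable lborel (\<lambda>t. f (Complex b t))"
    using ab by (auto simp: set_integrable_def)
  have lim: "((\<lambda>Y. integral {-Y..Y} (\<lambda>t. f (Complex c t))) \<longlongrightarrow> (LINT t|lborel. f (Complex c t))) at_top"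
    if c: "a \<le> c" "c \<le> b" for c
  proof -
    have "((\<lambda>Y. LINT t:{-Y..Y}|lborel. f (Complex c t)) \<longlongrightarrow> (LINT t:UNIV|lborel. f (Complex c t))) at_top"
    proof (rule tendsto_set_integral_exhaustion[OF int[OF c]])
      show "\<forall>\<^sub>F Y in at_top. x \<in> {- Y..Y}" for x :: real
        using eventually_ge_at_top[of "\<bar>x\<bar>"] by eventually_elim auto
    qed auto
    moreover have "(LINT t:{-Y..Y}|lborel. f (Complex c t)) = integral {-Y..Y} (\<lambda>t. f (Complex c t))" for Y
      by (rule set_borel_integral_eq_integral(2), rule set_integrable_subset[OF int[OF c]]) auto
    ultimately show ?thesis by (simp add: set_lebesgue_integral_def)
  qed
  have top: "((\<lambda>Y. integral {a..b} (\<lambda>x. f (Complex x (\<sigma> * Y)))) \<longlongrightarrow> 0) at_top" if \<sigma>: "\<bar>\<sigma>\<bar> = 1" for \<sigma>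
  proof (rule Lim_null_comparison)
    show "\<forall>\<^sub>F Y in at_top. norm (integral {a..b} (\<lambda>x. f (Complex x (\<sigma> * Y)))) \<le> (M * exp (- \<eta> * Y)) * (b - a)"
      using eventually_ge_at_top[of 0]
    proof eventually_elim
      case (elim Y)
      show ?case
      proof (rule integral_bound[OF ab])
        show "continuous_on {a..b} (\<lambda>x. f (Complex x (\<sigma> * Y)))"
          by (rule continuous_on_compose2[OF cont continuous_on_Complex_line(2)]) (use elim in \<open>auto simp: S_def\<close>)
        show "norm (f (Complex x (\<sigma> * Y))) \<le> M * exp (- \<eta> * Y)" if "x \<in> {a..b}" for x
          using bd[of "Complex x (\<sigma> * Y)"] that elim \<sigma> by (simp add: S_def abs_mult)
      qed
    qed
    have "((\<lambda>Y. exp (- \<eta> * Y)) \<longlongrightarrow> 0) at_top" using \<eta> by real_asymp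
    from tendsto_mult_right[OF this, of "M * (b - a)"]
    show "((\<lambda>Y. M * exp (- \<eta> * Y) * (b - a)) \<longlongrightarrow> 0) at_top" by (simp add: mult_ac)
  qed
  let ?L = "\<lambda>Y. integral {-Y..Y} (\<lambda>t. f (Complex b t)) - integral {-Y..Y} (\<lambda>t. f (Complex a t))"
  let ?R = "\<lambda>Y. \<i> * (integral {a..b} (\<lambda>x. f (Complex x (-1 * Y))) - integral {a..b} (\<lambda>x. f (Complex x (1 * Y))))"
  have limL: "(?L \<longlongrightarrow> (LINT t|lborel. f (Complex b t)) - (LINT t|lborel. f (Complex a t))) at_top"
    by (intro tendsto_diff lim ab order_refl)
  have limR: "(?R \<longlongrightarrow> \<i> * (0 - 0)) at_top"
    by (intro tendsto_intros top) auto
  have "\<forall>\<^sub>F Y in at_top. ?R Y = ?L Y"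
    using eventually_ge_at_top[of 0]
  proof eventually_elim
    case (elim Y)
    have "cbox (Complex a (-Y)) (Complex b Y) \<subseteq> U" using U(2) by (auto simp: in_cbox_complex_iff S_def)
    from rectangle_cauchy[OF U(1) this f ab(1)] elim show ?case by simp
  qed
  note lims = this
  have "(LINT t|lborel. f (Complex b t)) - (LINT t|lborel. f (Complex a t)) = \<i> * (0 - 0)"
    by (rule tendsto_unique[OF trivial_limit_at_top_linorder limL Lim_transform_eventually[OF limR lims]])
  thus "(LINT t|lborel. f (Complex b t)) = (LINT t|lborel. f (Complex a t))" by simp
qed

section \<open>The Mellin transform of the exponential function\<close>

lemma powr_le_exp:
  assumes "\<delta> > 0"
  obtains C where "C > 0" "\<And>t::real. t > 0 \<Longrightarrow> q \<ge> 0 \<Longrightarrow> t powr q \<le> C * exp (\<delta> * t)"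
proof
  \<comment> \<open>From ln(d t) <= d t one gets q ln t <= q d t - q ln d, and this d makes q d at
    most delta.\<close>
  define d where "d = \<delta> / (\<bar>q\<bar> + 1)"
  have d: "d > 0" using assms by (simp add: d_def)
  show "exp (- \<bar>q\<bar> * ln d) > 0" by simp
  fix t :: real assume t: "t > 0" and q: "q \<ge> 0"
  have "ln (d * t) \<le> d * t" using d t by (intro ln_bound) simp
  hence "ln t \<le> d * t - ln d" using d t by (simp add: ln_mult)
  hence "q * ln t \<le> q * (d * t - ln d)" using q by (rule mult_left_mono)
  also have "\<dots> = (q * d) * t - q * ln d" by (simp add: algebra_simps)
  also have "(q * d) * t \<le> \<delta> * t"
    using q t assms unfolding d_def by (intro mult_right_mono) (auto simp: field_simps)
  finally have "q * ln t \<le> - \<bar>q\<bar> * ln d + \<delta> * t" using q by simp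
  thus "t powr q \<le> exp (- \<bar>q\<bar> * ln d) * exp (\<delta> * t)" using t by (simp add: powr_def flip: exp_add)
qed

lemma strip_bound_of_tail_bound:
  fixes f :: "complex \<Rightarrow> complex"
  assumes cont: "continuous_on {w. a \<le> Re w \<and> Re w \<le> b} f"
    and tail: "\<And>w. a \<le> Re w \<Longrightarrow> Re w \<le> b \<Longrightarrow> \<bar>Im w\<bar> \<ge> Y \<Longrightarrow> norm (f w) \<le> M * exp (- \<eta> * \<bar>Im w\<bar>)"
    and \<eta>: "\<eta> > 0"
  shows "\<exists>M'. \<forall>w. a \<le> Re w \<longrightarrow> Re w \<le> b \<longrightarrow> norm (f w) \<le> M' * exp (- \<eta> * \<bar>Im w\<bar>)"
proof -
  have "compact (f ` cbox (Complex a (-Y)) (Complex b Y))"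
    by (intro compact_continuous_image continuous_on_subset[OF cont]) (auto simp: in_cbox_complex_iff)
  then obtain B where B: "\<And>u. u \<in> cbox (Complex a (-Y)) (Complex b Y) \<Longrightarrow> norm (f u) \<le> B"
    using compact_imp_bounded bounded_iff by (metis image_eqI)
  show ?thesis
  proof (intro exI[of _ "max M (max B 0 * exp (\<eta> * Y))"] allI impI)
    fix w assume w: "a \<le> Re w" "Re w \<le> b"
    show "norm (f w) \<le> max M (max B 0 * exp (\<eta> * Y)) * exp (- \<eta> * \<bar>Im w\<bar>)"
    proof (cases "\<bar>Im w\<bar> \<ge> Y")
      case True
      show ?thesis by (rule order_trans[OF tail[OF w True]]) (intro mult_right_mono; simp)
    next
      case False
      have "w \<in> cbox (Complex a (-Y)) (Complex b Y)" using w False by (auto simp: in_cbox_complex_iff)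
      hence "norm (f w) \<le> max B 0 * 1" using B by fastforce
      also have "\<dots> \<le> max B 0 * (exp (\<eta> * Y) * exp (- \<eta> * \<bar>Im w\<bar>))"
        using False \<eta> by (intro mult_left_mono) (auto simp: less_imp_le simp flip: exp_add)
      also have "\<dots> \<le> max M (max B 0 * exp (\<eta> * Y)) * exp (- \<eta> * \<bar>Im w\<bar>)"
        unfolding mult.assoc[symmetric] by (intro mult_right_mono) auto
      finally show ?thesis .
    qed
  qed
qed

lemma norm_sin_complex_ge:
  assumes t: "\<bar>Im u\<bar> \<ge> 1"
  shows "norm (sin (of_real pi * u)) \<ge> exp \<bar>Im u\<bar> / 4"
proof -
  let ?y = "pi * \<bar>Im u\<bar>"
  have "?y \<ge> 3 * \<bar>Im u\<bar>" using pi_gt3 by (intro mult_right_mono) auto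
  hence y: "?y \<ge> \<bar>Im u\<bar> + 2" using t by linarith
  have y2: "?y \<ge> 2" using y by simp
  have "sin (of_real pi * u) = (exp (\<i> * (of_real pi * u)) - exp (- (\<i> * (of_real pi * u)))) / (2 * \<i>)"
    by (simp add: sin_exp_eq)
  hence n: "norm (sin (of_real pi * u)) = norm (exp (\<i> * (of_real pi * u)) - exp (- (\<i> * (of_real pi * u)))) / 2"
    by (simp add: norm_divide norm_mult)
  have e1: "norm (exp (\<i> * (of_real pi * u))) = exp (- pi * Im u)" "norm (exp (- (\<i> * (of_real pi * u)))) = exp (pi * Im u)"
    by simp_all
  have "norm (exp (\<i> * (of_real pi * u)) - exp (- (\<i> * (of_real pi * u)))) \<ge> exp ?y - exp (- ?y)"
  proof (cases "Im u \<ge> 0")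
    case True
    thus ?thesis using norm_triangle_ineq2[of "exp (- (\<i> * (of_real pi * u)))" "exp (\<i> * (of_real pi * u))"]
      unfolding e1 by (simp add: norm_minus_commute)
  next
    case False
    thus ?thesis using norm_triangle_ineq2[of "exp (\<i> * (of_real pi * u))" "exp (- (\<i> * (of_real pi * u)))"]
      unfolding e1 by simp
  qed
  moreover have "exp (- ?y) \<le> 1" by simp
  moreover have "exp ?y \<ge> exp (\<bar>Im u\<bar> + 2)" using y by simp
  moreover have "exp (\<bar>Im u\<bar> + 2) = exp \<bar>Im u\<bar> * exp 2" by (rule exp_add)
  moreover have "exp (2::real) \<ge> 2" using exp_ge_add_one_self[of 2] by simp
  hence "exp \<bar>Im u\<bar> * exp 2 \<ge> exp \<bar>Im u\<bar> * 2" by (intro mult_left_mono) auto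
  moreover have "exp \<bar>Im u\<bar> \<ge> 1" by simp
  ultimately show ?thesis unfolding n by linarith
qed

text \<open>On the lines Re w = p + 1/2 and Re w = p - 1/2 the kernel pi / sin(pi (w - p)) equals pi
  / cosh(pi t) up to the sign. Its integral, via the primitive 2 arctan(exp(pi t)), supplies the two
  halves of a residue.\<close>

lemma integral_inverse_cosh:
  "integrable lborel (\<lambda>t. of_real (pi / cosh (pi * t)) :: complex)"
  "(LINT t|lborel. of_real (pi / cosh (pi * t)) :: complex) = of_real pi"
proof -
  have cosh_ge: "cosh (pi * t) \<ge> exp (pi * \<bar>t\<bar>) / 2" for t :: real
    by (cases "t \<ge> 0") (auto simp: cosh_def)
  have e: "set_integrable lborel {0..} (\<lambda>t::real. 2 * pi * exp (- pi * t))"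
    by (intro set_integrable_mult_right set_integrable_exp_atLeast) simp
  have bd: "norm (of_real (pi / cosh (pi * t)) :: complex) \<le> 2 * pi * exp (- pi * \<bar>t\<bar>)" for t :: real
  proof -
    have "cosh (pi * t) > 0" by simp
    hence "pi / cosh (pi * t) \<le> pi / (exp (pi * \<bar>t\<bar>) / 2)" by (intro divide_left_mono cosh_ge mult_pos_pos) auto
    also have "\<dots> = 2 * pi * exp (- pi * \<bar>t\<bar>)" by (simp add: exp_minus field_simps)
    finally show ?thesis using \<open>cosh (pi * t) > 0\<close> by (simp add: norm_divide)
  qed
  let ?f = "\<lambda>t::real. of_real (pi / cosh (pi * t)) :: complex"
  have cont: "continuous_on A ?f" for A
    by (intro continuous_intros) (simp add: less_imp_neq[OF cosh_real_pos, symmetric])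
  have p: "set_integrable lborel {0..} ?f"
  proof (rule set_integrable_continuous_bound[OF e _ cont])
    show "norm (?f t) \<le> 2 * pi * exp (- pi * t)" if "t \<in> {0..}" for t using bd[of t] that by simp
  qed simp
  have "integrable lborel (\<lambda>x. (\<lambda>t. indicat_real {0..} t *\<^sub>R ?f t) (0 + (-1) * x))"
    by (rule lborel_integrable_real_affine) (use p in \<open>auto simp: set_integrable_def\<close>)
  hence n: "set_integrable lborel {..0} ?f"
    unfolding set_integrable_def by (simp add: indicator_def)
  have "{0..} \<union> {..0} = (UNIV :: real set)" by auto
  with set_integrable_Un[OF p n] have U: "set_integrable lborel UNIV ?f" by simp
  thus "integrable lborel ?f" by (simp add: set_integrable_def)
  have "((\<lambda>Y. LINT t:{-Y..Y}|lborel. ?f t) \<longlongrightarrow> (LINT t:UNIV|lborel. ?f t)) at_top"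
  proof (rule tendsto_set_integral_exhaustion[OF U])
    show "\<forall>\<^sub>F Y in at_top. x \<in> {- Y..Y}" for x :: real
      using eventually_ge_at_top[of "\<bar>x\<bar>"] by eventually_elim auto
  qed auto
  hence lim: "((\<lambda>Y. LINT t:{-Y..Y}|lborel. ?f t) \<longlongrightarrow> (LINT t|lborel. ?f t)) at_top"
    by (simp add: set_lebesgue_integral_def)
  have val: "(LINT t:{-Y..Y}|lborel. ?f t) = of_real (2 * arctan (exp (pi * Y)) - 2 * arctan (exp (- pi * Y)))" if Y: "Y \<ge> 0" for Y
  proof -
    have "((\<lambda>t. pi / cosh (pi * t)) has_integral (2 * arctan (exp (pi * Y)) - 2 * arctan (exp (pi * (- Y))))) {-Y..Y}"
    proof (rule fundamental_theorem_of_calculus)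
      fix t assume "t \<in> {-Y..Y}"
      have "((\<lambda>t. 2 * arctan (exp (pi * t))) has_real_derivative (2 * (exp (pi * t) * pi / (1 + exp (pi * t) ^ 2)))) (at t within {-Y..Y})"
        by (rule derivative_eq_intros refl | simp add: divide_inverse mult_ac)+
      moreover have "2 * (exp (pi * t) * pi / (1 + exp (pi * t) ^ 2)) = pi / cosh (pi * t)"
      proof -
        define x where "x = exp (pi * t)"
        have x: "x > 0" by (simp add: x_def)
        have "cosh (pi * t) = (x + 1 / x) / 2" by (simp only: cosh_field_def x_def exp_minus inverse_eq_divide)
        also have "\<dots> = (1 + x ^ 2) / (2 * x)" using x by (simp add: divide_simps power2_eq_square)
        finally have c: "cosh (pi * t) = (1 + x ^ 2) / (2 * x)" .
        show ?thesis unfolding x_def[symmetric] c by simp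
      qed
      ultimately show "((\<lambda>t. 2 * arctan (exp (pi * t))) has_vector_derivative pi / cosh (pi * t)) (at t within {-Y..Y})"
        by (simp add: has_real_derivative_iff_has_vector_derivative)
    qed (use Y in auto)
    hence "(?f has_integral of_real (2 * arctan (exp (pi * Y)) - 2 * arctan (exp (pi * (- Y))))) {-Y..Y}"
      by (rule has_integral_of_real)
    hence "integral {-Y..Y} ?f = of_real (2 * arctan (exp (pi * Y)) - 2 * arctan (exp (- pi * Y)))"
      by (intro integral_unique) simp
    moreover have "(LINT t:{-Y..Y}|lborel. ?f t) = integral {-Y..Y} ?f"
      by (rule set_borel_integral_eq_integral(2), rule borel_integrable_atLeastAtMost'[OF cont])
    ultimately show ?thesis by simp
  qed
  have "((\<lambda>Y. 2 * arctan (exp (pi * Y)) - 2 * arctan (exp (- pi * Y))) \<longlongrightarrow> pi) at_top"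
    by real_asymp
  from tendsto_of_real[OF this, where 'a = complex]
  have "((\<lambda>Y. LINT t:{-Y..Y}|lborel. ?f t) \<longlongrightarrow> of_real pi) at_top"
    by (rule Lim_transform_eventually) (use val in \<open>auto intro!: eventually_mono[OF eventually_ge_at_top[of 0]]\<close>)
  from tendsto_unique[OF trivial_limit_at_top_linorder lim this]
  show "(LINT t|lborel. ?f t) = of_real pi" .
qed

text \<open>The residue theorem for one simple pole in an infinite strip, by comparison: pi / sin(pi
  (w - p)) has residue 1 at p, decays at both ends, and its t-integrals over the two lines are pi
  and -pi. Subtracting h(p) times this kernel removes the pole, and the remainder can be moved
  across the strip freely.\<close>

lemma strip_residue:
  fixes h :: "complex \<Rightarrow> complex" and p :: real
  assumes hol: "h holomorphic_on {w. \<bar>Re w - p\<bar> < 3/4}"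
    and bd: "\<And>w. \<bar>Re w - p\<bar> \<le> 1/2 \<Longrightarrow> \<bar>Im w\<bar> \<ge> Y \<Longrightarrow> norm (h w / (w - of_real p)) \<le> M * exp (- \<eta> * \<bar>Im w\<bar>)"
    and \<eta>: "\<eta> > 0" "\<eta> \<le> 1"
  shows "(LINT t|lborel. h (Complex (p + 1/2) t) / (Complex (p + 1/2) t - of_real p)) =
         (LINT t|lborel. h (Complex (p - 1/2) t) / (Complex (p - 1/2) t - of_real p)) + 2 * of_real pi * h (of_real p)"
proof -
  define U where "U = {w. \<bar>Re w - p\<bar> < 3/4}"
  have U: "open U" unfolding U_def
    by (intro open_Collect_less continuous_intros)
  \<comment> \<open>By the reflection formula this is pi (w - p) / sin(pi (w - p)) with the
    singularity at p already removed and value 1 there.\<close>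
  define G where "G w = Gamma (1 + (w - of_real p)) * Gamma (1 - (w - of_real p))" for w :: complex
  have np: "1 + (w - of_real p) \<notin> \<int>\<^sub>\<le>\<^sub>0" "1 - (w - of_real p) \<notin> \<int>\<^sub>\<le>\<^sub>0" if "w \<in> U" for w
  proof -
    have "\<bar>Re w - p\<bar> < 3/4" using that by (simp add: U_def)
    moreover have "Re (1 + (w - of_real p)) = 1 + (Re w - p)" "Re (1 - (w - of_real p)) = 1 - (Re w - p)" by simp_all
    ultimately have "Re (1 + (w - of_real p)) > 0" "Re (1 - (w - of_real p)) > 0" by linarith+
    thus "1 + (w - of_real p) \<notin> \<int>\<^sub>\<le>\<^sub>0" "1 - (w - of_real p) \<notin> \<int>\<^sub>\<le>\<^sub>0" by (auto elim!: nonpos_Ints_cases simp: complex_eq_iff)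
  qed
  have G: "G holomorphic_on U" unfolding G_def using np by (intro holomorphic_intros) auto
  define k where "k w = h w - h (of_real p) * G w" for w
  have k: "k holomorphic_on U" unfolding k_def using hol G by (intro holomorphic_intros) (auto simp: U_def)
  have k0: "k (of_real p) = 0" by (simp add: k_def G_def)
  define g where "g = (\<lambda>w. if w = of_real p then deriv k (of_real p) else (k w - k (of_real p)) / (w - of_real p))"
  have g: "g holomorphic_on U" unfolding g_def by (rule pole_lemma_open[OF k U])
  have Gsin: "G w / (w - of_real p) = of_real pi / sin (of_real pi * (w - of_real p))" if "w \<in> U" "w \<noteq> of_real p" for w
  proof -
    have "Gamma (1 + (w - of_real p)) = (w - of_real p) * Gamma (w - of_real p)"
    proof -
      have "w - of_real p \<notin> \<int>\<^sub>\<le>\<^sub>0"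
      proof
        assume "w - of_real p \<in> \<int>\<^sub>\<le>\<^sub>0"
        then obtain n :: nat where n: "w - of_real p = - of_nat n" by (auto elim!: nonpos_Ints_cases')
        hence "Re w - p = - real n" by (metis Re_complex_of_real minus_complex.sel(1) of_real_minus of_real_of_nat_eq)
        hence "n = 0" using that(1) by (simp add: U_def)
        thus False using n that(2) by simp
      qed
      thus ?thesis using Gamma_plus1[of "w - of_real p"] by (simp add: add.commute)
    qed
    hence "G w / (w - of_real p) = Gamma (w - of_real p) * Gamma (1 - (w - of_real p))"
      using that by (simp add: G_def)
    thus ?thesis by (simp add: Gamma_reflection_complex)
  qed
  have geq: "g w = h w / (w - of_real p) - h (of_real p) * (of_real pi / sin (of_real pi * (w - of_real p)))"
    if "w \<in> U" "w \<noteq> of_real p" for w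
  proof -
    have "g w = k w / (w - of_real p)" using that k0 by (simp add: g_def)
    thus ?thesis by (simp only: k_def diff_divide_distrib times_divide_eq_right[symmetric] Gsin[OF that])
  qed
  have cont: "continuous_on {w. p - 1/2 \<le> Re w \<and> Re w \<le> p + 1/2} g"
    by (rule continuous_on_subset[OF holomorphic_on_imp_continuous_on[OF g]]) (auto simp: U_def abs_if)
  have "\<exists>M'. \<forall>w. p - 1/2 \<le> Re w \<longrightarrow> Re w \<le> p + 1/2 \<longrightarrow> norm (g w) \<le> M' * exp (- \<eta> * \<bar>Im w\<bar>)"
  proof (rule strip_bound_of_tail_bound[OF cont])
    fix w assume w: "p - 1/2 \<le> Re w" "Re w \<le> p + 1/2" "\<bar>Im w\<bar> \<ge> max Y 1"
    have wU: "w \<in> U" using w by (auto simp: U_def abs_if)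
    have wp: "w \<noteq> of_real p" using w by auto
    have "norm (sin (of_real pi * (w - of_real p))) \<ge> exp \<bar>Im w\<bar> / 4" using norm_sin_complex_ge[of "w - of_real p"] w by simp
    hence "norm (of_real pi / sin (of_real pi * (w - of_real p))) \<le> pi / (exp \<bar>Im w\<bar> / 4)"
      unfolding norm_divide by (intro frac_le) auto
    also have "\<dots> = 4 * pi * exp (- \<bar>Im w\<bar>)" by (simp add: exp_minus field_simps)
    also have "\<dots> \<le> 4 * pi * exp (- \<eta> * \<bar>Im w\<bar>)" using \<eta> by (intro mult_left_mono) (auto intro!: mult_left_le_one_le)
    finally have s: "norm (of_real pi / sin (of_real pi * (w - of_real p))) \<le> 4 * pi * exp (- \<eta> * \<bar>Im w\<bar>)" .
    have "norm (g w) \<le> norm (h w / (w - of_real p)) + norm (h (of_real p)) * norm (of_real pi / sin (of_real pi * (w - of_real p)))"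
      unfolding geq[OF wU wp] norm_mult[symmetric] by (rule norm_triangle_ineq4)
    also have "\<dots> \<le> M * exp (- \<eta> * \<bar>Im w\<bar>) + norm (h (of_real p)) * (4 * pi * exp (- \<eta> * \<bar>Im w\<bar>))"
    proof (intro add_mono mult_left_mono s norm_ge_zero)
      have "\<bar>Re w - p\<bar> \<le> 1/2" using w(1,2) by linarith
      thus "norm (h w / (w - of_real p)) \<le> M * exp (- \<eta> * \<bar>Im w\<bar>)" by (rule bd) (use w(3) in simp)
    qed
    finally show "norm (g w) \<le> (M + norm (h (of_real p)) * (4 * pi)) * exp (- \<eta> * \<bar>Im w\<bar>)" by (simp add: algebra_simps)
  qed (rule \<eta>(1))
  then obtain M' where "\<And>w. p - 1/2 \<le> Re w \<Longrightarrow> Re w \<le> p + 1/2 \<Longrightarrow> norm (g w) \<le> M' * exp (- \<eta> * \<bar>Im w\<bar>)" by blast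
  hence M': "norm (g w) \<le> M' * exp (- \<eta> * \<bar>Im w\<bar>)" if "w \<in> {w. p - 1/2 \<le> Re w \<and> Re w \<le> p + 1/2}" for w using that by simp
  have sub: "{w. p - 1/2 \<le> Re w \<and> Re w \<le> p + 1/2} \<subseteq> U" by (auto simp: U_def abs_if)
  have "p - 1/2 \<le> p + 1/2" by simp
  note sh = full_strip_shift[OF this U sub g M' \<eta>(1)]
  have line: "h (Complex (p + \<sigma> / 2) t) / (Complex (p + \<sigma> / 2) t - of_real p) =
      g (Complex (p + \<sigma> / 2) t) + of_real \<sigma> * h (of_real p) * of_real (pi / cosh (pi * t))" if \<sigma>: "\<sigma> = 1 \<or> \<sigma> = -1" for \<sigma> t
  proof -
    have wU: "Complex (p + \<sigma> / 2) t \<in> U" using \<sigma> by (auto simp: U_def)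
    have wp: "Complex (p + \<sigma> / 2) t \<noteq> of_real p" using \<sigma> by (auto simp: complex_eq_iff)
    have "of_real pi * (Complex (p + \<sigma> / 2) t - of_real p) = of_real \<sigma> * (of_real pi / 2) + \<i> * of_real (pi * t)"
      by (auto simp: complex_eq_iff)
    hence "sin (of_real pi * (Complex (p + \<sigma> / 2) t - of_real p)) = of_real \<sigma> * cos (\<i> * of_real (pi * t))"
      using \<sigma> by (auto simp: sin_add simp flip: sin_of_real cos_of_real)
    also have "cos (\<i> * of_real (pi * t)) = cosh (of_real (pi * t) :: complex)" by (simp add: cosh_conv_cos)
    also have "\<dots> = of_real (cosh (pi * t))" by (simp add: cosh_field_def flip: exp_of_real)
    finally have s: "sin (of_real pi * (Complex (p + \<sigma> / 2) t - of_real p)) = of_real \<sigma> * of_real (cosh (pi * t))" .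
    show ?thesis unfolding geq[OF wU wp] s using \<sigma> by auto
  qed
  have J: "integrable lborel (\<lambda>t. c * of_real (pi / cosh (pi * t)) :: complex)" for c
    by (intro integrable_mult_right integral_inverse_cosh(1))
  have Jv: "(LINT t|lborel. c * of_real (pi / cosh (pi * t))) = c * of_real pi" for c :: complex
    by (simp only: integral_mult_right_zero integral_inverse_cosh(2))
  have "(\<lambda>t. h (Complex (p + 1/2) t) / (Complex (p + 1/2) t - of_real p)) = (\<lambda>t. g (Complex (p + 1/2) t) + h (of_real p) * of_real (pi / cosh (pi * t)))"
    using line[of 1] by (simp add: fun_eq_iff)
  hence R: "(LINT t|lborel. h (Complex (p + 1/2) t) / (Complex (p + 1/2) t - of_real p)) = (LINT t|lborel. g (Complex (p + 1/2) t)) + h (of_real p) * of_real pi"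
    by (simp only: Bochner_Integration.integral_add[OF sh(3) J] Jv)
  have "(\<lambda>t. h (Complex (p - 1/2) t) / (Complex (p - 1/2) t - of_real p)) = (\<lambda>t. g (Complex (p - 1/2) t) + (- h (of_real p)) * of_real (pi / cosh (pi * t)))"
    using line[of "-1"] by (simp add: fun_eq_iff)
  hence L: "(LINT t|lborel. h (Complex (p - 1/2) t) / (Complex (p - 1/2) t - of_real p)) = (LINT t|lborel. g (Complex (p - 1/2) t)) + (- h (of_real p)) * of_real pi"
    by (simp only: Bochner_Integration.integral_add[OF sh(2) J] Jv)
  show ?thesis unfolding R L using sh(1) by (simp add: algebra_simps)
qed

lemma Re_pos_not_nonpos_Int: "Re z > 0 \<Longrightarrow> z \<notin> \<int>\<^sub>\<le>\<^sub>0"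
  by (auto elim!: nonpos_Ints_cases)

lemma holomorphic_on_pochhammer: "f holomorphic_on A \<Longrightarrow> (\<lambda>z. pochhammer (f z :: complex) n) holomorphic_on A"
  by (induction n) (auto simp: pochhammer_Suc intro!: holomorphic_intros)

text \<open>Re z > 0 leaves a gap between |arg z| and pi/2. Gamma decays at rate pi/2 while z^(-w)
  grows at rate at most |arg z|; one half of the gap absorbs the power of |Im w|, the other half
  remains as decay.\<close>

lemma Gamma_powr_tail_bound:
  assumes z: "Re z > 0" and X: "X \<ge> 0"
  shows "\<exists>\<eta> M. 0 < \<eta> \<and> \<eta> \<le> 1 \<and> (\<forall>w. \<bar>Re w\<bar> \<le> X \<longrightarrow> \<bar>Im w\<bar> \<ge> max 4 (4 * X) \<longrightarrow>
     norm (Gamma w * z powr (- w)) \<le> M * exp (- \<eta> * \<bar>Im w\<bar>))"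
proof -
  have z0: "z \<noteq> 0" using z by auto
  define \<phi> where "\<phi> = \<bar>Im (Ln z)\<bar>"
  have \<phi>: "\<phi> < pi / 2" using Re_Ln_pos_lt_imp[of z] z by (simp add: \<phi>_def)
  define \<eta> where "\<eta> = min 1 ((pi / 2 - \<phi>) / 2)"
  have \<eta>: "\<eta> > 0" "\<eta> \<le> 1" "2 * \<eta> \<le> pi / 2 - \<phi>" using \<phi> by (auto simp: \<eta>_def min_def)
  obtain C where C: "C > 0" "\<And>w. \<bar>Re w\<bar> \<le> X \<Longrightarrow> \<bar>Im w\<bar> \<ge> max 4 (4 * X) \<Longrightarrow>
    norm (Gamma w) \<le> C * \<bar>Im w\<bar> powr (X + 1) * exp (- pi / 2 * \<bar>Im w\<bar>)"
    using Gamma_vertical_bounds[OF X] by metis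
  obtain D where D: "D > 0" "\<And>t::real. t > 0 \<Longrightarrow> X + 1 \<ge> 0 \<Longrightarrow> t powr (X + 1) \<le> D * exp (\<eta> * t)"
    using powr_le_exp[OF \<eta>(1)] by metis
  define L where "L = exp (X * \<bar>ln (norm z)\<bar>)"
  have "norm (Gamma w * z powr (- w)) \<le> (C * D * L) * exp (- \<eta> * \<bar>Im w\<bar>)"
    if w: "\<bar>Re w\<bar> \<le> X" "\<bar>Im w\<bar> \<ge> max 4 (4 * X)" for w
  proof -
    have "\<bar>Im w\<bar> \<ge> 4" using w(2) by simp
    hence w0: "\<bar>Im w\<bar> > 0" by linarith
    have "norm (z powr (- w)) = exp (- Re w * ln (norm z) + Im w * Im (Ln z))"
      using z0 by (simp add: powr_def)
    also have "\<dots> \<le> exp (X * \<bar>ln (norm z)\<bar> + \<bar>Im w\<bar> * \<phi>)"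
    proof -
      have "- Re w * ln (norm z) \<le> \<bar>Re w\<bar> * \<bar>ln (norm z)\<bar>" by (metis abs_ge_self abs_minus_cancel abs_mult)
      also have "\<dots> \<le> X * \<bar>ln (norm z)\<bar>" using w by (intro mult_right_mono) auto
      finally have 1: "- Re w * ln (norm z) \<le> X * \<bar>ln (norm z)\<bar>" .
      have 2: "Im w * Im (Ln z) \<le> \<bar>Im w\<bar> * \<phi>" unfolding \<phi>_def by (metis abs_ge_self abs_mult)
      show ?thesis using 1 2 by simp
    qed
    also have "\<dots> = L * exp (\<phi> * \<bar>Im w\<bar>)" by (simp add: L_def exp_add mult.commute)
    finally have zp: "norm (z powr (- w)) \<le> L * exp (\<phi> * \<bar>Im w\<bar>)" .
    have "norm (Gamma w) \<le> C * (D * exp (\<eta> * \<bar>Im w\<bar>)) * exp (- pi / 2 * \<bar>Im w\<bar>)"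
      by (rule order_trans[OF C(2)[OF w]]) (use C(1) D(2)[OF w0] X in \<open>auto intro!: mult_right_mono mult_left_mono\<close>)
    hence "norm (Gamma w * z powr (- w)) \<le> C * (D * exp (\<eta> * \<bar>Im w\<bar>)) * exp (- pi / 2 * \<bar>Im w\<bar>) * (L * exp (\<phi> * \<bar>Im w\<bar>))"
      unfolding norm_mult using zp C(1) D(1) by (intro mult_mono) auto
    also have "\<dots> = (C * D * L) * exp ((\<eta> - pi / 2 + \<phi>) * \<bar>Im w\<bar>)"
    proof -
      have "(\<eta> - pi / 2 + \<phi>) * \<bar>Im w\<bar> = \<eta> * \<bar>Im w\<bar> + (- pi / 2 * \<bar>Im w\<bar> + \<phi> * \<bar>Im w\<bar>)"
        by (simp add: algebra_simps)
      thus ?thesis by (simp only: exp_add mult_ac)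
    qed
    also have "\<dots> \<le> (C * D * L) * exp (- \<eta> * \<bar>Im w\<bar>)"
    proof (rule mult_left_mono)
      have "(\<eta> - pi / 2 + \<phi>) * \<bar>Im w\<bar> \<le> - \<eta> * \<bar>Im w\<bar>" using \<eta> by (intro mult_right_mono) auto
      thus "exp ((\<eta> - pi / 2 + \<phi>) * \<bar>Im w\<bar>) \<le> exp (- \<eta> * \<bar>Im w\<bar>)" by simp
      show "0 \<le> C * D * L" using C(1) D(1) by (simp add: L_def)
    qed
    finally show ?thesis .
  qed
  thus ?thesis using \<eta>(1,2) by blast
qed

lemma pochhammer_left_shift_ge:
  assumes "Re w = 1/2" shows "norm (pochhammer (w - of_nat n) n) \<ge> fact n / 2 ^ n"
proof (induction n)
  case (Suc n)
  have "real (Suc n) / 2 \<le> \<bar>Re (w - of_nat (Suc n))\<bar>" using assms by simp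
  also have "\<dots> \<le> norm (w - of_nat (Suc n))" by (rule abs_Re_le_cmod)
  finally have 1: "real (Suc n) / 2 \<le> norm (w - of_nat (Suc n))" .
  have "pochhammer (w - of_nat (Suc n)) (Suc n) = (w - of_nat (Suc n)) * pochhammer (w - of_nat n) n"
    by (simp add: pochhammer_rec)
  hence "norm (pochhammer (w - of_nat (Suc n)) (Suc n)) = norm (w - of_nat (Suc n)) * norm (pochhammer (w - of_nat n) n)"
    by (simp only: norm_mult)
  also have "\<dots> \<ge> real (Suc n) / 2 * (fact n / 2 ^ n)" using 1 Suc.IH by (intro mult_mono) auto
  finally show ?case by (simp add: field_simps)
qed auto

text \<open>Moving the line to the left by n units crosses the poles 0, -1, ..., 1 - n of Gamma, and
  their residues are the partial sum of the exponential series of -z. By the recurrence of Gamma the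
  integral left over on Re w = 1/2 - n is at most |2 z|^n / n! times the absolute integral on Re w =
  1/2, hence tends to 0.\<close>

lemma mellin_exp_half:
  assumes z: "Re z > 0"
  shows "(LINT t|lborel. Gamma (Complex (1/2) t) * z powr (- Complex (1/2) t)) = 2 * of_real pi * exp (- z)"
proof -
  have z0: "z \<noteq> 0" using z by auto
  define I where "I n = (LINT t|lborel. Gamma (Complex (1/2 - real n) t) * z powr (- Complex (1/2 - real n) t))" for n
  have not_pole: "w \<notin> \<int>\<^sub>\<le>\<^sub>0" if "Re w = 1/2 - real n" for w n
  proof
    assume "w \<in> \<int>\<^sub>\<le>\<^sub>0"
    then obtain m :: nat where "w = - of_nat m" by (auto elim!: nonpos_Ints_cases')
    hence "1/2 - real n = - real m" using that by simp
    hence "real (2 * n) = real (2 * m + 1)" by simp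
    hence "2 * n = 2 * m + 1" by (rule of_nat_eq_iff[THEN iffD1])
    thus False by presburger
  qed
  have step: "I n = I (Suc n) + 2 * of_real pi * ((- z) ^ n / fact n)" for n
  proof -
    define p where "p = - real n"
    \<comment> \<open>This is (w + n) Gamma(w) z^(-w), written so that it is holomorphic at the pole
      -n.\<close>
    define h where "h w = Gamma (w + of_nat n + 1) * z powr (- w) / pochhammer w n" for w
    have poch: "pochhammer w n \<noteq> 0" if w: "\<bar>Re w - p\<bar> < 3/4" for w
    proof
      assume "pochhammer w n = 0"
      then obtain k where k: "k < n" "w = - of_nat k" by (auto simp: pochhammer_eq_0_iff)
      hence "Re w = - real k" by simp
      thus False using w k by (simp add: p_def abs_less_iff)
    qed
    have arg: "w + of_nat n + 1 \<notin> \<int>\<^sub>\<le>\<^sub>0" if w: "\<bar>Re w - p\<bar> < 3/4" for w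
    proof -
      have "Re (w + of_nat n + 1) = 1 + (Re w - p)" by (simp add: p_def)
      hence "Re (w + of_nat n + 1) > 0" using w by linarith
      thus ?thesis by (rule Re_pos_not_nonpos_Int)
    qed
    have hol: "h holomorphic_on {w. \<bar>Re w - p\<bar> < 3/4}"
      unfolding h_def using poch arg z0
      by (intro holomorphic_intros holomorphic_on_pochhammer) auto
    have hG: "h w / (w - of_real p) = Gamma w * z powr (- w)" if w: "w \<notin> \<int>\<^sub>\<le>\<^sub>0" for w
    proof -
      have "Gamma w \<noteq> 0" using w by (simp add: Gamma_eq_zero_iff)
      hence e: "Gamma (w + of_nat (Suc n)) = pochhammer w (Suc n) * Gamma w"
        using pochhammer_Gamma[OF w, of "Suc n"] by (simp add: field_simps)
      have pn: "pochhammer w (Suc n) \<noteq> 0" using w by (auto simp: pochhammer_eq_0_iff)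
      have eq: "w + of_nat (Suc n) = w + of_nat n + 1" "w - of_real p = w + of_nat n" by (simp_all add: p_def)
      show ?thesis using e pn unfolding h_def eq pochhammer_Suc by (simp add: field_simps)
    qed
    obtain \<eta> M where \<eta>: "0 < \<eta>" "\<eta> \<le> 1" and M: "\<And>w. \<bar>Re w\<bar> \<le> real n + 1 \<Longrightarrow> \<bar>Im w\<bar> \<ge> max 4 (4 * (real n + 1)) \<Longrightarrow>
       norm (Gamma w * z powr (- w)) \<le> M * exp (- \<eta> * \<bar>Im w\<bar>)"
      using Gamma_powr_tail_bound[OF z, of "real n + 1"] by auto
    have "(LINT t|lborel. h (Complex (p + 1/2) t) / (Complex (p + 1/2) t - of_real p)) =
         (LINT t|lborel. h (Complex (p - 1/2) t) / (Complex (p - 1/2) t - of_real p)) + 2 * of_real pi * h (of_real p)"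
    proof (rule strip_residue[OF hol _ \<eta>])
      fix w assume w: "\<bar>Re w - p\<bar> \<le> 1/2" "\<bar>Im w\<bar> \<ge> max 4 (4 * (real n + 1))"
      have "w \<notin> \<int>\<^sub>\<le>\<^sub>0" using w(2) by (auto elim!: nonpos_Ints_cases)
      moreover have "\<bar>Re w\<bar> \<le> real n + 1" using w(1) unfolding p_def by linarith
      ultimately show "norm (h w / (w - of_real p)) \<le> M * exp (- \<eta> * \<bar>Im w\<bar>)" using M[of w] w(2) hG by simp
    qed
    moreover have "h (Complex (p + 1/2) t) / (Complex (p + 1/2) t - of_real p) = Gamma (Complex (1/2 - real n) t) * z powr (- Complex (1/2 - real n) t)" for t
      using hG[of "Complex (p + 1/2) t"] not_pole[of "Complex (p + 1/2) t" n] by (simp add: p_def)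
    moreover have "h (Complex (p - 1/2) t) / (Complex (p - 1/2) t - of_real p) = Gamma (Complex (1/2 - real (Suc n)) t) * z powr (- Complex (1/2 - real (Suc n)) t)" for t
    proof -
      have e: "p - 1/2 = 1/2 - real (Suc n)" by (simp add: p_def)
      show ?thesis unfolding e by (rule hG, rule not_pole[of _ "Suc n"]) simp
    qed
    moreover have "h (of_real p) = (- z) ^ n / fact n"
    proof -
      define \<sigma> where "\<sigma> = (- 1 :: complex) ^ n"
      have inv: "inverse \<sigma> = \<sigma>" unfolding \<sigma>_def by (cases "even n") simp_all
      have p: "(of_real p :: complex) = - of_nat n" by (simp add: p_def)
      have "pochhammer (- of_nat n :: complex) n = \<sigma> * fact n" unfolding \<sigma>_def by (rule pochhammer_same)
      moreover have "z powr (- (- of_nat n)) = z ^ n" using z0 by (simp add: powr_nat')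
      moreover have "- of_nat n + of_nat n + 1 = (1 :: complex)" by simp
      ultimately have "h (of_real p) = Gamma 1 * z ^ n / (\<sigma> * fact n)" unfolding p h_def by (simp only:)
      also have "\<dots> = \<sigma> * z ^ n / fact n"
        by (simp only: Gamma_1 divide_inverse inverse_mult_distrib inv mult_1_left mult_ac)
      also have "\<sigma> * z ^ n = (- z) ^ n" unfolding \<sigma>_def by (rule power_minus[symmetric])
      finally show ?thesis .
    qed
    ultimately show ?thesis by (simp add: I_def)
  qed
  have sum: "I 0 = I n + 2 * of_real pi * (\<Sum>k<n. (- z) ^ k / fact k)" for n
  proof (induction n)
    case (Suc n)
    show ?case using Suc.IH step[of n] by (simp add: distrib_left)
  qed simp
  define J where "J = (LINT t|lborel. norm (Gamma (Complex (1/2) t) * z powr (- Complex (1/2) t)))"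
  have bd: "norm (I n) \<le> (2 * norm z) ^ n / fact n * J" for n
  proof -
    have "norm (I n) \<le> (LINT t|lborel. norm (Gamma (Complex (1/2 - real n) t) * z powr (- Complex (1/2 - real n) t)))"
      unfolding I_def by (rule integral_norm_bound)
    also have "\<dots> \<le> (LINT t|lborel. (2 * norm z) ^ n / fact n * norm (Gamma (Complex (1/2) t) * z powr (- Complex (1/2) t)))"
    proof (rule integral_mono')
      fix t :: real
      let ?w = "Complex (1/2) t"
      have ew: "Complex (1/2 - real n) t = ?w - of_nat n" by (simp add: complex_eq_iff)
      have np: "?w - of_nat n \<notin> \<int>\<^sub>\<le>\<^sub>0" by (rule not_pole[of _ n]) simp
      have P: "norm (pochhammer (?w - of_nat n) n) \<ge> fact n / 2 ^ n" by (rule pochhammer_left_shift_ge) simp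
      have Ppos: "norm (pochhammer (?w - of_nat n) n) > 0" by (rule less_le_trans[OF _ P]) simp
      have "Gamma (?w - of_nat n) \<noteq> 0" using np by (simp add: Gamma_eq_zero_iff)
      hence "Gamma ?w = pochhammer (?w - of_nat n) n * Gamma (?w - of_nat n)"
        using pochhammer_Gamma[OF np, of n] by (simp add: field_simps)
      hence g: "norm (Gamma (?w - of_nat n)) = norm (Gamma ?w) / norm (pochhammer (?w - of_nat n) n)"
        using Ppos by (simp add: norm_mult)
      have "z powr (- (?w - of_nat n)) = z powr (- ?w) * z ^ n"
      proof -
        have "z ^ n = exp (of_nat n * Ln z)" using z0 by (simp add: exp_of_nat_mult)
        hence "z powr (- ?w) * z ^ n = exp (- ?w * Ln z + of_nat n * Ln z)" using z0 by (simp only: powr_def if_False exp_add)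
        thus ?thesis using z0 by (simp add: powr_def algebra_simps)
      qed
      hence "norm (Gamma (?w - of_nat n) * z powr (- (?w - of_nat n))) = norm (Gamma ?w * z powr (- ?w)) * norm z ^ n / norm (pochhammer (?w - of_nat n) n)"
        by (simp add: norm_mult norm_power g)
      also have "\<dots> \<le> norm (Gamma ?w * z powr (- ?w)) * norm z ^ n / (fact n / 2 ^ n)"
        using P Ppos by (intro divide_left_mono mult_pos_pos) auto
      also have "\<dots> = (2 * norm z) ^ n / fact n * norm (Gamma ?w * z powr (- ?w))" by (simp add: power_mult_distrib)
      finally show "norm (Gamma (Complex (1/2 - real n) t) * z powr (- Complex (1/2 - real n) t)) \<le> (2 * norm z) ^ n / fact n * norm (Gamma ?w * z powr (- ?w))"
        unfolding ew .
    next
      obtain \<eta> M where \<eta>: "0 < \<eta>" "\<eta> \<le> 1" and M: "\<And>w. \<bar>Re w\<bar> \<le> 1 \<Longrightarrow> \<bar>Im w\<bar> \<ge> max 4 (4 * 1) \<Longrightarrow>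
         norm (Gamma w * z powr (- w)) \<le> M * exp (- \<eta> * \<bar>Im w\<bar>)"
        using Gamma_powr_tail_bound[OF z, of 1] by auto
      have hol: "(\<lambda>w. Gamma w * z powr (- w)) holomorphic_on {w. Re w > 0}"
        using z0 by (intro holomorphic_intros) (auto elim!: nonpos_Ints_cases)
      have "\<exists>M'. \<forall>w. 1/2 \<le> Re w \<longrightarrow> Re w \<le> 1/2 \<longrightarrow> norm (Gamma w * z powr (- w)) \<le> M' * exp (- \<eta> * \<bar>Im w\<bar>)"
        by (rule strip_bound_of_tail_bound[OF continuous_on_subset[OF holomorphic_on_imp_continuous_on[OF hol]] M \<eta>(1)]) auto
      then obtain M' where M': "\<And>w. 1/2 \<le> Re w \<and> Re w \<le> 1/2 \<Longrightarrow> norm (Gamma w * z powr (- w)) \<le> M' * exp (- \<eta> * \<bar>Im w\<bar>)" by blast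
      have "integrable lborel (\<lambda>t. Gamma (Complex (1/2) t) * z powr (- Complex (1/2) t))"
        by (rule full_strip_shift(2)[OF order_refl open_halfspace_Re_gt[of 0] _ hol _ \<eta>(1)]) (use M' in auto)
      thus "integrable lborel (\<lambda>t. (2 * norm z) ^ n / fact n * norm (Gamma (Complex (1/2) t) * z powr (- Complex (1/2) t)))"
        by (intro integrable_mult_right integrable_norm)
    qed auto
    also have "\<dots> = (2 * norm z) ^ n / fact n * J" unfolding J_def by (rule integral_mult_right_zero)
    finally show ?thesis .
  qed
  have "(\<lambda>n. (2 * norm z) ^ n / fact n) \<longlonglongrightarrow> 0"
    using summable_LIMSEQ_zero[OF summable_exp_generic[of "2 * norm z"]] by (simp add: divide_inverse mult.commute)
  from tendsto_mult_left_zero[OF this, of J] have "I \<longlonglongrightarrow> 0"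
    by (rule Lim_null_comparison[rotated]) (use bd in auto)
  moreover have "(\<lambda>n. \<Sum>k<n. (- z) ^ k / fact k) \<longlonglongrightarrow> exp (- z)"
    using exp_converges[of "- z"] by (simp add: sums_def scaleR_conv_of_real divide_inverse mult.commute)
  ultimately have "(\<lambda>n. I n + 2 * of_real pi * (\<Sum>k<n. (- z) ^ k / fact k)) \<longlonglongrightarrow> 0 + 2 * of_real pi * exp (- z)"
    by (intro tendsto_intros)
  hence "(\<lambda>n. I 0) \<longlonglongrightarrow> 2 * of_real pi * exp (- z)" by (simp flip: sum)
  from LIMSEQ_unique[OF tendsto_const this] show ?thesis by (simp add: I_def)
qed

theorem mellin_exp:
  assumes z: "Re z > 0" and c: "c > 0"
  shows "integrable lborel (\<lambda>t. Gamma (Complex c t) * z powr (- Complex c t))"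
    and "(LINT t|lborel. Gamma (Complex c t) * z powr (- Complex c t)) = 2 * of_real pi * exp (- z)"
proof -
  have z0: "z \<noteq> 0" using z by auto
  define X where "X = max c (1/2)"
  have X: "X \<ge> 0" by (simp add: X_def)
  obtain \<eta> M where \<eta>: "0 < \<eta>" "\<eta> \<le> 1" and M: "\<And>w. \<bar>Re w\<bar> \<le> X \<Longrightarrow> \<bar>Im w\<bar> \<ge> max 4 (4 * X) \<Longrightarrow>
     norm (Gamma w * z powr (- w)) \<le> M * exp (- \<eta> * \<bar>Im w\<bar>)"
    using Gamma_powr_tail_bound[OF z X] by auto
  have hol: "(\<lambda>w. Gamma w * z powr (- w)) holomorphic_on {w. Re w > 0}"
    using z0 by (intro holomorphic_intros) (auto elim!: nonpos_Ints_cases)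
  have shift: "integrable lborel (\<lambda>t. Gamma (Complex a t) * z powr (- Complex a t)) \<and>
      integrable lborel (\<lambda>t. Gamma (Complex b t) * z powr (- Complex b t)) \<and>
      (LINT t|lborel. Gamma (Complex b t) * z powr (- Complex b t)) = (LINT t|lborel. Gamma (Complex a t) * z powr (- Complex a t))"
    if ab: "0 < a" "a \<le> b" "b \<le> X" for a b
  proof -
    have "\<exists>M'. \<forall>w. a \<le> Re w \<longrightarrow> Re w \<le> b \<longrightarrow> norm (Gamma w * z powr (- w)) \<le> M' * exp (- \<eta> * \<bar>Im w\<bar>)"
    proof (rule strip_bound_of_tail_bound[where Y = "max 4 (4 * X)" and M = M])
      show "continuous_on {w. a \<le> Re w \<and> Re w \<le> b} (\<lambda>w. Gamma w * z powr (- w))"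
        by (rule continuous_on_subset[OF holomorphic_on_imp_continuous_on[OF hol]]) (use ab in auto)
      show "norm (Gamma w * z powr (- w)) \<le> M * exp (- \<eta> * \<bar>Im w\<bar>)"
        if "a \<le> Re w" "Re w \<le> b" "max 4 (4 * X) \<le> \<bar>Im w\<bar>" for w
        by (rule M) (use that ab in auto)
    qed (rule \<eta>(1))
    then obtain M' where M': "\<And>w. w \<in> {w. a \<le> Re w \<and> Re w \<le> b} \<Longrightarrow> norm (Gamma w * z powr (- w)) \<le> M' * exp (- \<eta> * \<bar>Im w\<bar>)" by blast
    have sub: "{w. a \<le> Re w \<and> Re w \<le> b} \<subseteq> {w. Re w > 0}" using ab by auto
    show ?thesis using full_strip_shift[OF ab(2) open_halfspace_Re_gt[of 0] sub hol M' \<eta>(1)] by blast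
  qed
  show "integrable lborel (\<lambda>t. Gamma (Complex c t) * z powr (- Complex c t))"
    using shift[OF c order_refl] by (simp add: X_def)
  show "(LINT t|lborel. Gamma (Complex c t) * z powr (- Complex c t)) = 2 * of_real pi * exp (- z)"
  proof (cases "c \<le> 1/2")
    case True
    thus ?thesis using shift[OF c True] mellin_exp_half[OF z] by (simp add: X_def)
  next
    case False
    thus ?thesis using shift[of "1/2" c] mellin_exp_half[OF z] by (simp add: X_def)
  qed
qed

section \<open>Multiple Dirichlet series\<close>

definition pos_vecs :: "(nat^'n::finite) set" where
  "pos_vecs = {n. \<forall>\<nu>. n $ \<nu> \<ge> 1}"

lemma countable_pos_vecs [simp]: "countable (pos_vecs :: (nat^'n::finite) set)"
  by (rule countable_subset[OF subset_UNIV]) simp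

lemma bij_betw_PiE_pos_vecs:
  "bij_betw (\<lambda>g. \<chi> \<nu>. g \<nu>) (PiE UNIV (\<lambda>_. {1..})) (pos_vecs :: (nat^'n::finite) set)"
  by (rule bij_betwI[where g = "\<lambda>(n::nat^'n) \<nu>. n $ \<nu>"]) (auto simp: pos_vecs_def)

lemma prod_series:
  fixes f :: "'n::finite \<Rightarrow> nat \<Rightarrow> complex"
  assumes "\<And>\<nu>. integrable (count_space {1..}) (f \<nu>)"
  shows "integrable (count_space pos_vecs) (\<lambda>n::nat^'n. \<Prod>\<nu>\<in>UNIV. f \<nu> (n $ \<nu>))"
    and "(LINT n|count_space (pos_vecs :: (nat^'n) set). (\<Prod>\<nu>\<in>UNIV. f \<nu> (n $ \<nu>))) = (\<Prod>\<nu>\<in>UNIV. (LINT k|count_space {1..}. f \<nu> k))"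
proof -
  have s: "Infinite_Set_Sum.abs_summable_on (f \<nu>) {1..}" for \<nu>
    using assms by (simp add: abs_summable_on_def)
  have "Infinite_Set_Sum.abs_summable_on (\<lambda>g. \<Prod>\<nu>\<in>UNIV. f \<nu> ((\<chi> \<nu>. g \<nu>) $ \<nu>)) (PiE UNIV (\<lambda>_. {1..}))"
    using abs_summable_on_prod_PiE[of "UNIV :: 'n set" "\<lambda>_. {1..}" f] s by simp
  hence "Infinite_Set_Sum.abs_summable_on (\<lambda>n::nat^'n. \<Prod>\<nu>\<in>UNIV. f \<nu> (n $ \<nu>)) pos_vecs"
    by (subst (asm) abs_summable_on_reindex_bij_betw[OF bij_betw_PiE_pos_vecs])
  thus "integrable (count_space pos_vecs) (\<lambda>n::nat^'n. \<Prod>\<nu>\<in>UNIV. f \<nu> (n $ \<nu>))"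
    by (simp add: abs_summable_on_def)
  have "infsetsum (\<lambda>n::nat^'n. \<Prod>\<nu>\<in>UNIV. f \<nu> (n $ \<nu>)) pos_vecs = infsetsum (\<lambda>g. \<Prod>\<nu>\<in>UNIV. f \<nu> ((\<chi> \<nu>. g \<nu>) $ \<nu>)) (PiE UNIV (\<lambda>_. {1..}))"
    by (rule infsetsum_reindex_bij_betw[OF bij_betw_PiE_pos_vecs, symmetric])
  also have "\<dots> = (\<Prod>\<nu>\<in>UNIV. infsetsum (f \<nu>) {1..})"
    using infsetsum_prod_PiE[of "UNIV :: 'n set" "\<lambda>_. {1..}" f] s by simp
  finally show "(LINT n|count_space (pos_vecs :: (nat^'n) set). (\<Prod>\<nu>\<in>UNIV. f \<nu> (n $ \<nu>))) = (\<Prod>\<nu>\<in>UNIV. (LINT k|count_space {1..}. f \<nu> k))"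
    by (simp add: infsetsum_def)
qed

text \<open>The product form of the majorant reduces Fubini to two one-variable integrability
  statements; it fits the series in use because on a vertical line the terms depend on the index
  only through a factor of constant modulus.\<close>

lemma sum_integral_swap:
  fixes f :: "'a \<Rightarrow> 'b \<Rightarrow> complex"
  assumes I: "countable I" and M: "sigma_finite_measure M"
    and meas: "\<And>i. i \<in> I \<Longrightarrow> f i \<in> borel_measurable M"
    and a: "integrable (count_space I) a" and g: "integrable M g"
    and bd: "\<And>i x. i \<in> I \<Longrightarrow> x \<in> space M \<Longrightarrow> norm (f i x) \<le> a i * g x"
  shows "integrable M (\<lambda>x. LINT i|count_space I. f i x)"
    and "(LINT x|M. LINT i|count_space I. f i x) = (LINT i|count_space I. LINT x|M. f i x)"
proof -
  interpret M: sigma_finite_measure M by (rule M)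
  interpret C: sigma_finite_measure "count_space I" by (rule sigma_finite_measure_count_space_countable[OF I])
  interpret pair_sigma_finite "count_space I" M by standard
  have m: "case_prod f \<in> borel_measurable (count_space I \<Otimes>\<^sub>M M)"
    by (rule measurable_pair_measure_countable1[OF I]) (use meas in simp)
  have gi: "integrable M (f i)" if i: "i \<in> I" for i
    by (rule Bochner_Integration.integrable_bound[OF integrable_mult_right[OF g, of "a i"] meas[OF i]])
       (use bd[OF i] in \<open>force intro!: AE_I2 order_trans[OF _ abs_ge_self]\<close>)
  have "integrable (count_space I \<Otimes>\<^sub>M M) (case_prod f)"
  proof (rule Fubini_integrable[OF m])
    show "AE i in count_space I. integrable M (\<lambda>x. case_prod f (i, x))"
      using gi by (intro AE_I2) simp
    show "integrable (count_space I) (\<lambda>i. LINT x|M. norm (case_prod f (i, x)))"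
    proof (rule Bochner_Integration.integrable_bound[OF integrable_mult_left[OF a, of "LINT x|M. g x"]])
      show "AE i in count_space I. norm (LINT x|M. norm (case_prod f (i, x))) \<le> norm (a i * (LINT x|M. g x))"
      proof (rule AE_I2)
        fix i assume "i \<in> space (count_space I)"
        hence i: "i \<in> I" by simp
        have "(LINT x|M. norm (f i x)) \<le> (LINT x|M. a i * g x)"
          using gi[OF i] g bd[OF i] by (intro integral_mono) auto
        also have "\<dots> = a i * (LINT x|M. g x)" by (rule integral_mult_right_zero)
        finally have "(LINT x|M. norm (f i x)) \<le> norm (a i * (LINT x|M. g x))" by simp
        thus "norm (LINT x|M. norm (case_prod f (i, x))) \<le> norm (a i * (LINT x|M. g x))"
          by (simp add: Bochner_Integration.integral_nonneg)
      qed
    qed simp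
  qed
  from Fubini_integral[OF this] integrable_snd[OF this]
  show "integrable M (\<lambda>x. LINT i|count_space I. f i x)"
    "(LINT x|M. LINT i|count_space I. f i x) = (LINT i|count_space I. LINT x|M. f i x)" by simp_all
qed

lemma norm_of_nat_powr: "norm (of_nat n powr s :: complex) = real n powr Re s"
  using norm_powr_real_powr[of "of_nat n" s] by (cases "n = 0") auto

lemma selberg_series:
  assumes sel: "selberg_sharp a Fc Q lam mu om" and s: "Re s > 1"
  shows "integrable (count_space {1..}) (\<lambda>n. a n / of_nat n powr s)"
    and "(LINT n|count_space {1..}. a n / of_nat n powr s) = Fc s"
proof -
  have sm: "summable (\<lambda>n. norm (a (Suc n) / of_nat (Suc n) powr s))"
    and v: "Fc s = (\<Sum>n. a (Suc n) / of_nat (Suc n) powr s)"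
    using sel s unfolding selberg_sharp_def by blast+
  have bij: "bij_betw Suc UNIV {1..}"
    by (rule bij_betwI[where g = "\<lambda>n. n - 1"]) auto
  have "Infinite_Set_Sum.abs_summable_on (\<lambda>n. a (Suc n) / of_nat (Suc n) powr s) UNIV"
    unfolding abs_summable_on_nat_iff' by (rule sm)
  moreover from this have "infsetsum (\<lambda>n. a (Suc n) / of_nat (Suc n) powr s) UNIV = Fc s"
    unfolding v by (rule infsetsum_nat')
  ultimately show "integrable (count_space {1..}) (\<lambda>n. a n / of_nat n powr s)"
     "(LINT n|count_space {1..}. a n / of_nat n powr s) = Fc s"
    using abs_summable_on_reindex_bij_betw[OF bij, of "\<lambda>n. a n / of_nat n powr s"]
      infsetsum_reindex_bij_betw[OF bij, of "\<lambda>n. a n / of_nat n powr s"]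
    by (simp_all add: abs_summable_on_def infsetsum_def)
qed

lemma selberg_dual_series:
  assumes sel: "selberg_sharp a Fc Q lam mu om" and s: "Re s > 1"
  shows "integrable (count_space {1..}) (\<lambda>n. cnj (a n) / of_nat n powr s)"
    and "(LINT n|count_space {1..}. cnj (a n) / of_nat n powr s) = cnj (Fc (cnj s))"
proof -
  have e: "cnj (a n) / of_nat n powr s = cnj (a n / of_nat n powr cnj s)" if "n \<in> {1..}" for n
    using that cnj_powr[of "of_nat n" "cnj s"] by simp
  have s': "Re (cnj s) > 1" using s by simp
  have "integrable (count_space {1..}) (\<lambda>n. cnj (a n / of_nat n powr cnj s))"
    by (rule integrable_bounded_linear[OF bounded_linear_cnj selberg_series(1)[OF sel s']])
  thus "integrable (count_space {1..}) (\<lambda>n. cnj (a n) / of_nat n powr s)"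
    by (subst Bochner_Integration.integrable_cong[OF refl e]) simp_all
  have "(LINT n|count_space {1..}. cnj (a n) / of_nat n powr s) = (LINT n|count_space {1..}. cnj (a n / of_nat n powr cnj s))"
    by (rule Bochner_Integration.integral_cong[OF refl e]) simp
  also have "\<dots> = cnj (Fc (cnj s))" unfolding Bochner_Integration.integral_cnj selberg_series(2)[OF sel s'] ..
  finally show "(LINT n|count_space {1..}. cnj (a n) / of_nat n powr s) = cnj (Fc (cnj s))" .
qed

lemma finite_bounded_vecs: "finite {n::nat^'n::finite. \<forall>\<nu>. n $ \<nu> \<le> M}"
proof (rule finite_subset)
  show "{n::nat^'n. \<forall>\<nu>. n $ \<nu> \<le> M} \<subseteq> (\<lambda>g. \<chi> \<nu>. g \<nu>) ` PiE UNIV (\<lambda>_. {..M})"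
  proof
    fix n :: "nat^'n" assume "n \<in> {n. \<forall>\<nu>. n $ \<nu> \<le> M}"
    thus "n \<in> (\<lambda>g. \<chi> \<nu>. g \<nu>) ` PiE UNIV (\<lambda>_. {..M})"
      by (intro image_eqI[of _ _ "\<lambda>\<nu>. n $ \<nu>"]) auto
  qed
  show "finite ((\<lambda>g. \<chi> \<nu>. g \<nu>) ` PiE (UNIV :: 'n set) (\<lambda>_. {..M}))"
    by (intro finite_imageI finite_PiE) auto
qed

text \<open>Every factor is at least 1, so each single component is at most B^(1/kappa). This
  discreteness of the frequencies later isolates the resonant ones.\<close>

lemma finite_small_norm_vecs:
  fixes \<kappa> :: "'n::finite \<Rightarrow> real"
  assumes \<kappa>: "\<And>\<nu>. \<kappa> \<nu> > 0"
  shows "finite {n::nat^'n. n \<in> pos_vecs \<and> (\<Prod>\<nu>\<in>UNIV. real (n $ \<nu>) powr \<kappa> \<nu>) \<le> B}"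
proof -
  define M where "M = nat \<lceil>\<Sum>\<nu>\<in>UNIV. B powr (1 / \<kappa> \<nu>)\<rceil>"
  have "n $ \<nu> \<le> M" if n: "n \<in> pos_vecs" "(\<Prod>\<nu>\<in>UNIV. real (n $ \<nu>) powr \<kappa> \<nu>) \<le> B" for n :: "nat^'n" and \<nu>
  proof -
    have n1: "real (n $ \<mu>) \<ge> 1" for \<mu> using n(1) by (simp add: pos_vecs_def)
    have "real (n $ \<mu>) powr \<kappa> \<mu> \<ge> 1" for \<mu> using n1[of \<mu>] \<kappa>[of \<mu>] by (intro ge_one_powr_ge_zero) auto
    hence "(\<Prod>\<mu>\<in>{\<nu>}. real (n $ \<mu>) powr \<kappa> \<mu>) \<le> (\<Prod>\<mu>\<in>UNIV. real (n $ \<mu>) powr \<kappa> \<mu>)"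
      by (intro prod_mono2) auto
    hence "real (n $ \<nu>) powr \<kappa> \<nu> \<le> B" using n(2) by simp
    hence "(real (n $ \<nu>) powr \<kappa> \<nu>) powr (1 / \<kappa> \<nu>) \<le> B powr (1 / \<kappa> \<nu>)"
      using \<kappa>[of \<nu>] by (intro powr_mono2) auto
    hence "real (n $ \<nu>) \<le> B powr (1 / \<kappa> \<nu>)" using \<kappa>[of \<nu>] n1[of \<nu>] by (simp add: powr_powr)
    also have "\<dots> \<le> (\<Sum>\<nu>\<in>UNIV. B powr (1 / \<kappa> \<nu>))" by (rule member_le_sum) auto
    finally show ?thesis unfolding M_def by linarith
  qed
  thus ?thesis by (intro finite_subset[OF _ finite_bounded_vecs[of M]]) auto
qed

section \<open>Oscillating integrals\<close>

lemma has_vector_derivative_Complex_const: "(Complex c has_vector_derivative \<i>) (at t within A)"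
proof -
  have "((\<lambda>t. of_real c + of_real t * \<i>) has_vector_derivative 0 + 1 * \<i>) (at t within A)"
    by (intro has_vector_derivative_add has_vector_derivative_const has_vector_derivative_mult_left
        has_vector_derivative_of_real) (auto intro!: derivative_eq_intros)
  thus ?thesis by (simp add: Complex_eq[abs_def] mult.commute)
qed

lemma norm_powr_upper_le:
  assumes "w \<noteq> 0"
  shows "norm (w powr \<beta>) \<le> norm w powr Re \<beta> * exp (pi * \<bar>Im \<beta>\<bar>)"
proof -
  have "norm (w powr \<beta>) = exp (Re \<beta> * ln (norm w) - Im \<beta> * Im (Ln w))"
    using assms by (simp add: powr_def)
  also have "\<dots> \<le> exp (Re \<beta> * ln (norm w) + pi * \<bar>Im \<beta>\<bar>)"
  proof -
    have "\<bar>Im (Ln w)\<bar> \<le> pi" using mpi_less_Im_Ln[OF assms] Im_Ln_le_pi[OF assms] by (simp add: abs_le_iff)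
    hence "\<bar>Im \<beta>\<bar> * \<bar>Im (Ln w)\<bar> \<le> \<bar>Im \<beta>\<bar> * pi" by (intro mult_left_mono) auto
    hence "\<bar>Im \<beta> * Im (Ln w)\<bar> \<le> \<bar>Im \<beta>\<bar> * pi" by (simp add: abs_mult)
    hence "- (Im \<beta> * Im (Ln w)) \<le> pi * \<bar>Im \<beta>\<bar>" by (simp add: abs_le_iff mult.commute)
    thus ?thesis by simp
  qed
  also have "\<dots> = norm w powr Re \<beta> * exp (pi * \<bar>Im \<beta>\<bar>)" using assms by (simp add: powr_def exp_add)
  finally show ?thesis .
qed

locale tail_line =
  fixes c T :: real
  assumes c: "c > 0" and T: "T \<ge> 1"
begin

definition line_pt :: "real \<Rightarrow> complex" where "line_pt t = Complex (- c) t"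

text \<open>An incomplete Gamma integral along a vertical ray. In the application y = l - i eps,
  where l is the logarithm of x_m, so that exp(-y w) is x_m^(-w) with the damping factor.\<close>

definition J :: "complex \<Rightarrow> complex \<Rightarrow> complex" where
  "J y \<beta> = (LINT t:{T..}|lborel. exp (- y * line_pt t) * line_pt t powr \<beta>)"

lemma line_pt_simps [simp]: "Re (line_pt t) = - c" "Im (line_pt t) = t"
  by (auto simp: line_pt_def)

lemma line_pt_nz: "line_pt t \<noteq> 0"
  using c by (auto simp: complex_eq_iff)

lemma continuous_line_pt: "continuous_on A line_pt"
  unfolding line_pt_def by (rule continuous_on_Complex_line)

lemma line_pt_not_neg: "t > 0 \<Longrightarrow> line_pt t \<notin> \<real>\<^sub>\<le>\<^sub>0"
  by (auto simp: complex_nonpos_Reals_iff)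

lemma norm_line_pt_ge: "t \<ge> 0 \<Longrightarrow> norm (line_pt t) \<ge> t"
  using abs_Im_le_cmod[of "line_pt t"] by simp

lemma continuous_integrand: "continuous_on {T..} (\<lambda>t. exp (- y * line_pt t) * line_pt t powr \<beta>)"
proof -
  have "line_pt t \<notin> \<real>\<^sub>\<le>\<^sub>0" if "t \<in> {T..}" for t using that T by (intro line_pt_not_neg) auto
  hence "continuous_on {T..} (\<lambda>t. exp (- y * line_pt t) * exp (\<beta> * Ln (line_pt t)))"
    by (intro continuous_on_mult continuous_on_exp continuous_on_Ln' continuous_on_const continuous_line_pt) auto
  thus ?thesis by (simp add: powr_def line_pt_nz)
qed

lemma norm_exp_line_pt: "norm (exp (- (of_real l - \<i> * of_real \<epsilon>) * line_pt t)) = exp (l * c - \<epsilon> * t)"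
  by (simp add: algebra_simps)

lemma integrand_bound_2:
  assumes \<beta>: "Re \<beta> \<le> -2" and \<epsilon>: "\<epsilon> \<ge> 0" and t: "t \<ge> T"
  shows "norm (exp (- (of_real l - \<i> * of_real \<epsilon>) * line_pt t) * line_pt t powr \<beta>) \<le> exp (l * c) * exp (pi * \<bar>Im \<beta>\<bar>) * (1 / t ^ 2)"
proof -
  have t1: "t \<ge> 1" using t T by simp
  have n1: "norm (line_pt t) \<ge> t" using norm_line_pt_ge[of t] t1 by simp
  have "norm (line_pt t) powr Re \<beta> \<le> norm (line_pt t) powr (-2)" using n1 t1 \<beta> by (intro powr_mono) auto
  also have "\<dots> \<le> t powr (-2)" using n1 t1 by (intro powr_mono2') auto
  also have "\<dots> = 1 / t ^ 2" using t1 by (simp add: powr_minus_divide powr_numeral)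
  finally have 1: "norm (line_pt t) powr Re \<beta> \<le> 1 / t ^ 2" .
  have "norm (line_pt t powr \<beta>) \<le> (1 / t ^ 2) * exp (pi * \<bar>Im \<beta>\<bar>)"
    by (rule order_trans[OF norm_powr_upper_le[OF line_pt_nz]]) (use 1 in \<open>intro mult_right_mono; simp\<close>)
  moreover have "exp (l * c - \<epsilon> * t) \<le> exp (l * c)" using \<epsilon> t1 by simp
  ultimately have "norm (exp (- (of_real l - \<i> * of_real \<epsilon>) * line_pt t)) * norm (line_pt t powr \<beta>) \<le> exp (l * c) * ((1 / t ^ 2) * exp (pi * \<bar>Im \<beta>\<bar>))"
    unfolding norm_exp_line_pt by (intro mult_mono) auto
  thus ?thesis by (simp only: norm_mult mult_ac)
qed

lemma set_integrable_inv_sq: "set_integrable lborel {T..} (\<lambda>t. C * (1 / t ^ 2))"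
  using T by (intro set_integrable_mult_right set_integrable_powr2_atLeast) auto

lemma integrand_integrable_2:
  assumes "Re \<beta> \<le> -2" "\<epsilon> \<ge> 0"
  shows "set_integrable lborel {T..} (\<lambda>t. exp (- (of_real l - \<i> * of_real \<epsilon>) * line_pt t) * line_pt t powr \<beta>)"
  by (rule set_integrable_continuous_bound[OF set_integrable_inv_sq _ continuous_integrand])
     (use integrand_bound_2[OF assms] in auto)

lemma integrand_bound_exp:
  assumes \<epsilon>: "\<epsilon> > 0"
  obtains C where "C \<ge> 0" "\<And>t. t \<ge> T \<Longrightarrow> norm (exp (- (of_real l - \<i> * of_real \<epsilon>) * line_pt t) * line_pt t powr \<beta>) \<le> C * exp (- (\<epsilon> / 2) * t)"
proof -
  define q where "q = \<bar>Re \<beta>\<bar>"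
  obtain D where D: "D > 0" "\<And>t::real. t > 0 \<Longrightarrow> q \<ge> 0 \<Longrightarrow> t powr q \<le> D * exp (\<epsilon> / 2 * t)"
    using powr_le_exp[of "\<epsilon> / 2" q] \<epsilon> by (metis half_gt_zero)
  define C where "C = exp (l * c) * ((1 + c) powr q * D * exp (pi * \<bar>Im \<beta>\<bar>))"
  have "norm (exp (- (of_real l - \<i> * of_real \<epsilon>) * line_pt t) * line_pt t powr \<beta>) \<le> C * exp (- (\<epsilon> / 2) * t)" if t: "t \<ge> T" for t
  proof -
    have t1: "t \<ge> 1" using t T by simp
    have n1: "norm (line_pt t) \<ge> t" using norm_line_pt_ge[of t] t1 by simp
    have "norm (line_pt t) \<le> c + t" using cmod_le[of "line_pt t"] c t1 by simp
    also have "\<dots> \<le> (1 + c) * t" using c t1 by (simp add: algebra_simps mult_left_le)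
    finally have n2: "norm (line_pt t) \<le> (1 + c) * t" .
    have "norm (line_pt t) powr Re \<beta> \<le> norm (line_pt t) powr q" using n1 t1 by (intro powr_mono) (auto simp: q_def)
    also have "\<dots> \<le> ((1 + c) * t) powr q" using n2 by (intro powr_mono2) (auto simp: q_def)
    also have "\<dots> = (1 + c) powr q * t powr q" using c t1 by (simp add: powr_mult)
    also have "\<dots> \<le> (1 + c) powr q * (D * exp (\<epsilon> / 2 * t))" using D(2)[of t] t1 by (intro mult_left_mono) (auto simp: q_def)
    finally have 1: "norm (line_pt t) powr Re \<beta> \<le> (1 + c) powr q * (D * exp (\<epsilon> / 2 * t))" .
    have "norm (line_pt t powr \<beta>) \<le> (1 + c) powr q * (D * exp (\<epsilon> / 2 * t)) * exp (pi * \<bar>Im \<beta>\<bar>)"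
      by (rule order_trans[OF norm_powr_upper_le[OF line_pt_nz]]) (use 1 in \<open>intro mult_right_mono; simp\<close>)
    hence "norm (exp (- (of_real l - \<i> * of_real \<epsilon>) * line_pt t)) * norm (line_pt t powr \<beta>) \<le> exp (l * c - \<epsilon> * t) * ((1 + c) powr q * (D * exp (\<epsilon> / 2 * t)) * exp (pi * \<bar>Im \<beta>\<bar>))"
      unfolding norm_exp_line_pt by (intro mult_left_mono) auto
    also have "\<dots> = C * (exp (- \<epsilon> * t) * exp (\<epsilon> / 2 * t))" by (simp add: C_def exp_diff exp_minus field_simps)
    also have "exp (- \<epsilon> * t) * exp (\<epsilon> / 2 * t) = exp (- (\<epsilon> / 2) * t)" by (simp flip: exp_add)
    finally show ?thesis unfolding norm_mult .
  qed
  moreover have "C \<ge> 0" using D(1) by (simp add: C_def)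
  ultimately show ?thesis using that by blast
qed

lemma integrand_integrable_exp:
  assumes "\<epsilon> > 0"
  shows "set_integrable lborel {T..} (\<lambda>t. exp (- (of_real l - \<i> * of_real \<epsilon>) * line_pt t) * line_pt t powr \<beta>)"
proof -
  obtain C where C: "C \<ge> 0" "\<And>t. t \<ge> T \<Longrightarrow> norm (exp (- (of_real l - \<i> * of_real \<epsilon>) * line_pt t) * line_pt t powr \<beta>) \<le> C * exp (- (\<epsilon> / 2) * t)"
    using integrand_bound_exp[OF assms] by blast
  have "set_integrable lborel {T..} (\<lambda>t. C * exp (- (\<epsilon> / 2) * t))"
    using assms by (intro set_integrable_mult_right set_integrable_exp_atLeast) auto
  thus ?thesis by (rule set_integrable_continuous_bound[OF _ _ continuous_integrand]) (use C(2) in auto)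
qed

lemma integrand_derivative:
  assumes t: "t > 0"
  shows "((\<lambda>t. exp (- y * line_pt t) * line_pt t powr \<beta>) has_vector_derivative
     \<i> * (\<beta> * (exp (- y * line_pt t) * line_pt t powr (\<beta> - 1)) - y * (exp (- y * line_pt t) * line_pt t powr \<beta>))) (at t within A)"
proof -
  have d1: "(line_pt has_vector_derivative \<i>) (at t within A)"
    unfolding line_pt_def[abs_def] by (rule has_vector_derivative_Complex_const)
  have "((\<lambda>w. exp (- y * w) * w powr \<beta>) has_field_derivative
     (\<beta> * (exp (- y * line_pt t) * line_pt t powr (\<beta> - 1)) - y * (exp (- y * line_pt t) * line_pt t powr \<beta>))) (at (line_pt t) within line_pt ` A)"
    using line_pt_not_neg[OF t] by (auto intro!: derivative_eq_intros simp: algebra_simps)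
  from field_vector_diff_chain_within[OF d1 this] show ?thesis by (simp add: o_def)
qed

text \<open>The damping kills the boundary term at infinity. The exponent drops by one at the cost
  of a division by y, which stays harmless as eps tends to 0 only if l is nonzero.\<close>

lemma J_by_parts:
  assumes \<epsilon>: "\<epsilon> > 0"
  defines "y \<equiv> \<lambda>l. of_real l - \<i> * of_real \<epsilon>"
  shows "y l * J (y l) \<beta> = exp (- y l * line_pt T) * line_pt T powr \<beta> / \<i> + \<beta> * J (y l) (\<beta> - 1)"
proof -
  let ?g = "\<lambda>t. exp (- y l * line_pt t) * line_pt t powr \<beta>"
  let ?h = "\<lambda>t. exp (- y l * line_pt t) * line_pt t powr (\<beta> - 1)"
  let ?d = "\<lambda>t. \<i> * (\<beta> * ?h t - y l * ?g t)"
  have ig: "set_integrable lborel {T..} ?g" and ih: "set_integrable lborel {T..} ?h"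
    unfolding y_def by (rule integrand_integrable_exp[OF \<epsilon>])+
  have id: "set_integrable lborel {T..} ?d"
    by (intro set_integrable_mult_right set_integral_diff(1) ig ih)
  have v: "(LINT t:{T..}|lborel. ?d t) = \<i> * (\<beta> * J (y l) (\<beta> - 1) - y l * J (y l) \<beta>)"
    unfolding J_def using ig ih
    by (simp only: set_integral_mult_right set_integral_diff(2) set_integrable_mult_right)
  have "((\<lambda>Y. LINT t:{T..Y}|lborel. ?d t) \<longlongrightarrow> (LINT t:{T..}|lborel. ?d t)) at_top"
    by (rule tendsto_set_integral_exhaustion[OF id]) (auto intro: eventually_ge_at_top)
  moreover have "((\<lambda>Y. LINT t:{T..Y}|lborel. ?d t) \<longlongrightarrow> 0 - ?g T) at_top"
  proof (rule Lim_transform_eventually)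
    obtain C where C: "C \<ge> 0" "\<And>t. t \<ge> T \<Longrightarrow> norm (?g t) \<le> C * exp (- (\<epsilon> / 2) * t)"
      using integrand_bound_exp[OF \<epsilon>, of l \<beta>] unfolding y_def by blast
    have "((\<lambda>t. exp (- (\<epsilon> / 2) * t)) \<longlongrightarrow> 0) at_top" using \<epsilon> by real_asymp
    hence "((\<lambda>t. C * exp (- (\<epsilon> / 2) * t)) \<longlongrightarrow> 0) at_top" by (rule tendsto_mult_right_zero)
    hence "(?g \<longlongrightarrow> 0) at_top"
      by (rule Lim_null_comparison[rotated]) (use C(2) in \<open>auto intro: eventually_mono[OF eventually_ge_at_top[of T]]\<close>)
    thus "((\<lambda>Y. ?g Y - ?g T) \<longlongrightarrow> 0 - ?g T) at_top" by (intro tendsto_diff tendsto_const)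
    show "\<forall>\<^sub>F Y in at_top. ?g Y - ?g T = (LINT t:{T..Y}|lborel. ?d t)"
      using eventually_ge_at_top[of T]
    proof eventually_elim
      case (elim Y)
      have "(?d has_integral (?g Y - ?g T)) {T..Y}"
      proof (rule fundamental_theorem_of_calculus[OF elim])
        fix t assume "t \<in> {T..Y}"
        hence "t > 0" using T by simp
        thus "(?g has_vector_derivative ?d t) (at t within {T..Y})" by (rule integrand_derivative)
      qed
      hence "integral {T..Y} ?d = ?g Y - ?g T" by (rule integral_unique)
      moreover have "(LINT t:{T..Y}|lborel. ?d t) = integral {T..Y} ?d"
        by (rule set_borel_integral_eq_integral(2), rule set_integrable_subset[OF id]) auto
      ultimately show ?case by simp
    qed
  qed
  ultimately have "\<i> * (\<beta> * J (y l) (\<beta> - 1) - y l * J (y l) \<beta>) = 0 - ?g T"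
    unfolding v using tendsto_unique trivial_limit_at_top_linorder by blast
  hence "\<i> * (y l * J (y l) \<beta>) = ?g T + \<i> * (\<beta> * J (y l) (\<beta> - 1))" by (simp add: algebra_simps)
  from arg_cong[OF this, of "\<lambda>x. x / \<i>"] show ?thesis by (simp only: add_divide_distrib nonzero_mult_div_cancel_left[OF complex_i_not_zero])
qed

text \<open>This is the source of the poles: without oscillation the integral is elementary, and its
  denominator beta + 1 is what vanishes on a polar hyperplane. Absolute convergence is all that the
  later comparison with the twist requires.\<close>

lemma J_zero_value:
  assumes \<beta>: "Re \<beta> \<le> -2"
  shows "J 0 \<beta> = - (line_pt T powr (\<beta> + 1)) / (\<i> * (\<beta> + 1))"
proof -
  have b1: "\<beta> + 1 \<noteq> 0" using \<beta> by (auto simp: complex_eq_iff)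
  let ?g = "\<lambda>t. line_pt t powr (\<beta> + 1) / (\<i> * (\<beta> + 1))"
  let ?h = "\<lambda>t. line_pt t powr \<beta>"
  have ih: "set_integrable lborel {T..} ?h" using integrand_integrable_2[OF \<beta>, of 0 0] by simp
  have "((\<lambda>Y. LINT t:{T..Y}|lborel. ?h t) \<longlongrightarrow> (LINT t:{T..}|lborel. ?h t)) at_top"
    by (rule tendsto_set_integral_exhaustion[OF ih]) (auto intro: eventually_ge_at_top)
  moreover have "((\<lambda>Y. LINT t:{T..Y}|lborel. ?h t) \<longlongrightarrow> 0 - ?g T) at_top"
  proof (rule Lim_transform_eventually)
    have "norm (?g t) \<le> exp (pi * \<bar>Im \<beta>\<bar>) / norm (\<i> * (\<beta> + 1)) * (1 / t)" if t: "t \<ge> T" for t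
    proof -
      have t1: "t \<ge> 1" using t T by simp
      have n1: "norm (line_pt t) \<ge> t" using norm_line_pt_ge[of t] t1 by simp
      have "norm (line_pt t) powr Re (\<beta> + 1) \<le> norm (line_pt t) powr (-1)" using n1 t1 \<beta> by (intro powr_mono) auto
      also have "\<dots> \<le> t powr (-1)" using n1 t1 by (intro powr_mono2') auto
      also have "\<dots> = 1 / t" using t1 by (simp add: powr_minus_divide)
      finally have "norm (line_pt t powr (\<beta> + 1)) \<le> (1 / t) * exp (pi * \<bar>Im (\<beta> + 1)\<bar>)"
        by (intro order_trans[OF norm_powr_upper_le[OF line_pt_nz]] mult_right_mono) auto
      hence "norm (?g t) \<le> (1 / t) * exp (pi * \<bar>Im (\<beta> + 1)\<bar>) / norm (\<i> * (\<beta> + 1))"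
        unfolding norm_divide by (rule divide_right_mono) auto
      thus ?thesis by (simp add: mult_ac)
    qed
    moreover have "((\<lambda>t. exp (pi * \<bar>Im \<beta>\<bar>) / norm (\<i> * (\<beta> + 1)) * (1 / t)) \<longlongrightarrow> 0) at_top"
      by (intro tendsto_mult_right_zero) real_asymp
    ultimately have "(?g \<longlongrightarrow> 0) at_top"
      by (intro Lim_null_comparison[of ?g _ at_top]) (auto intro: eventually_mono[OF eventually_ge_at_top[of T]])
    thus "((\<lambda>Y. ?g Y - ?g T) \<longlongrightarrow> 0 - ?g T) at_top" by (intro tendsto_diff tendsto_const)
    show "\<forall>\<^sub>F Y in at_top. ?g Y - ?g T = (LINT t:{T..Y}|lborel. ?h t)"
      using eventually_ge_at_top[of T]
    proof eventually_elim
      case (elim Y)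
      have "(?h has_integral (?g Y - ?g T)) {T..Y}"
      proof (rule fundamental_theorem_of_calculus[OF elim])
        fix t assume "t \<in> {T..Y}"
        hence "t > 0" using T by simp
        from integrand_derivative[OF this, of 0 "\<beta> + 1" "{T..Y}"]
        have "((\<lambda>t. line_pt t powr (\<beta> + 1)) has_vector_derivative \<i> * ((\<beta> + 1) * line_pt t powr \<beta>)) (at t within {T..Y})" by simp
        from has_vector_derivative_divide[OF this, of "\<i> * (\<beta> + 1)"]
        show "(?g has_vector_derivative ?h t) (at t within {T..Y})" using b1 by simp
      qed
      hence "integral {T..Y} ?h = ?g Y - ?g T" by (rule integral_unique)
      moreover have "(LINT t:{T..Y}|lborel. ?h t) = integral {T..Y} ?h"
        by (rule set_borel_integral_eq_integral(2), rule set_integrable_subset[OF ih]) auto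
      ultimately show ?case by simp
    qed
  qed
  ultimately have "(LINT t:{T..}|lborel. ?h t) = 0 - ?g T"
    using tendsto_unique trivial_limit_at_top_linorder by blast
  thus ?thesis by (simp add: J_def)
qed

lemma J_tendsto_2:
  assumes \<beta>: "Re \<beta> \<le> -2"
  shows "((\<lambda>\<epsilon>. J (of_real l - \<i> * of_real \<epsilon>) \<beta>) \<longlongrightarrow> J (of_real l) \<beta>) (at_right 0)"
  unfolding tendsto_at_iff_sequentially o_def
proof (intro allI impI)
  fix X :: "nat \<Rightarrow> real" assume X: "\<forall>i. X i \<in> {0<..} - {0}" "X \<longlonglongrightarrow> 0"
  let ?f = "\<lambda>\<epsilon> t. indicat_real {T..} t *\<^sub>R (exp (- (of_real l - \<i> * of_real \<epsilon>) * line_pt t) * line_pt t powr \<beta>)"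
  have m: "?f \<epsilon> \<in> borel_measurable lborel" if "\<epsilon> \<ge> 0" for \<epsilon>
    using integrand_integrable_2[OF \<beta> that, of l] unfolding set_integrable_def by (rule borel_measurable_integrable)
  have "(\<lambda>n. LINT t|lborel. ?f (X n) t) \<longlonglongrightarrow> (LINT t|lborel. ?f 0 t)"
  proof (rule integral_dominated_convergence[where w = "\<lambda>t. indicat_real {T..} t *\<^sub>R (exp (l * c) * exp (pi * \<bar>Im \<beta>\<bar>) * (1 / t ^ 2))"])
    show "?f 0 \<in> borel_measurable lborel" by (rule m) simp
    show "?f (X n) \<in> borel_measurable lborel" for n using X(1) by (intro m) (auto simp: less_imp_le)
    show "integrable lborel (\<lambda>t. indicat_real {T..} t *\<^sub>R (exp (l * c) * exp (pi * \<bar>Im \<beta>\<bar>) * (1 / t ^ 2)))"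
      using set_integrable_inv_sq unfolding set_integrable_def .
    show "AE t in lborel. (\<lambda>n. ?f (X n) t) \<longlonglongrightarrow> ?f 0 t"
      by (intro AE_I2 tendsto_intros X(2))
    show "AE t in lborel. norm (?f (X n) t) \<le> indicat_real {T..} t *\<^sub>R (exp (l * c) * exp (pi * \<bar>Im \<beta>\<bar>) * (1 / t ^ 2))" for n
    proof (rule AE_I2)
      fix t :: real
      have "X n \<ge> 0" using X(1) by (auto simp: less_imp_le)
      thus "norm (?f (X n) t) \<le> indicat_real {T..} t *\<^sub>R (exp (l * c) * exp (pi * \<bar>Im \<beta>\<bar>) * (1 / t ^ 2))"
        using integrand_bound_2[OF \<beta>, of "X n" t l] by (simp add: indicator_def)
    qed
  qed
  thus "(\<lambda>n. J (of_real l - \<i> * of_real (X n)) \<beta>) \<longlonglongrightarrow> J (of_real l) \<beta>"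
    unfolding J_def set_lebesgue_integral_def by simp
qed

text \<open>Induction on the number of partial integrations: each one widens the half-plane Re beta
  < n - 2 by a unit and divides by l, which is harmless for |l| >= delta. The step uses the
  induction hypothesis for rho + 1 because it passes from beta to beta - 1. The factor exp(l c) is
  the size of exp(-l w) on Re w = -c; apart from it the constant is independent of l, so that the
  limits can be summed over all frequencies.\<close>

lemma J_limit:
  assumes \<delta>: "\<delta> > 0"
  shows "\<exists>Jt C. C \<ge> 0 \<and> (\<forall>l \<beta>. \<bar>l\<bar> \<ge> \<delta> \<longrightarrow> norm \<beta> < \<rho> \<longrightarrow> Re \<beta> < real n - 2 \<longrightarrow>
     ((\<lambda>\<epsilon>. J (of_real l - \<i> * of_real \<epsilon>) \<beta>) \<longlongrightarrow> Jt l \<beta>) (at_right 0) \<and> norm (Jt l \<beta>) \<le> C * exp (l * c) \<and>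
     (\<forall>\<epsilon>. 0 < \<epsilon> \<longrightarrow> \<epsilon> \<le> 1 \<longrightarrow> norm (J (of_real l - \<i> * of_real \<epsilon>) \<beta>) \<le> C * exp (l * c))) \<and>
     (\<forall>l. \<bar>l\<bar> \<ge> \<delta> \<longrightarrow> Jt l holomorphic_on {\<beta>. norm \<beta> < \<rho> \<and> Re \<beta> < real n - 2})"
proof (induction n arbitrary: \<rho>)
  case 0
  define S where "S = (LINT t:{T..}|lborel. 1 / t ^ 2)"
  define C where "C = exp (pi * \<bar>\<rho>\<bar>) * \<bar>S\<bar>"
  have sq: "set_integrable lborel {T..} (\<lambda>t. K * (1 / t ^ 2))" for K by (rule set_integrable_inv_sq)
  have bound: "norm (exp (- (of_real l - \<i> * of_real \<epsilon>) * line_pt t) * line_pt t powr \<beta>) \<le> exp (l * c) * exp (pi * \<bar>\<rho>\<bar>) * (1 / t ^ 2)"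
    if "norm \<beta> < \<rho>" "Re \<beta> \<le> -2" "\<epsilon> \<ge> 0" "t \<ge> T" for l \<epsilon> t \<beta>
  proof -
    have "\<bar>Im \<beta>\<bar> \<le> \<bar>\<rho>\<bar>" using abs_Im_le_cmod[of \<beta>] that by linarith
    hence "exp (pi * \<bar>Im \<beta>\<bar>) \<le> exp (pi * \<bar>\<rho>\<bar>)" by simp
    hence "exp (l * c) * exp (pi * \<bar>Im \<beta>\<bar>) * (1 / t ^ 2) \<le> exp (l * c) * exp (pi * \<bar>\<rho>\<bar>) * (1 / t ^ 2)"
      by (intro mult_right_mono mult_left_mono) auto
    thus ?thesis using integrand_bound_2[OF that(2-4), of l] by linarith
  qed
  have Jb: "norm (J (of_real l - \<i> * of_real \<epsilon>) \<beta>) \<le> C * exp (l * c)"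
    if "norm \<beta> < \<rho>" "Re \<beta> \<le> -2" "\<epsilon> \<ge> 0" for l \<epsilon> \<beta>
  proof -
    have "norm (J (of_real l - \<i> * of_real \<epsilon>) \<beta>) \<le> (LINT t:{T..}|lborel. norm (exp (- (of_real l - \<i> * of_real \<epsilon>) * line_pt t) * line_pt t powr \<beta>))"
      unfolding J_def by (rule set_integral_norm_bound[OF integrand_integrable_2[OF that(2,3)]])
    also have "\<dots> \<le> (LINT t:{T..}|lborel. exp (l * c) * exp (pi * \<bar>\<rho>\<bar>) * (1 / t ^ 2))"
      using bound[OF that] by (intro set_integral_mono sq set_integrable_norm integrand_integrable_2 that) auto
    also have "\<dots> = exp (l * c) * exp (pi * \<bar>\<rho>\<bar>) * S" unfolding S_def by (rule set_integral_mult_right)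
    also have "\<dots> \<le> exp (l * c) * exp (pi * \<bar>\<rho>\<bar>) * \<bar>S\<bar>" by (intro mult_left_mono) auto
    finally show ?thesis by (simp add: C_def mult_ac)
  qed
  have hol: "J (of_real l) holomorphic_on {\<beta>. norm \<beta> < \<rho> \<and> Re \<beta> < -2}" for l
  proof -
    have "(\<lambda>\<beta>. LINT t|lborel. indicat_real {T..} t *\<^sub>R (exp (- (of_real l - \<i> * of_real 0) * line_pt t) * line_pt t powr \<beta>)) holomorphic_on {\<beta>. norm \<beta> < \<rho> \<and> Re \<beta> < -2}"
    proof (rule holomorphic_on_integral_dominated)
      show "open {\<beta>. norm \<beta> < \<rho> \<and> Re \<beta> < -2}"
        by (intro open_Collect_conj open_Collect_less continuous_intros)
      show "(\<lambda>\<beta>. indicat_real {T..} t *\<^sub>R (exp (- (of_real l - \<i> * of_real 0) * line_pt t) * line_pt t powr \<beta>)) holomorphic_on {\<beta>. norm \<beta> < \<rho> \<and> Re \<beta> < -2}" for t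
        unfolding scaleR_conv_of_real using line_pt_nz[of t] by (intro holomorphic_intros)
      show "(\<lambda>t. indicat_real {T..} t *\<^sub>R (exp (- (of_real l - \<i> * of_real 0) * line_pt t) * line_pt t powr \<beta>)) \<in> borel_measurable lborel"
        if "\<beta> \<in> {\<beta>. norm \<beta> < \<rho> \<and> Re \<beta> < -2}" for \<beta>
        using integrand_integrable_2[of \<beta> 0 l] that unfolding set_integrable_def by (intro borel_measurable_integrable) auto
      show "integrable lborel (\<lambda>t. indicat_real {T..} t *\<^sub>R (exp (l * c) * exp (pi * \<bar>\<rho>\<bar>) * (1 / t ^ 2)))"
        using sq unfolding set_integrable_def .
      show "norm (indicat_real {T..} t *\<^sub>R (exp (- (of_real l - \<i> * of_real 0) * line_pt t) * line_pt t powr \<beta>)) \<le> indicat_real {T..} t *\<^sub>R (exp (l * c) * exp (pi * \<bar>\<rho>\<bar>) * (1 / t ^ 2))"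
        if "\<beta> \<in> {\<beta>. norm \<beta> < \<rho> \<and> Re \<beta> < -2}" for \<beta> t
        using bound[of \<beta> 0 t l] that by (cases "t \<ge> T") auto
    qed
    thus ?thesis unfolding J_def[abs_def] set_lebesgue_integral_def by simp
  qed
  show ?case
    using J_tendsto_2 Jb Jb[of _ 0] hol
    by (intro exI[of _ "\<lambda>l. J (of_real l)"] exI[of _ C]) (auto simp: C_def)
next
  case (Suc n)
  obtain Jt C where C0: "C \<ge> 0" and lim: "\<And>l \<beta>. \<bar>l\<bar> \<ge> \<delta> \<Longrightarrow> norm \<beta> < \<rho> + 1 \<Longrightarrow> Re \<beta> < real n - 2 \<Longrightarrow>
     ((\<lambda>\<epsilon>. J (of_real l - \<i> * of_real \<epsilon>) \<beta>) \<longlongrightarrow> Jt l \<beta>) (at_right 0)"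
   and Jtb: "\<And>l \<beta>. \<bar>l\<bar> \<ge> \<delta> \<Longrightarrow> norm \<beta> < \<rho> + 1 \<Longrightarrow> Re \<beta> < real n - 2 \<Longrightarrow> norm (Jt l \<beta>) \<le> C * exp (l * c)"
   and Jb: "\<And>l \<beta> \<epsilon>. \<bar>l\<bar> \<ge> \<delta> \<Longrightarrow> norm \<beta> < \<rho> + 1 \<Longrightarrow> Re \<beta> < real n - 2 \<Longrightarrow>
     0 < \<epsilon> \<Longrightarrow> \<epsilon> \<le> 1 \<Longrightarrow> norm (J (of_real l - \<i> * of_real \<epsilon>) \<beta>) \<le> C * exp (l * c)"
   and hol: "\<And>l. \<bar>l\<bar> \<ge> \<delta> \<Longrightarrow> Jt l holomorphic_on {\<beta>. norm \<beta> < \<rho> + 1 \<and> Re \<beta> < real n - 2}"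
    using Suc.IH[of "\<rho> + 1"] by blast
  define w0 where "w0 = line_pt T"
  define J' where "J' l \<beta> = (exp (- of_real l * w0) * w0 powr \<beta> / \<i> + \<beta> * Jt l (\<beta> - 1)) / of_real l" for l \<beta>
  define W where "W = (norm w0 powr \<bar>\<rho>\<bar> + 1) * exp (pi * \<bar>\<rho>\<bar>)"
  define C' where "C' = (W + \<bar>\<rho>\<bar> * C) / \<delta>"
  have w0: "w0 \<noteq> 0" by (simp add: w0_def line_pt_nz)
  have n0: "norm w0 \<ge> 1" using norm_line_pt_ge[of T] T by (simp add: w0_def)
  have sh: "norm (\<beta> - 1) < \<rho> + 1" "Re (\<beta> - 1) < real n - 2" if "norm \<beta> < \<rho>" "Re \<beta> < real (Suc n) - 2" for \<beta>
    using that norm_triangle_ineq4[of \<beta> 1] by auto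
  have Wb: "norm (w0 powr \<beta>) \<le> W" if "norm \<beta> < \<rho>" for \<beta>
  proof -
    have b: "Re \<beta> \<le> \<bar>\<rho>\<bar>" "\<bar>Im \<beta>\<bar> \<le> \<bar>\<rho>\<bar>" using that abs_Re_le_cmod[of \<beta>] abs_Im_le_cmod[of \<beta>] by linarith+
    have "norm (w0 powr \<beta>) \<le> norm w0 powr Re \<beta> * exp (pi * \<bar>Im \<beta>\<bar>)" by (rule norm_powr_upper_le[OF w0])
    also have "\<dots> \<le> norm w0 powr \<bar>\<rho>\<bar> * exp (pi * \<bar>\<rho>\<bar>)"
      using b n0 by (intro mult_mono powr_mono) auto
    also have "\<dots> \<le> W" unfolding W_def by (intro mult_right_mono) auto
    finally show ?thesis .
  qed
  have parts: "J (of_real l - \<i> * of_real \<epsilon>) \<beta> = (exp (- (of_real l - \<i> * of_real \<epsilon>) * w0) * w0 powr \<beta> / \<i> + \<beta> * J (of_real l - \<i> * of_real \<epsilon>) (\<beta> - 1)) / (of_real l - \<i> * of_real \<epsilon>)"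
    if "\<bar>l\<bar> \<ge> \<delta>" "\<epsilon> > 0" for l \<epsilon> \<beta>
  proof -
    have "of_real l - \<i> * of_real \<epsilon> \<noteq> 0" using that \<delta> by (auto simp: complex_eq_iff)
    thus ?thesis using J_by_parts[OF that(2), of l \<beta>] unfolding w0_def by (simp add: nonzero_eq_divide_eq mult.commute)
  qed
  have frac: "norm ((A + B) / y) \<le> C' * E"
    if "norm A \<le> W * E" "norm B \<le> \<bar>\<rho>\<bar> * C * E" "norm y \<ge> \<delta>" "E \<ge> 0" for A B y :: complex and E :: real
  proof -
    have "norm (A + B) \<le> (W + \<bar>\<rho>\<bar> * C) * E" using that norm_triangle_ineq[of A B] by (simp add: algebra_simps)
    moreover have "0 \<le> (W + \<bar>\<rho>\<bar> * C) * E" using that(4) C0 by (simp add: W_def)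
    ultimately have "norm (A + B) / norm y \<le> (W + \<bar>\<rho>\<bar> * C) * E / \<delta>" using that(3) \<delta> by (intro frac_le) auto
    thus ?thesis by (simp add: norm_divide C'_def)
  qed
  have prodb: "norm (\<beta> * z) \<le> \<bar>\<rho>\<bar> * C * E" if "norm \<beta> < \<rho>" "norm z \<le> C * E" for \<beta> z :: complex and E
  proof -
    have "norm (\<beta> * z) \<le> \<bar>\<rho>\<bar> * (C * E)" unfolding norm_mult using that by (intro mult_mono) auto
    thus ?thesis by (simp add: mult_ac)
  qed
  have expb: "norm (exp (- (of_real l - \<i> * of_real \<epsilon>) * w0) * w0 powr \<beta> / \<i>) \<le> W * exp (l * c)" if "norm \<beta> < \<rho>" "\<epsilon> \<ge> 0" for l \<epsilon> \<beta>
  proof -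
    have "norm (exp (- (of_real l - \<i> * of_real \<epsilon>) * w0)) = exp (l * c - \<epsilon> * T)" unfolding w0_def by (rule norm_exp_line_pt)
    also have "\<dots> \<le> exp (l * c)" using that T by simp
    finally have "norm (exp (- (of_real l - \<i> * of_real \<epsilon>) * w0)) * norm (w0 powr \<beta>) \<le> exp (l * c) * W"
      using Wb[OF that(1)] by (intro mult_mono) auto
    thus ?thesis by (simp add: norm_mult norm_divide mult.commute)
  qed
  show ?case
  proof (rule exI[of _ J'], rule exI[of _ C'], intro conjI allI impI)
    show "0 \<le> C'" using \<delta> C0 by (simp add: C'_def W_def)
    fix l \<beta> assume l: "\<bar>l\<bar> \<ge> \<delta>" and \<beta>: "norm \<beta> < \<rho>" "Re \<beta> < real (Suc n) - 2"
    have l0: "l \<noteq> 0" using l \<delta> by auto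
    have "((\<lambda>\<epsilon>. (exp (- (of_real l - \<i> * of_real \<epsilon>) * w0) * w0 powr \<beta> / \<i> + \<beta> * J (of_real l - \<i> * of_real \<epsilon>) (\<beta> - 1)) / (of_real l - \<i> * of_real \<epsilon>))
       \<longlongrightarrow> (exp (- (of_real l - \<i> * of_real 0) * w0) * w0 powr \<beta> / \<i> + \<beta> * Jt l (\<beta> - 1)) / (of_real l - \<i> * of_real 0)) (at_right 0)"
      by (intro tendsto_intros lim l sh \<beta>) (use l0 in auto)
    hence "((\<lambda>\<epsilon>. (exp (- (of_real l - \<i> * of_real \<epsilon>) * w0) * w0 powr \<beta> / \<i> + \<beta> * J (of_real l - \<i> * of_real \<epsilon>) (\<beta> - 1)) / (of_real l - \<i> * of_real \<epsilon>))
       \<longlongrightarrow> J' l \<beta>) (at_right 0)" by (simp add: J'_def)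
    thus "((\<lambda>\<epsilon>. J (of_real l - \<i> * of_real \<epsilon>) \<beta>) \<longlongrightarrow> J' l \<beta>) (at_right 0)"
      by (rule Lim_transform_eventually) (rule eventually_mono[OF eventually_at_right_less[of 0]], rule parts[OF l, symmetric])
    show "norm (J' l \<beta>) \<le> C' * exp (l * c)" unfolding J'_def
      using expb[OF \<beta>(1), of 0 l] by (intro frac prodb \<beta> Jtb l sh) (use l in auto)
    fix \<epsilon> :: real assume \<epsilon>: "0 < \<epsilon>" "\<epsilon> \<le> 1"
    have ny: "norm (of_real l - \<i> * of_real \<epsilon>) \<ge> \<delta>" using l abs_Re_le_cmod[of "of_real l - \<i> * of_real \<epsilon>"] by simp
    show "norm (J (of_real l - \<i> * of_real \<epsilon>) \<beta>) \<le> C' * exp (l * c)"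
      unfolding parts[OF l \<epsilon>(1), of \<beta>]
    proof (rule frac[OF _ _ ny])
      show "norm (exp (- (of_real l - \<i> * of_real \<epsilon>) * w0) * w0 powr \<beta> / \<i>) \<le> W * exp (l * c)"
        by (rule expb[OF \<beta>(1)]) (use \<epsilon> in simp)
      show "norm (\<beta> * J (of_real l - \<i> * of_real \<epsilon>) (\<beta> - 1)) \<le> \<bar>\<rho>\<bar> * C * exp (l * c)"
        by (rule prodb[OF \<beta>(1) Jb[OF l sh[OF \<beta>] \<epsilon>]])
    qed simp
  next
    fix l :: real assume l: "\<bar>l\<bar> \<ge> \<delta>"
    hence l0: "l \<noteq> 0" using \<delta> by auto
    have "(\<lambda>\<beta>. Jt l (\<beta> - 1)) holomorphic_on {\<beta>. norm \<beta> < \<rho> \<and> Re \<beta> < real (Suc n) - 2}"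
    proof -
      have 1: "(\<lambda>\<beta>. \<beta> - 1) holomorphic_on {\<beta>. norm \<beta> < \<rho> \<and> Re \<beta> < real (Suc n) - 2}" by (intro holomorphic_intros)
      have 2: "(\<lambda>\<beta>. \<beta> - 1) ` {\<beta>. norm \<beta> < \<rho> \<and> Re \<beta> < real (Suc n) - 2} \<subseteq> {\<beta>. norm \<beta> < \<rho> + 1 \<and> Re \<beta> < real n - 2}"
        using sh by fast
      show ?thesis using holomorphic_on_compose_gen[OF 1 hol[OF l] 2] by (simp only: o_def)
    qed
    thus "J' l holomorphic_on {\<beta>. norm \<beta> < \<rho> \<and> Re \<beta> < real (Suc n) - 2}"
      unfolding J'_def[abs_def] using l0 w0 by (intro holomorphic_intros) auto
  qed
qed

end

section \<open>Growth in the extended Selberg class\<close>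

text \<open>Division by the Gamma factors is multiplication by \<open>rGamma\<close>. The two
  arguments belonging to one index have opposite imaginary parts, so one condition per index keeps
  both off the real axis and away from the poles.\<close>

lemma selberg_functional_equation:
  assumes sel: "selberg_sharp a Fc Q lam mu om"
    and s: "Im s \<noteq> 0" "\<And>j. j < length lam \<Longrightarrow> lam ! j * Im s + Im (mu ! j) \<noteq> 0"
  shows "Fc s = om * exp ((1 - 2 * s) * of_real (ln Q)) *
     (\<Prod>j<length lam. Gamma (of_real (lam ! j) * (1 - s) + cnj (mu ! j)) * rGamma (of_real (lam ! j) * s + mu ! j)) * cnj (Fc (cnj (1 - s)))"
proof -
  have Q: "Q > 0" using sel by (simp add: selberg_sharp_def)
  have np: "z \<notin> \<int>\<^sub>\<le>\<^sub>0" if "Im z \<noteq> 0" for z using that by (auto elim!: nonpos_Ints_cases)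
  have n1: "of_real (lam ! j) * s + mu ! j \<notin> \<int>\<^sub>\<le>\<^sub>0" if "j < length lam" for j
    by (rule np) (use s(2)[OF that] in simp)
  have n2: "of_real (lam ! j) * (1 - s) + cnj (mu ! j) \<notin> \<int>\<^sub>\<le>\<^sub>0" if "j < length lam" for j
    by (rule np) (use s(2)[OF that] in \<open>simp add: algebra_simps\<close>)
  have "s \<notin> {0, 1}" using s by auto
  hence FE: "of_real Q powr s * (\<Prod>j<length lam. Gamma (of_real (lam ! j) * s + mu ! j)) * Fc s
          = om * of_real Q powr (1 - s) *
            (\<Prod>j<length lam. Gamma (of_real (lam ! j) * (1 - s) + cnj (mu ! j))) * cnj (Fc (cnj (1 - s)))"
    using sel n1 n2 unfolding selberg_sharp_def by blast
  let ?G = "\<Prod>j<length lam. Gamma (of_real (lam ! j) * s + mu ! j)"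
  let ?rG = "\<Prod>j<length lam. rGamma (of_real (lam ! j) * s + mu ! j)"
  let ?q = "exp (- s * of_real (ln Q))"
  have GrG: "?G * ?rG = 1"
    unfolding prod.distrib[symmetric]
    by (rule prod.neutral) (use n1 in \<open>auto simp: rGamma_inverse_Gamma Gamma_eq_zero_iff\<close>)
  have Qs: "of_real Q powr s = exp (s * of_real (ln Q))" "of_real Q powr (1 - s) = exp ((1 - s) * of_real (ln Q))"
    using Q by (simp_all add: powr_def Ln_of_real)
  have qq: "of_real Q powr s * ?q = 1" unfolding Qs by (simp flip: exp_add)
  have q2: "of_real Q powr (1 - s) * ?q = exp ((1 - 2 * s) * of_real (ln Q))"
    unfolding Qs by (simp flip: exp_add add: algebra_simps)
  have "Fc s = (of_real Q powr s * ?q) * (?G * ?rG) * Fc s" unfolding qq GrG by simp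
  also have "\<dots> = (of_real Q powr s * ?G * Fc s) * ?q * ?rG" by (simp add: mult_ac)
  also have "\<dots> = om * (of_real Q powr (1 - s) * ?q) * ((\<Prod>j<length lam. Gamma (of_real (lam ! j) * (1 - s) + cnj (mu ! j))) * ?rG) * cnj (Fc (cnj (1 - s)))"
    unfolding FE by (simp add: mult_ac)
  finally show ?thesis unfolding q2 prod.distrib .
qed

lemma selberg_growth:
  assumes sel: "selberg_sharp a Fc Q lam mu om"
  shows "\<exists>A p. A > 0 \<and> p > 0 \<and> (\<forall>s. \<bar>Im s\<bar> \<ge> 1 \<longrightarrow> norm (Fc s) \<le> exp (A * (1 + norm s) powr p))"
proof -
  obtain m :: nat and g A0 c0 where g: "\<And>s. s \<noteq> 1 \<Longrightarrow> g s = (s - 1) ^ m * Fc s"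
    and gb: "\<And>s. norm (g s) \<le> A0 * exp (norm s powr c0)"
    using sel unfolding selberg_sharp_def by blast
  define p where "p = max c0 1"
  have "norm (Fc s) \<le> exp ((\<bar>A0\<bar> + 1) * (1 + norm s) powr p)" if s: "\<bar>Im s\<bar> \<ge> 1" for s
  proof -
    have "s \<noteq> 1" using s by auto
    have s1: "norm (s - 1) \<ge> 1" using abs_Im_le_cmod[of "s - 1"] s by simp
    have ns: "norm s \<ge> 1" using abs_Im_le_cmod[of s] s by simp
    have "norm (Fc s) \<le> norm (s - 1) ^ m * norm (Fc s)" using s1 by (simp add: mult_ge1_I mult_le_cancel_right1)
    also have "\<dots> = norm (g s)" using g[OF \<open>s \<noteq> 1\<close>] by (simp add: norm_mult norm_power)
    also have "\<dots> \<le> A0 * exp (norm s powr c0)" by (rule gb)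
    also have "\<dots> \<le> exp \<bar>A0\<bar> * exp (norm s powr c0)"
    proof (rule mult_right_mono)
      show "A0 \<le> exp \<bar>A0\<bar>" using exp_ge_add_one_self[of "\<bar>A0\<bar>"] by linarith
    qed simp
    also have "\<dots> = exp (\<bar>A0\<bar> + norm s powr c0)" by (simp add: exp_add)
    also have "\<dots> \<le> exp ((\<bar>A0\<bar> + 1) * (1 + norm s) powr p)"
    proof -
      have "norm s powr c0 \<le> norm s powr p" using ns by (intro powr_mono) (auto simp: p_def)
      also have "\<dots> \<le> (1 + norm s) powr p" by (intro powr_mono2) (auto simp: p_def)
      finally have 1: "norm s powr c0 \<le> (1 + norm s) powr p" .
      have "1 \<le> (1 + norm s) powr p" using ns by (intro ge_one_powr_ge_zero) (auto simp: p_def)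
      hence "\<bar>A0\<bar> * 1 \<le> \<bar>A0\<bar> * (1 + norm s) powr p" by (intro mult_left_mono) auto
      thus ?thesis using 1 by (simp add: algebra_simps)
    qed
    finally show ?thesis .
  qed
  thus ?thesis by (intro exI[of _ "\<bar>A0\<bar> + 1"] exI[of _ p]) (auto simp: p_def)
qed

lemma selberg_right_bound:
  assumes sel: "selberg_sharp a Fc Q lam mu om" and \<sigma>: "\<sigma> > 1"
  shows "\<exists>C\<ge>0. \<forall>s. Re s \<ge> \<sigma> \<longrightarrow> norm (Fc s) \<le> C"
proof -
  define C where "C = (LINT n|count_space {1..}. norm (a n / of_nat n powr of_real \<sigma>))"
  have "norm (Fc s) \<le> C" if s: "Re s \<ge> \<sigma>" for s
  proof -
    have s1: "Re s > 1" "Re (of_real \<sigma>) > 1" using s \<sigma> by auto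
    have "norm (Fc s) \<le> (LINT n|count_space {1..}. norm (a n / of_nat n powr s))"
      unfolding selberg_series(2)[OF sel s1(1), symmetric] by (rule integral_norm_bound)
    also have "\<dots> \<le> C" unfolding C_def
    proof (rule integral_mono)
      show "integrable (count_space {1..}) (\<lambda>n. norm (a n / of_nat n powr s))"
        by (rule integrable_norm[OF selberg_series(1)[OF sel s1(1)]])
      show "integrable (count_space {1..}) (\<lambda>n. norm (a n / of_nat n powr of_real \<sigma>))"
        by (rule integrable_norm[OF selberg_series(1)[OF sel s1(2)]])
      fix n assume "n \<in> space (count_space {1::nat..})"
      hence n: "n \<ge> 1" by simp
      have "real n powr \<sigma> \<le> real n powr Re s" using n s by (intro powr_mono) auto
      thus "norm (a n / of_nat n powr s) \<le> norm (a n / of_nat n powr of_real \<sigma>)"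
        unfolding norm_divide norm_of_nat_powr using n by (intro divide_left_mono) auto
    qed
    finally show ?thesis .
  qed
  moreover have "C \<ge> 0" unfolding C_def by (rule Bochner_Integration.integral_nonneg) simp
  ultimately show ?thesis by blast
qed

text \<open>The bound is uniform in the parameter, and the exponent is left unspecified: any power
  is absorbed by a small exponential afterwards. The type \<open>unit\<close> serves as parameter
  when there is none.\<close>

definition poly_bounded :: "'p set \<Rightarrow> complex set \<Rightarrow> ('p \<Rightarrow> complex \<Rightarrow> complex) \<Rightarrow> bool" where
  "poly_bounded D W f \<longleftrightarrow> (\<exists>C q T. C \<ge> 0 \<and> q \<ge> 0 \<and> T \<ge> 1 \<and>
     (\<forall>s\<in>D. \<forall>w\<in>W. \<bar>Im w\<bar> \<ge> T \<longrightarrow> norm (f s w) \<le> C * \<bar>Im w\<bar> powr q))"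

lemma poly_bounded_const_bound:
  assumes "\<And>s w. s \<in> D \<Longrightarrow> w \<in> W \<Longrightarrow> \<bar>Im w\<bar> \<ge> T \<Longrightarrow> norm (f s w) \<le> C"
  shows "poly_bounded D W f"
  unfolding poly_bounded_def
  by (rule exI[of _ "max C 0"], rule exI[of _ 0], rule exI[of _ "max T 1"]) (use assms in \<open>fastforce intro: order_trans\<close>)

lemma poly_bounded_subset: "poly_bounded D W' f \<Longrightarrow> W \<subseteq> W' \<Longrightarrow> poly_bounded D W f"
  unfolding poly_bounded_def by (meson subsetD)

lemma poly_bounded_mult:
  assumes "poly_bounded D W f" "poly_bounded D W g"
  shows "poly_bounded D W (\<lambda>s w. f s w * g s w)"
proof -
  obtain C q T where f: "C \<ge> 0" "q \<ge> 0" "T \<ge> 1" "\<And>s w. s \<in> D \<Longrightarrow> w \<in> W \<Longrightarrow> \<bar>Im w\<bar> \<ge> T \<Longrightarrow> norm (f s w) \<le> C * \<bar>Im w\<bar> powr q"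
    using assms(1) unfolding poly_bounded_def by blast
  obtain C' q' T' where g: "C' \<ge> 0" "q' \<ge> 0" "T' \<ge> 1" "\<And>s w. s \<in> D \<Longrightarrow> w \<in> W \<Longrightarrow> \<bar>Im w\<bar> \<ge> T' \<Longrightarrow> norm (g s w) \<le> C' * \<bar>Im w\<bar> powr q'"
    using assms(2) unfolding poly_bounded_def by blast
  have "norm (f s w * g s w) \<le> (C * C') * \<bar>Im w\<bar> powr (q + q')" if "s \<in> D" "w \<in> W" "\<bar>Im w\<bar> \<ge> max T T'" for s w
  proof -
    have "norm (f s w) * norm (g s w) \<le> (C * \<bar>Im w\<bar> powr q) * (C' * \<bar>Im w\<bar> powr q')"
      using f g that by (intro mult_mono) auto
    thus ?thesis by (simp add: norm_mult powr_add mult_ac)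
  qed
  moreover have "C * C' \<ge> 0" "q + q' \<ge> 0" "max T T' \<ge> 1" using f g by auto
  ultimately show ?thesis unfolding poly_bounded_def by blast
qed

lemma poly_bounded_prod:
  "finite I \<Longrightarrow> (\<And>i. i \<in> I \<Longrightarrow> poly_bounded D W (f i)) \<Longrightarrow> poly_bounded D W (\<lambda>s w. \<Prod>i\<in>I. f i s w)"
proof (induction I rule: finite_induct)
  case empty
  show ?case by (rule poly_bounded_const_bound[of _ _ 0 _ 1]) auto
next
  case (insert i I)
  thus ?case by (auto intro: poly_bounded_mult)
qed

lemma poly_bounded_subst:
  assumes f: "poly_bounded UNIV W' (\<lambda>_::unit. f)" and k: "k > 0" and R: "R \<ge> 0"
    and \<beta>: "\<And>s. s \<in> D \<Longrightarrow> norm (\<beta> s) \<le> R"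
    and W: "\<And>s w. s \<in> D \<Longrightarrow> w \<in> W \<Longrightarrow> \<beta> s + of_real k * w \<in> W'"
  shows "poly_bounded D W (\<lambda>s w. f (\<beta> s + of_real k * w))"
proof -
  obtain C q T where f: "C \<ge> 0" "q \<ge> 0" "T \<ge> 1" "\<And>w. w \<in> W' \<Longrightarrow> \<bar>Im w\<bar> \<ge> T \<Longrightarrow> norm (f w) \<le> C * \<bar>Im w\<bar> powr q"
    using f unfolding poly_bounded_def by blast
  have "norm (f (\<beta> s + of_real k * w)) \<le> (C * (k + R) powr q) * \<bar>Im w\<bar> powr q"
    if s: "s \<in> D" and w: "w \<in> W" "\<bar>Im w\<bar> \<ge> (T + R) / k + 1" for s w
  proof -
    let ?v = "\<beta> s + of_real k * w"
    have b: "\<bar>Im (\<beta> s)\<bar> \<le> R" using \<beta>[OF s] abs_Im_le_cmod[of "\<beta> s"] by linarith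
    have "(T + R) / k \<ge> 0" using f(3) R k by simp
    hence w1: "\<bar>Im w\<bar> \<ge> 1" using w(2) by linarith
    have kw: "\<bar>k * Im w\<bar> = k * \<bar>Im w\<bar>" using k by (simp add: abs_mult)
    have "k * ((T + R) / k) \<le> k * \<bar>Im w\<bar>" using w(2) k by (intro mult_left_mono) auto
    hence "T + R \<le> k * \<bar>Im w\<bar>" using k by simp
    moreover have iv: "Im ?v = Im (\<beta> s) + k * Im w" by simp
    ultimately have T: "\<bar>Im ?v\<bar> \<ge> T" using b kw by linarith
    have "R * 1 \<le> R * \<bar>Im w\<bar>" using w1 R by (intro mult_left_mono) auto
    hence "\<bar>Im ?v\<bar> \<le> (k + R) * \<bar>Im w\<bar>" unfolding iv using b kw by (simp add: distrib_right)
    hence "\<bar>Im ?v\<bar> powr q \<le> ((k + R) * \<bar>Im w\<bar>) powr q" using f(2) by (intro powr_mono2) auto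
    also have "\<dots> = (k + R) powr q * \<bar>Im w\<bar> powr q" using k R by (simp add: powr_mult)
    finally have "C * \<bar>Im ?v\<bar> powr q \<le> C * ((k + R) powr q * \<bar>Im w\<bar> powr q)" using f(1) by (rule mult_left_mono)
    thus ?thesis using f(4)[OF W[OF s w(1)] T] by (simp add: mult.assoc)
  qed
  moreover have "C * (k + R) powr q \<ge> 0" "(T + R) / k + 1 \<ge> 1" using f k R by auto
  ultimately show ?thesis unfolding poly_bounded_def using f(2) by blast
qed

text \<open>Both arguments have the same |Im|, so the exponential factors of Gamma and 1/Gamma
  cancel exactly and only powers remain.\<close>

lemma Gamma_ratio_poly_bounded:
  assumes l: "l > (0::real)" and X: "X \<ge> 0"
  shows "poly_bounded UNIV {s. \<bar>Re s\<bar> \<le> X} (\<lambda>_::unit. \<lambda>s. Gamma (of_real l * (1 - s) + cnj m) * rGamma (of_real l * s + m))"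
proof -
  define Y where "Y = l * (X + 1) + norm m"
  have Y: "Y \<ge> 0" using l X by (simp add: Y_def)
  obtain C where C: "C > 0" "\<And>z. \<bar>Re z\<bar> \<le> Y \<Longrightarrow> \<bar>Im z\<bar> \<ge> max 4 (4 * Y) \<Longrightarrow>
    norm (Gamma z) \<le> C * \<bar>Im z\<bar> powr (Y + 1) * exp (- pi / 2 * \<bar>Im z\<bar>)"
    "\<And>z. \<bar>Re z\<bar> \<le> Y \<Longrightarrow> \<bar>Im z\<bar> \<ge> max 4 (4 * Y) \<Longrightarrow>
    norm (rGamma z) \<le> C * \<bar>Im z\<bar> powr (Y + 1) * exp (pi / 2 * \<bar>Im z\<bar>)"
    using Gamma_vertical_bounds[OF Y] by blast
  define T where "T = (max 4 (4 * Y) + norm m) / l + 1"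
  have T1: "T \<ge> 1" using l by (simp add: T_def)
  have "norm (Gamma (of_real l * (1 - s) + cnj m) * rGamma (of_real l * s + m)) \<le> (C * C * (l + norm m) powr (2 * (Y + 1))) * \<bar>Im s\<bar> powr (2 * (Y + 1))"
    if s: "\<bar>Re s\<bar> \<le> X" "\<bar>Im s\<bar> \<ge> T" for s
  proof -
    define h where "h = \<bar>l * Im s + Im m\<bar>"
    let ?z1 = "of_real l * (1 - s) + cnj m" and ?z2 = "of_real l * s + m"
    have im: "\<bar>Im ?z1\<bar> = h" "\<bar>Im ?z2\<bar> = h" by (simp_all add: h_def algebra_simps abs_minus_commute)
    have rm: "\<bar>Re m\<bar> \<le> norm m" "\<bar>Im m\<bar> \<le> norm m" by (rule abs_Re_le_cmod abs_Im_le_cmod)+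
    have "l * \<bar>Re s\<bar> \<le> l * X" using s l by (intro mult_left_mono) auto
    hence "\<bar>l * Re s\<bar> \<le> l * X" using l by (simp add: abs_mult)
    moreover have "Re ?z1 = l - l * Re s + Re m" "Re ?z2 = l * Re s + Re m" by (simp_all add: algebra_simps)
    ultimately have re: "\<bar>Re ?z1\<bar> \<le> Y" "\<bar>Re ?z2\<bar> \<le> Y" using rm l unfolding Y_def distrib_left by linarith+
    have ls: "\<bar>l * Im s\<bar> = l * \<bar>Im s\<bar>" using l by (simp add: abs_mult)
    have "l * ((max 4 (4 * Y) + norm m) / l) \<le> l * \<bar>Im s\<bar>" using s(2) l by (intro mult_left_mono) (auto simp: T_def)
    hence "max 4 (4 * Y) + norm m \<le> l * \<bar>Im s\<bar>" using l by simp
    hence hge: "h \<ge> max 4 (4 * Y)" unfolding h_def using rm ls by linarith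
    have s1: "\<bar>Im s\<bar> \<ge> 1" using s(2) T1 by linarith
    have "norm m * 1 \<le> norm m * \<bar>Im s\<bar>" using s1 by (intro mult_left_mono) auto
    hence hle: "h \<le> (l + norm m) * \<bar>Im s\<bar>" unfolding h_def distrib_right using rm ls by linarith
    have "norm (Gamma ?z1 * rGamma ?z2) \<le> (C * h powr (Y + 1) * exp (- pi / 2 * h)) * (C * h powr (Y + 1) * exp (pi / 2 * h))"
      unfolding norm_mult using C(2)[OF re(1)] C(3)[OF re(2)] hge C(1) unfolding im by (intro mult_mono) auto
    also have "\<dots> = C * C * (h powr (Y + 1) * h powr (Y + 1)) * (exp (- pi / 2 * h) * exp (pi / 2 * h))" by (simp add: mult_ac)
    also have "exp (- pi / 2 * h) * exp (pi / 2 * h) = 1" by (simp flip: exp_add)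
    also have "h powr (Y + 1) * h powr (Y + 1) = h powr (2 * (Y + 1))" by (simp flip: powr_add)
    also have "C * C * h powr (2 * (Y + 1)) * 1 \<le> C * C * ((l + norm m) * \<bar>Im s\<bar>) powr (2 * (Y + 1)) * 1"
      using hle C(1) Y by (intro mult_right_mono mult_left_mono powr_mono2) (auto simp: h_def)
    also have "\<dots> = (C * C * (l + norm m) powr (2 * (Y + 1))) * \<bar>Im s\<bar> powr (2 * (Y + 1))"
      using l by (simp add: powr_mult)
    finally show ?thesis .
  qed
  moreover have "C * C * (l + norm m) powr (2 * (Y + 1)) \<ge> 0" "2 * (Y + 1) \<ge> 0" using C(1) Y by auto
  ultimately show ?thesis unfolding poly_bounded_def using T1 by blast
qed

text \<open>For Re s <= -1 the functional equation expresses \<open>Fc s\<close> by a value at real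
  part at least 2, where the Dirichlet series is bounded, times Gamma quotients of polynomial
  size.\<close>

lemma selberg_left_poly_bounded:
  assumes sel: "selberg_sharp a Fc Q lam mu om" and X: "X \<ge> 0"
  shows "poly_bounded UNIV {s. - X \<le> Re s \<and> Re s \<le> -1} (\<lambda>_::unit. Fc)"
proof -
  let ?W = "{s. - X \<le> Re s \<and> Re s \<le> -1}"
  have lam: "lam ! j > 0" if "j < length lam" for j using sel that by (auto simp: selberg_sharp_def)
  let ?g = "\<lambda>j s. Gamma (of_real (lam ! j) * (1 - s) + cnj (mu ! j)) * rGamma (of_real (lam ! j) * s + mu ! j)"
  obtain B where B: "B \<ge> 0" "\<And>s. Re s \<ge> 2 \<Longrightarrow> norm (Fc s) \<le> B"
    using selberg_right_bound[OF sel, of 2] by auto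
  have om: "norm om = 1" using sel by (simp add: selberg_sharp_def)
  have mono: "poly_bounded UNIV ?W f" if "poly_bounded UNIV {s. \<bar>Re s\<bar> \<le> X} f" for f :: "unit \<Rightarrow> complex \<Rightarrow> complex"
    by (rule poly_bounded_subset[OF that]) auto
  have 1: "poly_bounded UNIV ?W (\<lambda>_::unit. \<lambda>s. om * exp ((1 - 2 * s) * of_real (ln Q)))"
  proof (rule poly_bounded_const_bound[of _ _ 0])
    fix s assume s: "s \<in> ?W"
    have "Re ((1 - 2 * s) * of_real (ln Q)) = (1 - 2 * Re s) * ln Q" by simp
    also have "\<dots> \<le> \<bar>1 - 2 * Re s\<bar> * \<bar>ln Q\<bar>" by (metis abs_ge_self abs_mult)
    also have "\<dots> \<le> (1 + 2 * X) * \<bar>ln Q\<bar>" using s by (intro mult_right_mono) auto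
    finally show "norm (om * exp ((1 - 2 * s) * of_real (ln Q))) \<le> exp ((1 + 2 * X) * \<bar>ln Q\<bar>)"
      by (simp add: norm_mult om)
  qed
  have 2: "poly_bounded UNIV ?W (\<lambda>_::unit. \<lambda>s. \<Prod>j<length lam. ?g j s)"
    by (intro poly_bounded_prod mono Gamma_ratio_poly_bounded lam X) auto
  have 3: "poly_bounded UNIV ?W (\<lambda>_::unit. \<lambda>s. cnj (Fc (cnj (1 - s))))"
  proof (rule poly_bounded_const_bound[of _ _ 0])
    fix s assume "s \<in> ?W"
    thus "norm (cnj (Fc (cnj (1 - s)))) \<le> B" unfolding complex_mod_cnj by (intro B(2)) simp
  qed
  obtain C q T where CT: "C \<ge> 0" "q \<ge> 0" "T \<ge> 1" "\<And>s. s \<in> ?W \<Longrightarrow> \<bar>Im s\<bar> \<ge> T \<Longrightarrow>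
     norm (om * exp ((1 - 2 * s) * of_real (ln Q)) * (\<Prod>j<length lam. ?g j s) * cnj (Fc (cnj (1 - s)))) \<le> C * \<bar>Im s\<bar> powr q"
    using poly_bounded_mult[OF poly_bounded_mult[OF 1 2] 3] unfolding poly_bounded_def by blast
  \<comment> \<open>Beyond this height lam * Im s dominates Im mu for every j, so the functional
    equation is applicable.\<close>
  define T' where "T' = max T (1 + (\<Sum>j<length lam. norm (mu ! j) / lam ! j))"
  have "norm (Fc s) \<le> C * \<bar>Im s\<bar> powr q" if s: "s \<in> ?W" "\<bar>Im s\<bar> \<ge> T'" for s
  proof -
    have s0: "\<bar>Im s\<bar> \<ge> T" using s(2) by (simp add: T'_def)
    have "lam ! j * Im s + Im (mu ! j) \<noteq> 0" if j: "j < length lam" for j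
    proof
      assume "lam ! j * Im s + Im (mu ! j) = 0"
      hence "\<bar>lam ! j * Im s\<bar> = \<bar>Im (mu ! j)\<bar>" by simp
      hence "lam ! j * \<bar>Im s\<bar> \<le> norm (mu ! j)" using lam[OF j] abs_Im_le_cmod[of "mu ! j"] by (simp add: abs_mult)
      hence "\<bar>Im s\<bar> \<le> norm (mu ! j) / lam ! j" using lam[OF j] by (simp add: pos_le_divide_eq mult.commute)
      also have "\<dots> \<le> (\<Sum>j<length lam. norm (mu ! j) / lam ! j)"
        using j by (intro member_le_sum) (auto intro!: divide_nonneg_pos lam)
      finally show False using s(2) by (simp add: T'_def)
    qed
    moreover have "Im s \<noteq> 0" using s0 CT(3) by auto
    ultimately show ?thesis using CT(4)[OF s(1) s0] selberg_functional_equation[OF sel, of s] by simp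
  qed
  moreover have "T' \<ge> 1" using CT(3) by (simp add: T'_def)
  ultimately show ?thesis unfolding poly_bounded_def using CT(1,2) by blast
qed

section \<open>The Mellin representation of the twist\<close>

locale multi_selberg =
  fixes a :: "'n::finite \<Rightarrow> nat \<Rightarrow> complex"
    and Fc :: "'n \<Rightarrow> complex \<Rightarrow> complex"
    and Q :: "'n \<Rightarrow> real" and lam :: "'n \<Rightarrow> real list" and mu :: "'n \<Rightarrow> complex list"
    and om :: "'n \<Rightarrow> complex"
    and \<kappa> :: "'n \<Rightarrow> real" and \<alpha> :: real
  assumes sel: "\<And>\<nu>. selberg_sharp (a \<nu>) (Fc \<nu>) (Q \<nu>) (lam \<nu>) (mu \<nu>) (om \<nu>)"
    and kappa_pos: "\<And>\<nu>. \<kappa> \<nu> > 0"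
    and kappa_sum: "(\<Sum>\<nu>\<in>UNIV. sel_degree (lam \<nu>) * \<kappa> \<nu>) = 1"
    and alpha_pos: "\<alpha> > 0"
begin

definition coef :: "complex^'n \<Rightarrow> nat^'n \<Rightarrow> complex" where
  "coef s n = (\<Prod>\<nu>\<in>UNIV. a \<nu> (n $ \<nu>) / of_nat (n $ \<nu>) powr (s $ \<nu>))"

definition freq :: "nat^'n \<Rightarrow> real" where
  "freq n = (\<Prod>\<nu>\<in>UNIV. real (n $ \<nu>) powr \<kappa> \<nu>)"

definition P :: "complex^'n \<Rightarrow> complex \<Rightarrow> complex" where
  "P s w = (\<Prod>\<nu>\<in>UNIV. Fc \<nu> (s $ \<nu> + of_real (\<kappa> \<nu>) * w))"

definition ex :: "real \<Rightarrow> complex" where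
  "ex \<epsilon> = of_real (ln (2 * pi * \<alpha>)) + \<i> * of_real (pi / 2 - \<epsilon>)"

text \<open>The Mellin integrand at \<open>z = exp (ex \<epsilon>) = 2 \<pi> \<alpha> \<i> exp (- \<i> \<epsilon>)\<close>, which tends to \<open>2 \<pi> \<i> \<alpha>\<close>.\<close>
definition \<Phi> :: "real \<Rightarrow> complex^'n \<Rightarrow> complex \<Rightarrow> complex" where
  "\<Phi> \<epsilon> s w = P s w * Gamma w * exp (- w * ex \<epsilon>)"

lemma freq_ge_1: "n \<in> pos_vecs \<Longrightarrow> freq n \<ge> 1"
  unfolding freq_def pos_vecs_def
  by (intro prod_ge_1 ge_one_powr_ge_zero) (auto simp: kappa_pos less_imp_le)

lemma freq_pos: "n \<in> pos_vecs \<Longrightarrow> freq n > 0"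
  using freq_ge_1[of n] by linarith

text \<open>The general b and z allow two uses: the coefficients at s with w, and the conjugate
  coefficients at 1 - s with -w for the dual series.\<close>

lemma dirichlet_term_shift:
  fixes b z :: "'n \<Rightarrow> complex"
  assumes n: "n \<in> pos_vecs"
  shows "(\<Prod>\<nu>\<in>UNIV. b \<nu> / of_nat (n $ \<nu>) powr (z \<nu> + of_real (\<kappa> \<nu>) * w)) =
    (\<Prod>\<nu>\<in>UNIV. b \<nu> / of_nat (n $ \<nu>) powr z \<nu>) * exp (- w * of_real (ln (freq n)))"
proof -
  have n1: "n $ \<nu> \<ge> 1" for \<nu> using n by (simp add: pos_vecs_def)
  have fac: "b \<nu> / of_nat (n $ \<nu>) powr (z \<nu> + of_real (\<kappa> \<nu>) * w) =
     (b \<nu> / of_nat (n $ \<nu>) powr z \<nu>) * exp (- w * of_real (\<kappa> \<nu> * ln (real (n $ \<nu>))))" for \<nu>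
  proof -
    have "(of_nat (n $ \<nu>) :: complex) \<noteq> 0" using n1[of \<nu>] by simp
    hence "of_nat (n $ \<nu>) powr (z \<nu> + of_real (\<kappa> \<nu>) * w) = of_nat (n $ \<nu>) powr z \<nu> * exp (w * of_real (\<kappa> \<nu> * ln (real (n $ \<nu>))))"
      using n1[of \<nu>] by (simp add: powr_def Ln_of_nat exp_add[symmetric] algebra_simps)
    thus ?thesis by (simp add: exp_minus divide_inverse)
  qed
  have "(\<Prod>\<nu>\<in>UNIV. exp (- w * of_real (\<kappa> \<nu> * ln (real (n $ \<nu>))))) = exp (\<Sum>\<nu>\<in>UNIV. - w * of_real (\<kappa> \<nu> * ln (real (n $ \<nu>))))"
    by (simp add: exp_sum)
  also have "(\<Sum>\<nu>\<in>UNIV. - w * of_real (\<kappa> \<nu> * ln (real (n $ \<nu>)))) = - w * of_real (\<Sum>\<nu>\<in>UNIV. \<kappa> \<nu> * ln (real (n $ \<nu>)))"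
    by (simp only: sum_distrib_left of_real_sum)
  also have "(\<Sum>\<nu>\<in>UNIV. \<kappa> \<nu> * ln (real (n $ \<nu>))) = ln (freq n)"
    unfolding freq_def using n1 by (subst ln_prod) (auto simp: ln_powr Suc_le_eq)
  finally show ?thesis unfolding fac prod.distrib by simp
qed

lemma coef_shift:
  assumes "n \<in> pos_vecs"
  shows "coef (\<chi> \<nu>. s $ \<nu> + of_real (\<kappa> \<nu>) * w) n = coef s n * exp (- w * of_real (ln (freq n)))"
  unfolding coef_def vec_lambda_beta by (rule dirichlet_term_shift[OF assms])

lemma coef_series:
  fixes s :: "complex^'n"
  assumes s: "\<And>\<nu>. Re (s $ \<nu>) > 1"
  shows "integrable (count_space pos_vecs) (coef s)"
    and "(LINT n|count_space pos_vecs. coef s n) = (\<Prod>\<nu>\<in>UNIV. Fc \<nu> (s $ \<nu>))"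
  using prod_series[of "\<lambda>\<nu> n. a \<nu> n / of_nat n powr (s $ \<nu>)"] selberg_series[OF sel s]
  unfolding coef_def[abs_def] by simp_all

lemma P_series:
  fixes s :: "complex^'n"
  assumes s: "\<And>\<nu>. Re (s $ \<nu>) > 1" and w: "Re w \<ge> 0"
  shows "P s w = (LINT n|count_space pos_vecs. coef s n * exp (- w * of_real (ln (freq n))))"
proof -
  let ?s = "\<chi> \<nu>. s $ \<nu> + of_real (\<kappa> \<nu>) * w"
  have "Re (?s $ \<nu>) > 1" for \<nu>
    using s[of \<nu>] mult_nonneg_nonneg[OF less_imp_le[OF kappa_pos[of \<nu>]] w] by simp
  from coef_series(2)[OF this] have "P s w = (LINT n|count_space pos_vecs. coef ?s n)" by (simp add: P_def)
  also have "\<dots> = (LINT n|count_space pos_vecs. coef s n * exp (- w * of_real (ln (freq n))))"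
    by (rule Bochner_Integration.integral_cong[OF refl]) (use coef_shift in simp)
  finally show ?thesis .
qed

lemma Ln_exp_ex:
  assumes "0 \<le> \<epsilon>" "\<epsilon> \<le> 1" "r > 0"
  shows "Ln (of_real r * exp (ex \<epsilon>)) = of_real (ln r) + ex \<epsilon>"
proof -
  have "of_real r * exp (ex \<epsilon>) = exp (of_real (ln r) + ex \<epsilon>)"
    using assms by (simp add: exp_add exp_of_real flip: of_real_exp)
  moreover have "Im (of_real (ln r) + ex \<epsilon>) = pi / 2 - \<epsilon>" by (simp add: ex_def)
  ultimately show ?thesis using assms pi_gt3 by (simp add: Ln_exp)
qed

lemma Re_exp_ex: "Re (exp (ex \<epsilon>)) = 2 * pi * \<alpha> * sin \<epsilon>"
  using alpha_pos by (simp add: ex_def Re_exp cos_diff)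

text \<open>Mellin inversion term by term. For 0 < eps <= 1 each
  \<open>freq n * exp (ex eps)\<close> has positive real part since sin eps > 0, and freq(n)^(-w)
  has modulus at most 1 on Re w = c, so the absolute coefficients times a single Gamma integral
  dominate.\<close>

lemma twist_integral:
  fixes s :: "complex^'n"
  assumes s: "\<And>\<nu>. Re (s $ \<nu>) > 1" and c: "c > 0" and \<epsilon>: "0 < \<epsilon>" "\<epsilon> \<le> 1"
  shows "integrable lborel (\<lambda>t. \<Phi> \<epsilon> s (Complex c t))"
    and "(LINT t|lborel. \<Phi> \<epsilon> s (Complex c t)) =
      2 * of_real pi * (LINT n|count_space pos_vecs. coef s n * exp (- (of_real (freq n) * exp (ex \<epsilon>))))"
proof -
  let ?z = "exp (ex \<epsilon>)"
  have sin: "sin \<epsilon> > 0" using \<epsilon> pi_gt3 by (intro sin_gt_zero) auto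
  have rez: "Re ?z > 0" unfolding Re_exp_ex using alpha_pos sin by simp
  have rezn: "Re (of_real (freq n) * ?z) > 0" if "n \<in> pos_vecs" for n
    using rez freq_pos[OF that] by simp
  have powr_eq: "(of_real (freq n) * ?z) powr (- w) = exp (- w * of_real (ln (freq n))) * exp (- w * ex \<epsilon>)" if "n \<in> pos_vecs" for n w
    using Ln_exp_ex[of \<epsilon> "freq n"] \<epsilon> freq_pos[OF that] by (simp add: powr_def exp_add[symmetric] algebra_simps)
  have zp: "?z powr (- w) = exp (- w * ex \<epsilon>)" for w
    using Ln_exp_ex[of \<epsilon> 1] \<epsilon> by (simp add: powr_def)
  let ?g = "\<lambda>t. Gamma (Complex c t) * exp (- Complex c t * ex \<epsilon>)"
  have g: "integrable lborel ?g" using mellin_exp(1)[OF rez c] unfolding zp .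
  let ?f = "\<lambda>n t. coef s n * exp (- Complex c t * of_real (ln (freq n))) * ?g t"
  have Phi_eq: "\<Phi> \<epsilon> s (Complex c t) = (LINT n|count_space pos_vecs. ?f n t)" for t
  proof -
    have "P s (Complex c t) = (LINT n|count_space pos_vecs. coef s n * exp (- Complex c t * of_real (ln (freq n))))"
      using c by (intro P_series s) auto
    hence "\<Phi> \<epsilon> s (Complex c t) = (LINT n|count_space pos_vecs. coef s n * exp (- Complex c t * of_real (ln (freq n)))) * ?g t"
      by (simp only: \<Phi>_def mult.assoc)
    thus ?thesis by (simp only: integral_mult_left_zero)
  qed
  have sfin: "sigma_finite_measure (lborel :: real measure)" by (rule sigma_finite_lborel)
  have meas: "?f n \<in> borel_measurable lborel" for n
  proof -
    have "continuous_on UNIV (\<lambda>t. coef s n * exp (- Complex c t * of_real (ln (freq n))))"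
      by (intro continuous_intros continuous_on_Complex_line)
    hence "(\<lambda>t. coef s n * exp (- Complex c t * of_real (ln (freq n)))) \<in> borel_measurable lborel"
      by (simp add: borel_measurable_continuous_onI)
    thus ?thesis using borel_measurable_integrable[OF g] by (rule borel_measurable_times)
  qed
  have bd: "norm (?f n t) \<le> norm (coef s n) * norm (?g t)" if n: "n \<in> pos_vecs" for n t
  proof -
    have "norm (exp (- Complex c t * of_real (ln (freq n)))) \<le> 1" using freq_ge_1[OF n] c by simp
    hence "norm (coef s n) * norm (exp (- Complex c t * of_real (ln (freq n)))) * norm (?g t) \<le> norm (coef s n) * 1 * norm (?g t)"
      by (intro mult_mono) auto
    thus ?thesis by (simp only: norm_mult mult_1_right)
  qed
  note sw = sum_integral_swap[OF countable_pos_vecs sfin meas integrable_norm[OF coef_series(1)[OF s]] integrable_norm[OF g] bd]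
  show "integrable lborel (\<lambda>t. \<Phi> \<epsilon> s (Complex c t))" unfolding Phi_eq by (rule sw(1)) auto
  have "(LINT t|lborel. \<Phi> \<epsilon> s (Complex c t)) = (LINT n|count_space pos_vecs. LINT t|lborel. ?f n t)"
    unfolding Phi_eq by (rule sw(2)) auto
  also have "\<dots> = (LINT n|count_space pos_vecs. coef s n * (2 * of_real pi * exp (- (of_real (freq n) * ?z))))"
  proof (rule Bochner_Integration.integral_cong[OF refl])
    fix n :: "nat^'n" assume "n \<in> space (count_space pos_vecs)"
    hence n: "n \<in> pos_vecs" by simp
    have "(LINT t|lborel. ?f n t) = (LINT t|lborel. coef s n * (Gamma (Complex c t) * (of_real (freq n) * ?z) powr (- Complex c t)))"
      unfolding powr_eq[OF n] by (simp only: mult_ac)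
    also have "\<dots> = coef s n * (2 * of_real pi * exp (- (of_real (freq n) * ?z)))"
      unfolding integral_mult_right_zero mellin_exp(2)[OF rezn[OF n] c] ..
    finally show "(LINT t|lborel. ?f n t) = coef s n * (2 * of_real pi * exp (- (of_real (freq n) * ?z)))" .
  qed
  also have "\<dots> = (LINT n|count_space pos_vecs. (2 * of_real pi) * (coef s n * exp (- (of_real (freq n) * ?z))))"
    by (simp only: mult_ac)
  also have "\<dots> = 2 * of_real pi * (LINT n|count_space pos_vecs. coef s n * exp (- (of_real (freq n) * ?z)))"
    by (rule integral_mult_right_zero)
  finally show "(LINT t|lborel. \<Phi> \<epsilon> s (Complex c t)) =
      2 * of_real pi * (LINT n|count_space pos_vecs. coef s n * exp (- (of_real (freq n) * exp (ex \<epsilon>))))" .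
qed

lemma multi_twist_integral:
  fixes s :: "complex^'n"
  assumes s: "\<And>\<nu>. Re (s $ \<nu>) > 1"
  shows "multi_twist a \<kappa> \<alpha> s = (LINT n|count_space pos_vecs. coef s n * exp (- (of_real (freq n) * exp (ex 0))))"
    and "integrable (count_space pos_vecs) (\<lambda>n. coef s n * exp (- (of_real (freq n) * exp (ex 0))))"
proof -
  have e0: "exp (ex 0) = 2 * of_real pi * of_real \<alpha> * \<i>"
  proof -
    have "exp (\<i> * of_real (pi / 2)) = \<i>" by (simp only: cis_conv_exp[symmetric] cis_pi_half)
    moreover have "exp (of_real (ln (2 * pi * \<alpha>))) = (of_real (2 * pi * \<alpha>) :: complex)"
      using alpha_pos by (simp only: exp_of_real) simp
    ultimately show ?thesis unfolding ex_def exp_add by simp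
  qed
  have n1: "norm (exp (- (of_real (freq n) * exp (ex 0)))) = 1" for n
    unfolding e0 by simp
  show int: "integrable (count_space pos_vecs) (\<lambda>n. coef s n * exp (- (of_real (freq n) * exp (ex 0))))"
  proof (rule Bochner_Integration.integrable_bound[OF coef_series(1)[OF s]])
    show "AE n in count_space pos_vecs. norm (coef s n * exp (- (of_real (freq n) * exp (ex 0)))) \<le> norm (coef s n)"
      by (intro AE_I2) (simp only: norm_mult n1 mult_1_right order_refl)
  qed simp
  hence "infsetsum (\<lambda>n. coef s n * exp (- (of_real (freq n) * exp (ex 0)))) pos_vecs = infsum (\<lambda>n. coef s n * exp (- (of_real (freq n) * exp (ex 0)))) pos_vecs"
    by (intro infsetsum_infsum) (simp add: abs_summable_on_def)
  also have "\<dots> = multi_twist a \<kappa> \<alpha> s"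
    unfolding multi_twist_def pos_vecs_def[symmetric] e0 coef_def freq_def
    by (intro infsum_cong) (simp add: mult_ac)
  finally show "multi_twist a \<kappa> \<alpha> s = (LINT n|count_space pos_vecs. coef s n * exp (- (of_real (freq n) * exp (ex 0))))"
    by (simp add: infsetsum_def)
qed

text \<open>For small eps > 0 the exponentials have modulus at most 1, so the absolute coefficients
  dominate uniformly in eps.\<close>

lemma twist_limit:
  fixes s :: "complex^'n"
  assumes s: "\<And>\<nu>. Re (s $ \<nu>) > 1" and c: "c > 0"
  shows "((\<lambda>\<epsilon>. LINT t|lborel. \<Phi> \<epsilon> s (Complex c t)) \<longlongrightarrow> 2 * of_real pi * multi_twist a \<kappa> \<alpha> s) (at_right 0)"
proof -
  let ?f = "\<lambda>\<epsilon> n. coef s n * exp (- (of_real (freq n) * exp (ex \<epsilon>)))"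
  have "((\<lambda>\<epsilon>. LINT n|count_space pos_vecs. ?f \<epsilon> n) \<longlongrightarrow> (LINT n|count_space pos_vecs. ?f 0 n)) (at_right 0)"
    unfolding tendsto_at_iff_sequentially o_def
  proof (intro allI impI)
    fix X :: "nat \<Rightarrow> real" assume X: "\<forall>i. X i \<in> {0<..} - {0}" "X \<longlonglongrightarrow> 0"
    have "eventually (\<lambda>n. X n < 1) sequentially" using X(2) by (rule order_tendstoD) simp
    then obtain N where N: "\<And>n. n \<ge> N \<Longrightarrow> X n < 1" by (auto simp: eventually_at_top_linorder)
    have X': "(\<lambda>n. X (n + N)) \<longlonglongrightarrow> 0" using X(2) by (rule LIMSEQ_ignore_initial_segment)
    have "(\<lambda>i. LINT n|count_space pos_vecs. ?f (X (i + N)) n) \<longlonglongrightarrow> (LINT n|count_space pos_vecs. ?f 0 n)"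
    proof (rule integral_dominated_convergence[where w = "\<lambda>n. norm (coef s n)"])
      show "AE n in count_space pos_vecs. (\<lambda>i. ?f (X (i + N)) n) \<longlonglongrightarrow> ?f 0 n"
        unfolding ex_def by (intro AE_I2 tendsto_intros X')
      show "integrable (count_space pos_vecs) (\<lambda>n. norm (coef s n))" by (rule integrable_norm[OF coef_series(1)[OF s]])
      show "AE n in count_space pos_vecs. norm (?f (X (i + N)) n) \<le> norm (coef s n)" for i
      proof (rule AE_I2)
        fix n :: "nat^'n" assume "n \<in> space (count_space pos_vecs)"
        hence n: "n \<in> pos_vecs" by simp
        have "0 < X (i + N)" "X (i + N) < 1" using X(1) N[of "i + N"] by auto
        hence "sin (X (i + N)) > 0" using pi_gt3 by (intro sin_gt_zero) auto
        moreover have "Re (of_real (freq n) * exp (ex (X (i + N)))) = freq n * (2 * pi * \<alpha> * sin (X (i + N)))"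
          by (simp add: Re_exp_ex)
        ultimately have "Re (of_real (freq n) * exp (ex (X (i + N)))) \<ge> 0"
          using alpha_pos freq_pos[OF n] by simp
        hence "norm (exp (- (of_real (freq n) * exp (ex (X (i + N)))))) \<le> 1" by simp
        thus "norm (?f (X (i + N)) n) \<le> norm (coef s n)" unfolding norm_mult by (rule mult_left_le) simp
      qed
    qed auto
    thus "(\<lambda>i. LINT n|count_space pos_vecs. ?f (X i) n) \<longlonglongrightarrow> (LINT n|count_space pos_vecs. ?f 0 n)"
      by (rule LIMSEQ_offset)
  qed
  from tendsto_mult_left[OF this, of "2 * of_real pi"]
  have "((\<lambda>\<epsilon>. 2 * of_real pi * (LINT n|count_space pos_vecs. ?f \<epsilon> n)) \<longlongrightarrow> 2 * of_real pi * multi_twist a \<kappa> \<alpha> s) (at_right 0)"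
    by (simp add: multi_twist_integral(1)[OF s])
  moreover have "\<forall>\<^sub>F \<epsilon> in at_right 0. 2 * of_real pi * (LINT n|count_space pos_vecs. ?f \<epsilon> n) = (LINT t|lborel. \<Phi> \<epsilon> s (Complex c t))"
    using eventually_at_right_real[OF zero_less_one]
    by eventually_elim (use twist_integral(2)[OF s c] in auto)
  ultimately show ?thesis by (rule Lim_transform_eventually)
qed

end

section \<open>Contour shift\<close>

definition exp_growth :: "complex set \<Rightarrow> (complex \<Rightarrow> complex) \<Rightarrow> bool" where
  "exp_growth W f \<longleftrightarrow> (\<exists>A p. A > 0 \<and> p > 0 \<and> (\<forall>w\<in>W. norm (f w) \<le> exp (A * (1 + norm w) powr p)))"

lemma exp_growth_mono:
  assumes "norm w \<ge> 0" "A \<le> A'" "p \<le> p'" "0 \<le> A"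
  shows "exp (A * (1 + norm w) powr p) \<le> exp (A' * (1 + norm (w::complex)) powr p')"
  using assms by (auto intro!: mult_mono powr_mono)

lemma exp_growth_mult:
  assumes "exp_growth W f" "exp_growth W g"
  shows "exp_growth W (\<lambda>w. f w * g w)"
proof -
  obtain A p where f: "A > 0" "p > 0" "\<And>w. w \<in> W \<Longrightarrow> norm (f w) \<le> exp (A * (1 + norm w) powr p)"
    using assms(1) unfolding exp_growth_def by blast
  obtain A' p' where g: "A' > 0" "p' > 0" "\<And>w. w \<in> W \<Longrightarrow> norm (g w) \<le> exp (A' * (1 + norm w) powr p')"
    using assms(2) unfolding exp_growth_def by blast
  have "norm (f w * g w) \<le> exp ((A + A') * (1 + norm w) powr (max p p'))" if w: "w \<in> W" for w
  proof -
    have "norm (f w) \<le> exp (A * (1 + norm w) powr max p p')"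
      by (rule order_trans[OF f(3)[OF w] exp_growth_mono]) (use f(1) in auto)
    moreover have "norm (g w) \<le> exp (A' * (1 + norm w) powr max p p')"
      by (rule order_trans[OF g(3)[OF w] exp_growth_mono]) (use g(1) in auto)
    ultimately have "norm (f w) * norm (g w) \<le> exp (A * (1 + norm w) powr max p p') * exp (A' * (1 + norm w) powr max p p')"
      by (intro mult_mono) auto
    thus ?thesis by (simp add: norm_mult distrib_right exp_add)
  qed
  moreover have "A + A' > 0" "max p p' > 0" using f g by auto
  ultimately show ?thesis unfolding exp_growth_def by blast
qed

lemma exp_growth_bounded:
  assumes "\<And>w. w \<in> W \<Longrightarrow> norm (f w) \<le> C"
  shows "exp_growth W f"
proof -
  have "norm (f w) \<le> exp ((\<bar>C\<bar> + 1) * (1 + norm w) powr 1)" if w: "w \<in> W" for w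
  proof -
    have "norm (f w) \<le> \<bar>C\<bar> + 1" using assms[OF w] by linarith
    also have "\<dots> \<le> (\<bar>C\<bar> + 1) * (1 + norm w)" by (simp add: mult_le_cancel_left1)
    also have "\<dots> \<le> exp ((\<bar>C\<bar> + 1) * (1 + norm w))" using exp_ge_add_one_self[of "(\<bar>C\<bar> + 1) * (1 + norm w)"] by linarith
    finally show ?thesis by simp
  qed
  thus ?thesis unfolding exp_growth_def by (intro exI[of _ "\<bar>C\<bar> + 1"] exI[of _ 1]) auto
qed

lemma exp_growth_prod:
  "finite I \<Longrightarrow> (\<And>i. i \<in> I \<Longrightarrow> exp_growth W (f i)) \<Longrightarrow> exp_growth W (\<lambda>w. \<Prod>i\<in>I. f i w)"
proof (induction I rule: finite_induct)
  case empty
  show ?case by (rule exp_growth_bounded[of _ _ 1]) auto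
next
  case (insert i I)
  thus ?case by (auto intro: exp_growth_mult)
qed

text \<open>Multiplication by exp(-i eta/2 w) spends half of the decay rate: on the two vertical
  sides the other half still absorbs the power, so the product is bounded on the boundary and by
  Phragmen-Lindelof inside. Undoing the multiplication leaves decay exp(-eta/2 Im w) throughout the
  half strip, which suffices for moving the line.\<close>

lemma pl_tail_shift:
  assumes c: "c > 0" and T: "T > 0" and f: "f holomorphic_on {w. Im w > T / 2}"
    and gr: "exp_growth {w. \<bar>Re w\<bar> \<le> c \<and> Im w \<ge> T} f"
    and lines: "\<And>w. \<bar>Re w\<bar> = c \<Longrightarrow> Im w \<ge> T \<Longrightarrow> norm (f w) \<le> C * Im w powr q * exp (- \<eta> * Im w)"
    and q: "q \<ge> 0" and C: "C \<ge> 0" and \<eta>: "\<eta> > 0"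
  shows "(LINT t:{T..}|lborel. f (Complex c t)) =
         (LINT t:{T..}|lborel. f (Complex (- c) t)) + \<i> * integral {-c..c} (\<lambda>x. f (Complex x T))"
proof -
  let ?S = "{w. - c \<le> Re w \<and> Re w \<le> c \<and> T \<le> Im w}"
  define h where "h w = f w * exp (- \<i> * of_real (\<eta> / 2) * w)" for w
  have nh: "norm (h w) = norm (f w) * exp (\<eta> / 2 * Im w)" for w by (simp add: h_def norm_mult)
  have U: "open {w. Im w > T / 2}" by (rule open_halfspace_Im_gt)
  have sub: "?S \<subseteq> {w. Im w > T / 2}" using T by auto
  have hh: "h holomorphic_on {w. Im w > T / 2}" unfolding h_def by (intro holomorphic_intros f)
  obtain C2 where C2: "C2 > 0" "\<And>t::real. t > 0 \<Longrightarrow> q \<ge> 0 \<Longrightarrow> t powr q \<le> C2 * exp (\<eta> / 2 * t)"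
    using powr_le_exp[of "\<eta> / 2" q] \<eta> by (metis half_gt_zero)
  have "compact (h ` cbox (Complex (-c) T) (Complex c T))"
    by (intro compact_continuous_image holomorphic_on_imp_continuous_on holomorphic_on_subset[OF hh])
       (use T in \<open>auto simp: in_cbox_complex_iff\<close>)
  then obtain M0 where M0: "\<And>u. u \<in> cbox (Complex (-c) T) (Complex c T) \<Longrightarrow> norm (h u) \<le> M0"
    using compact_imp_bounded bounded_iff by (metis image_eqI)
  have "exp_growth {w. \<bar>Re w\<bar> \<le> c \<and> Im w \<ge> T} (\<lambda>w. exp (- \<i> * of_real (\<eta> / 2) * w))"
    unfolding exp_growth_def
  proof (rule exI[of _ "\<eta> / 2"], rule exI[of _ 1], intro conjI ballI)
    fix w assume w: "w \<in> {w. \<bar>Re w\<bar> \<le> c \<and> Im w \<ge> T}"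
    have "Im w \<le> 1 + norm w" using abs_Im_le_cmod[of w] by linarith
    hence "\<eta> / 2 * Im w \<le> \<eta> / 2 * (1 + norm w)" using \<eta> by (intro mult_left_mono) auto
    thus "norm (exp (- \<i> * of_real (\<eta> / 2) * w)) \<le> exp (\<eta> / 2 * (1 + norm w) powr 1)" by simp
  qed (use \<eta> in auto)
  from exp_growth_mult[OF gr this] obtain A p where Ap: "A > 0" "p > 0"
    and grh: "\<And>w. \<bar>Re w\<bar> \<le> c \<Longrightarrow> Im w \<ge> T \<Longrightarrow> norm (h w) \<le> exp (A * (1 + norm w) powr p)"
    unfolding exp_growth_def h_def by blast
  define M where "M = max M0 (C * C2)"
  have hM: "norm (h w) \<le> M" if w: "w \<in> ?S" for w
  proof (rule phragmen_lindelof_half_strip[OF _ U sub hh _ Ap _ w])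
    show "- c < c" using c by simp
    show "norm (h w) \<le> exp (A * (1 + norm w) powr p)" if "w \<in> ?S" for w
      using that by (intro grh) auto
    fix w assume w: "w \<in> ?S" "Re w = - c \<or> Re w = c \<or> Im w = T"
    show "norm (h w) \<le> M"
    proof (cases "Im w = T")
      case True
      thus ?thesis using M0[of w] w by (auto simp: in_cbox_complex_iff M_def)
    next
      case False
      hence re: "\<bar>Re w\<bar> = c" using w c by auto
      have im: "Im w \<ge> T" using w by auto
      have "norm (f w) \<le> C * (C2 * exp (\<eta> / 2 * Im w)) * exp (- \<eta> * Im w)"
        by (rule order_trans[OF lines[OF re im]]) (use C2(2)[of "Im w"] q C im T in \<open>auto intro!: mult_right_mono mult_left_mono\<close>)
      hence "norm (h w) \<le> C * (C2 * exp (\<eta> / 2 * Im w)) * exp (- \<eta> * Im w) * exp (\<eta> / 2 * Im w)"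
        unfolding nh by (rule mult_right_mono) auto
      also have "\<dots> = C * C2 * (exp (\<eta> / 2 * Im w) * exp (- \<eta> * Im w) * exp (\<eta> / 2 * Im w))" by simp
      also have "exp (\<eta> / 2 * Im w) * exp (- \<eta> * Im w) * exp (\<eta> / 2 * Im w) = 1" by (simp flip: exp_add)
      finally show ?thesis by (simp add: M_def)
    qed
  qed
  have fM: "norm (f w) \<le> M * exp (- (\<eta> / 2) * Im w)" if w: "w \<in> ?S" for w
  proof -
    have "norm (f w) * exp (\<eta> / 2 * Im w) * exp (- (\<eta> / 2) * Im w) \<le> M * exp (- (\<eta> / 2) * Im w)"
      using hM[OF w] unfolding nh by (rule mult_right_mono) auto
    thus ?thesis by (simp add: mult.assoc flip: exp_add)
  qed
  show ?thesis
    by (rule upper_tail_shift[OF _ U sub f fM]) (use c \<eta> in auto)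
qed

lemma damping_limit:
  fixes f \<gamma> :: "real \<Rightarrow> complex"
  assumes A: "A \<in> sets borel" and g: "set_integrable lborel A g"
    and f: "continuous_on A f" and \<gamma>: "continuous_on A \<gamma>"
    and bd: "\<And>t \<epsilon>. t \<in> A \<Longrightarrow> 0 \<le> \<epsilon> \<Longrightarrow> \<epsilon> \<le> 1 \<Longrightarrow> norm (f t * exp (\<i> * of_real \<epsilon> * \<gamma> t)) \<le> g t"
  shows "((\<lambda>\<epsilon>. LINT t:A|lborel. f t * exp (\<i> * of_real \<epsilon> * \<gamma> t)) \<longlongrightarrow> (LINT t:A|lborel. f t)) (at_right 0)"
  unfolding tendsto_at_iff_sequentially o_def
proof (intro allI impI)
  fix X :: "nat \<Rightarrow> real" assume X: "\<forall>i. X i \<in> {0<..} - {0}" "X \<longlonglongrightarrow> 0"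
  have "eventually (\<lambda>n. X n < 1) sequentially" using X(2) by (rule order_tendstoD) simp
  then obtain N where N: "\<And>n. n \<ge> N \<Longrightarrow> X n < 1" by (auto simp: eventually_at_top_linorder)
  have X': "(\<lambda>n. X (n + N)) \<longlonglongrightarrow> 0" using X(2) by (rule LIMSEQ_ignore_initial_segment)
  let ?f = "\<lambda>\<epsilon> t. indicat_real A t *\<^sub>R (f t * exp (\<i> * of_real \<epsilon> * \<gamma> t))"
  have m: "?f \<epsilon> \<in> borel_measurable lborel" for \<epsilon>
  proof -
    have "continuous_on A (\<lambda>t. f t * exp (\<i> * of_real \<epsilon> * \<gamma> t))" by (intro continuous_intros f \<gamma>)
    from borel_measurable_continuous_on_indicator[OF A this] show ?thesis by simp
  qed
  have "(\<lambda>i. LINT t|lborel. ?f (X (i + N)) t) \<longlonglongrightarrow> (LINT t|lborel. ?f 0 t)"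
  proof (rule integral_dominated_convergence[where w = "\<lambda>t. indicat_real A t *\<^sub>R g t"])
    show "integrable lborel (\<lambda>t. indicat_real A t *\<^sub>R g t)" using g by (simp add: set_integrable_def)
    show "AE t in lborel. (\<lambda>i. ?f (X (i + N)) t) \<longlonglongrightarrow> ?f 0 t"
      by (intro AE_I2 tendsto_intros X')
    show "AE t in lborel. norm (?f (X (i + N)) t) \<le> indicat_real A t *\<^sub>R g t" for i
    proof (rule AE_I2)
      fix t :: real
      have "0 < X (i + N)" "X (i + N) < 1" using X(1) N[of "i + N"] by auto
      thus "norm (?f (X (i + N)) t) \<le> indicat_real A t *\<^sub>R g t"
        using bd[of t "X (i + N)"] by (cases "t \<in> A") auto
    qed
    show "?f 0 \<in> borel_measurable lborel" "?f (X (i + N)) \<in> borel_measurable lborel" for i by (rule m)+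
  qed
  hence "(\<lambda>i. LINT t|lborel. ?f (X i) t) \<longlonglongrightarrow> (LINT t|lborel. ?f 0 t)"
    by (rule LIMSEQ_offset)
  thus "(\<lambda>i. LINT t:A|lborel. f t * exp (\<i> * of_real (X i) * \<gamma> t)) \<longlonglongrightarrow> (LINT t:A|lborel. f t)"
    unfolding set_lebesgue_integral_def by simp
qed

lemma damping_limit_interval:
  fixes f \<gamma> :: "real \<Rightarrow> complex"
  assumes f: "continuous_on {x..y} f" and \<gamma>: "continuous_on {x..y} \<gamma>"
  shows "((\<lambda>\<epsilon>. integral {x..y} (\<lambda>t. f t * exp (\<i> * of_real \<epsilon> * \<gamma> t))) \<longlongrightarrow> integral {x..y} f) (at_right 0)"
proof -
  have "((\<lambda>\<epsilon>. LINT t:{x..y}|lborel. f t * exp (\<i> * of_real \<epsilon> * \<gamma> t)) \<longlongrightarrow> (LINT t:{x..y}|lborel. f t)) (at_right 0)"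
  proof (rule damping_limit[OF _ _ f \<gamma>])
    show "set_integrable lborel {x..y} (\<lambda>t. norm (f t) * exp (norm (\<gamma> t)))"
      by (intro borel_integrable_atLeastAtMost' continuous_intros f \<gamma>)
    fix t \<epsilon> :: real assume t: "t \<in> {x..y}" and \<epsilon>: "0 \<le> \<epsilon>" "\<epsilon> \<le> 1"
    have "Re (\<i> * of_real \<epsilon> * \<gamma> t) \<le> norm (\<i> * of_real \<epsilon> * \<gamma> t)" by (rule complex_Re_le_cmod)
    also have "\<dots> = \<epsilon> * norm (\<gamma> t)" using \<epsilon> by (simp add: norm_mult)
    also have "\<dots> \<le> norm (\<gamma> t)" using \<epsilon> by (intro mult_left_le_one_le) auto
    finally show "norm (f t * exp (\<i> * of_real \<epsilon> * \<gamma> t)) \<le> norm (f t) * exp (norm (\<gamma> t))"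
      by (simp add: norm_mult mult_left_mono)
  qed auto
  moreover have "(LINT t:{x..y}|lborel. f t * exp (\<i> * of_real \<epsilon> * \<gamma> t)) = integral {x..y} (\<lambda>t. f t * exp (\<i> * of_real \<epsilon> * \<gamma> t))" for \<epsilon>
    by (intro set_borel_integral_eq_integral(2) borel_integrable_atLeastAtMost' continuous_intros f \<gamma>)
  moreover have "(LINT t:{x..y}|lborel. f t) = integral {x..y} f"
    by (intro set_borel_integral_eq_integral(2) borel_integrable_atLeastAtMost' f)
  ultimately show ?thesis by simp
qed

lemma poly_bounded_Un:
  assumes "poly_bounded D W f" "poly_bounded D W' f" shows "poly_bounded D (W \<union> W') f"
proof -
  obtain C q T where f: "C \<ge> 0" "q \<ge> 0" "T \<ge> 1" "\<And>s w. s \<in> D \<Longrightarrow> w \<in> W \<Longrightarrow> \<bar>Im w\<bar> \<ge> T \<Longrightarrow> norm (f s w) \<le> C * \<bar>Im w\<bar> powr q"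
    using assms(1) unfolding poly_bounded_def by blast
  obtain C' q' T' where g: "C' \<ge> 0" "q' \<ge> 0" "T' \<ge> 1" "\<And>s w. s \<in> D \<Longrightarrow> w \<in> W' \<Longrightarrow> \<bar>Im w\<bar> \<ge> T' \<Longrightarrow> norm (f s w) \<le> C' * \<bar>Im w\<bar> powr q'"
    using assms(2) unfolding poly_bounded_def by blast
  have "norm (f s w) \<le> max C C' * \<bar>Im w\<bar> powr max q q'" if "s \<in> D" "w \<in> W \<union> W'" "\<bar>Im w\<bar> \<ge> max T T'" for s w
  proof -
    have p: "\<bar>Im w\<bar> powr q \<le> \<bar>Im w\<bar> powr max q q'" "\<bar>Im w\<bar> powr q' \<le> \<bar>Im w\<bar> powr max q q'"
      using that f(3) by (auto intro!: powr_mono)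
    have "C * \<bar>Im w\<bar> powr q \<le> max C C' * \<bar>Im w\<bar> powr max q q'" "C' * \<bar>Im w\<bar> powr q' \<le> max C C' * \<bar>Im w\<bar> powr max q q'"
      using p f(1) g(1) by (auto intro!: mult_mono)
    moreover have "norm (f s w) \<le> C * \<bar>Im w\<bar> powr q \<or> norm (f s w) \<le> C' * \<bar>Im w\<bar> powr q'"
      using f(4)[of s w] g(4)[of s w] that by auto
    ultimately show ?thesis by linarith
  qed
  moreover have "max C C' \<ge> 0" "max q q' \<ge> 0" "max T T' \<ge> 1" using f by auto
  ultimately show ?thesis unfolding poly_bounded_def by blast
qed

context multi_selberg
begin

definition region :: "real \<Rightarrow> (complex^'n) set" where
  "region R = {s. \<forall>\<nu>. norm (s $ \<nu>) < R}"

lemma open_region: "open (region R)"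
proof -
  have "region R = (\<Inter>\<nu>\<in>UNIV. {s. norm (s $ \<nu>) < R})" by (auto simp: region_def)
  also have "open \<dots>"
    by (rule open_INT) (auto intro!: open_Collect_less continuous_intros)
  finally show ?thesis .
qed

text \<open>The condition on c places every argument s_nu + kappa_nu w at real part at least 3 on Re
  w = c and at most -3 on Re w = -c, in the ranges where the series and the functional equation give
  bounds.\<close>

lemma P_line_poly_bounded:
  assumes R: "R > 0" and c: "c > 0" "\<And>\<nu>. \<kappa> \<nu> * c \<ge> R + 3"
  shows "poly_bounded (region R) {w. \<bar>Re w\<bar> = c} P"
proof -
  have reb: "\<bar>Re (s $ \<nu>)\<bar> < R" if "s \<in> region R" for s :: "complex^'n" and \<nu>
    using that abs_Re_le_cmod[of "s $ \<nu>"] unfolding region_def by (metis (mono_tags, lifting) le_less_trans mem_Collect_eq)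
  have "poly_bounded (region R) ({w. Re w = c} \<union> {w. Re w = - c}) (\<lambda>s w. Fc \<nu> (s $ \<nu> + of_real (\<kappa> \<nu>) * w))" for \<nu>
  proof (rule poly_bounded_Un)
    obtain B where B: "\<And>s. Re s \<ge> 2 \<Longrightarrow> norm (Fc \<nu> s) \<le> B" using selberg_right_bound[OF sel[of \<nu>], of 2] by auto
    show "poly_bounded (region R) {w. Re w = c} (\<lambda>s w. Fc \<nu> (s $ \<nu> + of_real (\<kappa> \<nu>) * w))"
    proof (rule poly_bounded_const_bound[of _ _ 0])
      fix s :: "complex^'n" and w assume "s \<in> region R" "w \<in> {w. Re w = c}"
      thus "norm (Fc \<nu> (s $ \<nu> + of_real (\<kappa> \<nu>) * w)) \<le> B"
        using reb[of s \<nu>] c(2)[of \<nu>] by (intro B) auto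
    qed
    define X where "X = R + \<kappa> \<nu> * c"
    have X: "X \<ge> 0" using R c kappa_pos[of \<nu>] by (simp add: X_def)
    show "poly_bounded (region R) {w. Re w = - c} (\<lambda>s w. Fc \<nu> (s $ \<nu> + of_real (\<kappa> \<nu>) * w))"
    proof (rule poly_bounded_subst[OF selberg_left_poly_bounded[OF sel[of \<nu>] X] kappa_pos])
      show "R \<ge> 0" using R by simp
      show "norm (s $ \<nu>) \<le> R" if "s \<in> region R" for s :: "complex^'n" using that by (simp add: region_def less_imp_le)
      fix s :: "complex^'n" and w assume "s \<in> region R" "w \<in> {w. Re w = - c}"
      thus "s $ \<nu> + of_real (\<kappa> \<nu>) * w \<in> {s. - X \<le> Re s \<and> Re s \<le> -1}"
        using reb[of s \<nu>] c(2)[of \<nu>] by (auto simp: X_def)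
    qed
  qed
  hence "poly_bounded (region R) {w. \<bar>Re w\<bar> = c} (\<lambda>s w. Fc \<nu> (s $ \<nu> + of_real (\<kappa> \<nu>) * w))" for \<nu>
    by (rule poly_bounded_subset) (use c in auto)
  thus ?thesis unfolding P_def[abs_def] by (intro poly_bounded_prod) auto
qed

lemma line_bound:
  assumes R: "R > 0" and c: "c > 0" "\<And>\<nu>. \<kappa> \<nu> * c \<ge> R + 3"
  shows "\<exists>C q T. C \<ge> 0 \<and> q \<ge> 0 \<and> (\<forall>s\<in>region R. \<forall>w. \<bar>Re w\<bar> = c \<longrightarrow> \<bar>Im w\<bar> \<ge> T \<longrightarrow>
     norm (P s w * Gamma w) \<le> C * \<bar>Im w\<bar> powr q * exp (- pi / 2 * \<bar>Im w\<bar>))"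
proof -
  obtain C q T where f: "C \<ge> 0" "q \<ge> 0" "T \<ge> 1" "\<And>s w. s \<in> region R \<Longrightarrow> \<bar>Re w\<bar> = c \<Longrightarrow> \<bar>Im w\<bar> \<ge> T \<Longrightarrow> norm (P s w) \<le> C * \<bar>Im w\<bar> powr q"
    using P_line_poly_bounded[OF assms] unfolding poly_bounded_def by blast
  obtain C' where G: "C' > 0" "\<And>z. \<bar>Re z\<bar> \<le> c \<Longrightarrow> \<bar>Im z\<bar> \<ge> max 4 (4 * c) \<Longrightarrow>
    norm (Gamma z) \<le> C' * \<bar>Im z\<bar> powr (c + 1) * exp (- pi / 2 * \<bar>Im z\<bar>)"
    using Gamma_vertical_bounds[OF less_imp_le[OF c(1)]] by metis
  have "norm (P s w * Gamma w) \<le> (C * C') * \<bar>Im w\<bar> powr (q + (c + 1)) * exp (- pi / 2 * \<bar>Im w\<bar>)"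
    if s: "s \<in> region R" and w: "\<bar>Re w\<bar> = c" "\<bar>Im w\<bar> \<ge> max T (max 4 (4 * c))" for s w
  proof -
    have "norm (P s w) * norm (Gamma w) \<le> (C * \<bar>Im w\<bar> powr q) * (C' * \<bar>Im w\<bar> powr (c + 1) * exp (- pi / 2 * \<bar>Im w\<bar>))"
      using f(4)[OF s w(1)] G(2)[of w] w f(1) by (intro mult_mono) auto
    thus ?thesis by (simp add: norm_mult powr_add mult_ac)
  qed
  moreover have "C * C' \<ge> 0" "q + (c + 1) \<ge> 0" using f G c by auto
  ultimately show ?thesis by blast
qed

end

text \<open>\<open>kc\<close> moves both vertical lines out of the critical strips of all factors.
  \<open>kT\<close> gives the arguments of all \<open>Fc\<close> an imaginary part of modulus at
  least 1 as soon as |Im w| > T/2; using T/2 leaves an open neighbourhood of the region |Im w| >= T.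
  T >= 4 c puts the tail Re w = -c into the cone of the Stirling expansion.\<close>

locale multi_selberg_region = multi_selberg a Fc Q lam mu om \<kappa> \<alpha>
  for a :: "'n::finite \<Rightarrow> nat \<Rightarrow> complex" and Fc Q lam mu om \<kappa> \<alpha> +
  fixes R c T :: real
  assumes R: "R > 0" and c: "c \<ge> 1" and kc: "\<And>\<nu>. \<kappa> \<nu> * c \<ge> R + 3"
    and T: "T \<ge> max 4 (4 * c)" and kT: "\<And>\<nu>. \<kappa> \<nu> * T \<ge> 2 * (R + 1)"
    and line: "\<exists>C q. C \<ge> 0 \<and> q \<ge> 0 \<and> (\<forall>s\<in>region R. \<forall>w. \<bar>Re w\<bar> = c \<longrightarrow> \<bar>Im w\<bar> \<ge> T \<longrightarrow>
     norm (P s w * Gamma w) \<le> C * \<bar>Im w\<bar> powr q * exp (- pi / 2 * \<bar>Im w\<bar>))"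
begin

abbreviation "D \<equiv> region R"

lemma T4: "T \<ge> 4" "T > 0" using T by auto

lemma D_coord: "s \<in> D \<Longrightarrow> norm (s $ \<nu>) < R" "s \<in> D \<Longrightarrow> \<bar>Re (s $ \<nu>)\<bar> < R" "s \<in> D \<Longrightarrow> \<bar>Im (s $ \<nu>)\<bar> < R"
  using abs_Re_le_cmod[of "s $ \<nu>"] abs_Im_le_cmod[of "s $ \<nu>"] by (auto simp: region_def intro: le_less_trans)

lemma arg_Im_ge:
  assumes s: "s \<in> D" and w: "\<bar>Im w\<bar> > T / 2"
  shows "\<bar>Im (s $ \<nu> + of_real (\<kappa> \<nu>) * w)\<bar> \<ge> 1"
proof -
  have "\<kappa> \<nu> * (T / 2) \<le> \<kappa> \<nu> * \<bar>Im w\<bar>" using w kappa_pos[of \<nu>] by (intro mult_left_mono) auto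
  hence "R + 1 \<le> \<kappa> \<nu> * \<bar>Im w\<bar>" using kT[of \<nu>] by simp
  moreover have "\<bar>\<kappa> \<nu> * Im w\<bar> = \<kappa> \<nu> * \<bar>Im w\<bar>" using kappa_pos[of \<nu>] by (simp add: abs_mult)
  moreover have "Im (s $ \<nu> + of_real (\<kappa> \<nu>) * w) = Im (s $ \<nu>) + \<kappa> \<nu> * Im w" by simp
  ultimately show ?thesis using D_coord(3)[OF s, of \<nu>] by linarith
qed

lemma Fc_holomorphic: "Fc \<nu> holomorphic_on UNIV - {1}"
  using sel[of \<nu>] unfolding selberg_sharp_def by blast

lemma P_holomorphic:
  assumes "\<And>w \<nu>. w \<in> W \<Longrightarrow> s $ \<nu> + of_real (\<kappa> \<nu>) * w \<noteq> 1"
  shows "P s holomorphic_on W"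
proof -
  have "(\<lambda>w. Fc \<nu> (s $ \<nu> + of_real (\<kappa> \<nu>) * w)) holomorphic_on W" for \<nu>
  proof -
    have 1: "(\<lambda>w. s $ \<nu> + of_real (\<kappa> \<nu>) * w) holomorphic_on W" by (intro holomorphic_intros)
    have 2: "(\<lambda>w. s $ \<nu> + of_real (\<kappa> \<nu>) * w) ` W \<subseteq> UNIV - {1}" using assms by auto
    show ?thesis using holomorphic_on_compose_gen[OF 1 Fc_holomorphic 2] by (simp only: o_def)
  qed
  thus ?thesis unfolding P_def[abs_def] by (intro holomorphic_on_prod)
qed

lemma Phi_holomorphic:
  assumes "s \<in> D" shows "\<Phi> \<epsilon> s holomorphic_on {w. \<bar>Im w\<bar> > T / 2}"
proof -
  have "P s holomorphic_on {w. \<bar>Im w\<bar> > T / 2}"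
  proof (rule P_holomorphic)
    fix w \<nu> assume "w \<in> {w. \<bar>Im w\<bar> > T / 2}"
    hence "\<bar>Im (s $ \<nu> + of_real (\<kappa> \<nu>) * w)\<bar> \<ge> 1" by (intro arg_Im_ge[OF assms]) simp
    thus "s $ \<nu> + of_real (\<kappa> \<nu>) * w \<noteq> 1" by (metis Im_complex_of_real abs_zero not_one_le_zero of_real_1)
  qed
  moreover have "w \<notin> \<int>\<^sub>\<le>\<^sub>0" if "\<bar>Im w\<bar> > T / 2" for w
    using that T4 by (auto elim!: nonpos_Ints_cases)
  ultimately show ?thesis unfolding \<Phi>_def[abs_def] by (intro holomorphic_intros) auto
qed

lemma P_holo_multi:
  assumes "\<And>s \<nu>. s \<in> D \<Longrightarrow> s $ \<nu> + of_real (\<kappa> \<nu>) * w \<noteq> 1"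
  shows "holo_multi_on (\<lambda>s. P s w) D"
  unfolding P_def
proof (rule holo_multi_on_prod)
  fix \<nu>
  show "holo_multi_on (\<lambda>s. Fc \<nu> (s $ \<nu> + of_real (\<kappa> \<nu>) * w)) D"
    by (rule holo_multi_on_compose[OF _ Fc_holomorphic])
       (use assms in \<open>auto intro!: holo_multi_intros\<close>)
qed

lemma Phi_holo_multi:
  assumes "\<And>s \<nu>. s \<in> D \<Longrightarrow> s $ \<nu> + of_real (\<kappa> \<nu>) * w \<noteq> 1"
  shows "holo_multi_on (\<lambda>s. \<Phi> \<epsilon> s w) D"
  unfolding \<Phi>_def by (intro holo_multi_intros P_holo_multi assms)

text \<open>All dependence on eps sits in one factor, of modulus exp(-eps Im w).\<close>

lemma Phi_damping: "\<Phi> \<epsilon> s w = \<Phi> 0 s w * exp (\<i> * of_real \<epsilon> * w)"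
  unfolding \<Phi>_def ex_def mult.assoc by (simp add: algebra_simps flip: exp_add)

lemma P_growth:
  assumes s: "s \<in> D"
  shows "exp_growth {w. \<bar>Im w\<bar> > T / 2} (P s)"
proof -
  have "exp_growth {w. \<bar>Im w\<bar> > T / 2} (\<lambda>w. Fc \<nu> (s $ \<nu> + of_real (\<kappa> \<nu>) * w))" for \<nu>
  proof -
    obtain A p where A: "A > 0" "p > 0" "\<And>s. \<bar>Im s\<bar> \<ge> 1 \<Longrightarrow> norm (Fc \<nu> s) \<le> exp (A * (1 + norm s) powr p)"
      using selberg_growth[OF sel[of \<nu>]] by blast
    define k where "k = 1 + R + \<kappa> \<nu>"
    have k: "k > 0" using R kappa_pos[of \<nu>] by (simp add: k_def)
    have "norm (Fc \<nu> (s $ \<nu> + of_real (\<kappa> \<nu>) * w)) \<le> exp ((A * k powr p) * (1 + norm w) powr p)" if w: "\<bar>Im w\<bar> > T / 2" for w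
    proof -
      let ?v = "s $ \<nu> + of_real (\<kappa> \<nu>) * w"
      have "norm ?v \<le> norm (s $ \<nu>) + norm (of_real (\<kappa> \<nu>) * w)" by (rule norm_triangle_ineq)
      also have "\<dots> \<le> R + \<kappa> \<nu> * norm w" using D_coord(1)[OF s, of \<nu>] kappa_pos[of \<nu>] by (simp add: norm_mult)
      finally have "1 + norm ?v \<le> 1 + R + \<kappa> \<nu> * norm w" by simp
      also have "\<dots> \<le> k * (1 + norm w)" using R kappa_pos[of \<nu>] by (simp add: k_def algebra_simps)
      finally have "(1 + norm ?v) powr p \<le> (k * (1 + norm w)) powr p" using A(2) by (intro powr_mono2) auto
      also have "\<dots> = k powr p * (1 + norm w) powr p" using k by (simp add: powr_mult)
      finally have "A * (1 + norm ?v) powr p \<le> A * (k powr p * (1 + norm w) powr p)" using A(1) by (intro mult_left_mono) auto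
      thus ?thesis using A(3)[OF arg_Im_ge[OF s w, of \<nu>]] by (simp add: mult.assoc) (meson exp_le_cancel_iff order_trans)
    qed
    moreover have "A * k powr p > 0" using A(1) k by simp
    ultimately show ?thesis unfolding exp_growth_def using A(2) by blast
  qed
  thus ?thesis unfolding P_def[abs_def] by (intro exp_growth_prod) auto
qed

lemma Phi_growth:
  assumes s: "s \<in> D"
  shows "exp_growth {w. \<bar>Re w\<bar> \<le> c \<and> \<bar>Im w\<bar> \<ge> T} (\<Phi> \<epsilon> s)"
proof -
  let ?W = "{w. \<bar>Re w\<bar> \<le> c \<and> \<bar>Im w\<bar> \<ge> T}"
  have 1: "exp_growth ?W (P s)"
    using P_growth[OF s] T4 unfolding exp_growth_def by fastforce
  obtain C' where G: "C' > 0" "\<And>z. \<bar>Re z\<bar> \<le> c \<Longrightarrow> \<bar>Im z\<bar> \<ge> max 4 (4 * c) \<Longrightarrow>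
    norm (Gamma z) \<le> C' * \<bar>Im z\<bar> powr (c + 1) * exp (- pi / 2 * \<bar>Im z\<bar>)"
  proof -
    have "c \<ge> 0" using c by simp
    from Gamma_vertical_bounds[OF this] that show thesis by metis
  qed
  obtain C2 where C2: "C2 > 0" "\<And>t::real. t > 0 \<Longrightarrow> c + 1 \<ge> 0 \<Longrightarrow> t powr (c + 1) \<le> C2 * exp (pi / 2 * t)"
    using powr_le_exp[of "pi / 2" "c + 1"] by (metis pi_half_gt_zero)
  have 2: "exp_growth ?W Gamma"
  proof (rule exp_growth_bounded)
    fix w assume w: "w \<in> ?W"
    have "\<bar>Im w\<bar> > 0" using w T4 by auto
    hence "\<bar>Im w\<bar> powr (c + 1) \<le> C2 * exp (pi / 2 * \<bar>Im w\<bar>)" using C2(2)[of "\<bar>Im w\<bar>"] c by simp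
    hence "C' * \<bar>Im w\<bar> powr (c + 1) * exp (- pi / 2 * \<bar>Im w\<bar>) \<le> C' * (C2 * exp (pi / 2 * \<bar>Im w\<bar>)) * exp (- pi / 2 * \<bar>Im w\<bar>)"
      using G(1) by (intro mult_right_mono mult_left_mono) auto
    also have "\<dots> = C' * C2 * (exp (pi / 2 * \<bar>Im w\<bar>) * exp (- pi / 2 * \<bar>Im w\<bar>))" by simp
    also have "exp (pi / 2 * \<bar>Im w\<bar>) * exp (- pi / 2 * \<bar>Im w\<bar>) = 1" by (simp flip: exp_add)
    finally show "norm (Gamma w) \<le> C' * C2" using G(2)[of w] w T by auto
  qed
  have 3: "exp_growth ?W (\<lambda>w. exp (- w * ex \<epsilon>))"
    unfolding exp_growth_def
  proof (rule exI[of _ "norm (ex \<epsilon>) + 1"], rule exI[of _ 1], intro conjI ballI)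
    fix w
    have "Re (- w * ex \<epsilon>) \<le> norm (- w * ex \<epsilon>)" by (rule complex_Re_le_cmod)
    also have "\<dots> = norm (ex \<epsilon>) * norm w" by (simp add: norm_mult mult.commute)
    also have "\<dots> \<le> (norm (ex \<epsilon>) + 1) * (1 + norm w)" by (intro mult_mono) auto
    finally show "norm (exp (- w * ex \<epsilon>)) \<le> exp ((norm (ex \<epsilon>) + 1) * (1 + norm w) powr 1)" by simp
  qed (auto simp: add_nonneg_pos)
  show ?thesis unfolding \<Phi>_def[abs_def] by (intro exp_growth_mult 1 2 3)
qed

text \<open>The exponent is -eps Im w on the upper side and -(pi - eps) |Im w| on the lower side.
  This asymmetry is why only the upper tail needs an asymptotic expansion.\<close>

lemma Phi_line_bound:
  obtains C q where "C \<ge> 0" "q \<ge> 0"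
    "\<And>\<epsilon> s w. s \<in> D \<Longrightarrow> \<bar>Re w\<bar> = c \<Longrightarrow> \<bar>Im w\<bar> \<ge> T \<Longrightarrow>
      norm (\<Phi> \<epsilon> s w) \<le> C * \<bar>Im w\<bar> powr q * exp (- pi / 2 * \<bar>Im w\<bar> + Im w * (pi / 2 - \<epsilon>))"
proof -
  obtain C q where C: "C \<ge> 0" "q \<ge> 0" "\<And>s w. s \<in> D \<Longrightarrow> \<bar>Re w\<bar> = c \<Longrightarrow> \<bar>Im w\<bar> \<ge> T \<Longrightarrow>
     norm (P s w * Gamma w) \<le> C * \<bar>Im w\<bar> powr q * exp (- pi / 2 * \<bar>Im w\<bar>)" using line by blast
  define L where "L = ln (2 * pi * \<alpha>)"
  have "norm (\<Phi> \<epsilon> s w) \<le> (C * exp (c * \<bar>L\<bar>)) * \<bar>Im w\<bar> powr q * exp (- pi / 2 * \<bar>Im w\<bar> + Im w * (pi / 2 - \<epsilon>))"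
    if s: "s \<in> D" and w: "\<bar>Re w\<bar> = c" "\<bar>Im w\<bar> \<ge> T" for \<epsilon> s w
  proof -
    have "- Re w * L \<le> \<bar>Re w\<bar> * \<bar>L\<bar>" by (metis abs_ge_self abs_minus_cancel abs_mult)
    moreover have "Re (- w * ex \<epsilon>) = - Re w * L + Im w * (pi / 2 - \<epsilon>)" by (simp add: ex_def L_def)
    ultimately have "norm (exp (- w * ex \<epsilon>)) \<le> exp (c * \<bar>L\<bar> + Im w * (pi / 2 - \<epsilon>))" unfolding w(1) norm_exp_eq_Re by simp
    hence "norm (P s w * Gamma w) * norm (exp (- w * ex \<epsilon>)) \<le> (C * \<bar>Im w\<bar> powr q * exp (- pi / 2 * \<bar>Im w\<bar>)) * exp (c * \<bar>L\<bar> + Im w * (pi / 2 - \<epsilon>))"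
      using C(3)[OF s w] C(1) by (intro mult_mono) auto
    thus ?thesis unfolding \<Phi>_def norm_mult[of "P s w * Gamma w"] exp_add by (simp only: mult_ac)
  qed
  moreover have "C * exp (c * \<bar>L\<bar>) \<ge> 0" using C(1) by simp
  ultimately show ?thesis using that C(2) by blast
qed

section \<open>Splitting of the shifted contour\<close>

definition Up :: "real \<Rightarrow> complex^'n \<Rightarrow> complex" where
  "Up \<epsilon> s = (LINT t:{T..}|lborel. \<Phi> \<epsilon> s (Complex (- c) t))"

definition Low :: "real \<Rightarrow> complex^'n \<Rightarrow> complex" where
  "Low \<epsilon> s = (LINT t:{T..}|lborel. \<Phi> \<epsilon> s (Complex (- c) (- t)))"

definition Mid :: "real \<Rightarrow> complex^'n \<Rightarrow> complex" where
  "Mid \<epsilon> s = integral {-T..T} (\<lambda>t. \<Phi> \<epsilon> s (Complex c t)) +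
     \<i> * integral {-c..c} (\<lambda>x. \<Phi> \<epsilon> s (Complex x T)) - \<i> * integral {-c..c} (\<lambda>x. \<Phi> \<epsilon> s (Complex x (- T)))"

lemma upper_shift:
  assumes s: "s \<in> D" and \<epsilon>: "0 < \<epsilon>"
  shows "(LINT t:{T..}|lborel. \<Phi> \<epsilon> s (Complex c t)) = Up \<epsilon> s + \<i> * integral {-c..c} (\<lambda>x. \<Phi> \<epsilon> s (Complex x T))"
proof -
  obtain C q where C: "C \<ge> 0" "q \<ge> 0"
    "\<And>\<epsilon> s w. s \<in> D \<Longrightarrow> \<bar>Re w\<bar> = c \<Longrightarrow> \<bar>Im w\<bar> \<ge> T \<Longrightarrow>
      norm (\<Phi> \<epsilon> s w) \<le> C * \<bar>Im w\<bar> powr q * exp (- pi / 2 * \<bar>Im w\<bar> + Im w * (pi / 2 - \<epsilon>))"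
    using Phi_line_bound by metis
  show ?thesis unfolding Up_def
  proof (rule pl_tail_shift[OF _ T4(2) _ _ _ C(2,1) \<epsilon>])
    show "c > 0" using c by simp
    show "\<Phi> \<epsilon> s holomorphic_on {w. Im w > T / 2}" by (rule holomorphic_on_subset[OF Phi_holomorphic[OF s]]) auto
    show "exp_growth {w. \<bar>Re w\<bar> \<le> c \<and> Im w \<ge> T} (\<Phi> \<epsilon> s)"
      using Phi_growth[OF s, of \<epsilon>] unfolding exp_growth_def by fastforce
    fix w assume w: "\<bar>Re w\<bar> = c" "Im w \<ge> T"
    have "\<bar>Im w\<bar> = Im w" using w T4 by simp
    moreover have "- pi / 2 * Im w + Im w * (pi / 2 - \<epsilon>) = - \<epsilon> * Im w" by (simp add: algebra_simps)
    ultimately show "norm (\<Phi> \<epsilon> s w) \<le> C * Im w powr q * exp (- \<epsilon> * Im w)" using C(3)[OF s w(1), of \<epsilon>] w(2) by simp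
  qed
qed

lemma lower_shift:
  assumes s: "s \<in> D" and \<epsilon>: "0 < \<epsilon>" "\<epsilon> \<le> 1"
  shows "(LINT t:{T..}|lborel. \<Phi> \<epsilon> s (Complex c (- t))) = Low \<epsilon> s - \<i> * integral {-c..c} (\<lambda>x. \<Phi> \<epsilon> s (Complex x (- T)))"
proof -
  obtain C q where C: "C \<ge> 0" "q \<ge> 0"
    "\<And>\<epsilon> s w. s \<in> D \<Longrightarrow> \<bar>Re w\<bar> = c \<Longrightarrow> \<bar>Im w\<bar> \<ge> T \<Longrightarrow>
      norm (\<Phi> \<epsilon> s w) \<le> C * \<bar>Im w\<bar> powr q * exp (- pi / 2 * \<bar>Im w\<bar> + Im w * (pi / 2 - \<epsilon>))"
    using Phi_line_bound by metis
  \<comment> \<open>Reflection in the real axis turns the lower tail into an upper one, with decay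
    rate pi - eps.\<close>
  define f where "f w = cnj (\<Phi> \<epsilon> s (cnj w))" for w
  have fC: "f (Complex x t) = cnj (\<Phi> \<epsilon> s (Complex x (- t)))" for x t
    by (simp add: f_def complex_cnj)
  have cnjint: "(LINT t:{T..}|lborel. cnj (g t)) = cnj (LINT t:{T..}|lborel. g t)" for g :: "real \<Rightarrow> complex"
    unfolding set_lebesgue_integral_def by (simp flip: Bochner_Integration.integral_cnj)
  have "(LINT t:{T..}|lborel. f (Complex c t)) = (LINT t:{T..}|lborel. f (Complex (- c) t)) + \<i> * integral {-c..c} (\<lambda>x. f (Complex x T))"
  proof (rule pl_tail_shift[OF _ T4(2) _ _ _ C(2,1)])
    show "c > 0" using c by simp
    show "pi - \<epsilon> > 0" using \<epsilon> pi_gt3 by simp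
    have im: "cnj ` {w. Im w > T / 2} \<subseteq> {w. \<bar>Im w\<bar> > T / 2}" by auto
    have "cnj \<circ> \<Phi> \<epsilon> s \<circ> cnj holomorphic_on {w. Im w > T / 2}"
      by (rule holomorphic_on_compose_cnj_cnj[OF holomorphic_on_subset[OF Phi_holomorphic[OF s] im] open_halfspace_Im_gt])
    thus "f holomorphic_on {w. Im w > T / 2}" by (simp add: f_def[abs_def] o_def)
    obtain A p where "A > 0" "p > 0" "\<And>w. \<bar>Re w\<bar> \<le> c \<Longrightarrow> \<bar>Im w\<bar> \<ge> T \<Longrightarrow> norm (\<Phi> \<epsilon> s w) \<le> exp (A * (1 + norm w) powr p)"
      using Phi_growth[OF s, of \<epsilon>] unfolding exp_growth_def by blast
    thus "exp_growth {w. \<bar>Re w\<bar> \<le> c \<and> Im w \<ge> T} f"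
      unfolding exp_growth_def f_def by (intro exI[of _ A] exI[of _ p]) (fastforce dest: spec[of _ "cnj _"])
    fix w assume w: "\<bar>Re w\<bar> = c" "Im w \<ge> T"
    have "\<bar>Im (cnj w)\<bar> = Im w" using w T4 by simp
    moreover have "- pi / 2 * Im w + Im (cnj w) * (pi / 2 - \<epsilon>) = - (pi - \<epsilon>) * Im w" by (simp add: algebra_simps)
    ultimately show "norm (f w) \<le> C * Im w powr q * exp (- (pi - \<epsilon>) * Im w)" using C(3)[OF s, of "cnj w" \<epsilon>] w by (simp add: f_def)
  qed
  hence "cnj (LINT t:{T..}|lborel. \<Phi> \<epsilon> s (Complex c (- t))) = cnj (Low \<epsilon> s) + \<i> * cnj (integral {-c..c} (\<lambda>x. \<Phi> \<epsilon> s (Complex x (- T))))"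
    unfolding fC cnjint Low_def Henstock_Kurzweil_Integration.integral_cnj .
  from arg_cong[OF this, of cnj] show ?thesis by simp
qed

lemma full_decomposition:
  assumes s: "s \<in> D" "\<And>\<nu>. Re (s $ \<nu>) > 1" and \<epsilon>: "0 < \<epsilon>" "\<epsilon> \<le> 1"
  shows "(LINT t|lborel. \<Phi> \<epsilon> s (Complex c t)) = Up \<epsilon> s + Low \<epsilon> s + Mid \<epsilon> s"
proof -
  let ?f = "\<lambda>t. \<Phi> \<epsilon> s (Complex c t)"
  have "c > 0" using c by simp
  from twist_integral(1)[OF s(2) this \<epsilon>] have int: "integrable lborel ?f" .
  have si: "set_integrable lborel A ?f" if "A \<in> sets borel" for A
    using integrable_mult_indicator[OF _ int, of A] that by (simp add: set_integrable_def)
  have U: "(LINT t|lborel. ?f t) = (LINT t:{..<-T} \<union> {-T..T} \<union> {T<..}|lborel. ?f t)"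
  proof -
    have "{..<-T} \<union> {-T..T} \<union> {T<..} = UNIV" using T4 by auto
    thus ?thesis by (simp add: set_lebesgue_integral_def)
  qed
  also have "\<dots> = (LINT t:{..<-T}|lborel. ?f t) + (LINT t:{-T..T}|lborel. ?f t) + (LINT t:{T<..}|lborel. ?f t)"
    using T4 by (subst set_integral_Un, auto intro!: si sets.Un)+
  also have "(LINT t:{T<..}|lborel. ?f t) = (LINT t:{T..}|lborel. ?f t)"
  proof (rule set_integral_null_delta)
    have "sym_diff {T<..} {T..} = {T}" by auto
    thus "sym_diff {T<..} {T..} \<in> null_sets lborel" by (intro null_setsI) auto
  qed (use int in auto)
  also have "(LINT t:{..<-T}|lborel. ?f t) = (LINT t:{T..}|lborel. \<Phi> \<epsilon> s (Complex c (- t)))"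
  proof -
    have "(LINT t:{..<-T}|lborel. ?f t) = (LINT t:{T<..}|lborel. ?f (- t))"
    proof -
      have "(LINT t|lborel. indicat_real {..<-T} t *\<^sub>R ?f t) = \<bar>-1\<bar> *\<^sub>R (LINT t|lborel. indicat_real {..<-T} (0 + (-1) * t) *\<^sub>R ?f (0 + (-1) * t))"
        by (rule lborel_integral_real_affine) simp
      moreover have "indicat_real {..<-T} (- t) = indicat_real {T<..} t" for t by (simp add: indicator_def)
      ultimately show ?thesis unfolding set_lebesgue_integral_def by simp
    qed
    also have "\<dots> = (LINT t:{T..}|lborel. ?f (- t))"
    proof (rule set_integral_null_delta)
      have "sym_diff {T<..} {T..} = {T}" by auto
      thus "sym_diff {T<..} {T..} \<in> null_sets lborel" by (intro null_setsI) auto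
      have "integrable lborel (\<lambda>t. ?f (0 + (-1) * t))" by (rule lborel_integrable_real_affine[OF int]) simp
      thus "integrable lborel (\<lambda>t. ?f (- t))" by simp
    qed (auto)
    finally show ?thesis .
  qed
  also have "(LINT t:{-T..T}|lborel. ?f t) = integral {-T..T} ?f"
    by (rule set_borel_integral_eq_integral(2)[OF si]) simp
  finally show ?thesis unfolding upper_shift[OF s(1) \<epsilon>(1)] lower_shift[OF s(1) \<epsilon>] Mid_def by simp
qed

text \<open>The disjunction describes the contour of \<open>Mid\<close>: the middle segment lies on
  Re w = c, where the series bounds the factors, and the horizontal ones have |Im w| = T, where
  finite order does.\<close>

lemma P_bounded_compact:
  assumes B: "B \<ge> 0"
  shows "\<exists>M. \<forall>s\<in>D. \<forall>w. norm w \<le> B \<longrightarrow> (Re w = c \<or> \<bar>Im w\<bar> \<ge> T) \<longrightarrow> norm (P s w) \<le> M"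
proof -
  have "\<exists>M. \<forall>s\<in>D. \<forall>w. norm w \<le> B \<longrightarrow> (Re w = c \<or> \<bar>Im w\<bar> \<ge> T) \<longrightarrow> norm (Fc \<nu> (s $ \<nu> + of_real (\<kappa> \<nu>) * w)) \<le> M" for \<nu>
  proof -
    obtain B1 where B1: "\<And>s. Re s \<ge> 2 \<Longrightarrow> norm (Fc \<nu> s) \<le> B1" using selberg_right_bound[OF sel[of \<nu>], of 2] by auto
    obtain A p where A: "A > 0" "p > 0" "\<And>s. \<bar>Im s\<bar> \<ge> 1 \<Longrightarrow> norm (Fc \<nu> s) \<le> exp (A * (1 + norm s) powr p)"
      using selberg_growth[OF sel[of \<nu>]] by blast
    define B2 where "B2 = exp (A * (1 + (R + \<kappa> \<nu> * B)) powr p)"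
    have "norm (Fc \<nu> (s $ \<nu> + of_real (\<kappa> \<nu>) * w)) \<le> max B1 B2" if s: "s \<in> D" and w: "norm w \<le> B" "Re w = c \<or> \<bar>Im w\<bar> \<ge> T" for s w
    proof (cases "Re w = c")
      case True
      have "Re (s $ \<nu> + of_real (\<kappa> \<nu>) * w) \<ge> 2" using D_coord(2)[OF s, of \<nu>] kc[of \<nu>] True by simp
      thus ?thesis using B1 by (simp add: le_max_iff_disj)
    next
      case False
      let ?v = "s $ \<nu> + of_real (\<kappa> \<nu>) * w"
      have "\<bar>Im w\<bar> > T / 2" using False w T4 by linarith
      hence im: "\<bar>Im ?v\<bar> \<ge> 1" by (rule arg_Im_ge[OF s])
      have "norm ?v \<le> norm (s $ \<nu>) + norm (of_real (\<kappa> \<nu>) * w)" by (rule norm_triangle_ineq)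
      also have "norm (of_real (\<kappa> \<nu>) * w) = \<kappa> \<nu> * norm w" using kappa_pos[of \<nu>] by (simp add: norm_mult)
      also have "norm (s $ \<nu>) + \<kappa> \<nu> * norm w \<le> R + \<kappa> \<nu> * B" using D_coord(1)[OF s, of \<nu>] w(1) kappa_pos[of \<nu>] by (intro add_mono mult_left_mono) auto
      finally have "(1 + norm ?v) powr p \<le> (1 + (R + \<kappa> \<nu> * B)) powr p" using A(2) by (intro powr_mono2) auto
      hence "A * (1 + norm ?v) powr p \<le> A * (1 + (R + \<kappa> \<nu> * B)) powr p" using A(1) by (intro mult_left_mono) auto
      hence "exp (A * (1 + norm ?v) powr p) \<le> B2" unfolding B2_def by simp
      thus ?thesis using A(3)[OF im] by linarith
    qed
    thus ?thesis by blast
  qed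
  then obtain M where M: "\<And>\<nu> s w. s \<in> D \<Longrightarrow> norm w \<le> B \<Longrightarrow> Re w = c \<or> \<bar>Im w\<bar> \<ge> T \<Longrightarrow> norm (Fc \<nu> (s $ \<nu> + of_real (\<kappa> \<nu>) * w)) \<le> M \<nu>"
    by metis
  have "norm (P s w) \<le> (\<Prod>\<nu>\<in>UNIV. M \<nu>)" if "s \<in> D" "norm w \<le> B" "Re w = c \<or> \<bar>Im w\<bar> \<ge> T" for s w
    unfolding P_def prod_norm[symmetric] by (intro prod_mono conjI norm_ge_zero M that)
  thus ?thesis by blast
qed

text \<open>One statement for the three segments of \<open>Mid\<close>; the condition on gamma keeps
  them away from the poles of all \<open>Fc\<close> and of Gamma, uniformly for s in the
  polydisc.\<close>

lemma segment_integral: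
  fixes \<gamma> :: "real \<Rightarrow> complex"
  assumes \<gamma>: "continuous_on {x..y} \<gamma>"
    and seg: "\<And>t. t \<in> {x..y} \<Longrightarrow> Re (\<gamma> t) = c \<or> \<bar>Im (\<gamma> t)\<bar> \<ge> T"
  shows "holo_multi_on (\<lambda>s. integral {x..y} (\<lambda>t. \<Phi> 0 s (\<gamma> t))) D"
    and "s \<in> D \<Longrightarrow> ((\<lambda>\<epsilon>. integral {x..y} (\<lambda>t. \<Phi> \<epsilon> s (\<gamma> t))) \<longlongrightarrow> integral {x..y} (\<lambda>t. \<Phi> 0 s (\<gamma> t))) (at_right 0)"
proof -
  let ?W = "{w. Re w = c \<or> \<bar>Im w\<bar> \<ge> T}"
  have sub: "\<gamma> ` {x..y} \<subseteq> ?W" using seg by blast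
  have ne1: "s $ \<nu> + of_real (\<kappa> \<nu>) * w \<noteq> 1" if s: "s \<in> D" and w: "w \<in> ?W" for s w \<nu>
  proof (cases "Re w = c")
    case True
    hence "Re (s $ \<nu> + of_real (\<kappa> \<nu>) * w) \<ge> 2" using D_coord(2)[OF s, of \<nu>] kc[of \<nu>] by simp
    thus ?thesis by (intro notI) simp
  next
    case False
    hence "\<bar>Im w\<bar> > T / 2" using w T4 by auto
    hence "\<bar>Im (s $ \<nu> + of_real (\<kappa> \<nu>) * w)\<bar> \<ge> 1" by (rule arg_Im_ge[OF s])
    thus ?thesis by (intro notI) simp
  qed
  have npole: "w \<notin> \<int>\<^sub>\<le>\<^sub>0" if "w \<in> ?W" for w
    using that c T4 by (auto elim!: nonpos_Ints_cases)
  have cG: "continuous_on {x..y} (\<lambda>t. Gamma (\<gamma> t) * exp (- \<gamma> t * ex 0))"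
  proof -
    have "continuous_on ?W Gamma" by (intro continuous_on_Gamma) (use npole in auto)
    from continuous_on_compose2[OF this \<gamma> sub] have "continuous_on {x..y} (\<lambda>t. Gamma (\<gamma> t))" .
    thus ?thesis by (intro continuous_intros \<gamma>)
  qed
  have cP: "continuous_on {x..y} (\<lambda>t. P s (\<gamma> t))" if s: "s \<in> D" for s
  proof -
    have "P s holomorphic_on ?W" by (rule P_holomorphic) (use ne1[OF s] in blast)
    from continuous_on_compose2[OF holomorphic_on_imp_continuous_on[OF this] \<gamma>] show ?thesis using sub by blast
  qed
  have cPhi: "continuous_on {x..y} (\<lambda>t. \<Phi> 0 s (\<gamma> t))" if s: "s \<in> D" for s
    using continuous_on_mult[OF cP[OF s] cG] by (simp add: \<Phi>_def mult.assoc)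
  obtain B where B: "\<And>t. t \<in> {x..y} \<Longrightarrow> norm (\<gamma> t) \<le> B"
    using compact_imp_bounded[OF compact_continuous_image[OF \<gamma> compact_Icc]] unfolding bounded_iff by blast
  obtain B' where B': "\<And>t. t \<in> {x..y} \<Longrightarrow> norm (Gamma (\<gamma> t) * exp (- \<gamma> t * ex 0)) \<le> B'"
    using compact_imp_bounded[OF compact_continuous_image[OF cG compact_Icc]] unfolding bounded_iff by blast
  obtain M where M: "\<And>s w. s \<in> D \<Longrightarrow> norm w \<le> max B 0 \<Longrightarrow> Re w = c \<or> \<bar>Im w\<bar> \<ge> T \<Longrightarrow> norm (P s w) \<le> M"
    using P_bounded_compact[of "max B 0"] by auto
  have bd: "norm (\<Phi> 0 s (\<gamma> t)) \<le> \<bar>M\<bar> * \<bar>B'\<bar>" if s: "s \<in> D" and t: "t \<in> {x..y}" for s t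
  proof -
    have "norm (P s (\<gamma> t)) \<le> \<bar>M\<bar>" using M[OF s _ seg[OF t]] B[OF t] by fastforce
    moreover have "norm (Gamma (\<gamma> t) * exp (- \<gamma> t * ex 0)) \<le> \<bar>B'\<bar>" using B'[OF t] by linarith
    ultimately show ?thesis unfolding \<Phi>_def mult.assoc norm_mult[of "P s (\<gamma> t)"] by (intro mult_mono) auto
  qed
  show "holo_multi_on (\<lambda>s. integral {x..y} (\<lambda>t. \<Phi> 0 s (\<gamma> t))) D"
  proof (rule holo_multi_on_integral_interval[OF open_region, where f = "\<lambda>s t. \<Phi> 0 s (\<gamma> t)"])
    show "holo_multi_on (\<lambda>s. \<Phi> 0 s (\<gamma> t)) D" if "t \<in> {x..y}" for t
      by (rule Phi_holo_multi) (use ne1 seg[OF that] in blast)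
    show "\<exists>e>0. \<exists>M. \<forall>s\<in>ball p e \<inter> D. \<forall>t\<in>{x..y}. norm (\<Phi> 0 s (\<gamma> t)) \<le> M" for p
      using bd by (intro exI[of _ "1::real"] conjI exI[of _ "\<bar>M\<bar> * \<bar>B'\<bar>"]) auto
  qed (rule cPhi)
  show "((\<lambda>\<epsilon>. integral {x..y} (\<lambda>t. \<Phi> \<epsilon> s (\<gamma> t))) \<longlongrightarrow> integral {x..y} (\<lambda>t. \<Phi> 0 s (\<gamma> t))) (at_right 0)" if s: "s \<in> D"
    using damping_limit_interval[OF cPhi[OF s] \<gamma>] by (simp only: Phi_damping[symmetric])
qed

lemma Mid_holo: "holo_multi_on (Mid 0) D"
  and Mid_tendsto: "s \<in> D \<Longrightarrow> ((\<lambda>\<epsilon>. Mid \<epsilon> s) \<longlongrightarrow> Mid 0 s) (at_right 0)"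
proof -
  have T0: "T > 0" using T4 by simp
  note 1 = segment_integral[OF continuous_on_Complex_line(1), of "-T" T c]
  note 2 = segment_integral[OF continuous_on_Complex_line(2), of "-c" c T]
  note 3 = segment_integral[OF continuous_on_Complex_line(2), of "-c" c "-T"]
  show "holo_multi_on (Mid 0) D"
    unfolding Mid_def[abs_def]
    by (intro holo_multi_on_diff holo_multi_on_add holo_multi_on_mult holo_multi_on_const 1 2 3) (use T0 in auto)
  show "((\<lambda>\<epsilon>. Mid \<epsilon> s) \<longlongrightarrow> Mid 0 s) (at_right 0)" if "s \<in> D"
    unfolding Mid_def
    by (intro tendsto_diff tendsto_add tendsto_mult tendsto_const 1 2 3 that) (use T0 in auto)
qed

lemma Phi_continuous_tail:
  assumes "s \<in> D" "\<bar>\<sigma>\<bar> = 1"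
  shows "continuous_on {T..} (\<lambda>t. \<Phi> \<epsilon> s (Complex (- c) (\<sigma> * t)))"
proof -
  have \<sigma>: "\<sigma> = 1 \<or> \<sigma> = -1" using assms(2) by (auto simp: abs_if split: if_splits)
  have 1: "continuous_on {T..} (\<lambda>t. Complex (- c) (\<sigma> * t))"
    by (auto simp: Complex_eq intro!: continuous_intros)
  show ?thesis
    by (rule continuous_on_compose2[OF holomorphic_on_imp_continuous_on[OF Phi_holomorphic[OF assms(1)]] 1])
       (use \<sigma> T4 in auto)
qed

text \<open>The integrand decays like a power times exp(-(pi - eps) t). For eps <= 1 this is
  dominated by a fixed multiple of exp(-t), which settles both holomorphy and the limit at
  once.\<close>

lemma Low_holo: "holo_multi_on (Low 0) D"
  and Low_tendsto: "s \<in> D \<Longrightarrow> ((\<lambda>\<epsilon>. Low \<epsilon> s) \<longlongrightarrow> Low 0 s) (at_right 0)"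
proof -
  obtain C q where C: "C \<ge> 0" "q \<ge> 0"
    "\<And>\<epsilon> s w. s \<in> D \<Longrightarrow> \<bar>Re w\<bar> = c \<Longrightarrow> \<bar>Im w\<bar> \<ge> T \<Longrightarrow>
      norm (\<Phi> \<epsilon> s w) \<le> C * \<bar>Im w\<bar> powr q * exp (- pi / 2 * \<bar>Im w\<bar> + Im w * (pi / 2 - \<epsilon>))"
    using Phi_line_bound by metis
  obtain C2 where C2: "C2 > 0" "\<And>t::real. t > 0 \<Longrightarrow> q \<ge> 0 \<Longrightarrow> t powr q \<le> C2 * exp (1 * t)"
    using powr_le_exp[of 1 q] by (metis zero_less_one)
  have bd: "norm (\<Phi> \<epsilon> s (Complex (- c) (- t))) \<le> C * C2 * exp (- 1 * t)" if s: "s \<in> D" and \<epsilon>: "\<epsilon> \<le> 1" and t: "t \<in> {T..}" for s \<epsilon> t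
  proof -
    have t0: "t > 0" "t \<ge> T" using t T4 by auto
    have "norm (\<Phi> \<epsilon> s (Complex (- c) (- t))) \<le> C * t powr q * exp (- pi / 2 * t + (- t) * (pi / 2 - \<epsilon>))"
      using C(3)[OF s, of "Complex (- c) (- t)" \<epsilon>] t0 c by simp
    also have "\<dots> \<le> C * (C2 * exp (1 * t)) * exp (- 2 * t)"
    proof (intro mult_mono)
      have "- pi / 2 * t + (- t) * (pi / 2 - \<epsilon>) = (\<epsilon> - pi) * t" by (simp add: algebra_simps)
      also have "\<dots> \<le> (-2) * t" using \<epsilon> pi_gt3 t0 by (intro mult_right_mono) auto
      finally show "exp (- pi / 2 * t + (- t) * (pi / 2 - \<epsilon>)) \<le> exp (- 2 * t)" by simp
      show "t powr q \<le> C2 * exp (1 * t)" using C2(2)[OF t0(1)] C(2) by simp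
    qed (use C(1) C2(1) in auto)
    also have "\<dots> = C * C2 * (exp (1 * t) * exp (- 2 * t))" by simp
    also have "exp (1 * t) * exp (- 2 * t) = exp (- 1 * t)" by (simp flip: exp_add)
    finally show ?thesis .
  qed
  have g: "set_integrable lborel {T..} (\<lambda>t. C * C2 * exp (- 1 * t))"
    by (intro set_integrable_mult_right set_integrable_exp_atLeast) simp
  have cont: "continuous_on {T..} (\<lambda>t. \<Phi> \<epsilon> s (Complex (- c) (- t)))" if "s \<in> D" for s \<epsilon>
    using Phi_continuous_tail[OF that, of "-1" \<epsilon>] by simp
  show "holo_multi_on (Low 0) D"
    unfolding Low_def[abs_def]
  proof (rule holo_multi_on_set_integral[OF open_region])
    fix t assume t: "t \<in> {T..}"
    show "holo_multi_on (\<lambda>s. \<Phi> 0 s (Complex (- c) (- t))) D"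
    proof (rule Phi_holo_multi)
      fix s \<nu> assume s: "s \<in> D"
      have "\<bar>Im (Complex (- c) (- t))\<bar> > T / 2" using t T4 by simp
      hence "\<bar>Im (s $ \<nu> + of_real (\<kappa> \<nu>) * Complex (- c) (- t))\<bar> \<ge> 1" by (rule arg_Im_ge[OF s])
      thus "s $ \<nu> + of_real (\<kappa> \<nu>) * Complex (- c) (- t) \<noteq> 1" by (intro notI) simp
    qed
  next
    show "set_borel_measurable lborel {T..} (\<lambda>t. \<Phi> 0 s (Complex (- c) (- t)))" if "s \<in> D" for s
      unfolding set_borel_measurable_def
      using borel_measurable_continuous_on_indicator[OF _ cont[OF that, of 0]] by simp
    show "\<exists>e>0. \<exists>g. set_integrable lborel {T..} g \<and> (\<forall>s\<in>ball p e \<inter> D. \<forall>t\<in>{T..}. norm (\<Phi> 0 s (Complex (- c) (- t))) \<le> g t)" for p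
      using g bd[of _ 0] by (intro exI[of _ "1::real"] conjI exI[of _ "\<lambda>t. C * C2 * exp (- 1 * t)"]) auto
  qed
  show "((\<lambda>\<epsilon>. Low \<epsilon> s) \<longlongrightarrow> Low 0 s) (at_right 0)" if s: "s \<in> D"
  proof -
    have "((\<lambda>\<epsilon>. LINT t:{T..}|lborel. \<Phi> 0 s (Complex (- c) (- t)) * exp (\<i> * of_real \<epsilon> * Complex (- c) (- t))) \<longlongrightarrow>
        (LINT t:{T..}|lborel. \<Phi> 0 s (Complex (- c) (- t)))) (at_right 0)"
    proof (rule damping_limit[OF _ g cont[OF s]])
      show "continuous_on {T..} (\<lambda>t. Complex (- c) (- t))" by (auto simp: Complex_eq intro!: continuous_intros)
      show "norm (\<Phi> 0 s (Complex (- c) (- t)) * exp (\<i> * of_real \<epsilon> * Complex (- c) (- t))) \<le> C * C2 * exp (- 1 * t)"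
        if "t \<in> {T..}" "0 \<le> \<epsilon>" "\<epsilon> \<le> 1" for t \<epsilon>
        using bd[OF s that(3,1)] by (simp only: Phi_damping[of \<epsilon>, symmetric])
    qed simp
    thus ?thesis unfolding Low_def by (simp only: Phi_damping[symmetric])
  qed
qed

theorem twist_decomposition:
  assumes s: "s \<in> D" "\<And>\<nu>. Re (s $ \<nu>) > 1" and U: "((\<lambda>\<epsilon>. Up \<epsilon> s) \<longlongrightarrow> u) (at_right 0)"
  shows "2 * of_real pi * multi_twist a \<kappa> \<alpha> s = u + Low 0 s + Mid 0 s"
proof -
  have c0: "c > 0" using c by simp
  have "((\<lambda>\<epsilon>. Up \<epsilon> s + Low \<epsilon> s + Mid \<epsilon> s) \<longlongrightarrow> u + Low 0 s + Mid 0 s) (at_right 0)"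
    by (intro tendsto_add U Low_tendsto Mid_tendsto s(1))
  moreover have "\<forall>\<^sub>F \<epsilon> in at_right 0. Up \<epsilon> s + Low \<epsilon> s + Mid \<epsilon> s = (LINT t|lborel. \<Phi> \<epsilon> s (Complex c t))"
    using eventually_at_right_real[OF zero_less_one]
    by eventually_elim (use full_decomposition[OF s] in auto)
  ultimately have "((\<lambda>\<epsilon>. LINT t|lborel. \<Phi> \<epsilon> s (Complex c t)) \<longlongrightarrow> u + Low 0 s + Mid 0 s) (at_right 0)"
    by (rule Lim_transform_eventually)
  from tendsto_unique[OF trivial_limit_at_right_real twist_limit[OF s(2) c0] this] show ?thesis .
qed

end

section \<open>The functional equation on the upper tail\<close>

text \<open>The main term of log Gamma(a w + b), expanded at a w as in
  \<open>ln_Gamma_affine_expansion\<close>; a may be negative.\<close>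

definition stir :: "real \<Rightarrow> complex \<Rightarrow> complex \<Rightarrow> complex" where
  "stir a b w = (of_real a * w + b - 1/2) * Ln (of_real a * w) - of_real a * w"

text \<open>The grouping anticipates the sum over all Gamma factors: a constant, w with a real
  coefficient, a common expression weighted by 2 p, and Ln w. The weights 2 p add up to 1, after
  which the third group cancels against the main term of Gamma(w) and the argument pi/2 of z. The
  term with i pi comes from the argument of -p w.\<close>

lemma stir_quotient:
  assumes w: "Im w > 0" and p: "p > 0"
  shows "stir (- p) b1 w - stir p b2 w =
    (of_real (ln p) * (b1 - b2) - \<i> * of_real pi * (b1 - 1/2)) + w * of_real (- (2 * p * ln p)) +
    (w + \<i> * of_real pi / 2 * w - Ln w * w) * of_real (2 * p) + Ln w * (b1 - b2)"
proof -
  have 1: "Ln (of_real p * w) = of_real (ln p) + Ln w" using Ln_real_mult_upper[of p w] p w by simp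
  have 2: "Ln (of_real (- p) * w) = of_real (ln p) + Ln w - \<i> * of_real pi"
    using Ln_real_mult_upper[of "- p" w] p w by simp
  show ?thesis unfolding stir_def 1 2 by (simp add: field_simps)
qed

lemma sum_affine:
  fixes E e :: "'i \<Rightarrow> complex"
  shows "(\<Sum>i\<in>I. E i + w * of_real (u i) + A * of_real (v i) + L * e i) =
    sum E I + w * of_real (sum u I) + A * of_real (sum v I) + L * sum e I"
  by (simp add: sum.distrib sum_distrib_left)

context multi_selberg
begin

abbreviation deg :: "'n \<Rightarrow> real" where "deg \<nu> \<equiv> sel_degree (lam \<nu>)"

definition lk :: "'n \<Rightarrow> nat \<Rightarrow> real" where "lk \<nu> j = lam \<nu> ! j * \<kappa> \<nu>"

definition num :: "complex^'n \<Rightarrow> 'n \<Rightarrow> nat \<Rightarrow> complex" where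
  "num s \<nu> j = of_real (lam \<nu> ! j) * (1 - s $ \<nu>) + cnj (mu \<nu> ! j)"

definition den :: "complex^'n \<Rightarrow> 'n \<Rightarrow> nat \<Rightarrow> complex" where
  "den s \<nu> j = of_real (lam \<nu> ! j) * s $ \<nu> + mu \<nu> ! j"

text \<open>The product of all Gamma factors divided by their Stirling main terms.\<close>
definition X :: "complex^'n \<Rightarrow> complex \<Rightarrow> complex" where
  "X s w = (Gamma (of_real 1 * w + 0) * exp (- stir 1 0 w)) * (\<Prod>\<nu>\<in>UNIV. \<Prod>j<length (lam \<nu>).
     (Gamma (of_real (- lk \<nu> j) * w + num s \<nu> j) * exp (- stir (- lk \<nu> j) (num s \<nu> j) w)) *
     (rGamma (of_real (lk \<nu> j) * w + den s \<nu> j) * exp (stir (lk \<nu> j) (den s \<nu> j) w)))"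

text \<open>\<open>exp lX0\<close> is \<open>\<alpha>\<close> times the normalising constant in \<open>\<alpha>\<^sub>n\<close>, so \<open>n\<close> is resonant iff \<open>ln (freq n) = lX0\<close>.\<close>
definition lX0 :: real where
  "lX0 = ln (2 * pi * \<alpha>) + (\<Sum>\<nu>\<in>UNIV. 2 * \<kappa> \<nu> * ln (Q \<nu>) + (\<Sum>j<length (lam \<nu>). 2 * lk \<nu> j * ln (lk \<nu> j)))"

text \<open>\<open>H\<^sup>*\<^sub>l\<close> is the hyperplane \<open>Bf s = l - 1\<close>.\<close>
definition Bf :: "complex^'n \<Rightarrow> complex" where
  "Bf s = ((\<Sum>\<nu>\<in>UNIV. of_real (deg \<nu>)) - 1) / 2 - (\<Sum>\<nu>\<in>UNIV. of_real (deg \<nu>) * s $ \<nu>)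
     - \<i> * of_real (\<Sum>\<nu>\<in>UNIV. deg \<nu> * sel_theta (lam \<nu>) (mu \<nu>))"

definition Ex :: "complex^'n \<Rightarrow> 'n \<Rightarrow> complex" where
  "Ex s \<nu> = (1 - 2 * s $ \<nu>) * of_real (ln (Q \<nu>)) + (\<Sum>j<length (lam \<nu>).
     of_real (ln (lk \<nu> j)) * (num s \<nu> j - den s \<nu> j) - \<i> * of_real pi * (num s \<nu> j - 1/2))"

definition Ef :: "complex^'n \<Rightarrow> complex" where
  "Ef s = (\<Prod>\<nu>\<in>UNIV. om \<nu>) * exp (\<Sum>\<nu>\<in>UNIV. Ex s \<nu>)"

definition dual :: "complex^'n \<Rightarrow> complex \<Rightarrow> complex" where
  "dual s w = (\<Prod>\<nu>\<in>UNIV. cnj (Fc \<nu> (cnj (1 - (s $ \<nu> + of_real (\<kappa> \<nu>) * w)))))"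

lemma lam_pos: "j < length (lam \<nu>) \<Longrightarrow> lam \<nu> ! j > 0"
  using sel[of \<nu>] nth_mem unfolding selberg_sharp_def by blast

lemma lk_pos: "j < length (lam \<nu>) \<Longrightarrow> lk \<nu> j > 0"
  using lam_pos kappa_pos unfolding lk_def by simp

lemma deg_sum: "deg \<nu> = (\<Sum>j<length (lam \<nu>). 2 * lam \<nu> ! j)"
  unfolding sel_degree_def sum_list_sum_nth atLeast0LessThan sum_distrib_left ..

lemma lk_sum: "(\<Sum>\<nu>\<in>UNIV. \<Sum>j<length (lam \<nu>). 2 * lk \<nu> j) = 1"
  using kappa_sum unfolding deg_sum lk_def sum_distrib_right by (simp add: mult.assoc)

lemma num_holo: "holo_multi_on (\<lambda>s. num s \<nu> j) S"
  and den_holo: "holo_multi_on (\<lambda>s. den s \<nu> j) S"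
  unfolding num_def den_def by (intro holo_multi_intros)+

lemma Bf_holo: "holo_multi_on Bf S"
  unfolding Bf_def[abs_def] by (intro holo_multi_intros)

lemma Ef_holo: "holo_multi_on Ef S"
  unfolding Ef_def[abs_def] Ex_def by (intro holo_multi_intros num_holo den_holo)

lemma asym_X:
  assumes R: "R > 0"
  shows "asym (region R) K X"
proof -
  have nb: "norm (num s \<nu> j) < lam \<nu> ! j * (1 + R) + norm (mu \<nu> ! j) + 1"
    and db: "norm (den s \<nu> j) < lam \<nu> ! j * (1 + R) + norm (mu \<nu> ! j) + 1"
    if s: "s \<in> region R" and j: "j < length (lam \<nu>)" for s \<nu> j
  proof -
    have sR: "norm (s $ \<nu>) < R" using s by (simp add: region_def)
    have "norm (1 - s $ \<nu>) \<le> 1 + R" using norm_triangle_ineq4[of 1 "s $ \<nu>"] sR by simp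
    hence "lam \<nu> ! j * norm (1 - s $ \<nu>) \<le> lam \<nu> ! j * (1 + R)" using lam_pos[OF j] by (intro mult_left_mono) auto
    thus "norm (num s \<nu> j) < lam \<nu> ! j * (1 + R) + norm (mu \<nu> ! j) + 1"
      using norm_triangle_ineq[of "of_real (lam \<nu> ! j) * (1 - s $ \<nu>)" "cnj (mu \<nu> ! j)"] lam_pos[OF j]
      unfolding num_def norm_mult norm_of_real complex_mod_cnj by linarith
    have "lam \<nu> ! j * norm (s $ \<nu>) \<le> lam \<nu> ! j * (1 + R)" using lam_pos[OF j] sR by (intro mult_left_mono) auto
    thus "norm (den s \<nu> j) < lam \<nu> ! j * (1 + R) + norm (mu \<nu> ! j) + 1"
      using norm_triangle_ineq[of "of_real (lam \<nu> ! j) * s $ \<nu>" "mu \<nu> ! j"] lam_pos[OF j]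
      unfolding den_def norm_mult norm_of_real by linarith
  qed
  have rp: "0 < lam \<nu> ! j * (1 + R) + norm (mu \<nu> ! j) + 1" if "j < length (lam \<nu>)" for \<nu> j
    using lam_pos[OF that] R by (simp add: add_nonneg_pos)
  have 1: "asym (region R) K (\<lambda>s w. Gamma (of_real 1 * w + 0) * exp (- stir 1 0 w))"
    unfolding stir_def by (rule asym_Gamma(1)[where \<rho> = 1]) (auto intro: holo_multi_on_const)
  have 2: "asym (region R) K (\<lambda>s w. Gamma (of_real (- lk \<nu> j) * w + num s \<nu> j) * exp (- stir (- lk \<nu> j) (num s \<nu> j) w))"
    if j: "j < length (lam \<nu>)" for \<nu> j
    unfolding stir_def by (rule asym_Gamma(1)[OF _ num_holo nb[OF _ j] rp[OF j]]) (use lk_pos[OF j] in auto)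
  have 3: "asym (region R) K (\<lambda>s w. rGamma (of_real (lk \<nu> j) * w + den s \<nu> j) * exp (stir (lk \<nu> j) (den s \<nu> j) w))"
    if j: "j < length (lam \<nu>)" for \<nu> j
    unfolding stir_def by (rule asym_Gamma(2)[OF _ den_holo db[OF _ j] rp[OF j]]) (use lk_pos[OF j] in auto)
  show ?thesis unfolding X_def[abs_def] by (intro asym_mult[OF 1] asym_prod asym_mult 2 3) auto
qed

text \<open>This is where the exponent B(s) originates: it collects the coefficients of Ln w. The
  extra 1/2 is compensated by the -1/2 in the main term of Gamma(w).\<close>

lemma num_den_sum:
  "(\<Sum>\<nu>\<in>UNIV. \<Sum>j<length (lam \<nu>). num s \<nu> j - den s \<nu> j) = Bf s + 1 / 2"
proof -
  \<comment> \<open>If there are no Gamma factors, the degree is 0 and both sides vanish; otherwise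
    the division by the degree in \<open>sel_theta\<close> cancels.\<close>
  have th: "deg \<nu> * sel_theta (lam \<nu>) (mu \<nu>) = (\<Sum>j<length (lam \<nu>). 2 * Im (mu \<nu> ! j))" for \<nu>
  proof (cases "length (lam \<nu>) = 0")
    case True
    thus ?thesis by (simp add: sel_degree_def)
  next
    case False
    have "deg \<nu> > 0" unfolding deg_sum using False lam_pos by (intro sum_pos) auto
    moreover have "length (mu \<nu>) = length (lam \<nu>)" using sel[of \<nu>] unfolding selberg_sharp_def by blast
    ultimately show ?thesis by (simp add: sel_theta_def sel_xi_def flip: sum_distrib_left)
  qed
  have "num s \<nu> j - den s \<nu> j = of_real (2 * lam \<nu> ! j) / 2 - of_real (2 * lam \<nu> ! j) * s $ \<nu> - \<i> * of_real (2 * Im (mu \<nu> ! j))" for \<nu> j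
    unfolding num_def den_def by (simp add: complex_eq_iff algebra_simps)
  hence "(\<Sum>j<length (lam \<nu>). num s \<nu> j - den s \<nu> j) =
      of_real (deg \<nu>) / 2 - of_real (deg \<nu>) * s $ \<nu> - \<i> * of_real (deg \<nu> * sel_theta (lam \<nu>) (mu \<nu>))" for \<nu>
    unfolding th by (simp only: deg_sum of_real_sum sum_subtractf sum_divide_distrib sum_distrib_left sum_distrib_right)
  thus ?thesis unfolding Bf_def by (simp add: sum_subtractf sum_divide_distrib[symmetric] sum_distrib_left diff_divide_distrib)
qed

text \<open>The functional equations trade the values of F for \<open>dual\<close>, and each Gamma
  factor is split into its Stirling main term and a part collected in \<open>X\<close>. In the sum
  of the main terms w Ln w, the linear w and i pi/2 w all cancel, because the weights sum to 1 and z
  has argument pi/2 - eps. There remain a real multiple of w, the power w^(Bf s) and the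
  damping.\<close>

lemma Phi_factor:
  assumes w: "Im w > 0" and im: "\<And>\<nu>. Im (s $ \<nu> + of_real (\<kappa> \<nu>) * w) \<noteq> 0"
    and im2: "\<And>\<nu> j. j < length (lam \<nu>) \<Longrightarrow> lam \<nu> ! j * Im (s $ \<nu> + of_real (\<kappa> \<nu>) * w) + Im (mu \<nu> ! j) \<noteq> 0"
  shows "\<Phi> \<epsilon> s w = X s w * dual s w * Ef s * exp (- w * of_real lX0) * w powr Bf s * exp (\<i> * of_real \<epsilon> * w)"
proof -
  have w0: "w \<noteq> 0" using w by auto
  let ?z = "\<lambda>\<nu>. s $ \<nu> + of_real (\<kappa> \<nu>) * w"
  let ?du = "\<lambda>\<nu>. cnj (Fc \<nu> (cnj (1 - ?z \<nu>)))"
  let ?Y = "\<lambda>\<nu> j. (Gamma (of_real (- lk \<nu> j) * w + num s \<nu> j) * exp (- stir (- lk \<nu> j) (num s \<nu> j) w)) *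
     (rGamma (of_real (lk \<nu> j) * w + den s \<nu> j) * exp (stir (lk \<nu> j) (den s \<nu> j) w))"
  let ?S = "\<lambda>\<nu> j. stir (- lk \<nu> j) (num s \<nu> j) w - stir (lk \<nu> j) (den s \<nu> j) w"
  have F: "Fc \<nu> (?z \<nu>) = om \<nu> * ?du \<nu> * (\<Prod>j<length (lam \<nu>). ?Y \<nu> j) * exp ((1 - 2 * ?z \<nu>) * of_real (ln (Q \<nu>)) + (\<Sum>j<length (lam \<nu>). ?S \<nu> j))" for \<nu>
  proof -
    have *: "Gamma (of_real (lam \<nu> ! j) * (1 - ?z \<nu>) + cnj (mu \<nu> ! j)) * rGamma (of_real (lam \<nu> ! j) * ?z \<nu> + mu \<nu> ! j)
      = ?Y \<nu> j * exp (?S \<nu> j)" for j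
    proof -
      have "of_real (lam \<nu> ! j) * (1 - ?z \<nu>) + cnj (mu \<nu> ! j) = of_real (- lk \<nu> j) * w + num s \<nu> j"
        "of_real (lam \<nu> ! j) * ?z \<nu> + mu \<nu> ! j = of_real (lk \<nu> j) * w + den s \<nu> j"
        unfolding lk_def num_def den_def by (simp_all add: algebra_simps)
      moreover have "exp (?S \<nu> j) = exp (stir (- lk \<nu> j) (num s \<nu> j) w) * exp (- stir (lk \<nu> j) (den s \<nu> j) w)"
        by (simp add: exp_add[symmetric])
      moreover have "g * r = (g * exp (- x)) * (r * exp y) * (exp x * exp (- y))" for g r x y :: complex
        by (simp add: exp_minus field_simps)
      ultimately show ?thesis by presburger
    qed
    have "Fc \<nu> (?z \<nu>) = om \<nu> * exp ((1 - 2 * ?z \<nu>) * of_real (ln (Q \<nu>))) * (\<Prod>j<length (lam \<nu>).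
       Gamma (of_real (lam \<nu> ! j) * (1 - ?z \<nu>) + cnj (mu \<nu> ! j)) * rGamma (of_real (lam \<nu> ! j) * ?z \<nu> + mu \<nu> ! j)) * ?du \<nu>"
      by (rule selberg_functional_equation[OF sel im]) (rule im2)
    also have "\<dots> = om \<nu> * ?du \<nu> * (\<Prod>j<length (lam \<nu>). ?Y \<nu> j) * exp ((1 - 2 * ?z \<nu>) * of_real (ln (Q \<nu>)) + (\<Sum>j<length (lam \<nu>). ?S \<nu> j))"
      unfolding * prod.distrib[of _ "\<lambda>j. exp (?S \<nu> j)"] exp_add exp_sum[OF finite_lessThan] by (simp only: mult_ac)
    finally show ?thesis .
  qed
  have S: "(\<Sum>\<nu>\<in>UNIV. (1 - 2 * ?z \<nu>) * of_real (ln (Q \<nu>)) + (\<Sum>j<length (lam \<nu>). ?S \<nu> j)) =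
     (\<Sum>\<nu>\<in>UNIV. Ex s \<nu>) + w * of_real (ln (2 * pi * \<alpha>) - lX0) + (w + \<i> * of_real pi / 2 * w - Ln w * w) + Ln w * (Bf s + 1/2)"
  proof -
    have "(1 - 2 * ?z \<nu>) * of_real (ln (Q \<nu>)) + (\<Sum>j<length (lam \<nu>). ?S \<nu> j) =
      Ex s \<nu> + w * of_real (- (2 * \<kappa> \<nu> * ln (Q \<nu>) + (\<Sum>j<length (lam \<nu>). 2 * lk \<nu> j * ln (lk \<nu> j)))) +
      (w + \<i> * of_real pi / 2 * w - Ln w * w) * of_real (\<Sum>j<length (lam \<nu>). 2 * lk \<nu> j) +
      Ln w * (\<Sum>j<length (lam \<nu>). num s \<nu> j - den s \<nu> j)" for \<nu>
    proof -
      have "(\<Sum>j<length (lam \<nu>). ?S \<nu> j) = (\<Sum>j<length (lam \<nu>).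
        (of_real (ln (lk \<nu> j)) * (num s \<nu> j - den s \<nu> j) - \<i> * of_real pi * (num s \<nu> j - 1/2)) + w * of_real (- (2 * lk \<nu> j * ln (lk \<nu> j))) +
        (w + \<i> * of_real pi / 2 * w - Ln w * w) * of_real (2 * lk \<nu> j) + Ln w * (num s \<nu> j - den s \<nu> j))"
        by (intro sum.cong refl stir_quotient[OF w] lk_pos) simp
      also have "\<dots> = (\<Sum>j<length (lam \<nu>). of_real (ln (lk \<nu> j)) * (num s \<nu> j - den s \<nu> j) - \<i> * of_real pi * (num s \<nu> j - 1/2)) +
         w * of_real (- (\<Sum>j<length (lam \<nu>). 2 * lk \<nu> j * ln (lk \<nu> j))) +
        (w + \<i> * of_real pi / 2 * w - Ln w * w) * of_real (\<Sum>j<length (lam \<nu>). 2 * lk \<nu> j) + Ln w * (\<Sum>j<length (lam \<nu>). num s \<nu> j - den s \<nu> j)"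
        unfolding sum_affine sum_negf ..
      finally show ?thesis unfolding Ex_def by (simp add: algebra_simps)
    qed
    hence "(\<Sum>\<nu>\<in>UNIV. (1 - 2 * ?z \<nu>) * of_real (ln (Q \<nu>)) + (\<Sum>j<length (lam \<nu>). ?S \<nu> j)) = (\<Sum>\<nu>\<in>UNIV. Ex s \<nu>) +
      w * of_real (\<Sum>\<nu>\<in>UNIV. - (2 * \<kappa> \<nu> * ln (Q \<nu>) + (\<Sum>j<length (lam \<nu>). 2 * lk \<nu> j * ln (lk \<nu> j)))) +
      (w + \<i> * of_real pi / 2 * w - Ln w * w) * of_real (\<Sum>\<nu>\<in>UNIV. \<Sum>j<length (lam \<nu>). 2 * lk \<nu> j) +
      Ln w * (\<Sum>\<nu>\<in>UNIV. \<Sum>j<length (lam \<nu>). num s \<nu> j - den s \<nu> j)" by (simp only: sum_affine)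
    thus ?thesis unfolding num_den_sum lk_sum sum_negf lX0_def by simp
  qed
  have G: "Gamma w = (Gamma (of_real 1 * w + 0) * exp (- stir 1 0 w)) * exp (stir 1 0 w)" by (simp add: exp_minus field_simps)
  have "P s w = (\<Prod>\<nu>\<in>UNIV. om \<nu>) * dual s w * (\<Prod>\<nu>\<in>UNIV. \<Prod>j<length (lam \<nu>). ?Y \<nu> j) *
     exp (\<Sum>\<nu>\<in>UNIV. (1 - 2 * ?z \<nu>) * of_real (ln (Q \<nu>)) + (\<Sum>j<length (lam \<nu>). ?S \<nu> j))"
    unfolding P_def dual_def exp_sum[OF finite_class.finite_UNIV] F prod.distrib ..
  hence "\<Phi> \<epsilon> s w = X s w * dual s w * (\<Prod>\<nu>\<in>UNIV. om \<nu>) *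
     exp ((\<Sum>\<nu>\<in>UNIV. (1 - 2 * ?z \<nu>) * of_real (ln (Q \<nu>)) + (\<Sum>j<length (lam \<nu>). ?S \<nu> j)) + stir 1 0 w + (- w * ex \<epsilon>))"
    unfolding \<Phi>_def X_def exp_add by (subst G) (simp only: mult_ac)
  also have "(\<Sum>\<nu>\<in>UNIV. (1 - 2 * ?z \<nu>) * of_real (ln (Q \<nu>)) + (\<Sum>j<length (lam \<nu>). ?S \<nu> j)) + stir 1 0 w + (- w * ex \<epsilon>) =
     (\<Sum>\<nu>\<in>UNIV. Ex s \<nu>) + (- w * of_real lX0) + Bf s * Ln w + \<i> * of_real \<epsilon> * w"
    unfolding S unfolding stir_def ex_def by (simp add: algebra_simps)
  finally show ?thesis unfolding Ef_def powr_def using w0 by (simp only: exp_add mult_ac if_False)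
qed

lemma Bf_bounded: "R > 0 \<Longrightarrow> \<exists>Bm. Bm > 0 \<and> (\<forall>s\<in>region R. norm (Bf s) < Bm)"
proof -
  assume R: "R > 0"
  let ?c = "((\<Sum>\<nu>\<in>UNIV. of_real (deg \<nu>)) - 1) / 2 - \<i> * of_real (\<Sum>\<nu>\<in>UNIV. deg \<nu> * sel_theta (lam \<nu>) (mu \<nu>)) :: complex"
  have "norm (Bf s) < norm ?c + (\<Sum>\<nu>\<in>UNIV. \<bar>deg \<nu>\<bar> * R) + 1" if s: "s \<in> region R" for s
  proof -
    have "norm (s $ \<nu>) \<le> R" for \<nu> using s less_imp_le unfolding region_def by blast
    hence "norm (\<Sum>\<nu>\<in>UNIV. of_real (deg \<nu>) * s $ \<nu>) \<le> (\<Sum>\<nu>\<in>UNIV. \<bar>deg \<nu>\<bar> * R)"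
      by (intro sum_norm_le) (auto simp: norm_mult intro!: mult_left_mono)
    moreover have eq: "Bf s = ?c - (\<Sum>\<nu>\<in>UNIV. of_real (deg \<nu>) * s $ \<nu>)" unfolding Bf_def by simp
    ultimately show ?thesis unfolding eq using norm_triangle_ineq4[of ?c "\<Sum>\<nu>\<in>UNIV. of_real (deg \<nu>) * s $ \<nu>"] by linarith
  qed
  moreover have "norm ?c + (\<Sum>\<nu>\<in>UNIV. \<bar>deg \<nu>\<bar> * R) + 1 > 0"
    using R by (intro add_nonneg_pos add_nonneg_nonneg sum_nonneg mult_nonneg_nonneg) auto
  ultimately show ?thesis by blast
qed

text \<open>The coefficients of \<open>dual s w\<close> as a series in \<open>exp (w * ln (freq n))\<close>; \<open>bb\<close> is their common majorant.\<close>
definition cc :: "complex^'n \<Rightarrow> nat^'n \<Rightarrow> complex" where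
  "cc s n = (\<Prod>\<nu>\<in>UNIV. cnj (a \<nu> (n $ \<nu>)) / of_nat (n $ \<nu>) powr (1 - s $ \<nu>))"

definition bb :: "nat^'n \<Rightarrow> real" where "bb n = norm (coef (\<chi> \<nu>. 2) n)"

lemma bb_integrable: "integrable (count_space pos_vecs) bb"
  unfolding bb_def[abs_def] by (intro integrable_norm coef_series(1)) simp

lemma bb_nonneg: "bb n \<ge> 0" by (simp add: bb_def)

lemma cc_shift:
  assumes "n \<in> pos_vecs"
  shows "(\<Prod>\<nu>\<in>UNIV. cnj (a \<nu> (n $ \<nu>)) / of_nat (n $ \<nu>) powr (1 - (s $ \<nu> + of_real (\<kappa> \<nu>) * w))) = cc s n * exp (w * of_real (ln (freq n)))"
  using dirichlet_term_shift[OF assms, of "\<lambda>\<nu>. cnj (a \<nu> (n $ \<nu>))" "\<lambda>\<nu>. 1 - s $ \<nu>" "- w"]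
  unfolding cc_def by (simp add: diff_diff_eq)

text \<open>On Re w = -c the exponent of n_nu is 1 + kappa_nu c - Re s_nu, which exceeds 2 for every
  s of the polydisc; hence one absolutely convergent majorant serves all s.\<close>

lemma cc_bound:
  assumes n: "n \<in> pos_vecs" and s: "s \<in> region R" and kc: "\<And>\<nu>. \<kappa> \<nu> * c \<ge> R + 3"
  shows "norm (cc s n) * exp (- c * ln (freq n)) \<le> bb n"
proof -
  have n1: "n $ \<nu> \<ge> 1" for \<nu> using n by (simp add: pos_vecs_def)
  have "norm (cc s n) * exp (- c * ln (freq n)) = norm (cc s n * exp (of_real (- c) * of_real (ln (freq n))))"
    by (simp add: norm_mult)
  also have "\<dots> = (\<Prod>\<nu>\<in>UNIV. norm (a \<nu> (n $ \<nu>)) / real (n $ \<nu>) powr (1 + \<kappa> \<nu> * c - Re (s $ \<nu>)))"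
    unfolding cc_shift[OF n, symmetric] prod_norm[symmetric] norm_divide norm_of_nat_powr by (simp add: diff_diff_eq2 add_diff_eq)
  also have "\<dots> \<le> (\<Prod>\<nu>\<in>UNIV. norm (a \<nu> (n $ \<nu>)) / real (n $ \<nu>) powr 2)"
  proof (intro prod_mono conjI)
    fix \<nu>
    have "norm (s $ \<nu>) < R" using s by (simp add: region_def)
    hence "1 + \<kappa> \<nu> * c - Re (s $ \<nu>) \<ge> 2" using kc[of \<nu>] complex_Re_le_cmod[of "s $ \<nu>"] by linarith
    thus "norm (a \<nu> (n $ \<nu>)) / real (n $ \<nu>) powr (1 + \<kappa> \<nu> * c - Re (s $ \<nu>)) \<le> norm (a \<nu> (n $ \<nu>)) / real (n $ \<nu>) powr 2"
      using n1[of \<nu>] by (intro divide_left_mono powr_mono mult_pos_pos) (auto simp: powr_gt_zero)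
  qed auto
  also have "\<dots> = bb n" unfolding bb_def coef_def prod_norm[symmetric] norm_divide norm_of_nat_powr by simp
  finally show ?thesis .
qed

lemma dual_series:
  assumes s: "s \<in> region R" and kc: "\<And>\<nu>. \<kappa> \<nu> * c \<ge> R + 3" and w: "Re w = - c"
  shows "(LINT n|count_space pos_vecs. cc s n * exp (w * of_real (ln (freq n)))) = dual s w"
proof -
  have "Re (1 - (s $ \<nu> + of_real (\<kappa> \<nu>) * w)) > 1" for \<nu>
  proof -
    have "norm (s $ \<nu>) < R" using s by (simp add: region_def)
    thus ?thesis using kc[of \<nu>] complex_Re_le_cmod[of "s $ \<nu>"] w by simp
  qed
  note re = this
  have "dual s w = (LINT n|count_space pos_vecs. (\<Prod>\<nu>\<in>UNIV. cnj (a \<nu> (n $ \<nu>)) / of_nat (n $ \<nu>) powr (1 - (s $ \<nu> + of_real (\<kappa> \<nu>) * w))))"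
    unfolding dual_def selberg_dual_series(2)[OF sel re, symmetric]
    by (intro prod_series(2)[symmetric] selberg_dual_series(1)[OF sel re])
  also have "\<dots> = (LINT n|count_space pos_vecs. cc s n * exp (w * of_real (ln (freq n))))"
    by (intro Bochner_Integration.integral_cong refl cc_shift) simp
  finally show ?thesis ..
qed

lemma cc_holo: "holo_multi_on (\<lambda>s. cc s n) S" if n: "n \<in> pos_vecs"
proof -
  have "(of_nat (n $ \<nu>) :: complex) = 0 \<longleftrightarrow> False" for \<nu> using n by (auto simp: pos_vecs_def Suc_le_eq)
  hence "cc s n = (\<Prod>\<nu>\<in>UNIV. cnj (a \<nu> (n $ \<nu>)) * exp (- ((1 - s $ \<nu>) * Ln (of_nat (n $ \<nu>)))))" for s
    by (simp only: cc_def powr_def if_False exp_minus divide_inverse)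
  thus ?thesis by (simp only:) (intro holo_multi_intros)
qed

lemma dual_holo:
  assumes "\<And>s \<nu>. s \<in> S \<Longrightarrow> s $ \<nu> + of_real (\<kappa> \<nu>) * w \<noteq> 0"
  shows "holo_multi_on (\<lambda>s. dual s w) S"
  and "(\<And>w \<nu>. w \<in> W \<Longrightarrow> s $ \<nu> + of_real (\<kappa> \<nu>) * w \<noteq> 0) \<Longrightarrow> dual s holomorphic_on W"
proof -
  have h: "1 - x \<in> - {1}" if "x \<noteq> 0" for x :: complex using that by simp
  have F: "(cnj \<circ> Fc \<nu> \<circ> cnj) holomorphic_on - {1}" for \<nu>
  proof (rule holomorphic_on_compose_cnj_cnj)
    have "cnj ` (- {1}) \<subseteq> UNIV - {1}" by auto
    thus "Fc \<nu> holomorphic_on cnj ` (- {1})"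
      using sel[of \<nu>] holomorphic_on_subset unfolding selberg_sharp_def by blast
  qed auto
  show "holo_multi_on (\<lambda>s. dual s w) S"
    unfolding dual_def
  proof (rule holo_multi_on_prod)
    fix \<nu>
    have "holo_multi_on (\<lambda>s. (cnj \<circ> Fc \<nu> \<circ> cnj) (1 - (s $ \<nu> + of_real (\<kappa> \<nu>) * w))) S"
    proof (rule holo_multi_on_compose[OF _ F])
      show "(\<lambda>s. 1 - (s $ \<nu> + of_real (\<kappa> \<nu>) * w)) ` S \<subseteq> - {1}" by (intro image_subsetI h assms)
    qed (auto intro!: holo_multi_intros)
    thus "holo_multi_on (\<lambda>s. cnj (Fc \<nu> (cnj (1 - (s $ \<nu> + of_real (\<kappa> \<nu>) * w))))) S" by (simp only: o_def)
  qed
  assume W: "\<And>w \<nu>. w \<in> W \<Longrightarrow> s $ \<nu> + of_real (\<kappa> \<nu>) * w \<noteq> 0"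
  have "(\<lambda>w. (cnj \<circ> Fc \<nu> \<circ> cnj) (1 - (s $ \<nu> + of_real (\<kappa> \<nu>) * w))) holomorphic_on W" for \<nu>
  proof -
    have 1: "(\<lambda>w. 1 - (s $ \<nu> + of_real (\<kappa> \<nu>) * w)) holomorphic_on W" by (intro holomorphic_intros)
    have 2: "(\<lambda>w. 1 - (s $ \<nu> + of_real (\<kappa> \<nu>) * w)) ` W \<subseteq> - {1}" by (intro image_subsetI h W)
    show ?thesis using holomorphic_on_compose_gen[OF 1 F 2] by (simp only: o_def)
  qed
  thus "dual s holomorphic_on W" unfolding dual_def[abs_def] o_def by (intro holomorphic_on_prod)
qed

end

text \<open>\<open>ReB\<close> is tuned to the truncation order: |w^(Bf s)| |w|^(-K) is O(|w|^(-2))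
  on the tail. \<open>mu_T\<close> keeps the Gamma arguments of the functional equation off the real
  axis for Im w >= T. \<open>X_expansion\<close> starts at |w| >= T and therefore covers the entire
  tail.\<close>

locale multi_selberg_tail = multi_selberg_region a Fc Q lam mu om \<kappa> \<alpha> R c T
  for a :: "'n::finite \<Rightarrow> nat \<Rightarrow> complex" and Fc Q lam mu om \<kappa> \<alpha> R c T +
  fixes K :: nat and ck :: "nat \<Rightarrow> complex^'n \<Rightarrow> complex" and Cx :: real
  assumes ReB: "\<And>s. s \<in> region R \<Longrightarrow> Re (Bf s) \<le> real K - 2"
    and ck_holo: "\<And>k. holo_multi_on (ck k) (region R)"
    and Cx: "Cx \<ge> 0"
    and ck_bound: "\<And>k s. k < K \<Longrightarrow> s \<in> region R \<Longrightarrow> norm (ck k s) \<le> Cx"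
    and X_expansion: "\<And>s w. s \<in> region R \<Longrightarrow> 4 * \<bar>Re w\<bar> \<le> Im w \<Longrightarrow> norm w \<ge> T \<Longrightarrow>
      norm (X s w - (\<Sum>k<K. ck k s / w ^ k)) \<le> Cx / norm w ^ K"
    and mu_T: "\<And>\<nu> j. j < length (lam \<nu>) \<Longrightarrow> lam \<nu> ! j * (\<kappa> \<nu> * T - R) > \<bar>Im (mu \<nu> ! j)\<bar>"
begin

sublocale tl: tail_line c T
  by unfold_locales (use c T4 in auto)

text \<open>The logarithm of x_n, the quotient of alpha by alpha_n; exp(-w lx n) is the oscillating
  factor of the n-th dual term.\<close>

definition lx :: "nat^'n \<Rightarrow> real" where "lx n = lX0 - ln (freq n)"

definition Mf :: "nat \<Rightarrow> complex^'n \<Rightarrow> complex \<Rightarrow> complex" where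
  "Mf k s w = dual s w * exp (- w * of_real lX0) * w powr (Bf s - of_nat k)"

text \<open>The error left by the truncated expansion. Dividing by the zero-free factor
  \<open>Ef s\<close> lets \<open>Rm_factor\<close> express it through the error of \<open>X\<close>
  alone.\<close>

definition Rm :: "complex^'n \<Rightarrow> real \<Rightarrow> complex" where
  "Rm s t = \<Phi> 0 s (tl.line_pt t) / Ef s - (\<Sum>k<K. ck k s * Mf k s (tl.line_pt t))"

lemma Ef_nz: "Ef s \<noteq> 0"
proof -
  have "om \<nu> \<noteq> 0" for \<nu> using sel[of \<nu>] unfolding selberg_sharp_def by force
  thus ?thesis unfolding Ef_def by simp
qed

lemma tail_arg:
  assumes s: "s \<in> D" and t: "t \<ge> T"
  shows "\<bar>Im (s $ \<nu> + of_real (\<kappa> \<nu>) * tl.line_pt t)\<bar> \<ge> 1"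
  by (rule arg_Im_ge[OF s]) (use t T4 in simp)

lemma tail_cone: "t \<ge> T \<Longrightarrow> 4 * \<bar>Re (tl.line_pt t)\<bar> \<le> Im (tl.line_pt t)"
  using T c by simp

lemma Phi_tail:
  assumes s: "s \<in> D" and t: "t \<ge> T"
  defines "w \<equiv> tl.line_pt t"
  shows "\<Phi> \<epsilon> s w = X s w * dual s w * Ef s * exp (- w * of_real lX0) * w powr Bf s * exp (\<i> * of_real \<epsilon> * w)"
proof (rule Phi_factor)
  show "Im w > 0" using t T4 by (simp add: w_def)
  show "Im (s $ \<nu> + of_real (\<kappa> \<nu>) * w) \<noteq> 0" for \<nu> using tail_arg[OF s t, of \<nu>] unfolding w_def by linarith
  show "lam \<nu> ! j * Im (s $ \<nu> + of_real (\<kappa> \<nu>) * w) + Im (mu \<nu> ! j) \<noteq> 0" if j: "j < length (lam \<nu>)" for \<nu> j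
  proof -
    have "\<kappa> \<nu> * T \<le> \<kappa> \<nu> * t" using t kappa_pos[of \<nu>] by simp
    hence "\<kappa> \<nu> * T - R \<le> Im (s $ \<nu> + of_real (\<kappa> \<nu>) * w)" using D_coord(3)[OF s, of \<nu>] by (simp add: w_def)
    from mult_left_mono[OF this less_imp_le[OF lam_pos[OF j]]] show ?thesis using mu_T[OF j] by linarith
  qed
qed

lemma dual_bound:
  assumes s: "s \<in> D"
  shows "norm (dual s (tl.line_pt t)) \<le> (LINT n|count_space pos_vecs. bb n)"
proof -
  let ?f = "\<lambda>n. cc s n * exp (tl.line_pt t * of_real (ln (freq n)))"
  have le: "norm (?f n) \<le> bb n" if "n \<in> pos_vecs" for n
    using cc_bound[OF that s kc] by (simp add: norm_mult)
  have int: "integrable (count_space pos_vecs) ?f"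
    by (rule Bochner_Integration.integrable_bound[OF bb_integrable]) (use le in \<open>auto intro!: AE_I2 order_trans[OF _ abs_ge_self]\<close>)
  have "norm (LINT n|count_space pos_vecs. ?f n) \<le> (LINT n|count_space pos_vecs. norm (?f n))" by (rule integral_norm_bound)
  also have "\<dots> \<le> (LINT n|count_space pos_vecs. bb n)"
    by (intro integral_mono integrable_norm int bb_integrable le) simp
  finally have "norm (LINT n|count_space pos_vecs. ?f n) \<le> (LINT n|count_space pos_vecs. bb n)" .
  thus ?thesis using dual_series[OF s kc, of "tl.line_pt t"] by simp
qed

lemma Rm_factor:
  assumes s: "s \<in> D" and t: "t \<ge> T"
  defines "w \<equiv> tl.line_pt t"
  shows "Rm s t = dual s w * exp (- w * of_real lX0) * w powr Bf s * (X s w - (\<Sum>k<K. ck k s / w ^ k))"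
proof -
  have w: "w \<noteq> 0" unfolding w_def by (rule tl.line_pt_nz)
  have "Mf k s w = dual s w * exp (- w * of_real lX0) * w powr Bf s * (1 / w ^ k)" for k
    unfolding Mf_def powr_diff using w by (simp add: powr_nat)
  hence "Rm s t = dual s w * exp (- w * of_real lX0) * w powr Bf s * X s w - (\<Sum>k<K. dual s w * exp (- w * of_real lX0) * w powr Bf s * (ck k s / w ^ k))"
    unfolding Rm_def w_def[symmetric] Phi_tail[OF s t, folded w_def] using Ef_nz[of s] by (simp add: field_simps)
  thus ?thesis by (simp only: sum_distrib_left right_diff_distrib)
qed

lemma Rm_bound: "\<exists>C. \<forall>s\<in>D. \<forall>t\<ge>T. norm (Rm s t) \<le> C * (1 / t ^ 2)"
proof -
  obtain Bm where Bm: "Bm > 0" "\<And>s. s \<in> D \<Longrightarrow> norm (Bf s) < Bm" using Bf_bounded[OF R] by blast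
  let ?S = "LINT n|count_space pos_vecs. bb n"
  have S0: "?S \<ge> 0" by (simp add: bb_nonneg)
  have "norm (Rm s t) \<le> (?S * exp (c * lX0) * exp (pi * Bm) * Cx) * (1 / t ^ 2)" if s: "s \<in> D" and t: "t \<ge> T" for s t
  proof -
    define w where "w = tl.line_pt t"
    have w: "w \<noteq> 0" unfolding w_def by (rule tl.line_pt_nz)
    have t0: "t \<ge> 1" using t T4 by simp
    have wt: "norm w \<ge> t" unfolding w_def using t0 by (intro tl.norm_line_pt_ge) simp
    have 1: "norm (dual s w) \<le> ?S" unfolding w_def by (rule dual_bound[OF s])
    have 2: "norm (exp (- w * of_real lX0)) = exp (c * lX0)" by (simp add: w_def)
    have "\<bar>Im (Bf s)\<bar> \<le> Bm" using abs_Im_le_cmod[of "Bf s"] Bm(2)[OF s] by linarith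
    hence 3: "norm (w powr Bf s) \<le> norm w powr Re (Bf s) * exp (pi * Bm)"
      by (intro order_trans[OF norm_powr_upper_le[OF w]] mult_left_mono) auto
    have 4: "norm (X s w - (\<Sum>k<K. ck k s / w ^ k)) \<le> Cx / norm w ^ K"
      by (rule X_expansion[OF s]) (use tail_cone[OF t] wt t in \<open>auto simp: w_def[symmetric]\<close>)
    have 5: "norm w powr Re (Bf s) / norm w ^ K \<le> 1 / t ^ 2"
    proof -
      have "norm w powr Re (Bf s) / norm w ^ K = norm w powr (Re (Bf s) - real K)"
        using w by (simp add: powr_diff powr_realpow)
      also have "\<dots> \<le> norm w powr (- 2)" using ReB[OF s] wt t0 by (intro powr_mono) auto
      also have "\<dots> = 1 / norm w ^ 2" using w by (simp add: powr_minus powr_numeral divide_inverse)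
      also have "\<dots> \<le> 1 / t ^ 2" using wt t0 by (intro divide_left_mono power_mono mult_pos_pos zero_less_power) auto
      finally show ?thesis .
    qed
    have "norm (Rm s t) = norm (dual s w) * exp (c * lX0) * norm (w powr Bf s) * norm (X s w - (\<Sum>k<K. ck k s / w ^ k))"
      unfolding Rm_factor[OF s t, folded w_def] norm_mult 2 ..
    also have "\<dots> \<le> ?S * exp (c * lX0) * (norm w powr Re (Bf s) * exp (pi * Bm)) * (Cx / norm w ^ K)"
      by (intro mult_mono 1 3 4 order_refl mult_nonneg_nonneg norm_ge_zero S0) auto
    also have "\<dots> = (?S * exp (c * lX0) * exp (pi * Bm) * Cx) * (norm w powr Re (Bf s) / norm w ^ K)" by simp
    also have "\<dots> \<le> (?S * exp (c * lX0) * exp (pi * Bm) * Cx) * (1 / t ^ 2)"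
      by (rule mult_left_mono[OF 5]) (intro mult_nonneg_nonneg S0 Cx exp_ge_zero)
    finally show ?thesis .
  qed
  thus ?thesis by blast
qed

lemma Mf_continuous:
  assumes s: "s \<in> D"
  shows "continuous_on {T..} (\<lambda>t. Mf k s (tl.line_pt t))"
proof -
  have dh: "dual s holomorphic_on {w. Im w \<ge> T}"
  proof (rule dual_holo(2)[of "{}"])
    fix w \<nu> assume w: "w \<in> {w. Im w \<ge> T}"
    have "\<bar>Im (s $ \<nu> + of_real (\<kappa> \<nu>) * w)\<bar> \<ge> 1" by (rule arg_Im_ge[OF s]) (use w T4 in auto)
    thus "s $ \<nu> + of_real (\<kappa> \<nu>) * w \<noteq> 0" by (intro notI) simp
  qed simp
  have "continuous_on {T..} (\<lambda>t. dual s (tl.line_pt t))"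
    by (rule continuous_on_compose2[OF holomorphic_on_imp_continuous_on[OF dh] tl.continuous_line_pt]) auto
  from continuous_on_mult[OF this tl.continuous_integrand[of "of_real lX0" "Bf s - of_nat k"]]
  show ?thesis unfolding Mf_def by (simp add: mult.assoc mult.commute[of _ "of_real lX0"])
qed

lemma Rm_continuous:
  assumes "s \<in> D" shows "continuous_on {T..} (Rm s)"
  unfolding Rm_def[abs_def] using Phi_continuous_tail[of s 1 0] Ef_nz assms
  by (intro continuous_intros Mf_continuous) (simp_all add: tl.line_pt_def)

lemma Rm_holo: "t \<ge> T \<Longrightarrow> holo_multi_on (\<lambda>s. Rm s t) D"
proof -
  assume t: "t \<ge> T"
  have "holo_multi_on (\<lambda>s. \<Phi> 0 s (tl.line_pt t)) D"
  proof (rule Phi_holo_multi)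
    fix s \<nu> assume "s \<in> D"
    from tail_arg[OF this t, of \<nu>] show "s $ \<nu> + of_real (\<kappa> \<nu>) * tl.line_pt t \<noteq> 1" by (intro notI) simp
  qed
  moreover have "holo_multi_on (\<lambda>s. dual s (tl.line_pt t)) D"
  proof (rule dual_holo(1))
    fix s \<nu> assume "s \<in> D"
    from tail_arg[OF this t, of \<nu>] show "s $ \<nu> + of_real (\<kappa> \<nu>) * tl.line_pt t \<noteq> 0" by (intro notI) simp
  qed
  ultimately show ?thesis
    unfolding Rm_def Mf_def powr_def using tl.line_pt_nz Ef_nz
    by (simp only: if_False) (intro holo_multi_intros holo_multi_on_divide Ef_holo ck_holo Bf_holo)
qed

definition Rem :: "complex^'n \<Rightarrow> complex" where "Rem s = (LINT t:{T..}|lborel. Rm s t)"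

lemma Rem_holo: "holo_multi_on Rem D"
proof -
  obtain C where C: "\<And>s t. s \<in> D \<Longrightarrow> t \<ge> T \<Longrightarrow> norm (Rm s t) \<le> C * (1 / t ^ 2)" using Rm_bound by blast
  show ?thesis unfolding Rem_def[abs_def]
  proof (rule holo_multi_on_set_integral[OF open_region])
    show "holo_multi_on (\<lambda>s. Rm s t) D" if "t \<in> {T..}" for t using that by (intro Rm_holo) simp
    show "set_borel_measurable lborel {T..} (Rm s)" if "s \<in> D" for s
      unfolding set_borel_measurable_def
      using borel_measurable_continuous_on_indicator[OF _ Rm_continuous[OF that]] by simp
    show "\<exists>e>0. \<exists>g. set_integrable lborel {T..} g \<and> (\<forall>s\<in>ball p e \<inter> D. \<forall>t\<in>{T..}. norm (Rm s t) \<le> g t)" for p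
      using C tl.set_integrable_inv_sq[of C] by (intro exI[of _ "1::real"] conjI exI[of _ "\<lambda>t. C * (1 / t ^ 2)"]) auto
  qed
qed

lemma norm_damping: "norm (exp (\<i> * of_real \<epsilon> * tl.line_pt t)) = exp (- \<epsilon> * t)" by simp

lemma Rem_damped:
  assumes s: "s \<in> D"
  shows "\<epsilon> \<ge> 0 \<Longrightarrow> set_integrable lborel {T..} (\<lambda>t. Rm s t * exp (\<i> * of_real \<epsilon> * tl.line_pt t))"
    and "((\<lambda>\<epsilon>. LINT t:{T..}|lborel. Rm s t * exp (\<i> * of_real \<epsilon> * tl.line_pt t)) \<longlongrightarrow> Rem s) (at_right 0)"
proof -
  obtain C where C: "\<And>s t. s \<in> D \<Longrightarrow> t \<ge> T \<Longrightarrow> norm (Rm s t) \<le> C * (1 / t ^ 2)" using Rm_bound by blast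
  have bd: "norm (Rm s t * exp (\<i> * of_real \<epsilon> * tl.line_pt t)) \<le> C * (1 / t ^ 2)" if "t \<in> {T..}" "\<epsilon> \<ge> 0" for t \<epsilon>
  proof -
    have "exp (- \<epsilon> * t) \<le> 1" using that T4 by simp
    hence "norm (Rm s t) * exp (- \<epsilon> * t) \<le> norm (Rm s t)" by (intro mult_left_le) auto
    thus ?thesis using C[OF s, of t] that unfolding norm_mult norm_damping by auto
  qed
  show "set_integrable lborel {T..} (\<lambda>t. Rm s t * exp (\<i> * of_real \<epsilon> * tl.line_pt t))" if "\<epsilon> \<ge> 0"
  proof (rule set_integrable_bound[OF tl.set_integrable_inv_sq[of C]])
    have "continuous_on {T..} (\<lambda>t. Rm s t * exp (\<i> * of_real \<epsilon> * tl.line_pt t))"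
      by (intro continuous_intros Rm_continuous[OF s] tl.continuous_line_pt)
    thus "set_borel_measurable lborel {T..} (\<lambda>t. Rm s t * exp (\<i> * of_real \<epsilon> * tl.line_pt t))"
      unfolding set_borel_measurable_def using borel_measurable_continuous_on_indicator[of "{T..}"] by simp
    show "AE t in lborel. t \<in> {T..} \<longrightarrow> norm (Rm s t * exp (\<i> * of_real \<epsilon> * tl.line_pt t)) \<le> norm (C * (1 / t ^ 2))"
      by (intro AE_I2 impI order_trans[OF bd[OF _ that]]) (auto simp: divide_right_mono)
  qed
  show "((\<lambda>\<epsilon>. LINT t:{T..}|lborel. Rm s t * exp (\<i> * of_real \<epsilon> * tl.line_pt t)) \<longlongrightarrow> Rem s) (at_right 0)"
    unfolding Rem_def
    by (rule damping_limit[OF _ tl.set_integrable_inv_sq[of C] Rm_continuous[OF s] tl.continuous_line_pt bd]) auto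
qed

lemma main_series:
  assumes s: "s \<in> D" and \<epsilon>: "\<epsilon> > 0"
  shows "set_integrable lborel {T..} (\<lambda>t. Mf k s (tl.line_pt t) * exp (\<i> * of_real \<epsilon> * tl.line_pt t))"
    and "(LINT t:{T..}|lborel. Mf k s (tl.line_pt t) * exp (\<i> * of_real \<epsilon> * tl.line_pt t)) =
      (LINT n|count_space pos_vecs. cc s n * tl.J (of_real (lx n) - \<i> * of_real \<epsilon>) (Bf s - of_nat k))"
proof -
  let ?\<beta> = "Bf s - of_nat k"
  let ?e = "\<lambda>l t. exp (- (of_real l - \<i> * of_real \<epsilon>) * tl.line_pt t) * tl.line_pt t powr ?\<beta>"
  let ?f = "\<lambda>n t. indicat_real {T..} t *\<^sub>R (cc s n * ?e (lx n) t)"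
  \<comment> \<open>The separated factor has constant modulus exp(l c) on the line, so the
    dependence on n goes entirely into \<open>bb n\<close> and the t-integral into one fixed
    majorant.\<close>
  have split: "?e l t = exp (of_real (- l) * tl.line_pt t) * ?e 0 t" for l t
    by (simp add: exp_add[symmetric] algebra_simps)
  have ig: "integrable lborel (\<lambda>t. norm (indicat_real {T..} t *\<^sub>R ?e 0 t))"
    using tl.integrand_integrable_exp[OF \<epsilon>, of 0 ?\<beta>] unfolding set_integrable_def by (intro integrable_norm)
  have ib: "integrable (count_space pos_vecs) (\<lambda>n. exp (c * lX0) * bb n)" by (intro integrable_mult_right bb_integrable)
  have bd: "norm (?f n t) \<le> (exp (c * lX0) * bb n) * norm (indicat_real {T..} t *\<^sub>R ?e 0 t)" if n: "n \<in> pos_vecs" for n t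
  proof -
    have "norm (cc s n) * norm (exp (of_real (- lx n) * tl.line_pt t)) = exp (c * lX0) * (norm (cc s n) * exp (- c * ln (freq n)))"
      unfolding norm_exp_eq_Re lx_def by (simp add: algebra_simps exp_add[symmetric])
    also have "\<dots> \<le> exp (c * lX0) * bb n" by (intro mult_left_mono cc_bound[OF n s kc]) auto
    finally have "norm (cc s n) * norm (exp (of_real (- lx n) * tl.line_pt t)) * norm (indicat_real {T..} t *\<^sub>R ?e 0 t) \<le>
       (exp (c * lX0) * bb n) * norm (indicat_real {T..} t *\<^sub>R ?e 0 t)" by (intro mult_right_mono) auto
    moreover have "norm (?f n t) = norm (cc s n) * norm (exp (of_real (- lx n) * tl.line_pt t)) * norm (indicat_real {T..} t *\<^sub>R ?e 0 t)"
      unfolding split[of "lx n"] norm_scaleR norm_mult by (simp only: mult_ac)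
    ultimately show ?thesis by linarith
  qed
  have meas: "?f n \<in> borel_measurable lborel" for n
    using borel_measurable_continuous_on_indicator[OF _ continuous_on_mult[OF continuous_on_const tl.continuous_integrand], of "cc s n" "of_real (lx n) - \<i> * of_real \<epsilon>" ?\<beta>]
    by simp
  have eq: "(LINT n|count_space pos_vecs. ?f n t) = indicat_real {T..} t *\<^sub>R (Mf k s (tl.line_pt t) * exp (\<i> * of_real \<epsilon> * tl.line_pt t))" for t
  proof -
    have e: "exp (- (of_real (lx n) - \<i> * of_real \<epsilon>) * tl.line_pt t) =
        exp (- tl.line_pt t * of_real lX0) * exp (\<i> * of_real \<epsilon> * tl.line_pt t) * exp (tl.line_pt t * of_real (ln (freq n)))" for n
      unfolding exp_add[symmetric] lx_def by (simp add: algebra_simps)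
    have "?f n t = (indicat_real {T..} t *\<^sub>R (exp (- tl.line_pt t * of_real lX0) * tl.line_pt t powr ?\<beta> * exp (\<i> * of_real \<epsilon> * tl.line_pt t))) *
        (cc s n * exp (tl.line_pt t * of_real (ln (freq n))))" for n
      unfolding e scaleR_conv_of_real by (simp only: mult_ac)
    thus ?thesis
      unfolding Mf_def using dual_series[OF s kc, of "tl.line_pt t"]
      by (simp only: integral_mult_right_zero tl.line_pt_simps refl simp_thms) (simp only: scaleR_conv_of_real mult_ac)
  qed
  note sw = sum_integral_swap[OF countable_pos_vecs sigma_finite_lborel meas ib ig bd]
  show "set_integrable lborel {T..} (\<lambda>t. Mf k s (tl.line_pt t) * exp (\<i> * of_real \<epsilon> * tl.line_pt t))"
    using sw(1) unfolding eq set_integrable_def by blast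
  show "(LINT t:{T..}|lborel. Mf k s (tl.line_pt t) * exp (\<i> * of_real \<epsilon> * tl.line_pt t)) =
      (LINT n|count_space pos_vecs. cc s n * tl.J (of_real (lx n) - \<i> * of_real \<epsilon>) ?\<beta>)"
    using sw(2) unfolding eq set_lebesgue_integral_def[symmetric] set_integral_mult_right tl.J_def[symmetric] by simp
qed

lemma Up_split:
  assumes s: "s \<in> D" and \<epsilon>: "\<epsilon> > 0"
  shows "Up \<epsilon> s = Ef s * ((\<Sum>k<K. ck k s * (LINT n|count_space pos_vecs. cc s n * tl.J (of_real (lx n) - \<i> * of_real \<epsilon>) (Bf s - of_nat k))) +
      (LINT t:{T..}|lborel. Rm s t * exp (\<i> * of_real \<epsilon> * tl.line_pt t)))"
proof -
  let ?E = "\<lambda>t. exp (\<i> * of_real \<epsilon> * tl.line_pt t)"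
  let ?M = "\<lambda>k t. Mf k s (tl.line_pt t)"
  have si: "set_integrable lborel {T..} (\<lambda>t. \<Sum>k<K. ck k s * (?M k t * ?E t))"
    unfolding set_integrable_def scaleR_sum_right
    by (rule Bochner_Integration.integrable_sum) (use set_integrable_mult_right[OF main_series(1)[OF s \<epsilon>]] in \<open>auto simp: set_integrable_def\<close>)
  have "\<Phi> \<epsilon> s (tl.line_pt t) = Ef s * ((\<Sum>k<K. ck k s * (?M k t * ?E t)) + Rm s t * ?E t)" for t
    unfolding Rm_def Phi_damping[of \<epsilon>] using Ef_nz[of s]
    by (simp add: field_simps sum_distrib_left sum_distrib_right sum_divide_distrib)
  hence "Up \<epsilon> s = Ef s * (LINT t:{T..}|lborel. (\<Sum>k<K. ck k s * (?M k t * ?E t)) + Rm s t * ?E t)"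
    unfolding Up_def tl.line_pt_def by simp
  also have "(LINT t:{T..}|lborel. (\<Sum>k<K. ck k s * (?M k t * ?E t)) + Rm s t * ?E t) =
     (LINT t:{T..}|lborel. (\<Sum>k<K. ck k s * (?M k t * ?E t))) + (LINT t:{T..}|lborel. Rm s t * ?E t)"
    by (rule set_integral_add(2)[OF si Rem_damped(1)[OF s less_imp_le[OF \<epsilon>]]])
  also have "(LINT t:{T..}|lborel. (\<Sum>k<K. ck k s * (?M k t * ?E t))) = (\<Sum>k<K. LINT t:{T..}|lborel. ck k s * (?M k t * ?E t))"
    unfolding set_lebesgue_integral_def scaleR_sum_right
    by (rule Bochner_Integration.integral_sum) (use set_integrable_mult_right[OF main_series(1)[OF s \<epsilon>]] in \<open>auto simp: set_integrable_def\<close>)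
  finally show ?thesis unfolding set_integral_mult_right main_series(2)[OF s \<epsilon>] .
qed

text \<open>The indices with \<open>\<alpha>\<^sub>n = \<alpha>\<close>: only these contribute poles.\<close>
definition crit :: "(nat^'n) set" where "crit = {n \<in> pos_vecs. lx n = 0}"

text \<open>Only finitely many frequencies lie below exp(lX0 + 1), and above it |lx n| exceeds 1.
  The gap is what makes repeated partial integration, with its divisions by lx n, uniform in
  n.\<close>

lemma lx_gap: "\<exists>\<delta>>0. \<forall>n\<in>pos_vecs. lx n \<noteq> 0 \<longrightarrow> \<bar>lx n\<bar> \<ge> \<delta>"
proof -
  let ?F = "{n \<in> pos_vecs. freq n \<le> exp (lX0 + 1)}"
  \<comment> \<open>The inserted 1 accounts for the large frequencies and keeps the set
    nonempty.\<close>
  let ?L = "insert 1 ((\<lambda>n. \<bar>lx n\<bar>) ` {n \<in> ?F. lx n \<noteq> 0})"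
  have "finite ?F" unfolding freq_def by (rule finite_small_norm_vecs[OF kappa_pos])
  hence "finite {n \<in> ?F. lx n \<noteq> 0}" by (rule rev_finite_subset) blast
  hence fin: "finite ?L" by (intro finite.insertI finite_imageI)
  have "\<bar>lx n\<bar> \<ge> Min ?L" if n: "n \<in> pos_vecs" "lx n \<noteq> 0" for n
  proof (cases "freq n \<le> exp (lX0 + 1)")
    case True
    thus ?thesis using n fin by (intro Min_le) auto
  next
    case False
    hence "ln (freq n) > lX0 + 1" using freq_pos[OF n(1)] by (subst ln_exp[symmetric], subst ln_less_cancel_iff) auto
    hence "1 \<le> \<bar>lx n\<bar>" by (simp add: lx_def)
    thus ?thesis using Min_le[OF fin, of 1] by auto
  qed
  moreover have "Min ?L > 0" using fin by (subst Min_gr_iff) auto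
  ultimately show ?thesis by blast
qed

lemma crit_finite: "finite crit"
proof (rule finite_subset)
  show "crit \<subseteq> {n \<in> pos_vecs. freq n \<le> exp lX0}"
  proof
    fix n assume "n \<in> crit"
    hence n: "n \<in> pos_vecs" "ln (freq n) = lX0" unfolding crit_def lx_def by auto
    have "freq n = exp lX0" using n(2) freq_pos[OF n(1)] by (metis exp_ln)
    thus "n \<in> {n \<in> pos_vecs. freq n \<le> exp lX0}" using n(1) by simp
  qed
  show "finite {n \<in> pos_vecs. freq n \<le> exp lX0}" unfolding freq_def by (rule finite_small_norm_vecs[OF kappa_pos])
qed

lemma cc_exp_bound:
  assumes n: "n \<in> pos_vecs" and s: "s \<in> D"
  shows "norm (cc s n) * exp (lx n * c) \<le> exp (c * lX0) * bb n"
proof -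
  have "norm (cc s n) * exp (lx n * c) = exp (c * lX0) * (norm (cc s n) * exp (- c * ln (freq n)))"
    unfolding lx_def by (simp add: algebra_simps exp_add[symmetric])
  also have "\<dots> \<le> exp (c * lX0) * bb n" by (intro mult_left_mono cc_bound[OF n s kc]) auto
  finally show ?thesis .
qed

text \<open>Oscillating terms converge by \<open>J_limit\<close>, with bounds that \<open>bb\<close>
  makes summable and limits holomorphic on all of D; their sum is U. Resonant terms are left as the
  integral at y = 0, and only for them is Re (Bf s) <= -2 needed in the limit.\<close>

lemma series_limit:
  "\<exists>U. (\<forall>k<K. holo_multi_on (U k) D) \<and> (\<forall>k<K. \<forall>s\<in>D. Re (Bf s) \<le> - 2 \<longrightarrow>
    ((\<lambda>\<epsilon>. LINT n|count_space pos_vecs. cc s n * tl.J (of_real (lx n) - \<i> * of_real \<epsilon>) (Bf s - of_nat k))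
      \<longlongrightarrow> U k s + (\<Sum>n\<in>crit. cc s n) * tl.J 0 (Bf s - of_nat k)) (at_right 0))"
proof -
  obtain \<delta> where \<delta>: "\<delta> > 0" "\<And>n. n \<in> pos_vecs \<Longrightarrow> lx n \<noteq> 0 \<Longrightarrow> \<bar>lx n\<bar> \<ge> \<delta>" using lx_gap by blast
  obtain Bm where Bm: "Bm > 0" "\<And>s. s \<in> D \<Longrightarrow> norm (Bf s) < Bm" using Bf_bounded[OF R] by blast
  \<comment> \<open>With this N and rho below, all exponents Bf s - k for k < K lie in the domain
    covered by N partial integrations.\<close>
  obtain N :: nat where N: "Bm + 2 < real N" using reals_Archimedean2 by blast
  define \<rho> where "\<rho> = Bm + real K"
  have \<beta>: "norm (Bf s - of_nat k) < \<rho>" "Re (Bf s - of_nat k) < real N - 2" if "s \<in> D" "k < K" for s k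
  proof -
    have "norm (Bf s - of_nat k) \<le> norm (Bf s) + real k" using norm_triangle_ineq4[of "Bf s" "of_nat k"] by simp
    thus "norm (Bf s - of_nat k) < \<rho>" using Bm(2)[OF that(1)] that(2) by (simp add: \<rho>_def)
    show "Re (Bf s - of_nat k) < real N - 2" using complex_Re_le_cmod[of "Bf s"] Bm(2)[OF that(1)] N by simp
  qed
  obtain Jt C where C: "C \<ge> 0" and JJ: "\<forall>l \<beta>. \<bar>l\<bar> \<ge> \<delta> \<longrightarrow> norm \<beta> < \<rho> \<longrightarrow> Re \<beta> < real N - 2 \<longrightarrow>
     ((\<lambda>\<epsilon>. tl.J (of_real l - \<i> * of_real \<epsilon>) \<beta>) \<longlongrightarrow> Jt l \<beta>) (at_right 0) \<and> norm (Jt l \<beta>) \<le> C * exp (l * c) \<and>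
     (\<forall>\<epsilon>. 0 < \<epsilon> \<longrightarrow> \<epsilon> \<le> 1 \<longrightarrow> norm (tl.J (of_real l - \<i> * of_real \<epsilon>) \<beta>) \<le> C * exp (l * c))"
     "\<forall>l. \<bar>l\<bar> \<ge> \<delta> \<longrightarrow> Jt l holomorphic_on {\<beta>. norm \<beta> < \<rho> \<and> Re \<beta> < real N - 2}"
    using tl.J_limit[OF \<delta>(1), of \<rho> N] by (elim exE conjE) (rule that)
  have J:
     "((\<lambda>\<epsilon>. tl.J (of_real l - \<i> * of_real \<epsilon>) \<beta>) \<longlongrightarrow> Jt l \<beta>) (at_right 0)"
     "norm (Jt l \<beta>) \<le> C * exp (l * c)"
     "0 < \<epsilon> \<Longrightarrow> \<epsilon> \<le> 1 \<Longrightarrow> norm (tl.J (of_real l - \<i> * of_real \<epsilon>) \<beta>) \<le> C * exp (l * c)"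
    if "\<bar>l\<bar> \<ge> \<delta>" "norm \<beta> < \<rho>" "Re \<beta> < real N - 2" for l \<beta> \<epsilon>
    using JJ(1)[rule_format, OF that] by blast+
  define u where "u k s n = (if lx n = 0 then 0 else cc s n * Jt (lx n) (Bf s - of_nat k))" for k s n
  define U where "U k s = (LINT n|count_space pos_vecs. u k s n)" for k s
  let ?g = "\<lambda>n. C * (exp (c * lX0) * bb n)"
  have gi: "integrable (count_space pos_vecs) ?g" by (intro integrable_mult_right bb_integrable)
  have cJ: "norm (cc s n * z) \<le> ?g n" if "norm z \<le> C * exp (lx n * c)" "n \<in> pos_vecs" "s \<in> D" for s n z
  proof -
    have "norm (cc s n * z) \<le> norm (cc s n) * (C * exp (lx n * c))"
      unfolding norm_mult by (intro mult_left_mono that) auto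
    also have "\<dots> = C * (norm (cc s n) * exp (lx n * c))" by simp
    also have "\<dots> \<le> ?g n" by (intro mult_left_mono cc_exp_bound that C)
    finally show ?thesis .
  qed
  have g0: "?g n \<ge> 0" for n using C bb_nonneg[of n] by simp
  have ub: "norm (u k s n) \<le> ?g n" if "k < K" "s \<in> D" "n \<in> pos_vecs" for k s n
    unfolding u_def using cJ[OF J(2)[OF \<delta>(2) \<beta>]] that g0 by auto
  have ui: "integrable (count_space pos_vecs) (u k s)" if "k < K" "s \<in> D" for k s
    by (rule Bochner_Integration.integrable_bound[OF gi]) (use ub[OF that] in \<open>auto intro!: AE_I2 order_trans[OF _ abs_ge_self]\<close>)
  have "holo_multi_on (U k) D" if k: "k < K" for k
    unfolding U_def[abs_def]
  proof (rule holo_multi_on_integral[OF open_region])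
    fix n assume n: "n \<in> space (count_space (pos_vecs :: (nat^'n) set))"
    show "holo_multi_on (\<lambda>s. u k s n) D"
    proof (cases "lx n = 0")
      case False
      have "holo_multi_on (\<lambda>s. Jt (lx n) (Bf s - of_nat k)) D"
      proof (rule holo_multi_on_compose[where g = "Jt (lx n)" and f = "\<lambda>s. Bf s - of_nat k"])
        show "Jt (lx n) holomorphic_on {\<beta>. norm \<beta> < \<rho> \<and> Re \<beta> < real N - 2}" using JJ(2) \<delta>(2) n False by simp
        show "open {\<beta>. norm \<beta> < \<rho> \<and> Re \<beta> < real N - 2}"
          by (intro open_Collect_conj open_Collect_less continuous_intros)
        show "(\<lambda>s. Bf s - of_nat k) ` D \<subseteq> {\<beta>. norm \<beta> < \<rho> \<and> Re \<beta> < real N - 2}" using \<beta>[OF _ k] by blast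
      qed (intro holo_multi_intros Bf_holo)
      thus ?thesis unfolding u_def using False n by (simp add: holo_multi_on_mult cc_holo)
    qed (simp add: u_def holo_multi_on_const)
  next
    show "\<exists>e>0. \<exists>g. integrable (count_space pos_vecs) g \<and> (\<forall>s\<in>ball p e \<inter> D. \<forall>n\<in>space (count_space pos_vecs). norm (u k s n) \<le> g n)" for p
      using ub[OF k] gi by (intro exI[of _ "1::real"] conjI exI[of _ ?g]) auto
  qed simp
  moreover have "((\<lambda>\<epsilon>. LINT n|count_space pos_vecs. cc s n * tl.J (of_real (lx n) - \<i> * of_real \<epsilon>) (Bf s - of_nat k))
      \<longlongrightarrow> U k s + (\<Sum>n\<in>crit. cc s n) * tl.J 0 (Bf s - of_nat k)) (at_right 0)"
    if k: "k < K" and s: "s \<in> D" and Re: "Re (Bf s) \<le> - 2" for k s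
  proof -
    let ?\<beta> = "Bf s - of_nat k"
    have Re': "Re ?\<beta> \<le> - 2" using Re by simp
    let ?h = "\<lambda>n. if n \<in> crit then cc s n * tl.J 0 ?\<beta> else 0"
    have "(LINT n|count_space pos_vecs. u k s n + ?h n) = U k s + (LINT n|count_space pos_vecs. ?h n)"
      unfolding U_def
    proof (rule Bochner_Integration.integral_add[OF ui[OF k s]])
      show "integrable (count_space pos_vecs) ?h"
      proof (rule Bochner_Integration.integrable_bound)
        show "integrable (count_space pos_vecs) (\<lambda>n. norm (tl.J 0 ?\<beta>) * (exp (c * lX0) * bb n))"
          by (intro integrable_mult_right bb_integrable)
        have "norm (?h n) \<le> norm (tl.J 0 ?\<beta>) * (exp (c * lX0) * bb n)" if n: "n \<in> pos_vecs" for n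
        proof (cases "n \<in> crit")
          case True
          hence "norm (cc s n) \<le> exp (c * lX0) * bb n" using cc_exp_bound[OF n s] by (simp add: crit_def)
          thus ?thesis using True by (simp add: norm_mult mult.commute mult_right_mono)
        qed (simp add: bb_nonneg)
        thus "AE n in count_space pos_vecs. norm (?h n) \<le> norm (norm (tl.J 0 ?\<beta>) * (exp (c * lX0) * bb n))"
          by (intro AE_I2 order_trans[OF _ abs_ge_self[THEN order_trans[OF _ eq_refl[OF real_norm_def[symmetric]]]]]) simp
      qed simp
    qed
    also have "(LINT n|count_space pos_vecs. ?h n) = (\<Sum>n\<in>crit. cc s n) * tl.J 0 ?\<beta>"
    proof -
      have "(LINT n|count_space pos_vecs. ?h n) = (\<Sum>n | n \<in> pos_vecs \<and> ?h n \<noteq> 0. ?h n)"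
        by (rule lebesgue_integral_count_space_finite_support) (rule finite_subset[OF _ crit_finite], auto)
      also have "\<dots> = (\<Sum>n\<in>crit. ?h n)"
        by (rule sum.mono_neutral_left[OF crit_finite]) (auto simp: crit_def)
      finally show ?thesis by (simp add: sum_distrib_right)
    qed
    finally have eq: "(LINT n|count_space pos_vecs. u k s n + ?h n) = U k s + (\<Sum>n\<in>crit. cc s n) * tl.J 0 ?\<beta>" .
    show ?thesis
      unfolding eq[symmetric] tendsto_at_iff_sequentially o_def
    proof (intro allI impI)
      fix Y :: "nat \<Rightarrow> real" assume Y: "\<forall>i. Y i \<in> {0<..} - {0}" "Y \<longlonglongrightarrow> 0"
      have Yr: "filterlim Y (at_right 0) sequentially"
        using Y(1) by (intro tendsto_imp_filterlim_at_right Y(2) always_eventually) auto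
      have "eventually (\<lambda>i. Y i < 1) sequentially" using Y(2) by (rule order_tendstoD) simp
      then obtain i0 where i0: "\<And>i. i \<ge> i0 \<Longrightarrow> Y i < 1" by (auto simp: eventually_at_top_linorder)
      define Z where "Z i = Y (i + i0)" for i
      have Z: "0 < Z i" "Z i \<le> 1" for i using Y(1) i0[of "i + i0"] by (auto simp: Z_def)
      have Zr: "filterlim Z (at_right 0) sequentially"
        unfolding Z_def using Yr by (rule filterlim_compose[OF _ filterlim_add_const_nat_at_top])
      have J0: "(\<lambda>i. tl.J (of_real 0 - \<i> * of_real (Z i)) ?\<beta>) \<longlonglongrightarrow> tl.J 0 ?\<beta>"
        using filterlim_compose[OF tl.J_tendsto_2[OF Re', of 0] Zr] by simp
      \<comment> \<open>\<open>J_limit\<close> gives no bound for a resonant term; as it converges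
        along the sequence, it is bounded, and \<open>b\<close> enters the majorant.\<close>
      hence "Bseq (\<lambda>i. tl.J (of_real 0 - \<i> * of_real (Z i)) ?\<beta>)" by (intro convergent_imp_Bseq convergentI)
      then obtain b where b: "b > 0" "\<And>i. norm (tl.J (of_real 0 - \<i> * of_real (Z i)) ?\<beta>) \<le> b" unfolding Bseq_def by blast
      let ?w = "\<lambda>n. (C + b) * (exp (c * lX0) * bb n)"
      have "(\<lambda>i. LINT n|count_space pos_vecs. cc s n * tl.J (of_real (lx n) - \<i> * of_real (Z i)) ?\<beta>) \<longlonglongrightarrow>
        (LINT n|count_space pos_vecs. u k s n + ?h n)"
      proof (rule integral_dominated_convergence[where w = ?w])
        show "integrable (count_space pos_vecs) ?w" by (intro integrable_mult_right bb_integrable)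
        show "AE n in count_space pos_vecs. (\<lambda>i. cc s n * tl.J (of_real (lx n) - \<i> * of_real (Z i)) ?\<beta>) \<longlonglongrightarrow> u k s n + ?h n"
        proof (rule AE_I2)
          fix n assume "n \<in> space (count_space (pos_vecs :: (nat^'n) set))"
          hence n: "n \<in> pos_vecs" by simp
          show "(\<lambda>i. cc s n * tl.J (of_real (lx n) - \<i> * of_real (Z i)) ?\<beta>) \<longlonglongrightarrow> u k s n + ?h n"
          proof (cases "lx n = 0")
            case True
            thus ?thesis using tendsto_mult[OF tendsto_const J0, of "cc s n"] n by (simp add: u_def crit_def)
          next
            case False
            thus ?thesis
              using tendsto_mult[OF tendsto_const filterlim_compose[OF J(1)[OF \<delta>(2)[OF n False] \<beta>[OF s k]] Zr], of "cc s n"]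
              by (simp add: u_def crit_def)
          qed
        qed
        show "AE n in count_space pos_vecs. norm (cc s n * tl.J (of_real (lx n) - \<i> * of_real (Z i)) ?\<beta>) \<le> ?w n" for i
        proof (rule AE_I2)
          fix n assume "n \<in> space (count_space (pos_vecs :: (nat^'n) set))"
          hence n: "n \<in> pos_vecs" by simp
          have "norm (tl.J (of_real (lx n) - \<i> * of_real (Z i)) ?\<beta>) \<le> (C + b) * exp (lx n * c)"
          proof (cases "lx n = 0")
            case True
            thus ?thesis using b(2)[of i] C by simp
          next
            case False
            show ?thesis
              by (rule order_trans[OF J(3)[OF \<delta>(2)[OF n False] \<beta>[OF s k] Z]]) (use b(1) in \<open>simp add: mult_right_mono\<close>)
          qed
          hence "norm (cc s n * tl.J (of_real (lx n) - \<i> * of_real (Z i)) ?\<beta>) \<le> norm (cc s n) * ((C + b) * exp (lx n * c))"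
            unfolding norm_mult by (rule mult_left_mono) simp
          also have "\<dots> = (C + b) * (norm (cc s n) * exp (lx n * c))" by simp
          also have "\<dots> \<le> ?w n" using C b(1) by (intro mult_left_mono cc_exp_bound n s) auto
          finally show "norm (cc s n * tl.J (of_real (lx n) - \<i> * of_real (Z i)) ?\<beta>) \<le> ?w n" .
        qed
      qed simp_all
      thus "(\<lambda>i. LINT n|count_space pos_vecs. cc s n * tl.J (of_real (lx n) - \<i> * of_real (Y i)) ?\<beta>) \<longlonglongrightarrow>
        (LINT n|count_space pos_vecs. u k s n + ?h n)"
        unfolding Z_def by (rule LIMSEQ_offset)
    qed
  qed
  ultimately show ?thesis by blast
qed

text \<open>The identity holds only where the Dirichlet series and the resonant integrals both
  converge absolutely, but H and the A k are holomorphic on the whole polydisc, so the right-hand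
  side is the local continuation with its poles displayed. If every resonant index has a vanishing
  coefficient, the sums over \<open>crit\<close> are empty of nonzero terms and all A k
  vanish.\<close>

theorem tail_expansion:
  "\<exists>H A. holo_multi_on H D \<and> (\<forall>k<K. holo_multi_on (A k) D) \<and>
    (\<forall>s\<in>D. (\<forall>\<nu>. Re (s $ \<nu>) > 1) \<longrightarrow> Re (Bf s) \<le> - 2 \<longrightarrow>
       multi_twist a \<kappa> \<alpha> s = H s + (\<Sum>k<K. A k s / (Bf s - of_nat k + 1))) \<and>
    ((\<forall>n\<in>pos_vecs. ln (freq n) = lX0 \<longrightarrow> (\<Prod>\<nu>\<in>UNIV. a \<nu> (n $ \<nu>)) = 0) \<longrightarrow> (\<forall>k s. A k s = 0))"
proof -
  obtain U where U: "\<And>k. k < K \<Longrightarrow> holo_multi_on (U k) D"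
    "\<And>k s. k < K \<Longrightarrow> s \<in> D \<Longrightarrow> Re (Bf s) \<le> - 2 \<Longrightarrow>
    ((\<lambda>\<epsilon>. LINT n|count_space pos_vecs. cc s n * tl.J (of_real (lx n) - \<i> * of_real \<epsilon>) (Bf s - of_nat k))
      \<longlongrightarrow> U k s + (\<Sum>n\<in>crit. cc s n) * tl.J 0 (Bf s - of_nat k)) (at_right 0)"
    using series_limit by (elim exE conjE) (rule that; blast)
  let ?w = "tl.line_pt T"
  \<comment> \<open>By \<open>J_zero_value\<close> a resonant term contributes -w0^(beta + 1) / (i
    (beta + 1)) with beta = Bf s - k and w0 the lower end of the tail; 1 / (2 pi) is the factor of
    Mellin inversion. On the hyperplane beta = -1 the power of w0 equals 1.\<close>
  define A where "A k s = - (Ef s * ck k s * (\<Sum>n\<in>crit. cc s n) * ?w powr (Bf s - of_nat k + 1)) / (2 * of_real pi * \<i>)" for k s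
  define H where "H s = (Ef s * ((\<Sum>k<K. ck k s * U k s) + Rem s) + Low 0 s + Mid 0 s) / (2 * of_real pi)" for s
  have "holo_multi_on H D" unfolding H_def[abs_def]
    by (intro holo_multi_on_divide holo_multi_intros Ef_holo ck_holo U(1) Rem_holo Low_holo Mid_holo) auto
  moreover have "holo_multi_on (A k) D" for k
    unfolding A_def[abs_def] powr_def using tl.line_pt_nz
    by (simp only: if_False) (intro holo_multi_on_divide holo_multi_intros Ef_holo ck_holo Bf_holo cc_holo; auto simp: crit_def)
  moreover have "multi_twist a \<kappa> \<alpha> s = H s + (\<Sum>k<K. A k s / (Bf s - of_nat k + 1))"
    if s: "s \<in> D" "\<And>\<nu>. Re (s $ \<nu>) > 1" and Re: "Re (Bf s) \<le> - 2" for s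
  proof -
    let ?u = "Ef s * ((\<Sum>k<K. ck k s * (U k s + (\<Sum>n\<in>crit. cc s n) * tl.J 0 (Bf s - of_nat k))) + Rem s)"
    let ?v = "\<lambda>\<epsilon>. Ef s * ((\<Sum>k<K. ck k s * (LINT n|count_space pos_vecs. cc s n * tl.J (of_real (lx n) - \<i> * of_real \<epsilon>) (Bf s - of_nat k))) +
      (LINT t:{T..}|lborel. Rm s t * exp (\<i> * of_real \<epsilon> * tl.line_pt t)))"
    have "(?v \<longlongrightarrow> ?u) (at_right 0)"
      by (intro tendsto_mult tendsto_const tendsto_add tendsto_sum U(2) s(1) Re Rem_damped(2)) auto
    moreover have "eventually (\<lambda>\<epsilon>. ?v \<epsilon> = Up \<epsilon> s) (at_right 0)"
      by (rule eventually_at_right_less[THEN eventually_mono]) (simp add: Up_split[OF s(1)])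
    ultimately have "((\<lambda>\<epsilon>. Up \<epsilon> s) \<longlongrightarrow> ?u) (at_right 0)" by (rule Lim_transform_eventually)
    from twist_decomposition[OF s this]
    have "2 * of_real pi * multi_twist a \<kappa> \<alpha> s = ?u + Low 0 s + Mid 0 s" .
    moreover have val: "tl.J 0 (Bf s - of_nat k) = - (?w powr (Bf s - of_nat k + 1)) / (\<i> * (Bf s - of_nat k + 1))" for k
      by (rule tl.J_zero_value) (use Re in simp)
    have "Ef s * (ck k s * (U k s + (\<Sum>n\<in>crit. cc s n) * tl.J 0 (Bf s - of_nat k))) =
        Ef s * (ck k s * U k s) + 2 * of_real pi * (A k s / (Bf s - of_nat k + 1))" for k
    proof -
      have gen: "e * (x * (u + S * (- p / (\<i> * q)))) = e * (x * u) + 2 * of_real pi * (- (e * x * S * p) / (2 * of_real pi * \<i>) / q)"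
        if "q \<noteq> 0" for e x u S p q :: complex using that by (simp add: field_simps)
      have "Re (Bf s - of_nat k + 1) < 0" using Re by simp
      hence "Bf s - of_nat k + 1 \<noteq> 0" by (intro notI) simp
      thus ?thesis unfolding A_def val by (rule gen)
    qed
    hence "Ef s * (\<Sum>k<K. ck k s * (U k s + (\<Sum>n\<in>crit. cc s n) * tl.J 0 (Bf s - of_nat k))) =
        Ef s * (\<Sum>k<K. ck k s * U k s) + 2 * of_real pi * (\<Sum>k<K. A k s / (Bf s - of_nat k + 1))"
      by (simp only: sum_distrib_left sum.distrib[symmetric])
    ultimately show ?thesis unfolding H_def distrib_left[of "Ef s"] by (simp add: field_simps)
  qed
  moreover have "A k s = 0" if z: "\<forall>n\<in>pos_vecs. ln (freq n) = lX0 \<longrightarrow> (\<Prod>\<nu>\<in>UNIV. a \<nu> (n $ \<nu>)) = 0" for k s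
  proof -
    have "cc s n = 0" if "n \<in> crit" for n
    proof -
      have "(\<Prod>\<nu>\<in>UNIV. a \<nu> (n $ \<nu>)) = 0" using z that unfolding crit_def lx_def by auto
      thus ?thesis unfolding cc_def by auto
    qed
    thus ?thesis unfolding A_def by simp
  qed
  ultimately show ?thesis by (intro exI[of _ H] exI[of _ A] conjI) blast+
qed

end

section \<open>Gluing\<close>

text \<open>The complex line through s and a point of U meets the convex set in a convex planar
  domain. B is affine on that line, so the excluded parameters are countable, and a connected open
  planar set stays connected after removal of a countable set. Hence the one-variable identity
  theorem applies on the line.\<close>

lemma holo_multi_identity:
  fixes f g B :: "complex^'n::finite \<Rightarrow> complex"
  assumes \<Omega>: "open \<Omega>" "convex \<Omega>" and B: "holo_multi_on B UNIV"
    and affine: "\<And>p h. \<exists>b0 b1. \<forall>z. B (p + z *s h) = b0 + b1 * z"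
    and S: "closed S" "countable S"
    and f: "holo_multi_on f (\<Omega> - B -` S)" and g: "holo_multi_on g (\<Omega> - B -` S)"
    and U: "open U" "U \<noteq> {}" "U \<subseteq> \<Omega> - B -` S" and eq: "\<And>s. s \<in> U \<Longrightarrow> f s = g s"
    and s: "s \<in> \<Omega>" "B s \<notin> S"
  shows "f s = g s"
proof -
  obtain p where p: "p \<in> U" using U(2) by blast
  define L where "L z = p + z *s (s - p)" for z
  obtain b0 b1 where b: "\<And>z. B (L z) = b0 + b1 * z" unfolding L_def using affine by blast
  have oV: "open (\<Omega> - B -` S)"
    by (intro open_Diff \<Omega>(1) closed_vimage S(1) holo_multi_on_continuous_on B)
  let ?W = "{z. L z \<in> \<Omega> - B -` S}" and ?Z = "{z. L z \<in> \<Omega>}"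
  have L01: "L 0 = p" "L 1 = s" by (simp_all add: L_def)
  have convZ: "convex ?Z"
  proof (rule convexI)
    fix x y :: complex and u v :: real assume xy: "x \<in> ?Z" "y \<in> ?Z" and uv: "0 \<le> u" "0 \<le> v" "u + v = 1"
    have v: "of_real v = 1 - (of_real u :: complex)" using uv(3) by (metis add_diff_cancel_left' of_real_1 of_real_diff)
    have Li: "L z $ i = p $ i + z * (s $ i - p $ i)" for z i by (simp add: L_def right_diff_distrib)
    have "L (u *\<^sub>R x + v *\<^sub>R y) $ i = (u *\<^sub>R L x + v *\<^sub>R L y) $ i" for i
      unfolding vector_add_component vector_scaleR_component Li by (simp add: scaleR_conv_of_real v algebra_simps)
    hence "L (u *\<^sub>R x + v *\<^sub>R y) = u *\<^sub>R L x + v *\<^sub>R L y" by (simp add: vec_eq_iff)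
    thus "u *\<^sub>R x + v *\<^sub>R y \<in> ?Z" using convexD[OF \<Omega>(2), of "L x" "L y" u v] xy uv by simp
  qed
  have oZ: "open ?Z" unfolding L_def by (rule open_line_preimage[OF \<Omega>(1)])
  have "connected ?W"
  \<comment> \<open>If B is constant on the line, its value is B s, which is not in S, so no
    parameter is excluded.\<close>
  proof (cases "b1 = 0")
    case True
    hence "b0 \<notin> S" using b[of 1] s(2) L01 by simp
    hence "?W = ?Z" using b True by auto
    thus ?thesis using convex_connected[OF convZ] by simp
  next
    case False
    have "{z. b0 + b1 * z \<in> S} \<subseteq> (\<lambda>y. (y - b0) / b1) ` S"
    proof
      fix z assume "z \<in> {z. b0 + b1 * z \<in> S}"
      moreover have "z = ((b0 + b1 * z) - b0) / b1" using False by simp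
      ultimately show "z \<in> (\<lambda>y. (y - b0) / b1) ` S" by blast
    qed
    hence "countable {z. b0 + b1 * z \<in> S}" using S(2) by (metis countable_image countable_subset)
    hence "connected (?Z - {z. b0 + b1 * z \<in> S})"
      by (intro connected_open_diff_countable oZ convex_connected[OF convZ]) simp
    moreover have "?W = ?Z - {z. b0 + b1 * z \<in> S}" using b by auto
    ultimately show ?thesis by simp
  qed
  moreover have o: "open ?W" "open {z. L z \<in> U}" unfolding L_def
    by (rule open_line_preimage[OF oV], rule open_line_preimage[OF U(1)])
  moreover have h: "(\<lambda>z. f (L z)) holomorphic_on ?W" "(\<lambda>z. g (L z)) holomorphic_on ?W"
    unfolding L_def by (rule holo_multi_on_line[OF f oV], rule holo_multi_on_line[OF g oV])
  moreover have "{z. L z \<in> U} \<subseteq> ?W" "{z. L z \<in> U} \<noteq> {}" "1 \<in> ?W" using U(3) p s L01 by (blast, blast, simp)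
  ultimately have "f (L 1) = g (L 1)"
    by (intro analytic_continuation_open[OF o(2) o(1) _ _ _ h, of 1]) (use eq in blast)+
  thus ?thesis using L01 by simp
qed

context multi_selberg
begin

text \<open>The bound Re (Bf s) <= K - 2 guarantees that a hyperplane Bf = l - 1 meeting the
  polydisc has l < K, so that the finite sum lists every pole there.\<close>

definition expands :: "real \<Rightarrow> nat \<Rightarrow> (complex^'n \<Rightarrow> complex) \<Rightarrow> (nat \<Rightarrow> complex^'n \<Rightarrow> complex) \<Rightarrow> bool" where
  "expands R K H A \<longleftrightarrow> (\<forall>s\<in>region R. Re (Bf s) \<le> real K - 2) \<and> holo_multi_on H (region R) \<and> (\<forall>k<K. holo_multi_on (A k) (region R)) \<and>
    (\<forall>s\<in>region R. (\<forall>\<nu>. Re (s $ \<nu>) > 1) \<longrightarrow> Re (Bf s) \<le> - 2 \<longrightarrow>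
       multi_twist a \<kappa> \<alpha> s = H s + (\<Sum>k<K. A k s / (Bf s - of_nat k + 1))) \<and>
    ((\<forall>n\<in>pos_vecs. ln (freq n) = lX0 \<longrightarrow> (\<Prod>\<nu>\<in>UNIV. a \<nu> (n $ \<nu>)) = 0) \<longrightarrow> (\<forall>k s. A k s = 0))"

text \<open>Each constant is a sum of nonnegative requirements over nu and j and therefore dominates
  every one of them. The order of choice matters: c and K depend on R only, and T comes last because
  it must also exceed the thresholds of the line bound and of the expansion of \<open>X\<close> for
  these c and K.\<close>

lemma region_expansion:
  assumes R: "R > 0"
  shows "\<exists>K H A. expands R K H A"
proof -
  define c where "c = 1 + (\<Sum>\<nu>\<in>UNIV. (R + 3) / \<kappa> \<nu>)"
  have c1: "c \<ge> 1" unfolding c_def using R less_imp_le[OF kappa_pos] by (auto intro!: sum_nonneg)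
  have le_sum: "f \<nu> \<le> (\<Sum>\<nu>\<in>UNIV. f \<nu>)" if "\<And>\<nu>. f \<nu> \<ge> 0" for f :: "'n \<Rightarrow> real" and \<nu>
    using that by (intro member_le_sum) auto
  have kc: "\<kappa> \<nu> * c \<ge> R + 3" for \<nu>
  proof -
    have "(R + 3) / \<kappa> \<nu> \<le> c" using le_sum[of "\<lambda>\<nu>. (R + 3) / \<kappa> \<nu>" \<nu>] R less_imp_le[OF kappa_pos] by (auto simp: c_def)
    thus ?thesis using kappa_pos[of \<nu>] by (simp add: divide_le_eq mult.commute)
  qed
  have c0: "c > 0" using c1 by simp
  obtain C q T1 where line: "C \<ge> 0" "q \<ge> 0" "\<forall>s\<in>region R. \<forall>w. \<bar>Re w\<bar> = c \<longrightarrow> \<bar>Im w\<bar> \<ge> T1 \<longrightarrow>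
     norm (P s w * Gamma w) \<le> C * \<bar>Im w\<bar> powr q * exp (- pi / 2 * \<bar>Im w\<bar>)"
    using line_bound[OF R c0 kc] by blast
  obtain Bm where Bm: "Bm > 0" "\<And>s. s \<in> region R \<Longrightarrow> norm (Bf s) < Bm" using Bf_bounded[OF R] by blast
  obtain K :: nat where K: "Bm + 2 < real K" using reals_Archimedean2 by blast
  have K0: "K > 0" using K Bm(1) by (cases K) auto
  obtain ck T2 Cx where ck: "T2 > 0" "Cx \<ge> 0" "\<And>k. holo_multi_on (ck k) (region R)"
    "\<And>k s. k < K \<Longrightarrow> s \<in> region R \<Longrightarrow> norm (ck k s) \<le> Cx"
    "\<And>s w. s \<in> region R \<Longrightarrow> 4 * \<bar>Re w\<bar> \<le> Im w \<Longrightarrow> norm w > T2 \<Longrightarrow> norm (X s w - (\<Sum>k<K. ck k s / w ^ k)) \<le> Cx / norm w ^ K"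
    by (rule asym_expansion[OF asym_X[OF R] open_region K0]) blast
  define m where "m \<nu> = (\<Sum>j<length (lam \<nu>). \<bar>Im (mu \<nu> ! j)\<bar> / lam \<nu> ! j)" for \<nu>
  define S where "S = (\<Sum>\<nu>\<in>UNIV. (2 * (R + 1) + m \<nu>) / \<kappa> \<nu>)"
  have m0: "m \<nu> \<ge> 0" for \<nu> unfolding m_def using lam_pos less_imp_le by (intro sum_nonneg divide_nonneg_nonneg) auto
  have S0: "S \<ge> 0" unfolding S_def using R m0 less_imp_le[OF kappa_pos] by (intro sum_nonneg divide_nonneg_nonneg add_nonneg_nonneg) auto
  have kS: "\<kappa> \<nu> * S \<ge> 2 * (R + 1) + m \<nu>" for \<nu>
  proof -
    have "(2 * (R + 1) + m \<nu>) / \<kappa> \<nu> \<le> S" unfolding S_def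
      using R m0 less_imp_le[OF kappa_pos] by (intro le_sum divide_nonneg_nonneg add_nonneg_nonneg) auto
    thus ?thesis using kappa_pos[of \<nu>] by (simp add: divide_le_eq mult.commute)
  qed
  define T where "T = 4 + 4 * c + \<bar>T1\<bar> + T2 + S"
  have ST: "S \<le> T" "T1 \<le> T" "T2 < T" "4 \<le> T" "4 * c \<le> T" unfolding T_def using c1 ck(1) S0 by auto
  have kT: "\<kappa> \<nu> * T \<ge> 2 * (R + 1) + m \<nu>" for \<nu>
    using kS[of \<nu>] mult_left_mono[OF ST(1) less_imp_le[OF kappa_pos[of \<nu>]]] by linarith
  interpret multi_selberg_tail a Fc Q lam mu om \<kappa> \<alpha> R c T K ck Cx
  proof
    show "R > 0" "c \<ge> 1" "\<kappa> \<nu> * c \<ge> R + 3" "T \<ge> max 4 (4 * c)" for \<nu> using R c1 kc ST by auto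
    show "\<kappa> \<nu> * T \<ge> 2 * (R + 1)" for \<nu> using kT[of \<nu>] m0[of \<nu>] by linarith
    show "\<exists>C q. C \<ge> 0 \<and> q \<ge> 0 \<and> (\<forall>s\<in>region R. \<forall>w. \<bar>Re w\<bar> = c \<longrightarrow> \<bar>Im w\<bar> \<ge> T \<longrightarrow>
     norm (P s w * Gamma w) \<le> C * \<bar>Im w\<bar> powr q * exp (- pi / 2 * \<bar>Im w\<bar>))"
      using line ST(2) by (meson order_trans)
    show "Re (Bf s) \<le> real K - 2" if "s \<in> region R" for s
      using Bm(2)[OF that] K complex_Re_le_cmod[of "Bf s"] by linarith
    show "holo_multi_on (ck k) (region R)" for k by (rule ck(3))
    show "Cx \<ge> 0" by (rule ck(2))
    show "norm (ck k s) \<le> Cx" if "k < K" "s \<in> region R" for k s by (rule ck(4)[OF that])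
    show "norm (X s w - (\<Sum>k<K. ck k s / w ^ k)) \<le> Cx / norm w ^ K" if "s \<in> region R" "4 * \<bar>Re w\<bar> \<le> Im w" "norm w \<ge> T" for s w
      by (rule ck(5)[OF that(1,2)]) (use that(3) ST(3) in simp)
    show "\<bar>Im (mu \<nu> ! j)\<bar> < lam \<nu> ! j * (\<kappa> \<nu> * T - R)" if j: "j < length (lam \<nu>)" for \<nu> j
    proof -
      have "\<bar>Im (mu \<nu> ! j)\<bar> / lam \<nu> ! j \<le> m \<nu>"
        unfolding m_def using j lam_pos less_imp_le
        by (intro member_le_sum[where f = "\<lambda>j. \<bar>Im (mu \<nu> ! j)\<bar> / lam \<nu> ! j"] divide_nonneg_nonneg) auto
      also have "m \<nu> < \<kappa> \<nu> * T - R"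
      proof -
        have "m \<nu> + R < 2 * (R + 1) + m \<nu>" using R by simp
        from less_le_trans[OF this kT] show ?thesis by (simp only: less_diff_eq)
      qed
      finally have "\<bar>Im (mu \<nu> ! j)\<bar> / lam \<nu> ! j < \<kappa> \<nu> * T - R" .
      thus ?thesis using lam_pos[OF j] by (simp add: divide_less_eq mult.commute)
    qed
  qed
  show ?thesis using tail_expansion ReB unfolding expands_def by blast
qed

lemma multi_twist_holo: "holo_multi_on (multi_twist a \<kappa> \<alpha>) {s. \<forall>\<nu>. Re (s $ \<nu>) > 1}"
proof -
  let ?C = "{s::complex^'n. \<forall>\<nu>. Re (s $ \<nu>) > 1}"
  let ?e = "\<lambda>n. exp (- (of_real (freq n) * exp (ex 0)))"
  have e1: "norm (?e n) = 1" for n using Re_exp_ex[of 0] by (simp add: Re_complex_of_real[symmetric] del: Re_complex_of_real)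
  have oC: "open ?C"
  proof -
    have "?C = (\<Inter>\<nu>\<in>UNIV. {s. Re (s $ \<nu>) > 1})" by auto
    also have "open \<dots>" by (rule open_INT) (auto intro!: open_Collect_less continuous_intros)
    finally show ?thesis .
  qed
  have h: "holo_multi_on (\<lambda>s. LINT n|count_space pos_vecs. coef s n * ?e n) ?C"
  proof (rule holo_multi_on_integral[OF oC])
    fix n assume "n \<in> space (count_space (pos_vecs :: (nat^'n) set))"
    hence "(of_nat (n $ \<nu>) :: complex) = 0 \<longleftrightarrow> False" for \<nu> by (auto simp: pos_vecs_def Suc_le_eq)
    hence "coef s n = (\<Prod>\<nu>\<in>UNIV. a \<nu> (n $ \<nu>) * exp (- (s $ \<nu> * Ln (of_nat (n $ \<nu>)))))" for s
      by (simp only: coef_def powr_def if_False exp_minus divide_inverse)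
    thus "holo_multi_on (\<lambda>s. coef s n * ?e n) ?C" by (simp only:) (intro holo_multi_intros)
  next
    fix p assume p: "p \<in> ?C"
    \<comment> \<open>Half the distance to the boundary of the region of convergence: in this ball
      every Re s_nu is at least (Re p_nu + 1) / 2, which is still greater than 1, so the series at
      these real points dominates.\<close>
    define e where "e = Min (range (\<lambda>\<nu>. (Re (p $ \<nu>) - 1) / 2))"
    have e0: "e > 0" unfolding e_def using p by (subst Min_gr_iff) auto
    have e: "e \<le> (Re (p $ \<nu>) - 1) / 2" for \<nu> unfolding e_def by (rule Min_le) auto
    let ?s = "(\<chi> \<nu>. of_real ((Re (p $ \<nu>) + 1) / 2)) :: complex^'n"
    have "norm (coef s n * ?e n) \<le> norm (coef ?s n)" if s: "s \<in> ball p e" and n: "n \<in> pos_vecs" for s n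
    proof -
      have "norm (coef s n * ?e n) = (\<Prod>\<nu>\<in>UNIV. norm (a \<nu> (n $ \<nu>)) / real (n $ \<nu>) powr Re (s $ \<nu>))"
        unfolding norm_mult e1 coef_def prod_norm[symmetric] norm_divide norm_of_nat_powr by simp
      also have "\<dots> \<le> (\<Prod>\<nu>\<in>UNIV. norm (a \<nu> (n $ \<nu>)) / real (n $ \<nu>) powr ((Re (p $ \<nu>) + 1) / 2))"
      proof (intro prod_mono conjI)
        fix \<nu>
        have "\<bar>Re ((p - s) $ \<nu>)\<bar> \<le> norm (p - s)" by (rule order_trans[OF abs_Re_le_cmod Finite_Cartesian_Product.norm_nth_le])
        hence "Re (s $ \<nu>) \<ge> (Re (p $ \<nu>) + 1) / 2" using s e[of \<nu>] by (simp add: dist_norm field_simps)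
        moreover have "real (n $ \<nu>) \<ge> 1" using n by (simp add: pos_vecs_def)
        ultimately show "norm (a \<nu> (n $ \<nu>)) / real (n $ \<nu>) powr Re (s $ \<nu>) \<le> norm (a \<nu> (n $ \<nu>)) / real (n $ \<nu>) powr ((Re (p $ \<nu>) + 1) / 2)"
          by (intro divide_left_mono powr_mono mult_pos_pos) auto
      qed auto
      also have "\<dots> = norm (coef ?s n)" unfolding coef_def prod_norm[symmetric] norm_divide norm_of_nat_powr by simp
      finally show ?thesis .
    qed
    moreover have "integrable (count_space pos_vecs) (\<lambda>n. norm (coef ?s n))"
      by (intro integrable_norm coef_series(1)) (use p in auto)
    ultimately show "\<exists>e>0. \<exists>g. integrable (count_space pos_vecs) g \<and> (\<forall>s\<in>ball p e \<inter> ?C. \<forall>n\<in>space (count_space pos_vecs). norm (coef s n * ?e n) \<le> g n)"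
      using e0 by (intro exI[of _ e] conjI exI[of _ "\<lambda>n. norm (coef ?s n)"]) auto
  qed simp
  have eq: "multi_twist a \<kappa> \<alpha> s = (LINT n|count_space pos_vecs. coef s n * ?e n)" if "s \<in> ?C" for s
  proof -
    have "\<And>\<nu>. Re (s $ \<nu>) > 1" using that by simp
    thus ?thesis by (rule multi_twist_integral(1))
  qed
  note cong = holo_multi_on_cong[of ?C "multi_twist a \<kappa> \<alpha>" "\<lambda>s. LINT n|count_space pos_vecs. coef s n * ?e n"]
  show ?thesis by (rule cong[THEN iffD2, OF eq h])
qed

section \<open>A common domain for the local expansions\<close>

definition D0 :: real where "D0 = (\<Sum>\<nu>\<in>UNIV. deg \<nu>)"

lemma deg_nonneg: "deg \<nu> \<ge> 0"
  unfolding deg_sum using less_imp_le[OF lam_pos] by (intro sum_nonneg) auto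

lemma D0_pos: "D0 > 0" and deg_exists: "\<exists>\<nu>. deg \<nu> > 0"
proof -
  show "\<exists>\<nu>. deg \<nu> > 0"
  proof (rule ccontr)
    assume "\<nexists>\<nu>. deg \<nu> > 0"
    hence "deg \<nu> = 0" for \<nu> using deg_nonneg[of \<nu>] by (auto simp: less_le)
    thus False using kappa_sum by simp
  qed
  then obtain \<nu> where "deg \<nu> > 0" by blast
  thus "D0 > 0" unfolding D0_def using deg_nonneg by (intro sum_pos2[of _ \<nu>]) auto
qed

lemma Bf_affine: "\<exists>b0 b1. \<forall>z. Bf (p + z *s h) = b0 + b1 * z"
proof (intro exI allI)
  fix z
  show "Bf (p + z *s h) = Bf p + (- (\<Sum>\<nu>\<in>UNIV. of_real (deg \<nu>) * h $ \<nu>)) * z"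
    unfolding Bf_def by (simp add: algebra_simps sum.distrib sum_distrib_left sum_distrib_right)
qed

lemma Bf_diff: "(\<Sum>\<nu>\<in>UNIV. of_real (deg \<nu>) * (w $ \<nu> - s $ \<nu>)) = Bf s - Bf w"
  unfolding Bf_def by (simp add: right_diff_distrib sum_subtractf)

lemma region_convex: "convex (region R)"
proof -
  have "region R = (\<Inter>\<nu>. (\<lambda>s. s $ \<nu>) -` ball 0 R)" by (auto simp: region_def)
  also have "convex \<dots>" by (intro convex_INT convex_linear_vimage convex_ball bounded_linear.linear bounded_linear_vec_nth)
  finally show ?thesis .
qed

lemma C1_open_convex:
  "open {s::complex^'n. \<forall>\<nu>. Re (s $ \<nu>) > 1}" "convex {s::complex^'n. \<forall>\<nu>. Re (s $ \<nu>) > 1}"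
proof -
  have *: "{s::complex^'n. \<forall>\<nu>. Re (s $ \<nu>) > 1} = (\<Inter>\<nu>. (\<lambda>s. s $ \<nu>) -` {z. Re z > 1})" by auto
  show "convex {s::complex^'n. \<forall>\<nu>. Re (s $ \<nu>) > 1}"
    unfolding * by (intro convex_INT convex_linear_vimage convex_halfspace_Re_gt bounded_linear.linear bounded_linear_vec_nth)
  show "open {s::complex^'n. \<forall>\<nu>. Re (s $ \<nu>) > 1}"
    unfolding * by (rule open_INT) (auto intro!: open_Collect_less continuous_intros simp: vimage_def)
qed

text \<open>Chosen so that the point with all coordinates 2 + 3 / D0 lies in the polydisc. There Re
  Bf equals -(3 D0 + 7) / 2, which is less than -2.\<close>

definition Rmin :: real where "Rmin = 3 + 3 / D0"

lemma Rmin_pos: "Rmin > 0" unfolding Rmin_def using D0_pos by (intro add_pos_nonneg) auto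

text \<open>A nonempty open set disjoint from all polar hyperplanes on which every local expansion agrees with the twist.\<close>
definition base :: "real \<Rightarrow> (complex^'n) set" where
  "base R = region R \<inter> {s. \<forall>\<nu>. Re (s $ \<nu>) > 1} \<inter> {s. Re (Bf s) < - 2}"

lemma base_open: "open (base R)"
proof -
  have "continuous_on UNIV Bf" by (rule holo_multi_on_continuous_on[OF Bf_holo])
  thus ?thesis unfolding base_def
    by (intro open_Int open_region C1_open_convex open_Collect_less continuous_intros)
qed

lemma base_nonempty:
  assumes "R \<ge> Rmin" shows "base R \<noteq> {}"
proof -
  define x where "x = 2 + 3 / D0"
  let ?s = "(\<chi> \<nu>. of_real x) :: complex^'n"
  have x: "x > 1" "x < R" using assms D0_pos unfolding x_def Rmin_def by (auto intro: add_pos_nonneg)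
  have "Bf ?s = of_real ((D0 - 1) / 2 - D0 * x) - \<i> * of_real (\<Sum>\<nu>\<in>UNIV. deg \<nu> * sel_theta (lam \<nu>) (mu \<nu>))"
    unfolding Bf_def D0_def by (simp add: sum_distrib_right)
  hence "Re (Bf ?s) = (D0 - 1) / 2 - D0 * x" by simp
  also have "D0 * x = 2 * D0 + 3" using D0_pos by (simp add: x_def field_simps)
  finally have "Re (Bf ?s) < - 2" using D0_pos by (simp add: field_simps)
  hence "?s \<in> base R" using x unfolding base_def region_def by simp
  thus ?thesis by blast
qed

lemma region_mono: "R \<le> R' \<Longrightarrow> region R \<subseteq> region R'"
  unfolding region_def by (auto intro: less_le_trans)

text \<open>Some radius above \<open>Rmin\<close> whose polydisc contains s; by gluing, the value of
  the continuation at s is the same for every such radius.\<close>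

definition Rof :: "complex^'n \<Rightarrow> real" where "Rof s = Rmin + 1 + (\<Sum>\<nu>\<in>UNIV. norm (s $ \<nu>))"

lemma Rof: "Rof s > Rmin" "s \<in> region (Rof s)"
proof -
  show "Rof s > Rmin" unfolding Rof_def using sum_nonneg[of UNIV "\<lambda>\<nu>. norm (s $ \<nu>)"] by simp
  have le: "norm (s $ \<nu>) \<le> (\<Sum>\<nu>\<in>UNIV. norm (s $ \<nu>))" for \<nu> by (rule member_le_sum) auto
  have "norm (s $ \<nu>) < Rof s" for \<nu> using le[of \<nu>] Rmin_pos unfolding Rof_def by linarith
  thus "s \<in> region (Rof s)" by (simp add: region_def)
qed

text \<open>Two local functions agree with the twist, hence with each other, on the base of the
  smaller polydisc, and the identity theorem carries this over the smaller polydisc off the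
  hyperplanes. Near a point a single radius can therefore be kept fixed, which gives holomorphy
  although \<open>Rof\<close> varies. The set S is empty in the entire case and consists of the
  values l - 1 in the other.\<close>

lemma glue:
  assumes S: "closed S" "countable S" "\<And>z. z \<in> S \<Longrightarrow> Re z \<ge> - 1"
    and Y: "\<And>R. R > 0 \<Longrightarrow> holo_multi_on (Y R) (region R - Bf -` S)"
    and eq: "\<And>R s. R > 0 \<Longrightarrow> s \<in> base R \<Longrightarrow> Y R s = multi_twist a \<kappa> \<alpha> s"
  defines "G \<equiv> \<lambda>s. Y (Rof s) s"
  shows "\<And>R s. R > Rmin \<Longrightarrow> s \<in> region R - Bf -` S \<Longrightarrow> G s = Y R s"
    and "holo_multi_on G (UNIV - Bf -` S)"
    and "\<And>s. (\<forall>\<nu>. Re (s $ \<nu>) > 1) \<Longrightarrow> Bf s \<notin> S \<Longrightarrow> G s = multi_twist a \<kappa> \<alpha> s"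
proof -
  have cB: "continuous_on UNIV Bf" by (rule holo_multi_on_continuous_on[OF Bf_holo])
  have base_S: "base R \<subseteq> region R - Bf -` S" for R using S(3) unfolding base_def by fastforce
  have base_mono: "base R \<subseteq> base R'" if "R \<le> R'" for R R' using region_mono[OF that] unfolding base_def by blast
  have YY: "Y R s = Y R' s" if RR: "R > Rmin" "R' > Rmin" and s: "s \<in> region R" "s \<in> region R'" "Bf s \<notin> S" for R R' s
  proof (rule holo_multi_identity[OF open_region region_convex Bf_holo Bf_affine S(1,2), of "Y R" "min R R'" "Y R'" "base (min R R')"])
    let ?m = "min R R'"
    have m: "?m \<le> R" "?m \<le> R'" by auto
    have R0: "R > 0" "R' > 0" using RR Rmin_pos by auto
    show "holo_multi_on (Y R) (region ?m - Bf -` S)" by (rule holo_multi_on_subset[OF Y[OF R0(1)]]) (use region_mono[OF m(1)] in blast)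
    show "holo_multi_on (Y R') (region ?m - Bf -` S)" by (rule holo_multi_on_subset[OF Y[OF R0(2)]]) (use region_mono[OF m(2)] in blast)
    show "base ?m \<noteq> {}" by (rule base_nonempty) (use RR in auto)
    show "Y R x = Y R' x" if "x \<in> base ?m" for x
      using eq[OF R0(1) subsetD[OF base_mono[OF m(1)] that]] eq[OF R0(2) subsetD[OF base_mono[OF m(2)] that]] by (rule trans[OF _ sym])
    show "s \<in> region ?m" using s by (auto simp: region_def min_def)
  qed (use s base_open base_S in auto)
  show G: "G s = Y R s" if "R > Rmin" "s \<in> region R - Bf -` S" for R s
    unfolding G_def by (rule YY) (use that Rof[of s] in auto)
  show "holo_multi_on G (UNIV - Bf -` S)"
  proof (rule holo_multi_on_locally)
    show "open (UNIV - Bf -` S)" by (intro open_Diff open_UNIV closed_vimage S(1) cB)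
    fix p assume p: "p \<in> UNIV - Bf -` S"
    have "Rof p > 0" using Rof(1)[of p] Rmin_pos by simp
    hence "holo_multi_on G (region (Rof p) - Bf -` S)"
      by (subst holo_multi_on_cong[where g = "Y (Rof p)"]) (use G[OF Rof(1)[of p]] Y in auto)
    moreover have "open (region (Rof p) - Bf -` S)" by (intro open_Diff open_region closed_vimage S(1) cB)
    ultimately show "\<exists>U. open U \<and> p \<in> U \<and> U \<subseteq> UNIV - Bf -` S \<and> holo_multi_on G U"
      using p Rof(2)[of p] by (intro exI[of _ "region (Rof p) - Bf -` S"]) auto
  qed
  show "G s = multi_twist a \<kappa> \<alpha> s" if s: "\<forall>\<nu>. Re (s $ \<nu>) > 1" "Bf s \<notin> S" for s
    unfolding G_def
  proof (rule holo_multi_identity[OF _ _ Bf_holo Bf_affine S(1,2), of "region (Rof s) \<inter> {s. \<forall>\<nu>. Re (s $ \<nu>) > 1}" "Y (Rof s)" "multi_twist a \<kappa> \<alpha>" "base (Rof s)"])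
    have R0: "Rof s > 0" using Rof(1)[of s] Rmin_pos by simp
    show "open (region (Rof s) \<inter> {s. \<forall>\<nu>. Re (s $ \<nu>) > 1})" by (intro open_Int open_region C1_open_convex)
    show "convex (region (Rof s) \<inter> {s. \<forall>\<nu>. Re (s $ \<nu>) > 1})" by (intro convex_Int region_convex C1_open_convex)
    show "holo_multi_on (Y (Rof s)) (region (Rof s) \<inter> {s. \<forall>\<nu>. Re (s $ \<nu>) > 1} - Bf -` S)"
      by (rule holo_multi_on_subset[OF Y[OF R0]]) blast
    show "holo_multi_on (multi_twist a \<kappa> \<alpha>) (region (Rof s) \<inter> {s. \<forall>\<nu>. Re (s $ \<nu>) > 1} - Bf -` S)"
      by (rule holo_multi_on_subset[OF multi_twist_holo]) blast
    show "base (Rof s) \<noteq> {}" by (rule base_nonempty) (use Rof(1)[of s] in simp)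
    show "base (Rof s) \<subseteq> region (Rof s) \<inter> {s. \<forall>\<nu>. Re (s $ \<nu>) > 1} - Bf -` S" using base_S[of "Rof s"] unfolding base_def by blast
    show "Y (Rof s) x = multi_twist a \<kappa> \<alpha> x" if "x \<in> base (Rof s)" for x by (rule eq[OF R0 that])
    show "s \<in> region (Rof s) \<inter> {s. \<forall>\<nu>. Re (s $ \<nu>) > 1}" using s(1) Rof(2)[of s] by simp
  qed (use s base_open in auto)
qed

section \<open>Polar hyperplanes and the spectrum\<close>

lemma twist_H_iff: "s \<in> twist_H deg (\<lambda>\<nu>. sel_theta (lam \<nu>) (mu \<nu>)) l \<longleftrightarrow> Bf s = of_nat l - 1"
  unfolding twist_H_def Bf_def mem_Collect_eq
  by (simp add: field_simps) (auto simp: algebra_simps)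

text \<open>On taking logarithms, the conductor together with kappa^d supplies the sums of 2 lk
  ln(lk) in \<open>lX0\<close>, since lk is lambda times kappa. The powers of 2 pi combine to a
  single factor because the weights d kappa add up to 1, and it cancels against the one in ln(2 pi
  alpha).\<close>

lemma spectrum_criterion:
  assumes n: "n \<in> pos_vecs" and l: "ln (freq n) = lX0"
  shows "(\<Prod>\<nu>\<in>UNIV. (real (n $ \<nu>) / (sel_conductor (Q \<nu>) (lam \<nu>) * \<kappa> \<nu> powr deg \<nu>)) powr \<kappa> \<nu>) = \<alpha>"
proof -
  have n1: "real (n $ \<nu>) > 0" for \<nu> using n by (simp add: pos_vecs_def Suc_le_eq)
  have Q0: "Q \<nu> > 0" for \<nu> using sel[of \<nu>] unfolding selberg_sharp_def by blast
  define q where "q \<nu> = sel_conductor (Q \<nu>) (lam \<nu>) * \<kappa> \<nu> powr deg \<nu>" for \<nu>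
  have l0: "lam \<nu> ! j powr (2 * lam \<nu> ! j) > 0" if "j < length (lam \<nu>)" for \<nu> j using lam_pos[OF that] by simp
  hence lp: "(\<Prod>j<length (lam \<nu>). lam \<nu> ! j powr (2 * lam \<nu> ! j)) > 0" for \<nu> by (intro prod_pos) auto
  have q0: "q \<nu> > 0" for \<nu> unfolding q_def sel_conductor_def using Q0[of \<nu>] kappa_pos[of \<nu>] lp[of \<nu>] by simp
  have lq: "\<kappa> \<nu> * ln (q \<nu>) = \<kappa> \<nu> * deg \<nu> * ln (2 * pi) + (2 * \<kappa> \<nu> * ln (Q \<nu>) + (\<Sum>j<length (lam \<nu>). 2 * lk \<nu> j * ln (lk \<nu> j)))" for \<nu>
  proof -
    have "ln (\<Prod>j<length (lam \<nu>). lam \<nu> ! j powr (2 * lam \<nu> ! j)) = (\<Sum>j<length (lam \<nu>). 2 * lam \<nu> ! j * ln (lam \<nu> ! j))"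
      by (subst ln_prod) (use l0 lam_pos in \<open>auto simp: ln_powr intro!: sum.cong\<close>)
    moreover have "ln (q \<nu>) = deg \<nu> * ln (2 * pi) + 2 * ln (Q \<nu>) + ln (\<Prod>j<length (lam \<nu>). lam \<nu> ! j powr (2 * lam \<nu> ! j)) + deg \<nu> * ln (\<kappa> \<nu>)"
    proof -
      have "ln ((2 * pi) powr x * y\<^sup>2 * L * z powr x) = x * ln (2 * pi) + 2 * ln y + ln L + x * ln z"
        if "y > 0" "z > 0" "L > 0" for x y z L :: real
        using that by (simp add: ln_mult ln_powr ln_realpow distrib_left)
      from this[OF Q0 kappa_pos lp] show ?thesis unfolding q_def sel_conductor_def .
    qed
    ultimately have "\<kappa> \<nu> * ln (q \<nu>) = \<kappa> \<nu> * deg \<nu> * ln (2 * pi) + 2 * \<kappa> \<nu> * ln (Q \<nu>) +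
       \<kappa> \<nu> * ((\<Sum>j<length (lam \<nu>). 2 * lam \<nu> ! j * ln (lam \<nu> ! j)) + (\<Sum>j<length (lam \<nu>). 2 * lam \<nu> ! j) * ln (\<kappa> \<nu>))"
      unfolding deg_sum by (simp add: algebra_simps)
    also have "\<kappa> \<nu> * ((\<Sum>j<length (lam \<nu>). 2 * lam \<nu> ! j * ln (lam \<nu> ! j)) + (\<Sum>j<length (lam \<nu>). 2 * lam \<nu> ! j) * ln (\<kappa> \<nu>)) =
      (\<Sum>j<length (lam \<nu>). 2 * lk \<nu> j * ln (lk \<nu> j))"
      unfolding sum_distrib_right sum.distrib[symmetric] sum_distrib_left
      by (rule sum.cong) (use lam_pos kappa_pos[of \<nu>] in \<open>auto simp: lk_def ln_mult algebra_simps\<close>)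
    finally show ?thesis by simp
  qed
  have pos: "(real (n $ \<nu>) / q \<nu>) powr \<kappa> \<nu> > 0" for \<nu> using n1[of \<nu>] q0[of \<nu>] by simp
  have lnv: "ln ((real (n $ \<nu>) / q \<nu>) powr \<kappa> \<nu>) = \<kappa> \<nu> * ln (real (n $ \<nu>)) - \<kappa> \<nu> * ln (q \<nu>)" for \<nu>
    using n1[of \<nu>] q0[of \<nu>] by (simp add: ln_powr ln_div right_diff_distrib)
  have "ln (\<Prod>\<nu>\<in>UNIV. (real (n $ \<nu>) / q \<nu>) powr \<kappa> \<nu>) = (\<Sum>\<nu>\<in>UNIV. ln ((real (n $ \<nu>) / q \<nu>) powr \<kappa> \<nu>))"
  proof (rule ln_prod)
    show "(real (n $ \<nu>) / q \<nu>) powr \<kappa> \<nu> \<noteq> 0" for \<nu> using pos[of \<nu>] by linarith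
  qed simp
  also have "\<dots> = (\<Sum>\<nu>\<in>UNIV. \<kappa> \<nu> * ln (real (n $ \<nu>)) - \<kappa> \<nu> * ln (q \<nu>))" by (simp only: lnv)
  also have "\<dots> = (\<Sum>\<nu>\<in>UNIV. \<kappa> \<nu> * ln (real (n $ \<nu>))) - (\<Sum>\<nu>\<in>UNIV. \<kappa> \<nu> * deg \<nu> * ln (2 * pi)) -
     (\<Sum>\<nu>\<in>UNIV. 2 * \<kappa> \<nu> * ln (Q \<nu>) + (\<Sum>j<length (lam \<nu>). 2 * lk \<nu> j * ln (lk \<nu> j)))"
    unfolding lq sum_subtractf sum.distrib[of "\<lambda>\<nu>. \<kappa> \<nu> * deg \<nu> * ln (2 * pi)"] by simp
  also have "(\<Sum>\<nu>\<in>UNIV. \<kappa> \<nu> * ln (real (n $ \<nu>))) = ln (freq n)"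
    unfolding freq_def using n1 by (subst ln_prod) (auto simp: ln_powr)
  also have "(\<Sum>\<nu>\<in>UNIV. \<kappa> \<nu> * deg \<nu> * ln (2 * pi)) = ln (2 * pi)"
    using kappa_sum by (simp add: sum_distrib_right[symmetric] mult.commute)
  also have "ln (freq n) - ln (2 * pi) - (\<Sum>\<nu>\<in>UNIV. 2 * \<kappa> \<nu> * ln (Q \<nu>) + (\<Sum>j<length (lam \<nu>). 2 * lk \<nu> j * ln (lk \<nu> j))) = ln \<alpha>"
    unfolding l lX0_def using alpha_pos by (simp add: ln_mult)
  finally have "ln (\<Prod>\<nu>\<in>UNIV. (real (n $ \<nu>) / q \<nu>) powr \<kappa> \<nu>) = ln \<alpha>" .
  moreover have "(\<Prod>\<nu>\<in>UNIV. (real (n $ \<nu>) / q \<nu>) powr \<kappa> \<nu>) > 0" by (intro prod_pos ballI pos)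
  ultimately show ?thesis unfolding q_def using alpha_pos by (simp add: ln_inj_iff)
qed

section \<open>The two cases of the continuation\<close>

lemma expansion_choice:
  obtains K H A where "\<And>R. R > 0 \<Longrightarrow> expands R (K R) (H R) (A R)"
proof -
  have "\<forall>R. \<exists>t. R > 0 \<longrightarrow> expands R (fst t) (fst (snd t)) (snd (snd t))"
    using region_expansion by fastforce
  then obtain t where "\<And>R. R > 0 \<Longrightarrow> expands R (fst (t R)) (fst (snd (t R))) (snd (snd (t R)))" by metis
  thus thesis by (rule that)
qed

text \<open>Off the spectrum every resonant index has a vanishing coefficient, so all polar
  coefficients are 0 and the holomorphic parts H can be glued with an empty exceptional set.\<close>

theorem entire_continuation:
  assumes "\<alpha> \<notin> twist_spec a (\<lambda>\<nu>. sel_conductor (Q \<nu>) (lam \<nu>)) deg \<kappa>"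
  shows "\<exists>G. holo_multi_on G UNIV \<and> (\<forall>s. (\<forall>\<nu>. Re (s $ \<nu>) > 1) \<longrightarrow> G s = multi_twist a \<kappa> \<alpha> s)"
proof -
  obtain K H A where E: "\<And>R. R > 0 \<Longrightarrow> expands R (K R) (H R) (A R)" by (rule expansion_choice) blast
  have z: "\<forall>n\<in>pos_vecs. ln (freq n) = lX0 \<longrightarrow> (\<Prod>\<nu>\<in>UNIV. a \<nu> (n $ \<nu>)) = 0"
  proof (intro ballI impI, rule ccontr)
    fix n :: "nat^'n" assume n: "n \<in> pos_vecs" "ln (freq n) = lX0" "(\<Prod>\<nu>\<in>UNIV. a \<nu> (n $ \<nu>)) \<noteq> 0"
    have "\<alpha> \<in> twist_spec a (\<lambda>\<nu>. sel_conductor (Q \<nu>) (lam \<nu>)) deg \<kappa>"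
      unfolding twist_spec_def using spectrum_criterion[OF n(1,2)] n(1,3) unfolding pos_vecs_def by blast
    thus False using assms by contradiction
  qed
  have A0: "A R k s = 0" if "R > 0" for R k s using E[OF that] z unfolding expands_def by blast
  have Y: "holo_multi_on (H R) (region R - Bf -` {})" if "R > 0" for R using E[OF that] unfolding expands_def by simp
  have eq: "H R s = multi_twist a \<kappa> \<alpha> s" if "R > 0" "s \<in> base R" for R s
  proof -
    have "multi_twist a \<kappa> \<alpha> s = H R s + (\<Sum>k<K R. A R k s / (Bf s - of_nat k + 1))"
      using E[OF that(1)] that(2) unfolding expands_def base_def by force
    thus ?thesis using A0[OF that(1)] by simp
  qed
  from glue(2,3)[OF closed_empty countable_empty _ Y eq] show ?thesis
    by (intro exI[of _ "\<lambda>s. H (Rof s) s"]) auto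
qed

text \<open>The linear form in the limit equals Bf s - Bf w, with Bf s = l - 1 on the hyperplane;
  multiplied by a local expansion, it cancels the denominator with k = l and sends all other terms
  to 0, so the limit is -A l s. The limits are established for every alpha; on the spectrum and off
  it the argument is the same.\<close>

theorem meromorphic_continuation:
  defines "Hy \<equiv> \<lambda>l. twist_H deg (\<lambda>\<nu>. sel_theta (lam \<nu>) (mu \<nu>)) l"
  shows "\<exists>G. holo_multi_on G (UNIV - (\<Union>l. Hy l)) \<and>
    (\<forall>s. (\<forall>\<nu>. Re (s $ \<nu>) > 1) \<and> s \<notin> (\<Union>l. Hy l) \<longrightarrow> G s = multi_twist a \<kappa> \<alpha> s) \<and>
    (\<forall>l. \<exists>Xi. holo_multi_on Xi (Hy l) \<and>
      (\<forall>s\<in>Hy l. ((\<lambda>w. (\<Sum>\<nu>\<in>UNIV. of_real (deg \<nu>) * (w $ \<nu> - s $ \<nu>)) * G w) \<longlongrightarrow> Xi s) (at s within (UNIV - Hy l))))"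
proof -
  obtain K H A where E: "\<And>R. R > 0 \<Longrightarrow> expands R (K R) (H R) (A R)" by (rule expansion_choice) blast
  define S :: "complex set" where "S = range (\<lambda>l::nat. of_nat l - 1)"
  have Hy: "s \<in> Hy l \<longleftrightarrow> Bf s = of_nat l - 1" for s l unfolding Hy_def by (rule twist_H_iff)
  have HS: "(\<Union>l. Hy l) = Bf -` S" unfolding S_def using Hy by auto
  \<comment> \<open>Unit separation makes S closed, and near a point of one hyperplane it excludes
    all the others.\<close>
  have dS: "dist (of_nat k - 1 :: complex) (of_nat l - 1) \<ge> 1" if "k \<noteq> l" for k l :: nat
  proof -
    have "dist (of_nat k - 1 :: complex) (of_nat l - 1) = norm (of_int (int k - int l) :: complex)" by (simp add: dist_norm)
    also have "\<dots> = of_int \<bar>int k - int l\<bar>" by (simp only: norm_of_int of_int_abs)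
    finally show ?thesis using that by linarith
  qed
  have S: "closed S" "countable S" "\<And>z. z \<in> S \<Longrightarrow> Re z \<ge> - 1"
  proof -
    show "closed S" unfolding S_def by (rule discrete_imp_closed[of 1]) (use dS in force)+
  qed (auto simp: S_def)
  define Y where "Y R s = H R s + (\<Sum>k<K R. A R k s / (Bf s - of_nat k + 1))" for R s
  have Y: "holo_multi_on (Y R) (region R - Bf -` S)" if "R > 0" for R
  proof -
    have h: "holo_multi_on (H R) (region R - Bf -` S)" "\<And>k. k < K R \<Longrightarrow> holo_multi_on (A R k) (region R - Bf -` S)"
      using E[OF that] unfolding expands_def by (blast intro: holo_multi_on_subset)+
    have "Bf s - of_nat k + 1 \<noteq> 0" if "s \<in> region R - Bf -` S" for s k
      using that unfolding S_def by (auto simp: algebra_simps eq_diff_eq)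
    thus ?thesis unfolding Y_def[abs_def] by (intro holo_multi_intros holo_multi_on_divide h Bf_holo) auto
  qed
  have eq: "Y R s = multi_twist a \<kappa> \<alpha> s" if "R > 0" "s \<in> base R" for R s
    using E[OF that(1)] that(2) unfolding expands_def base_def Y_def by force
  define G where "G s = Y (Rof s) s" for s
  have gl1: "G s = Y R s" if "R > Rmin" "s \<in> region R - Bf -` S" for R s
    unfolding G_def by (rule glue(1)[OF S Y eq that])
  have gl2: "holo_multi_on G (UNIV - Bf -` S)"
    unfolding G_def[abs_def] by (rule glue(2)[OF S Y eq])
  have gl3: "G s = multi_twist a \<kappa> \<alpha> s" if "\<forall>\<nu>. Re (s $ \<nu>) > 1" "Bf s \<notin> S" for s
    unfolding G_def by (rule glue(3)[OF S Y eq that])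
  have lim: "((\<lambda>w. (\<Sum>\<nu>\<in>UNIV. of_real (deg \<nu>) * (w $ \<nu> - s $ \<nu>)) * G w) \<longlongrightarrow> - A R l s) (at s within (UNIV - Hy l))"
    if R: "R > Rmin" and s: "s \<in> region R" "s \<in> Hy l" for R l s
  proof -
    have R0: "R > 0" using R Rmin_pos by simp
    have Bs: "Bf s = of_nat l - 1" using s(2) Hy by simp
    have "Re (Bf s) \<le> real (K R) - 2" using E[OF R0] s(1) unfolding expands_def by blast
    hence lK: "l < K R" by (simp add: Bs)
    let ?F = "at s within (UNIV - Hy l)"
    have tend: "(f \<longlongrightarrow> f s) ?F" if "holo_multi_on f (region R)" for f
    proof -
      have "continuous (at s) f" using holo_multi_on_continuous_on[OF that] s(1) open_region
        by (simp add: continuous_on_eq_continuous_at)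
      thus ?thesis unfolding continuous_at by (rule filterlim_mono[OF _ order_refl at_le]) simp
    qed
    have tB: "(Bf \<longlongrightarrow> of_nat l - 1) ?F" using tend[OF Bf_holo] by (simp add: Bs)
    have tA: "(A R k \<longlongrightarrow> A R k s) ?F" if "k < K R" for k using E[OF R0] that unfolding expands_def by (blast intro: tend)
    have tH: "(H R \<longlongrightarrow> H R s) ?F" using E[OF R0] unfolding expands_def by (blast intro: tend)
    \<comment> \<open>The product of the linear form and the expansion with the factor already
      cancelled in the term k = l, so that Z is continuous up to the hyperplane.\<close>
    define Z where "Z w = - ((Bf w - (of_nat l - 1)) * H R w +
      (\<Sum>k<K R. if k = l then A R l w else (Bf w - (of_nat l - 1)) * A R k w / (Bf w - of_nat k + 1)))" for w
    have "(Z \<longlongrightarrow> - (((of_nat l - 1) - (of_nat l - 1)) * H R s +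
      (\<Sum>k<K R. if k = l then A R l s else ((of_nat l - 1) - (of_nat l - 1)) * A R k s / ((of_nat l - 1) - of_nat k + 1)))) ?F"
      unfolding Z_def
    proof (intro tendsto_minus tendsto_add tendsto_mult tendsto_diff tendsto_const tB tH tendsto_sum)
      fix k assume k: "k \<in> {..<K R}"
      show "((\<lambda>w. if k = l then A R l w else (Bf w - (of_nat l - 1)) * A R k w / (Bf w - of_nat k + 1)) \<longlongrightarrow>
        (if k = l then A R l s else ((of_nat l - 1) - (of_nat l - 1)) * A R k s / ((of_nat l - 1) - of_nat k + 1))) ?F"
      proof (cases "k = l")
        case True
        thus ?thesis using tA[OF lK] by simp
      next
        case False
        hence nz: "(of_nat l - 1) - of_nat k + 1 \<noteq> (0::complex)" by simp
        have "((\<lambda>w. (Bf w - (of_nat l - 1)) * A R k w / (Bf w - of_nat k + 1)) \<longlongrightarrow>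
            ((of_nat l - 1) - (of_nat l - 1)) * A R k s / ((of_nat l - 1) - of_nat k + 1)) ?F"
          by (intro tendsto_divide tendsto_mult tendsto_diff tendsto_add tendsto_const tB tA nz) (use k in simp)
        thus ?thesis using False by (simp only: if_False)
      qed
    qed
    moreover have "(\<Sum>k<K R. if k = l then A R l s else ((of_nat l - 1) - (of_nat l - 1)) * A R k s / ((of_nat l - 1) - of_nat k + 1)) = A R l s"
      using lK by (simp add: if_distrib cong: if_cong)
    ultimately have "(Z \<longlongrightarrow> - A R l s) ?F" by simp
    moreover have "eventually (\<lambda>w. Z w = (\<Sum>\<nu>\<in>UNIV. of_real (deg \<nu>) * (w $ \<nu> - s $ \<nu>)) * G w) ?F"
    proof -
      have "eventually (\<lambda>w. dist (Bf w) (of_nat l - 1) < 1) ?F" using tB by (rule tendstoD) simp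
      moreover have "eventually (\<lambda>w. w \<in> region R) ?F"
        using eventually_at_topological open_region s(1) by blast
      moreover have "eventually (\<lambda>w. w \<in> UNIV - Hy l) ?F" by (simp add: eventually_at_filter)
      ultimately show ?thesis
      proof eventually_elim
        case (elim w)
        \<comment> \<open>The value k = l is excluded because w lies off the hyperplane, the other
          values because Bf w is within distance 1 of l - 1.\<close>
        have "Bf w \<noteq> of_nat k - 1" for k
          using elim(1,3) Hy[of w l] dS[of k l] by (cases "k = l") (auto simp: not_le[symmetric])
        hence nB: "Bf w \<noteq> of_nat k - 1" for k .
        hence "Bf w \<notin> S" unfolding S_def by blast
        hence nS: "w \<in> region R - Bf -` S" using elim(2) by simp
        have nz: "Bf w - of_nat k + 1 \<noteq> 0" for k
        proof
          assume "Bf w - of_nat k + 1 = 0"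
          hence "Bf w = of_nat k - 1" by algebra
          thus False using nB by blast
        qed
        have "(Bf w - (of_nat l - 1)) * (\<Sum>k<K R. A R k w / (Bf w - of_nat k + 1)) =
          (\<Sum>k<K R. if k = l then A R l w else (Bf w - (of_nat l - 1)) * A R k w / (Bf w - of_nat k + 1))"
          unfolding sum_distrib_left using nz[of l] by (intro sum.cong) (auto simp: field_simps)
        hence "Z w = - ((Bf w - (of_nat l - 1)) * Y R w)" unfolding Z_def Y_def by (simp add: distrib_left)
        also have "\<dots> = (Bf s - Bf w) * G w" unfolding gl1[OF R nS] Bs by (simp add: algebra_simps)
        finally show ?case unfolding Bf_diff .
      qed
    qed
    ultimately show ?thesis by (rule Lim_transform_eventually)
  qed
  \<comment> \<open>Moving one coordinate of positive degree leaves the hyperplane, so s is a limit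
    of admissible points. Without this, limits along the filter would not be unique.\<close>
  have nontriv: "at s within (UNIV - Hy l) \<noteq> bot" if s: "s \<in> Hy l" for s l
    unfolding trivial_limit_within islimpt_approachable
  proof (intro notI, erule notE, intro allI impI)
    fix e :: real assume e: "e > 0"
    obtain \<nu>0 where \<nu>0: "deg \<nu>0 > 0" using deg_exists by blast
    define w where "w = s + axis \<nu>0 (of_real (e / 2))"
    have wd: "w $ \<nu> - s $ \<nu> = (if \<nu> = \<nu>0 then of_real (e / 2) else 0)" for \<nu> by (simp add: w_def axis_def)
    have "Bf s - Bf w = of_real (deg \<nu>0) * of_real (e / 2)"
      unfolding Bf_diff[symmetric] wd by (simp add: if_distrib cong: if_cong)
    hence ne: "Bf w \<noteq> Bf s" using \<nu>0 e by auto
    have "norm (axis \<nu>0 x) = norm x" for x :: complex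
      by (simp add: norm_vec_def L2_set_def axis_def if_distrib[of norm] if_distrib[of "\<lambda>x. x ^ 2"] cong: if_cong)
    hence "dist w s = e / 2" using e by (simp add: w_def dist_norm)
    thus "\<exists>x'\<in>UNIV - Hy l. x' \<noteq> s \<and> dist x' s < e" using e ne s Hy by (intro bexI[of _ w]) auto
  qed
  have "\<exists>Xi. holo_multi_on Xi (Hy l) \<and>
      (\<forall>s\<in>Hy l. ((\<lambda>w. (\<Sum>\<nu>\<in>UNIV. of_real (deg \<nu>) * (w $ \<nu> - s $ \<nu>)) * G w) \<longlongrightarrow> Xi s) (at s within (UNIV - Hy l)))" for l
  proof (intro exI[of _ "\<lambda>s. - A (Rof s) l s"] conjI ballI)
    show "((\<lambda>w. (\<Sum>\<nu>\<in>UNIV. of_real (deg \<nu>) * (w $ \<nu> - s $ \<nu>)) * G w) \<longlongrightarrow> - A (Rof s) l s) (at s within (UNIV - Hy l))" if "s \<in> Hy l" for s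
      by (rule lim[OF Rof that])
    show "holo_multi_on (\<lambda>s. - A (Rof s) l s) (Hy l)"
      unfolding holo_multi_on_def
    proof
      fix z assume z: "z \<in> Hy l"
      let ?R = "Rof z"
      have R0: "?R > 0" using Rof(1)[of z] Rmin_pos by simp
      have "Re (Bf z) \<le> real (K ?R) - 2" using E[OF R0] Rof(2)[of z] unfolding expands_def by blast
      hence "l < K ?R" using z Hy by simp
      hence "holo_multi_on (\<lambda>s. - A ?R l s) (region ?R)" using E[OF R0] unfolding expands_def by (blast intro: holo_multi_on_minus)
      then obtain b where "((\<lambda>s. - A ?R l s) has_derivative (\<lambda>h. \<Sum>i\<in>UNIV. b $ i * h $ i)) (at z within region ?R)"
        using Rof(2)[of z] unfolding holo_multi_on_def by blast
      hence d: "((\<lambda>s. - A ?R l s) has_derivative (\<lambda>h. \<Sum>i\<in>UNIV. b $ i * h $ i)) (at z within Hy l)"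
        using at_within_open[OF Rof(2) open_region] by (simp add: has_derivative_at_withinI)
      obtain e where e: "e > 0" "ball z e \<subseteq> region ?R" using open_region Rof(2)[of z] open_contains_ball by blast
      \<comment> \<open>The coefficient formally depends on the chosen radius, but both sides are
        limits of the same function. So near z the radius of z can be used throughout, and
        holomorphy of that one coefficient passes to the limit function.\<close>
      have "- A ?R l s = - A (Rof s) l s" if "s \<in> Hy l" "dist s z < e" for s
      proof (rule tendsto_unique[OF nontriv[OF that(1)] lim[OF Rof(1) _ that(1)] lim[OF Rof that(1)]])
        show "s \<in> region ?R" using e(2) that(2) by (auto simp: dist_commute)
      qed
      from has_derivative_transform_within[OF d e(1) z this]
      show "\<exists>b. ((\<lambda>s. - A (Rof s) l s) has_derivative (\<lambda>h. \<Sum>i\<in>UNIV. b $ i * h $ i)) (at z within Hy l)" by blast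
    qed
  qed
  moreover have "holo_multi_on G (UNIV - (\<Union>l. Hy l))" unfolding HS by (rule gl2)
  moreover have "G s = multi_twist a \<kappa> \<alpha> s" if "\<forall>\<nu>. Re (s $ \<nu>) > 1" "s \<notin> (\<Union>l. Hy l)" for s
    using gl3 that unfolding HS by blast
  ultimately show ?thesis by blast
qed

end

theorem theorem1:
  fixes a :: "'n::finite \<Rightarrow> nat \<Rightarrow> complex"
    and Fc :: "'n \<Rightarrow> complex \<Rightarrow> complex"
    and Q :: "'n \<Rightarrow> real" and lam :: "'n \<Rightarrow> real list" and mu :: "'n \<Rightarrow> complex list"
    and om :: "'n \<Rightarrow> complex"
    and \<kappa> :: "'n \<Rightarrow> real" and \<alpha> :: real
  assumes N2: "CARD('n) \<ge> 2"
    and sel: "\<And>\<nu>. selberg_sharp (a \<nu>) (Fc \<nu>) (Q \<nu>) (lam \<nu>) (mu \<nu>) (om \<nu>)"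
    and deg_pos: "\<And>\<nu>. sel_degree (lam \<nu>) > 0"
    and kappa_pos: "\<And>\<nu>. \<kappa> \<nu> > 0"
    and kappa_sum: "(\<Sum>\<nu>\<in>UNIV. sel_degree (lam \<nu>) * \<kappa> \<nu>) = 1"
    and alpha_pos: "\<alpha> > 0"
  defines "d \<equiv> (\<lambda>\<nu>. sel_degree (lam \<nu>))"
    and "q \<equiv> (\<lambda>\<nu>. sel_conductor (Q \<nu>) (lam \<nu>))"
    and "\<theta> \<equiv> (\<lambda>\<nu>. sel_theta (lam \<nu>) (mu \<nu>))"
    and "C1 \<equiv> {s::complex^'n. \<forall>\<nu>. Re (s $ \<nu>) > 1}"
  shows
    "(\<alpha> \<notin> twist_spec a q d \<kappa> \<longrightarrow>
        (\<exists>G. holo_multi_on G UNIV \<and> (\<forall>s\<in>C1. G s = multi_twist a \<kappa> \<alpha> s)))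
     \<and>
     (\<alpha> \<in> twist_spec a q d \<kappa> \<longrightarrow>
        (\<exists>G. holo_multi_on G (UNIV - (\<Union>l. twist_H d \<theta> l)) \<and>
             (\<forall>s\<in>C1 - (\<Union>l. twist_H d \<theta> l). G s = multi_twist a \<kappa> \<alpha> s) \<and>
             (\<forall>l. \<exists>Xi. holo_multi_on Xi (twist_H d \<theta> l) \<and>
                  (\<forall>s\<in>twist_H d \<theta> l.
                     ((\<lambda>w. (\<Sum>\<nu>\<in>UNIV. of_real (d \<nu>) * (w $ \<nu> - s $ \<nu>)) * G w)
                        \<longlongrightarrow> Xi s) (at s within (UNIV - twist_H d \<theta> l))))))"
proof -
  interpret multi_selberg a Fc Q lam mu om \<kappa> \<alpha>
    by unfold_locales (use sel kappa_pos kappa_sum alpha_pos in auto)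
  show ?thesis
  proof (intro conjI impI)
    assume "\<alpha> \<notin> twist_spec a q d \<kappa>"
    thus "\<exists>G. holo_multi_on G UNIV \<and> (\<forall>s\<in>C1. G s = multi_twist a \<kappa> \<alpha> s)"
      using entire_continuation unfolding q_def d_def C1_def by simp
  next
    have C1: "(\<forall>s. (\<forall>\<nu>. Re (s $ \<nu>) > 1) \<and> s \<notin> V \<longrightarrow> G s = t s) \<longleftrightarrow> (\<forall>s\<in>C1 - V. G s = t s)" for G t V
      unfolding C1_def by auto
    show "\<exists>G. holo_multi_on G (UNIV - (\<Union>l. twist_H d \<theta> l)) \<and>
             (\<forall>s\<in>C1 - (\<Union>l. twist_H d \<theta> l). G s = multi_twist a \<kappa> \<alpha> s) \<and>
             (\<forall>l. \<exists>Xi. holo_multi_on Xi (twist_H d \<theta> l) \<and>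
                  (\<forall>s\<in>twist_H d \<theta> l.
                     ((\<lambda>w. (\<Sum>\<nu>\<in>UNIV. of_real (d \<nu>) * (w $ \<nu> - s $ \<nu>)) * G w)
                        \<longlongrightarrow> Xi s) (at s within (UNIV - twist_H d \<theta> l))))"
      using meromorphic_continuation unfolding C1 d_def \<theta>_def .
  qed
qed

end
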